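(* Let $r\in\{1/2,1/3,1/6,1/12\}$, let $M'$ be the least common denominator of $1/3$ and $r$, and let $$\mathrm{HD}_{\mathbb{K}_5(r)}:=\{\{1/3,r\},\{1,1\}\},\qquad \overline{\mathrm{HD}_{\mathbb{K}_5(r)}}:=\{\{2/3,1-r\},\{1,1\}\}.$$ Let $f^{\sharp}_{\mathrm{HD}_{\mathbb{K}_5(r)}}$ be the weight two Hecke eigenform attached to $r$ (specified by the list below and described in the context), and let $a_p(f^{\sharp}_{\mathrm{HD}_{\mathbb{K}_5(r)}})$ be its $p$-th Fourier coefficient. Then for every prime $p\equiv1\pmod{M'}$ and every prime ideal $\mathfrak{p}$ of $\mathbb{Z}[\zeta_{M'}]$ lying above $p$, $$-a_p\left(f^{\sharp}_{\mathrm{HD}_{\mathbb{K}_5(r)}}\right)=\iota_{\mathfrak{p}}(r)(27)\,\mathbb{P}\left(\mathrm{HD}_{\mathbb{K}_5(r)};1;\mathfrak{p}\right)+\iota_{\mathfrak{p}}(1-r)(27)\,\mathbb{P}\left(\overline{\mathrm{HD}_{\mathbb{K}_5(r)}};1;\mathfrak{p}\right),$$ where (with LMFDB labels) - $r=1/2$ and $r=1/6$: $M'=6$, $f^{\sharp}_{\mathrm{HD}_{\mathbb{K}_5(r)}}=f_{36.2.a.a}$; - $r=1/3$: $M'=3$, $f^{\sharp}_{\mathrm{HD}_{\mathbb{K}_5(r)}}=f_{27.2.a.a}$; - $r=1/12$: $M'=12$, $f^{\sharp}_{\mathrm{HD}_{\mathbb{K}_5(r)}}=f_{432.2.c.a}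$.
   Context: **Characters.** $\zeta_M$ is a primitive $M$-th root of unity. For a prime ideal $\mathfrak{p}$ of $\mathbb{Z}[\zeta_M]$ coprime to $M$ with residue field of size $q$ and an integer $i$, $\iota_{\mathfrak{p}}(i/M)$ is the multiplicative character of $\mathbb{Z}[\zeta_M]/\mathfrak{p}$ given by the $i$-th power of the $M$-th power residue symbol: for $x\notin\mathfrak{p}$, $\iota_{\mathfrak{p}}(i/M)(x)=\left(\frac{x}{\mathfrak{p}}\right)_M^i$ is the $M$-th root of unity congruent to $x^{(q-1)i/M}$ modulo $\mathfrak{p}$. Thus $\iota_{\mathfrak{p}}(1)$ is the trivial character $\varepsilon$. All multiplicative characters (including $\varepsilon$) are extended by $\chi(0)=0$. If $p\equiv1\pmod{M}$ and $\mathfrak{p}\mid p$, the residue field is $\mathbb{F}_p$, so $q=p$. **Period functions.** For multiplicative characters $A,B$ of $\mathbb{F}_q$, $J(A,B)=\sum_{x\in\mathbb{F}_q}A(x)B(1-x)$ and $\binom{A}{B}:=\frac{B(-1)}{q}J(A,\overline{B})$. For rational numbers $r_1,r_2,q_2$ with common denominator $M$, let $R_i=\iota_{\mathfrak{p}}(r_i)$, $Q_2=\iota_{\mathfrak{p}}(q_2)$. For $z\in\mathbb{F}_q^\times$, $$\mathbb{P}\left(\{\{r_1,r_2\},\{1,q_2\}\};z;\mathfrak{p}\right):=\frac{q^{2}}{q-1}\,R_2Q_2(-1)\sum_{\chi\in\widehat{\mathbb{F}_q^\times}}\binom{R_1\chi}{\chi}\binom{R_2\chi}{Q_2\chi}\chi(z).$$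 **Eigenforms.** Let $\eta(\tau)=q^{1/24}\prod_{n\ge1}(1-q^n)$ with $q=e^{2\pi i\tau}$, and for $0<r<2/3$ with $12r\in\mathbb{Z}$ let $$\mathbb{K}_5(r)(\tau):=\eta(3\tau)^{12r-2}\,\eta(\tau)^{-12r+6}.$$ The eigenforms (labels from the L-functions and Modular Forms Database, LMFDB) are: for $r=1/2$, $f_{36.2.a.a}=\mathbb{K}_5(1/2)(2\tau)$; for $r=1/6$, $f_{36.2.a.a}=\mathbb{K}_5(1/6)(6\tau)$; for $r=1/3$, $f_{27.2.a.a}=\mathbb{K}_5(1/3)(3\tau)$; for $r=1/12$, $f_{432.2.c.a}=\mathbb{K}_5(1/12)(12\tau)-3\sqrt{-3}\,\mathbb{K}_5(7/12)(12\tau)$ (level $432$, character $(3/\cdot)$). For $r=1/b$ and primes $p\equiv1\pmod{M'}$, $a_p(f^{\sharp}_{\mathrm{HD}_{\mathbb{K}_5(r)}})$ is the coefficient of $q^p$ in $\mathbb{K}_5(1/b)(b\tau)$. *)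

theory Defs
  imports
    "HOL-Analysis.Analysis"
    "HOL-Algebra.QuotRing"
    "HOL-Computational_Algebra.Polynomial"
    "HOL-Number_Theory.Cong"
begin

subsection \<open>Cyclotomic integers and power residue characters\<close>

definition zeta :: "nat \<Rightarrow> complex" where
  "zeta M = cis (2 * pi / real M)"

definition cyclotomic_ring :: "nat \<Rightarrow> complex ring" where
  "cyclotomic_ring M =
     \<lparr>carrier = range (\<lambda>f :: int poly. poly (map_poly of_int f) (zeta M)),
      mult = (*), one = 1, zero = 0, add = (+)\<rparr>"

definition lies_above :: "complex set \<Rightarrow> nat \<Rightarrow> bool" where
  "lies_above P p \<longleftrightarrow> P \<inter> \<int> = range (\<lambda>n. of_int (int p * n))"

abbreviation residue_field :: "nat \<Rightarrow> complex set \<Rightarrow> complex set ring" where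
  "residue_field M P \<equiv> cyclotomic_ring M Quot P"

abbreviation residue_class :: "nat \<Rightarrow> complex set \<Rightarrow> complex \<Rightarrow> complex set" where
  "residue_class M P x \<equiv> P +>\<^bsub>cyclotomic_ring M\<^esub> x"

text \<open>Only meaningful for a nonzero residue class \<open>c\<close>; the value is taken in the complex numbers,
  of which the ring of cyclotomic integers is a subring.\<close>

definition power_residue_symbol :: "nat \<Rightarrow> complex set \<Rightarrow> complex set \<Rightarrow> complex" where
  "power_residue_symbol M P c =
     (THE w. w ^ M = 1 \<and>
        residue_class M P w =
          c [^]\<^bsub>residue_field M P\<^esub> ((card (carrier (residue_field M P)) - 1) div M))"

text \<open>The rational number \<open>r\<close> is of the form \<open>i / M\<close>, so the floor below is the integer \<open>i\<close>.\<close>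

definition iota :: "nat \<Rightarrow> complex set \<Rightarrow> rat \<Rightarrow> complex set \<Rightarrow> complex" where
  "iota M P r c =
     (if c \<in> carrier (residue_field M P) - {\<zero>\<^bsub>residue_field M P\<^esub>}
      then power_residue_symbol M P c powi \<lfloor>of_nat M * r\<rfloor> else 0)"

subsection \<open>Finite period functions\<close>

text \<open>Multiplicative characters are functions on the whole type: they vanish at \<open>0\<close>, and
  also outside the carrier, so that each character is a single function.\<close>

definition mult_characters :: "('a, 'b) ring_scheme \<Rightarrow> ('a \<Rightarrow> complex) set" where
  "mult_characters F =
     {\<psi>. \<psi> \<one>\<^bsub>F\<^esub> = 1 \<and>
         (\<forall>x \<in> carrier F - {\<zero>\<^bsub>F\<^esub>}. \<forall>y \<in> carrier F - {\<zero>\<^bsub>F\<^esub>}.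
            \<psi> (x \<otimes>\<^bsub>F\<^esub> y) = \<psi> x * \<psi> y) \<and>
         (\<forall>x. x \<notin> carrier F - {\<zero>\<^bsub>F\<^esub>} \<longrightarrow> \<psi> x = 0)}"

definition jacobi_sum ::
    "('a, 'b) ring_scheme \<Rightarrow> ('a \<Rightarrow> complex) \<Rightarrow> ('a \<Rightarrow> complex) \<Rightarrow> complex" where
  "jacobi_sum F A B = (\<Sum>x\<in>carrier F. A x * B (\<one>\<^bsub>F\<^esub> \<ominus>\<^bsub>F\<^esub> x))"

definition char_binom ::
    "('a, 'b) ring_scheme \<Rightarrow> ('a \<Rightarrow> complex) \<Rightarrow> ('a \<Rightarrow> complex) \<Rightarrow> complex" where
  "char_binom F A B =
     B (\<ominus>\<^bsub>F\<^esub> \<one>\<^bsub>F\<^esub>) / of_nat (card (carrier F)) * jacobi_sum F A (\<lambda>x. cnj (B x))"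

text \<open>The period function of the datum \<open>{{r1, r2}, {1, q2}}\<close>.  The formula is not symmetric in
  \<open>r1\<close> and \<open>r2\<close>, so the order in which they are listed matters.\<close>

definition period_fun ::
    "nat \<Rightarrow> complex set \<Rightarrow> rat \<Rightarrow> rat \<Rightarrow> rat \<Rightarrow> complex set \<Rightarrow> complex" where
  "period_fun M P r1 r2 q2 z =
     (let F = residue_field M P; q = of_nat (card (carrier F));
          R1 = iota M P r1; R2 = iota M P r2; Q2 = iota M P q2
      in q\<^sup>2 / (q - 1) * (R2 (\<ominus>\<^bsub>F\<^esub> \<one>\<^bsub>F\<^esub>) * Q2 (\<ominus>\<^bsub>F\<^esub> \<one>\<^bsub>F\<^esub>)) *
         (\<Sum>\<psi>\<in>mult_characters F.
            char_binom F (\<lambda>x. R1 x * \<psi> x) \<psi> *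
            char_binom F (\<lambda>x. R2 x * \<psi> x) (\<lambda>x. Q2 x * \<psi> x) * \<psi> z))"

subsection \<open>Eigenforms\<close>

definition dedekind_eta :: "complex \<Rightarrow> complex" where
  "dedekind_eta \<tau> =
     exp (2 * of_real pi * \<i> * \<tau> / 24) *
     (\<Prod>n. 1 - exp (2 * of_real pi * \<i> * \<tau>) ^ Suc n)"

text \<open>Used for \<open>12 r\<close> an integer, so the floors are exact.\<close>

definition K5 :: "rat \<Rightarrow> complex \<Rightarrow> complex" where
  "K5 r \<tau> = dedekind_eta (3 * \<tau>) powi \<lfloor>12 * r - 2\<rfloor> * dedekind_eta \<tau> powi \<lfloor>- 12 * r + 6\<rfloor>"

definition f_36_2_a_a :: "complex \<Rightarrow> complex" where
  "f_36_2_a_a \<tau> = K5 (1/2) (2 * \<tau>)"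

lemma f_36_2_a_a_altdef: "f_36_2_a_a \<tau> = K5 (1/6) (6 * \<tau>)"
  by (simp add: f_36_2_a_a_def K5_def)

definition f_27_2_a_a :: "complex \<Rightarrow> complex" where
  "f_27_2_a_a \<tau> = K5 (1/3) (3 * \<tau>)"

definition f_432_2_c_a :: "complex \<Rightarrow> complex" where
  "f_432_2_c_a \<tau> = K5 (1/12) (12 * \<tau>) - 3 * (\<i> * of_real (sqrt 3)) * K5 (7/12) (12 * \<tau>)"

definition f_sharp :: "rat \<Rightarrow> complex \<Rightarrow> complex" where
  "f_sharp r =
     (if r = 1/2 \<or> r = 1/6 then f_36_2_a_a
      else if r = 1/3 then f_27_2_a_a
      else if r = 1/12 then f_432_2_c_a
      else undefined)"

text \<open>The coefficient of \<open>q ^ n\<close>, \<open>q = exp (2 pi i \<tau>)\<close>, for a function on the upper half plane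
  that is given by a power series in \<open>q\<close> (which is then unique).\<close>

definition fourier_coeff :: "(complex \<Rightarrow> complex) \<Rightarrow> nat \<Rightarrow> complex" where
  "fourier_coeff f =
     (THE a. \<forall>\<tau>. Im \<tau> > 0 \<longrightarrow> (\<lambda>n. a n * exp (2 * of_real pi * \<i> * \<tau>) ^ n) sums f \<tau>)"

subsection \<open>Least common denominators\<close>

definition least_common_denom :: "rat \<Rightarrow> rat \<Rightarrow> nat" where
  "least_common_denom r s = nat (lcm (snd (quotient_of r)) (snd (quotient_of s)))"

lemma least_common_denom_values:
  "least_common_denom (1/3) (1/2) = 6" "least_common_denom (1/3) (1/6) = 6"
  "least_common_denom (1/3) (1/3) = 3" "least_common_denom (1/3) (1/12) = 12"
  by code_simp+

end

theory Submission
  imports Defs "HOL-Complex_Analysis.Complex_Analysis" "HOL-Number_Theory.Number_Theory"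
begin

text \<open>Write \<open>\<chi>\<close> and \<open>\<rho>\<close> for the characters \<open>iota (1/3)\<close> and \<open>iota r\<close> of the residue field, which is the field with \<open>p\<close>
elements, and \<open>J\<close> for Jacobi sums. The characters that occur in the second period function are the conjugates
of those in the first, so the right-hand side is \<open>T + cnj T\<close> with \<open>T\<close> its first term, and everything rests on two computations that end
in the same elementary data: representations of \<open>p\<close> or \<open>4 p\<close> by the form \<open>u\<^sup>2 + 3 v\<^sup>2\<close>.

Arithmetic side. Expanding both binomials of a period function at \<open>1\<close>, orthogonality of characters leaves
only the pairs of arguments with sum \<open>1\<close>, so the sum over all characters collapses to one Jacobi sum
(\<open>period_fun_eq_jac\<close>). Hence \<open>T = \<rho> (- 27) J \<chi> \<rho>\<close>. A cubic Jacobi sum lies in \<open>\<int>[w]\<close>, \<open>w\<close> a primitive cube root of unity, and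
has absolute value \<open>sqrt p\<close> (\<open>jac_norm\<close>); congruences modulo \<open>3\<close> and \<open>2\<close>, obtained by counting orbits and by
parity, fix it up to conjugation (\<open>cubic_jacobi_sum\<close>, \<open>cubic_quadratic_jacobi_sum\<close>). This treats \<open>r = 1/3\<close> and
\<open>r = 1/2\<close>. For \<open>r = 1/6\<close> the substitution of \<open>1/x\<close> for \<open>x\<close> leads back to \<open>r = 1/2\<close>, and for \<open>r = 1/12\<close> the sum \<open>J \<chi> \<rho>\<close>
equals \<open>J \<chi> \<chi>\<close> (\<open>jac_quartic_twist\<close>). The factor \<open>\<rho> (- 27)\<close> is \<open>1\<close> for the first three values of \<open>r\<close>. For \<open>r = 1/12\<close> it
is a quartic symbol of \<open>-3\<close>, which is a product of two quadratic symbols because \<open>- 3 d\<^sup>2\<close> is the square of \<open>c\<close> modulo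
\<open>p = c\<^sup>2 + 3 d\<^sup>2\<close>; quadratic reciprocity evaluates it (\<open>quadratic_symbol_product\<close>).

Modular side. Each eigenform is, up to a part without coefficients in the relevant residue class, an eta quotient
of weight two that can be written through products of a theta series with a derivative of a theta series (\<open>eta_1_4_theta\<close>,
\<open>eta_1_2_3_2_theta\<close>, \<open>eta_1_5_3_theta\<close>). These rest on the Jacobi triple product and, in the third case, on a Lambert
series of Kronecker. They turn the coefficient at \<open>p\<close> into a sum over the solutions of \<open>u\<^sup>2 + 3 v\<^sup>2 = 4 p\<close>, which are all
obtained from a single one by conjugation and multiplication by sixth roots of unity (\<open>four_p_representation_cases\<close>). So the coefficient is an explicit
linear form in one solution (\<open>coeff_f_36\<close>, \<open>coeff_f_27\<close>, \<open>coeff_f_432\<close>), and it is the same linear form as on the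
arithmetic side.\<close>

section \<open>Infinite products and theta series\<close>

text \<open>The shifted factorial \<open>(a; q)\<close> with infinitely many factors. Euler's product, which is the eta function without its
fractional power of \<open>q\<close>, is \<open>qpoch q q\<close>.\<close>

definition qpoch :: "complex \<Rightarrow> complex \<Rightarrow> complex" where
  "qpoch a q = (\<Prod>n. 1 - a * q ^ n)"

lemma qpoch_convergent:
  fixes a q :: complex
  assumes "norm q < 1"
  shows "convergent_prod (\<lambda>n. 1 - a * q ^ n)"
proof -
  have "summable (\<lambda>n. norm (a * q ^ n))"
    unfolding norm_mult norm_power using assms by (intro summable_mult summable_geometric) simp
  then have "abs_convergent_prod (\<lambda>n. 1 - a * q ^ n)"
    by (intro summable_imp_abs_convergent_prod) simp
  then show ?thesis
    by (rule abs_convergent_prod_imp_convergent_prod)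
qed

lemma qpoch_LIMSEQ:
  assumes "norm q < 1"
  shows "(\<lambda>N. \<Prod>i<N. 1 - a * q ^ i) \<longlonglongrightarrow> qpoch a q"
  using convergent_prod_LIMSEQ[OF qpoch_convergent[OF assms, of a]]
  by (simp add: LIMSEQ_lessThan_iff_atMost[of "prod (\<lambda>i. 1 - a * q ^ i)"] qpoch_def)

lemma qpoch_nonzero:
  assumes "norm q < 1" "\<And>n. a * q ^ n \<noteq> 1"
  shows "qpoch a q \<noteq> 0"
proof -
  have "1 - a * q ^ n \<noteq> 0" for n using assms(2)[of n] by (metis eq_iff_diff_eq_0)
  then show ?thesis
    unfolding qpoch_def by (intro prodinf_nonzero qpoch_convergent assms(1)) auto
qed

lemma qpoch_nonzero_small:
  assumes "norm q < 1" "norm a < 1"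
  shows "qpoch a q \<noteq> 0"
proof (rule qpoch_nonzero[OF assms(1)])
  fix n
  have "norm (a * q ^ n) \<le> norm a * 1"
    unfolding norm_mult norm_power using assms(1) by (intro mult_left_mono power_le_one) auto
  then show "a * q ^ n \<noteq> 1" using assms(2) by auto
qed

lemma qpoch_rec:
  assumes "norm q < 1"
  shows "qpoch a q = (1 - a) * qpoch (a * q) q"
proof -
  have "(\<lambda>N. \<Prod>i<Suc N. 1 - a * q ^ i) \<longlonglongrightarrow> qpoch a q"
    by (rule LIMSEQ_Suc[OF qpoch_LIMSEQ[OF assms]])
  moreover have "(\<Prod>i<Suc N. 1 - a * q ^ i) = (1 - a) * (\<Prod>i<N. 1 - (a * q) * q ^ i)" for N
    by (simp add: prod.lessThan_Suc_shift mult_ac del: prod.lessThan_Suc)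
  moreover have "(\<lambda>N. (1 - a) * (\<Prod>i<N. 1 - (a * q) * q ^ i)) \<longlonglongrightarrow> (1 - a) * qpoch (a * q) q"
    by (intro tendsto_mult_left qpoch_LIMSEQ assms)
  ultimately show ?thesis using LIMSEQ_unique by auto
qed

lemma norm_power_less_1:
  fixes q :: complex
  assumes "norm q < 1" "0 < n"
  shows "norm (q ^ n) < 1"
  using assms by (simp add: norm_power power_less_one_iff)

lemma qpoch_dissect2:
  assumes "norm q < 1"
  shows "qpoch a q = qpoch a (q\<^sup>2) * qpoch (a * q) (q\<^sup>2)"
proof -
  have q2: "norm (q\<^sup>2) < 1" using norm_power_less_1[OF assms] by simp
  have split: "(\<Prod>i<2*N. g i) = (\<Prod>i<N. g (2*i)) * (\<Prod>i<N. g (2*i+1))" for N and g :: "nat \<Rightarrow> complex"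
    by (induction N) (simp_all add: mult_ac)
  have "(\<Prod>i<2*N. 1 - a * q ^ i) = (\<Prod>i<N. 1 - a * (q\<^sup>2) ^ i) * (\<Prod>i<N. 1 - (a * q) * (q\<^sup>2) ^ i)" for N
    unfolding split by (simp add: power_mult mult.assoc)
  moreover have "(\<lambda>N. \<Prod>i<2*N. 1 - a * q ^ i) \<longlonglongrightarrow> qpoch a q"
    using LIMSEQ_subseq_LIMSEQ[OF qpoch_LIMSEQ[OF assms, of a], of "\<lambda>N. 2*N"]
    by (auto simp: strict_mono_def o_def)
  moreover have "(\<lambda>N. (\<Prod>i<N. 1 - a * (q\<^sup>2) ^ i) * (\<Prod>i<N. 1 - (a * q) * (q\<^sup>2) ^ i))
      \<longlonglongrightarrow> qpoch a (q\<^sup>2) * qpoch (a * q) (q\<^sup>2)"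
    by (intro tendsto_mult qpoch_LIMSEQ q2)
  ultimately show ?thesis using LIMSEQ_unique by auto
qed

lemma qpoch_dissect3:
  assumes "norm q < 1"
  shows "qpoch a q = qpoch a (q ^ 3) * qpoch (a * q) (q ^ 3) * qpoch (a * q\<^sup>2) (q ^ 3)"
proof -
  have q3: "norm (q ^ 3) < 1" using norm_power_less_1[OF assms] by simp
  have split: "(\<Prod>i<3*N. g i) = (\<Prod>i<N. g (3*i)) * (\<Prod>i<N. g (3*i+1)) * (\<Prod>i<N. g (3*i+2))"
    for N and g :: "nat \<Rightarrow> complex"
  proof (induction N)
    case (Suc N)
    have "3 * Suc N = Suc (Suc (Suc (3 * N)))" by simp
    then show ?case using Suc by (simp only: prod.lessThan_Suc) (simp add: algebra_simps)
  qed simp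
  have "(\<Prod>i<3*N. 1 - a * q ^ i) = (\<Prod>i<N. 1 - a * (q ^ 3) ^ i) * (\<Prod>i<N. 1 - (a * q) * (q ^ 3) ^ i)
      * (\<Prod>i<N. 1 - (a * q\<^sup>2) * (q ^ 3) ^ i)" for N
    unfolding split by (simp add: power_mult power_add power2_eq_square mult.assoc mult.commute[of "(q ^ 3) ^ _"])
  moreover have "(\<lambda>N. \<Prod>i<3*N. 1 - a * q ^ i) \<longlonglongrightarrow> qpoch a q"
    using LIMSEQ_subseq_LIMSEQ[OF qpoch_LIMSEQ[OF assms, of a], of "\<lambda>N. 3*N"]
    by (auto simp: strict_mono_def o_def)
  moreover have "(\<lambda>N. (\<Prod>i<N. 1 - a * (q ^ 3) ^ i) * (\<Prod>i<N. 1 - (a * q) * (q ^ 3) ^ i)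
      * (\<Prod>i<N. 1 - (a * q\<^sup>2) * (q ^ 3) ^ i))
      \<longlonglongrightarrow> qpoch a (q ^ 3) * qpoch (a * q) (q ^ 3) * qpoch (a * q\<^sup>2) (q ^ 3)"
    by (intro tendsto_mult qpoch_LIMSEQ q3)
  ultimately show ?thesis using LIMSEQ_unique by auto
qed

lemma qpoch_minus:
  assumes "norm q < 1"
  shows "qpoch a q * qpoch (- a) q = qpoch (a\<^sup>2) (q\<^sup>2)"
proof -
  have q2: "norm (q\<^sup>2) < 1" using norm_power_less_1[OF assms] by simp
  have "(\<Prod>i<N. 1 - a * q ^ i) * (\<Prod>i<N. 1 - (- a) * q ^ i) = (\<Prod>i<N. 1 - a\<^sup>2 * (q\<^sup>2) ^ i)" for N
    unfolding prod.distrib[symmetric]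
    by (intro prod.cong refl) (simp add: algebra_simps power2_eq_square power_mult_distrib)
  moreover have "(\<lambda>N. (\<Prod>i<N. 1 - a * q ^ i) * (\<Prod>i<N. 1 - (- a) * q ^ i))
       \<longlonglongrightarrow> qpoch a q * qpoch (- a) q"
    by (intro tendsto_mult qpoch_LIMSEQ assms)
  ultimately show ?thesis using LIMSEQ_unique[OF _ qpoch_LIMSEQ[OF q2, of "a\<^sup>2"]] by auto
qed

text \<open>The factors combine by \<open>(1 - x) (1 - w x) (1 - w\<^sup>2 x) = 1 - x\<^sup>3\<close>.\<close>

lemma qpoch_cubic:
  assumes "norm q < 1" and w: "w\<^sup>2 + w + 1 = 0"
  shows "qpoch a q * qpoch (w * a) q * qpoch (w\<^sup>2 * a) q = qpoch (a ^ 3) (q ^ 3)"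
proof -
  have q3: "norm (q ^ 3) < 1" using norm_power_less_1[OF assms(1)] by simp
  have c: "(1 - x) * (1 - w * x) * (1 - w\<^sup>2 * x) = 1 - x ^ 3" for x
  proof -
    have "(1 - x) * (1 - w * x) * (1 - w\<^sup>2 * x)
        = 1 - x ^ 3 + (w\<^sup>2 + w + 1) * (- x + w * x\<^sup>2 - (w - 1) * x ^ 3)"
      by (simp add: algebra_simps power2_eq_square power3_eq_cube)
    then show ?thesis by (simp only: w mult_zero_left add_0_right)
  qed
  have "(\<Prod>i<N. 1 - a * q ^ i) * (\<Prod>i<N. 1 - (w * a) * q ^ i) * (\<Prod>i<N. 1 - (w\<^sup>2 * a) * q ^ i)
      = (\<Prod>i<N. 1 - a ^ 3 * (q ^ 3) ^ i)" for N
  proof -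
    have "(1 - a * q ^ i) * (1 - w * a * q ^ i) * (1 - w\<^sup>2 * a * q ^ i) = 1 - a ^ 3 * (q ^ 3) ^ i" for i
    proof -
      have "(a * q ^ i) ^ 3 = a ^ 3 * (q ^ 3) ^ i"
        by (simp add: power_mult_distrib power_mult[symmetric] mult.commute)
      then show ?thesis using c[of "a * q ^ i"] by (simp add: mult.assoc)
    qed
    then show ?thesis unfolding prod.distrib[symmetric] by (intro prod.cong refl)
  qed
  moreover have "(\<lambda>N. (\<Prod>i<N. 1 - a * q ^ i) * (\<Prod>i<N. 1 - (w * a) * q ^ i) * (\<Prod>i<N. 1 - (w\<^sup>2 * a) * q ^ i))
       \<longlonglongrightarrow> qpoch a q * qpoch (w * a) q * qpoch (w\<^sup>2 * a) q"
    by (intro tendsto_mult qpoch_LIMSEQ assms)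
  ultimately show ?thesis using LIMSEQ_unique[OF _ qpoch_LIMSEQ[OF q3, of "a ^ 3"]] by auto
qed

text \<open>Tannery's theorem: outside a finite set that carries almost all of \<open>h\<close>, both sums are small, and on the finite set
the limit may be taken termwise.\<close>

lemma infsum_dominated_LIMSEQ:
  fixes f :: "nat \<Rightarrow> 'a \<Rightarrow> complex"
  assumes lim: "\<And>x. (\<lambda>n. f n x) \<longlonglongrightarrow> g x"
    and bound: "\<And>n x. norm (f n x) \<le> h x"
    and h: "h summable_on UNIV"
  shows "(\<lambda>n. \<Sum>\<^sub>\<infinity>x. f n x) \<longlonglongrightarrow> (\<Sum>\<^sub>\<infinity>x. g x)"
proof (rule LIMSEQ_I)
  fix e :: real assume e: "0 < e"
  have gb: "norm (g x) \<le> h x" for x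
    by (rule LIMSEQ_le_const2[OF tendsto_norm[OF lim]]) (use bound in auto)
  have sf: "(\<lambda>x. norm (f n x)) summable_on A" for n A
    by (rule summable_on_subset[OF summable_on_comparison_test[OF h]]) (use bound in auto)
  have sg: "(\<lambda>x. norm (g x)) summable_on A" for A
    by (rule summable_on_subset[OF summable_on_comparison_test[OF h]]) (use gb in auto)
  have sh: "h summable_on A" for A by (rule summable_on_subset[OF h]) auto
  obtain F where F: "finite F" "dist (sum h F) (infsum h UNIV) \<le> e/4"
    using infsum_finite_approximation[OF h, of "e/4"] e by auto
  have tail: "infsum h (- F) \<le> e/4"
  proof -
    have "infsum h UNIV = infsum h F + infsum h (- F)"
      using infsum_Un_disjoint[OF sh sh, of F "- F"] by simp
    then show ?thesis using F by (auto simp: dist_real_def)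
  qed
  have split: "infsum k UNIV = sum k F + infsum k (- F)"
    if "\<And>A. (\<lambda>x. norm (k x)) summable_on A" for k :: "'a \<Rightarrow> complex"
    using infsum_Un_disjoint[OF abs_summable_summable[OF that] abs_summable_summable[OF that], of F "- F"] F(1) by simp
  have small: "norm (infsum k (- F)) \<le> e/4"
    if that: "\<And>A. (\<lambda>x. norm (k x)) summable_on A" "\<And>x. norm (k x) \<le> h x" for k :: "'a \<Rightarrow> complex"
  proof -
    have "norm (infsum k (- F)) \<le> infsum (\<lambda>x. norm (k x)) (- F)" by (rule norm_infsum_bound[OF that(1)])
    also have "\<dots> \<le> infsum h (- F)" by (rule infsum_mono[OF that(1) sh that(2)])
    finally show ?thesis using tail by linarith
  qed
  have "(\<lambda>n. sum (f n) F) \<longlonglongrightarrow> sum g F" by (intro tendsto_sum lim)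
  then obtain N where N: "\<And>n. n \<ge> N \<Longrightarrow> norm (sum (f n) F - sum g F) < e/4"
    using LIMSEQ_D[of "\<lambda>n. sum (f n) F" "sum g F" "e/4"] e by auto
  show "\<exists>N. \<forall>n\<ge>N. norm (infsum (f n) UNIV - infsum g UNIV) < e"
  proof (intro exI allI impI)
    fix n assume "n \<ge> N"
    have "infsum (f n) UNIV - infsum g UNIV
        = (sum (f n) F - sum g F) + (infsum (f n) (- F) - infsum g (- F))"
      using split[of "f n"] split[of g] sf sg by simp
    also have "norm \<dots> \<le> norm (sum (f n) F - sum g F) + (norm (infsum (f n) (- F)) + norm (infsum g (- F)))"
      by (intro norm_triangle_le add_mono norm_triangle_ineq4) auto
    also have "\<dots> < e"
      using N[OF \<open>n \<ge> N\<close>] small[of "f n"] small[of g] sf sg bound gb e by fastforce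
    finally show "norm (infsum (f n) UNIV - infsum g UNIV) < e" .
  qed
qed

text \<open>The general term of Jacobi's theta series, normalised so that the sum over all integers vanishes at \<open>z = 1\<close>.\<close>

definition theta_term :: "complex \<Rightarrow> complex \<Rightarrow> int \<Rightarrow> complex" where
  "theta_term z q k = (- z) powi k * q powi (k * (k - 1) div 2)"

lemma theta_term_Suc:
  assumes "z \<noteq> 0" "q \<noteq> 0"
  shows "theta_term z q (k + 1) = - z * q powi k * theta_term z q k"
proof -
  have "(k + 1) * ((k + 1) - 1) = k * (k - 1) + k * 2" by (simp add: algebra_simps)
  then have "(k + 1) * ((k + 1) - 1) div 2 = k * (k - 1) div 2 + k" by simp
  then show ?thesis
    unfolding theta_term_def using assms by (simp add: power_int_add mult_ac)
qed

text \<open>The exponent of \<open>r\<close> is quadratic, so the ratio of consecutive terms tends to \<open>0\<close>; the factor \<open>n + 1\<close> is there for the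
sake of derivatives of theta series.\<close>

lemma summable_gaussian:
  fixes c r :: real
  assumes "0 \<le> c" "0 \<le> r" "r < 1"
  shows "summable (\<lambda>n. (real n + 1) * c ^ n * r ^ (n * (n - 1) div 2))"
proof (cases "c = 0 \<or> r = 0")
  case True
  have "(real n + 1) * c ^ n * r ^ (n * (n - 1) div 2) = 0" if "n \<notin> {..1}" for n
  proof -
    have "2 \<le> n * (n - 1)" using that mult_mono[of 2 n 1 "n-1"] by auto
    then have "n * (n - 1) div 2 > 0" by linarith
    then show ?thesis using True that by (auto simp: power_0_left)
  qed
  then show ?thesis by (intro summable_finite[of "{..1}"]) auto
next
  case False
  with assms have pos: "0 < c" "0 < r" by auto
  have "(\<lambda>n. 2 * c * r ^ n) \<longlonglongrightarrow> 2 * c * 0"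
    using pos assms by (intro tendsto_mult_left LIMSEQ_realpow_zero) auto
  then have "eventually (\<lambda>n. 2 * c * r ^ n < 1/2) sequentially"
    by (intro order_tendstoD(2)) auto
  then obtain N where N: "\<And>n. n \<ge> N \<Longrightarrow> 2 * c * r ^ n < 1/2"
    by (auto simp: eventually_sequentially)
  show ?thesis
  proof (rule summable_ratio_test[of "1/2" N])
    fix n assume n: "N \<le> n"
    have e: "Suc n * (Suc n - 1) div 2 = n * (n - 1) div 2 + n"
    proof (cases n)
      case (Suc m)
      have "Suc n * (Suc n - 1) = n * (n - 1) + n * 2" by (simp add: Suc algebra_simps)
      then show ?thesis by simp
    qed auto
    define u where "u = c ^ n * r ^ (n * (n - 1) div 2)"
    have u: "u > 0" using pos by (simp add: u_def)
    have "norm ((real (Suc n) + 1) * c ^ Suc n * r ^ (Suc n * (Suc n - 1) div 2))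
        = (real n + 2) * (c * r ^ n) * u"
      unfolding e u_def using pos by (simp add: power_add mult_ac abs_mult)
    also have "\<dots> \<le> (2 * (real n + 1)) * (c * r ^ n) * u"
      using u pos by (intro mult_right_mono) auto
    also have "\<dots> = (2 * c * r ^ n) * ((real n + 1) * u)" by (simp add: mult_ac)
    also have "\<dots> \<le> 1/2 * ((real n + 1) * u)"
      using N[OF n] u by (intro mult_right_mono) auto
    also have "\<dots> = 1/2 * norm ((real n + 1) * c ^ n * r ^ (n * (n - 1) div 2))"
      using pos by (simp add: u_def mult_ac)
    finally show "norm ((real (Suc n) + 1) * c ^ Suc n * r ^ (Suc n * (Suc n - 1) div 2))
        \<le> 1/2 * norm ((real n + 1) * c ^ n * r ^ (n * (n - 1) div 2))" .
  qed simp
qed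

lemma summable_on_int_iff_nats:
  fixes f :: "int \<Rightarrow> real"
  assumes "summable (\<lambda>n. f (int n))" "summable (\<lambda>n. f (- int n - 1))" "\<And>k. f k \<ge> 0"
  shows "f summable_on UNIV"
proof -
  have "(f \<circ> int) summable_on UNIV"
    using assms by (intro summable_nonneg_imp_summable_on) (auto simp: o_def)
  then have 1: "f summable_on range int"
    by (subst summable_on_reindex) auto
  have inj: "inj (\<lambda>n. - int n - 1)" by (auto simp: inj_def)
  have "(f \<circ> (\<lambda>n. - int n - 1)) summable_on UNIV"
    using assms by (intro summable_nonneg_imp_summable_on) (auto simp: o_def)
  then have 2: "f summable_on range (\<lambda>n. - int n - 1)"
    by (subst summable_on_reindex[OF inj]) auto
  have "k \<in> range int \<union> range (\<lambda>n. - int n - 1)" for k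
  proof (cases "k \<ge> 0")
    case True then have "k = int (nat k)" by simp
    then show ?thesis by blast
  next
    case False then have "k = - int (nat (- k - 1)) - 1" by simp
    then show ?thesis by blast
  qed
  then have "UNIV = range int \<union> range (\<lambda>n. - int n - 1)" by blast
  moreover have "f summable_on (range int \<union> range (\<lambda>n. - int n - 1))"
    by (intro summable_on_Un_disjoint 1 2) auto
  ultimately show ?thesis by simp
qed

lemma theta_term_weighted_summable:
  assumes "z \<noteq> 0" "q \<noteq> 0" "norm q < 1"
  shows "(\<lambda>k. (\<bar>real_of_int k\<bar> + 1) * norm (theta_term z q k)) summable_on UNIV"
proof (rule summable_on_int_iff_nats)
  define r where "r = norm q"
  have r: "0 < r" "r < 1" using assms by (auto simp: r_def)
  have t: "norm (theta_term z q k) = norm z powi k * r powi (k * (k - 1) div 2)" for k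
    by (simp add: theta_term_def norm_mult norm_power_int r_def)
  have "(\<bar>real_of_int (int n)\<bar> + 1) * norm (theta_term z q (int n))
       = (real n + 1) * norm z ^ n * r ^ (n * (n - 1) div 2)" for n
  proof -
    have "int n * (int n - 1) div 2 = int (n * (n - 1) div 2)"
      by (cases n) (auto simp: zdiv_int algebra_simps)
    then show ?thesis unfolding t by simp
  qed
  then show "summable (\<lambda>n. (\<bar>real_of_int (int n)\<bar> + 1) * norm (theta_term z q (int n)))"
    using summable_gaussian[of "norm z" r] r by (simp only: norm_ge_zero less_imp_le)
  let ?g = "\<lambda>n. 2 * norm (1/z) * ((real n + 1) * norm (1/z) ^ n * r ^ (n * (n - 1) div 2))"
  show "summable (\<lambda>n. (\<bar>real_of_int (- int n - 1)\<bar> + 1) * norm (theta_term z q (- int n - 1)))"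
  proof (rule summable_comparison_test')
    show "summable ?g" using summable_gaussian[of "norm (1/z)" r] r by (intro summable_mult) auto
    fix n :: nat
    have e: "(- int n - 1) * ((- int n - 1) - 1) div 2 = int ((n + 1) * (n + 2) div 2)"
      by (simp add: zdiv_int algebra_simps)
    have "(\<bar>real_of_int (- int n - 1)\<bar> + 1) * norm (theta_term z q (- int n - 1))
        = (real n + 2) * (norm (1/z) * norm (1/z) ^ n * r ^ ((n + 1) * (n + 2) div 2))"
    proof -
      have "norm z powi (- int n - 1) = norm (1/z) * norm (1/z) ^ n"
        using assms(1) by (simp add: power_int_diff power_int_minus norm_divide divide_simps)
      moreover have "\<bar>real_of_int (- int n - 1)\<bar> + 1 = real n + 2" by simp
      ultimately show ?thesis unfolding t e power_int_of_nat by (simp only: mult.assoc)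
    qed
    also have "\<dots> \<le> (2 * (real n + 1)) * (norm (1/z) * norm (1/z) ^ n * r ^ (n * (n - 1) div 2))"
    proof -
      have "n * (n - 1) \<le> (n + 1) * (n + 2)" by (intro mult_mono) auto
      then have "r ^ ((n + 1) * (n + 2) div 2) \<le> r ^ (n * (n - 1) div 2)"
        using r by (intro power_decreasing div_le_mono) auto
      then show ?thesis using r by (intro mult_mono) auto
    qed
    also have "\<dots> = ?g n" by (simp add: mult_ac)
    finally show "norm ((\<bar>real_of_int (- int n - 1)\<bar> + 1) * norm (theta_term z q (- int n - 1))) \<le> ?g n"
      by simp
  qed
qed simp

section \<open>The Jacobi triple product\<close>

definition qfact :: "complex \<Rightarrow> nat \<Rightarrow> complex" where
  "qfact q n = (\<Prod>i<n. 1 - q ^ Suc i)"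

text \<open>The reciprocal of a \<open>q\<close>-factorial is \<open>0\<close> at negative integers; with this convention its recursion holds at every
integer and symmetric sums may be extended or shifted freely.\<close>

definition inv_qfact :: "complex \<Rightarrow> int \<Rightarrow> complex" where
  "inv_qfact q n = (if n < 0 then 0 else 1 / qfact q (nat n))"

text \<open>The Gaussian binomial coefficient of \<open>2 N\<close> over \<open>N + k\<close>.\<close>

definition central_qbinom :: "complex \<Rightarrow> nat \<Rightarrow> int \<Rightarrow> complex" where
  "central_qbinom q N k = qfact q (2 * N) * inv_qfact q (int N - k) * inv_qfact q (int N + k)"

lemma one_minus_power_nonzero:
  fixes q :: complex
  assumes "norm q < 1"
  shows "1 - q ^ Suc n \<noteq> 0"
  using norm_power_less_1[OF assms, of "Suc n"] by auto

lemma qfact_nonzero: "norm q < 1 \<Longrightarrow> qfact q n \<noteq> 0"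
  unfolding qfact_def using one_minus_power_nonzero by (subst prod_zero_iff) blast+

lemma qfact_LIMSEQ: "norm q < 1 \<Longrightarrow> qfact q \<longlonglongrightarrow> qpoch q q"
  using qpoch_LIMSEQ[of q q] by (simp add: qfact_def[abs_def])

lemma inv_qfact_pred:
  assumes "norm q < 1"
  shows "inv_qfact q (n - 1) = (1 - q powi n) * inv_qfact q n"
proof (cases "n \<le> 0")
  case True
  then show ?thesis by (cases "n = 0") (auto simp: inv_qfact_def)
next
  case False
  then obtain m where m: "n = int (Suc m)" by (metis gr0_conv_Suc linorder_not_less zero_less_imp_eq_int)
  have "inv_qfact q (n - 1) = 1 / qfact q m" "inv_qfact q n = 1 / qfact q (Suc m)"
    unfolding inv_qfact_def m by (auto simp del: of_nat_Suc simp add: nat_int nat_diff_distrib)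
  moreover have "q powi n = q ^ Suc m" unfolding m by (rule power_int_of_nat)
  moreover have "qfact q (Suc m) = qfact q m * (1 - q ^ Suc m)" by (simp add: qfact_def)
  ultimately show ?thesis
    using qfact_nonzero[OF assms, of m] one_minus_power_nonzero[OF assms, of m] by simp
qed

lemma central_qbinom_outside: "\<bar>k\<bar> > int N \<Longrightarrow> central_qbinom q N k = 0"
  by (auto simp: central_qbinom_def inv_qfact_def)

text \<open>Two steps of the Pascal rule for Gaussian binomials at once, one at either end. This is the combination that arises when
the finite triple product is enlarged by one factor on each side.\<close>

lemma central_qbinom_Suc:
  assumes q: "norm q < 1" "q \<noteq> 0"
  shows "central_qbinom q (Suc N) k = (1 + q ^ (2 * N + 1)) * central_qbinom q N k
     + q powi (int N - k + 1) * central_qbinom q N (k - 1)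
     + q powi (int N + k + 1) * central_qbinom q N (k + 1)"
proof -
  define x y where "x = inv_qfact q (int N + 1 - k)" and "y = inv_qfact q (int N + 1 + k)"
  define a b where "a = q powi (int N + 1 - k)" and "b = q powi (int N + 1 + k)"
  have pred: "inv_qfact q m = (1 - q powi n) * inv_qfact q n" if "m = n - 1" for m n
    using inv_qfact_pred[OF q(1), of n] that by simp
  have aq: "q powi (int N - k) = a / q" "q powi (int N + k) = b / q"
    using q by (auto simp: a_def b_def power_int_diff power_int_add)
  have 1: "inv_qfact q (int N - k) = (1 - a) * x" "inv_qfact q (int N + k) = (1 - b) * y"
    unfolding x_def y_def a_def b_def by (rule pred; simp)+
  have 2: "inv_qfact q (int N - (k - 1)) = x" "inv_qfact q (int N + (k - 1)) = (1 - b / q) * ((1 - b) * y)"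
    using pred[of "int N + (k - 1)" "int N + k"] unfolding 1 aq by (auto simp: x_def algebra_simps)
  have 3: "inv_qfact q (int N - (k + 1)) = (1 - a / q) * ((1 - a) * x)" "inv_qfact q (int N + (k + 1)) = y"
    using pred[of "int N - (k + 1)" "int N - k"] unfolding 1 aq by (auto simp: y_def algebra_simps)
  have ab: "a * b = q ^ (2 * N + 2)"
  proof -
    have "a * b = q powi ((int N + 1 - k) + (int N + 1 + k))"
      unfolding a_def b_def using q by (subst power_int_add) auto
    also have "(int N + 1 - k) + (int N + 1 + k) = int (2 * N + 2)" by simp
    finally show ?thesis by (simp only: power_int_of_nat)
  qed
  have ab': "q ^ (2 * N + 1) = a * b / q" unfolding ab using q by simp
  have f: "qfact q (2 * Suc N) = qfact q (2 * N) * (1 - a * b / q) * (1 - a * b)"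
    unfolding ab'[symmetric] ab by (simp add: qfact_def)
  have "(1 - a * b / q) * (1 - a * b)
      = (1 + a * b / q) * ((1 - a) * (1 - b)) + a * ((1 - b / q) * (1 - b)) + b * ((1 - a / q) * (1 - a))"
    using q by (simp add: field_simps)
  then have "qfact q (2 * N) * ((1 - a * b / q) * (1 - a * b)) * (x * y) = qfact q (2 * N)
      * ((1 + a * b / q) * ((1 - a) * (1 - b)) + a * ((1 - b / q) * (1 - b)) + b * ((1 - a / q) * (1 - a))) * (x * y)"
    by simp
  also have "\<dots> = (1 + a * b / q) * (qfact q (2 * N) * ((1 - a) * x) * ((1 - b) * y))
      + a * (qfact q (2 * N) * x * ((1 - b / q) * ((1 - b) * y)))
      + b * (qfact q (2 * N) * ((1 - a / q) * ((1 - a) * x)) * y)"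
  proof -
    have "F * ((1 + t) * ((1 - a) * (1 - b)) + a * ((1 - v) * (1 - b)) + b * ((1 - u) * (1 - a))) * (x * y)
      = (1 + t) * (F * ((1 - a) * x) * ((1 - b) * y)) + a * (F * x * ((1 - v) * ((1 - b) * y)))
        + b * (F * ((1 - u) * ((1 - a) * x)) * y)" for F t u v :: complex
      by (simp add: algebra_simps)
    then show ?thesis .
  qed
  finally have "qfact q (2 * N) * ((1 - a * b / q) * (1 - a * b)) * (x * y) = \<dots>" .
  moreover have "central_qbinom q (Suc N) k = qfact q (2 * N) * ((1 - a * b / q) * (1 - a * b)) * (x * y)"
    unfolding central_qbinom_def f x_def y_def by (simp only: of_nat_Suc add_ac mult_ac)
  moreover have "q powi (int N - k + 1) = a" "q powi (int N + k + 1) = b"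
    by (simp_all add: a_def b_def algebra_simps)
  ultimately show ?thesis
    unfolding central_qbinom_def 1 2 3 ab' by simp
qed

text \<open>Multiplying a theta term by \<open>z q\<^sup>N\<close> or by \<open>q\<^sup>N q / z\<close> moves it to a neighbouring index, so the two new factors act
on the coefficients exactly as in the recursion of the central Gaussian binomials.\<close>

lemma finite_Jacobi_triple_product:
  assumes q: "norm q < 1" "q \<noteq> 0" and z: "z \<noteq> 0"
  shows "(\<Prod>i<N. 1 - z * q ^ i) * (\<Prod>i<N. 1 - q / z * q ^ i)
      = (\<Sum>k=-int N..int N. central_qbinom q N k * theta_term z q k)"
proof (induction N)
  case 0
  then show ?case by (simp add: central_qbinom_def inv_qfact_def qfact_def theta_term_def)
next
  case (Suc N)
  let ?c = "central_qbinom q N" and ?t = "theta_term z q"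
  let ?I = "{-int (Suc N)..int (Suc N)}"
  have up: "?t (k + 1) = - z * q powi k * ?t k" for k using theta_term_Suc[OF z q(2)] .
  have up': "z * q ^ N * ?t k = - (q powi (int N - k) * ?t (k + 1))" for k
    unfolding up using q by (simp add: power_int_diff)
  have down: "q ^ N * (q / z) * ?t k = - (q powi (int N + k) * ?t (k - 1))" for k
    using up[of "k - 1"] q z by (simp add: power_int_diff power_int_add)
  have prod: "(1 - z * q ^ N) * (1 - q / z * q ^ N) * ?t k
      = (1 + q ^ (2 * N + 1)) * ?t k + q powi (int N - k) * ?t (k + 1) + q powi (int N + k) * ?t (k - 1)" for k
  proof -
    have "(1 - z * q ^ N) * (1 - q / z * q ^ N) * ?t k
       = (1 + q ^ (2 * N + 1)) * ?t k - z * q ^ N * ?t k - q ^ N * (q / z) * ?t k"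
      using z by (simp add: field_simps power_mult power2_eq_square flip: power_add)
    then show ?thesis unfolding up' down by simp
  qed
  have ext: "(\<Sum>k\<in>{-int N..int N}. ?c k * g k) = (\<Sum>k\<in>{-int N-l..int N+l'}. ?c k * g k)"
    if "l \<ge> 0" "l' \<ge> 0" for g :: "int \<Rightarrow> complex" and l l' :: int
    by (rule sum.mono_neutral_left) (use that in \<open>auto simp: central_qbinom_outside\<close>)
  have "(\<Prod>i<Suc N. 1 - z * q ^ i) * (\<Prod>i<Suc N. 1 - q / z * q ^ i)
      = (\<Sum>k\<in>{-int N..int N}. ?c k * ?t k) * ((1 - z * q ^ N) * (1 - q / z * q ^ N))"
    unfolding Suc.IH[symmetric] by (simp add: mult_ac)
  also have "\<dots> = (\<Sum>k\<in>{-int N..int N}. ?c k * ((1 - z * q ^ N) * (1 - q / z * q ^ N) * ?t k))"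
    unfolding sum_distrib_right by (simp add: mult_ac)
  also have "\<dots> = (\<Sum>k\<in>{-int N..int N}. ?c k * ((1 + q ^ (2 * N + 1)) * ?t k))
       + (\<Sum>k\<in>{-int N..int N}. ?c k * (q powi (int N - k) * ?t (k + 1)))
       + (\<Sum>k\<in>{-int N..int N}. ?c k * (q powi (int N + k) * ?t (k - 1)))"
    unfolding prod by (simp add: ring_distribs sum.distrib)
  also have "(\<Sum>k\<in>{-int N..int N}. ?c k * ((1 + q ^ (2 * N + 1)) * ?t k))
       = (\<Sum>k\<in>?I. (1 + q ^ (2 * N + 1)) * ?c k * ?t k)"
  proof -
    have "?I = {-int N - 1..int N + 1}" by auto
    then show ?thesis using ext[of 1 1 "\<lambda>k. (1 + q ^ (2 * N + 1)) * ?t k"] by (simp only: mult_ac zero_le_one)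
  qed
  also have "(\<Sum>k\<in>{-int N..int N}. ?c k * (q powi (int N - k) * ?t (k + 1)))
       = (\<Sum>k\<in>?I. q powi (int N - k + 1) * ?c (k - 1) * ?t k)"
    unfolding ext[of 2 0, simplified]
    by (rule sum.reindex_bij_witness[of _ "\<lambda>k. k - 1" "\<lambda>k. k + 1"]) (auto simp: mult_ac)
  also have "(\<Sum>k\<in>{-int N..int N}. ?c k * (q powi (int N + k) * ?t (k - 1)))
       = (\<Sum>k\<in>?I. q powi (int N + k + 1) * ?c (k + 1) * ?t k)"
    unfolding ext[of 0 2, simplified]
    by (rule sum.reindex_bij_witness[of _ "\<lambda>k. k + 1" "\<lambda>k. k - 1"]) (auto simp: mult_ac add_ac)
  finally show ?case
    unfolding central_qbinom_Suc[OF q] by (simp add: ring_distribs sum.distrib mult_ac)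
qed

lemma central_qbinom_LIMSEQ:
  assumes q: "norm q < 1"
  shows "(\<lambda>N. central_qbinom q N k) \<longlonglongrightarrow> 1 / qpoch q q"
proof -
  have nz: "qpoch q q \<noteq> 0" by (rule qpoch_nonzero_small) (use q in auto)
  have shift: "(\<lambda>N. inv_qfact q (int N + l)) \<longlonglongrightarrow> 1 / qpoch q q" for l
  proof -
    have "(\<lambda>n. 1 / qfact q n) \<longlonglongrightarrow> 1 / qpoch q q"
      by (intro tendsto_divide tendsto_const qfact_LIMSEQ q nz)
    moreover have "filterlim (\<lambda>N. nat (int N + l)) at_top sequentially"
      unfolding filterlim_at_top eventually_sequentially
    proof
      fix Z :: nat
      show "\<exists>N. \<forall>n\<ge>N. Z \<le> nat (int n + l)" by (rule exI[of _ "nat (int Z - l)"]) auto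
    qed
    ultimately have "(\<lambda>N. 1 / qfact q (nat (int N + l))) \<longlonglongrightarrow> 1 / qpoch q q"
      by (rule filterlim_compose)
    moreover have "\<forall>\<^sub>F N in sequentially. 1 / qfact q (nat (int N + l)) = inv_qfact q (int N + l)"
      unfolding eventually_sequentially by (rule exI[of _ "nat (- l)"]) (auto simp: inv_qfact_def)
    ultimately show ?thesis by (rule Lim_transform_eventually)
  qed
  have two: "(\<lambda>N. qfact q (2 * N)) \<longlonglongrightarrow> qpoch q q"
    using LIMSEQ_subseq_LIMSEQ[OF qfact_LIMSEQ[OF q], of "\<lambda>N. 2*N"] by (auto simp: strict_mono_def o_def)
  have "(\<lambda>N. central_qbinom q N k) \<longlonglongrightarrow> qpoch q q * (1 / qpoch q q) * (1 / qpoch q q)"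
    unfolding central_qbinom_def using shift[of "- k"] shift[of k] two by (intro tendsto_mult) auto
  then show ?thesis using nz by simp
qed

lemma central_qbinom_bounded:
  assumes q: "norm q < 1"
  obtains B where "B > 0" "\<And>N k. norm (central_qbinom q N k) \<le> B"
proof -
  have nz: "qpoch q q \<noteq> 0" by (rule qpoch_nonzero_small) (use q in auto)
  have "Bseq (qfact q)" by (rule convergent_imp_Bseq) (use qfact_LIMSEQ[OF q] in \<open>auto simp: convergent_def\<close>)
  then obtain B1 where B1: "B1 > 0" "\<And>n. norm (qfact q n) \<le> B1" by (auto simp: Bseq_def)
  have "(\<lambda>n. 1 / qfact q n) \<longlonglongrightarrow> 1 / qpoch q q"
    by (intro tendsto_divide tendsto_const qfact_LIMSEQ q nz)
  then have "Bseq (\<lambda>n. 1 / qfact q n)" by (intro convergent_imp_Bseq) (auto simp: convergent_def)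
  then obtain B2 where B2: "B2 > 0" "\<And>n. norm (1 / qfact q n) \<le> B2" by (auto simp: Bseq_def)
  have i: "norm (inv_qfact q n) \<le> B2" for n
    using B2(2)[of "nat n"] B2(1) by (auto simp: inv_qfact_def)
  have "norm (central_qbinom q N k) \<le> B1 * B2 * B2" for N k
    unfolding central_qbinom_def norm_mult
    using B1 B2(1) i by (intro mult_mono) auto
  then show ?thesis using that[of "B1 * B2 * B2"] B1(1) B2(1) by auto
qed

text \<open>The coefficients converge and are bounded uniformly in \<open>N\<close> and \<open>k\<close>, so the limit is taken termwise. The weight \<open>g\<close> is
\<open>1\<close> for theta series and \<open>k\<close> for their derivatives.\<close>

lemma theta_finite_sum_LIMSEQ:
  assumes q: "norm q < 1" "q \<noteq> 0" and z: "z \<noteq> 0"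
    and g: "\<And>k. norm (g k) \<le> \<bar>real_of_int k\<bar> + 1"
  shows "(\<lambda>N. \<Sum>k=-int N..int N. central_qbinom q N k * (g k * theta_term z q k))
     \<longlonglongrightarrow> (\<Sum>\<^sub>\<infinity>k. g k * theta_term z q k) / qpoch q q"
proof -
  obtain B where B: "B > 0" "\<And>N k. norm (central_qbinom q N k) \<le> B"
    using central_qbinom_bounded[OF q(1)] by blast
  have "(\<lambda>N. \<Sum>\<^sub>\<infinity>k. central_qbinom q N k * (g k * theta_term z q k))
      \<longlonglongrightarrow> (\<Sum>\<^sub>\<infinity>k. 1 / qpoch q q * (g k * theta_term z q k))"
  proof (rule infsum_dominated_LIMSEQ)
    show "(\<lambda>k. B * ((\<bar>real_of_int k\<bar> + 1) * norm (theta_term z q k))) summable_on UNIV"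
      using theta_term_weighted_summable[OF z q(2,1)] by (rule summable_on_cmult_right)
    show "(\<lambda>N. central_qbinom q N k * (g k * theta_term z q k)) \<longlonglongrightarrow> 1 / qpoch q q * (g k * theta_term z q k)" for k
      by (intro tendsto_mult_right central_qbinom_LIMSEQ q)
  qed (use B g in \<open>auto simp: norm_mult intro!: mult_mono\<close>)
  moreover have "(\<Sum>\<^sub>\<infinity>k. central_qbinom q N k * (g k * theta_term z q k))
      = (\<Sum>k=-int N..int N. central_qbinom q N k * (g k * theta_term z q k))" for N
  proof -
    have "(\<Sum>\<^sub>\<infinity>k. central_qbinom q N k * (g k * theta_term z q k))
        = (\<Sum>\<^sub>\<infinity>k\<in>{-int N..int N}. central_qbinom q N k * (g k * theta_term z q k))"
      by (rule infsum_cong_neutral) (auto simp: central_qbinom_outside)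
    then show ?thesis by simp
  qed
  ultimately show ?thesis by (simp add: infsum_cmult_right' divide_inverse mult.commute)
qed

definition theta :: "complex \<Rightarrow> complex \<Rightarrow> complex" where
  "theta z q = (\<Sum>\<^sub>\<infinity>k. theta_term z q k)"

text \<open>The derivative of the theta series with respect to \<open>z d/dz\<close>.\<close>

definition theta' :: "complex \<Rightarrow> complex \<Rightarrow> complex" where
  "theta' z q = (\<Sum>\<^sub>\<infinity>k. of_int k * theta_term z q k)"

theorem Jacobi_triple_product:
  assumes q: "norm q < 1" "q \<noteq> 0" and z: "z \<noteq> 0"
  shows "theta z q = qpoch q q * qpoch z q * qpoch (q / z) q"
proof -
  have nz: "qpoch q q \<noteq> 0" by (rule qpoch_nonzero_small) (use q in auto)
  have "(\<lambda>N. \<Sum>k=-int N..int N. central_qbinom q N k * (1 * theta_term z q k))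
     \<longlonglongrightarrow> (\<Sum>\<^sub>\<infinity>k. 1 * theta_term z q k) / qpoch q q"
    by (rule theta_finite_sum_LIMSEQ[OF q z]) auto
  moreover have "(\<lambda>N. (\<Prod>i<N. 1 - z * q ^ i) * (\<Prod>i<N. 1 - q / z * q ^ i)) \<longlonglongrightarrow> qpoch z q * qpoch (q / z) q"
    by (intro tendsto_mult qpoch_LIMSEQ q)
  ultimately have "qpoch z q * qpoch (q / z) q = theta z q / qpoch q q"
    unfolding finite_Jacobi_triple_product[OF q z] theta_def using LIMSEQ_unique by auto
  then show ?thesis using nz by (simp add: field_simps)
qed

lemma finite_theta_has_derivative:
  assumes q: "q \<noteq> 0" and z: "z \<noteq> 0"
  shows "((\<lambda>z. \<Sum>k=-int N..int N. central_qbinom q N k * theta_term z q k) has_field_derivative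
     (\<Sum>k=-int N..int N. central_qbinom q N k * (of_int k * theta_term z q k)) / z) (at z)"
proof -
  have "((\<lambda>z. theta_term z q k) has_field_derivative of_int k * theta_term z q k / z) (at z)" for k
    unfolding theta_term_def
    by (rule derivative_eq_intros refl | use z in \<open>simp add: power_int_diff\<close>)+
  then show ?thesis
    unfolding sum_divide_distrib
    by (intro DERIV_sum) (auto intro!: derivative_eq_intros)
qed

text \<open>Jacobi's series for the cube of Euler's product. In the finite triple product the factor \<open>1 - z\<close> is the
only one that vanishes at \<open>z = 1\<close>, so the derivative there is minus the product of the others.\<close>

theorem theta'_1:
  assumes q: "norm q < 1" "q \<noteq> 0"
  shows "theta' 1 q = - (qpoch q q ^ 3)"
proof -
  have nz: "qpoch q q \<noteq> 0" by (rule qpoch_nonzero_small) (use q in auto)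
  \<comment> \<open>The finite triple product without its factor \<open>1 - z\<close>.\<close>
  define G where "G = (\<lambda>N z. (\<Prod>i<N. 1 - (z * q) * q ^ i) * (\<Prod>i<Suc N. 1 - q / z * q ^ i))"
  have fact: "(\<Prod>i<Suc N. 1 - z * q ^ i) * (\<Prod>i<Suc N. 1 - q / z * q ^ i) = (1 - z) * G N z" for N z
    unfolding G_def by (simp add: prod.lessThan_Suc_shift[of "\<lambda>i. 1 - z * q ^ i"] mult_ac del: prod.lessThan_Suc)
  have "(\<Sum>k=-int (Suc N)..int (Suc N). central_qbinom q (Suc N) k * (of_int k * theta_term 1 q k)) = - G N 1" for N
  proof -
    have "G N holomorphic_on (- {0})"
      unfolding G_def by (intro holomorphic_intros) auto
    then have "(G N) field_differentiable (at 1)"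
      by (rule holomorphic_on_imp_differentiable_at) auto
    then obtain D where D: "(G N has_field_derivative D) (at 1)" by (auto simp: field_differentiable_def)
    have d: "((\<lambda>z. (1 - z) * G N z) has_field_derivative (- G N 1)) (at 1)"
      by (rule derivative_eq_intros D refl | simp)+
    have ev: "\<forall>\<^sub>F z in nhds 1. (1 - z) * G N z
        = (\<Sum>k=-int (Suc N)..int (Suc N). central_qbinom q (Suc N) k * theta_term z q k)"
    proof -
      have "\<forall>\<^sub>F z in nhds (1::complex). z \<noteq> 0" by (rule t1_space_nhds) auto
      then show ?thesis
        by eventually_elim (subst fact[symmetric], rule finite_Jacobi_triple_product[OF q])
    qed
    from DERIV_unique[OF DERIV_cong_ev[OF refl ev refl, THEN iffD1, OF d] finite_theta_has_derivative[OF q(2)]]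
    show ?thesis by simp
  qed
  moreover have "(\<lambda>N. \<Sum>k=-int N..int N. central_qbinom q N k * (of_int k * theta_term 1 q k))
     \<longlonglongrightarrow> theta' 1 q / qpoch q q"
    unfolding theta'_def by (rule theta_finite_sum_LIMSEQ[OF q]) auto
  from LIMSEQ_Suc[OF this] have "(\<lambda>N. \<Sum>k=-int (Suc N)..int (Suc N). central_qbinom q (Suc N) k * (of_int k * theta_term 1 q k))
     \<longlonglongrightarrow> theta' 1 q / qpoch q q" .
  ultimately have "(\<lambda>N. - G N 1) \<longlonglongrightarrow> theta' 1 q / qpoch q q" by simp
  moreover have "(\<lambda>N. - G N 1) \<longlonglongrightarrow> - (qpoch q q * qpoch q q)"
  proof -
    have 1: "(\<lambda>N. \<Prod>i<N. 1 - q * q ^ i) \<longlonglongrightarrow> qpoch q q" by (rule qpoch_LIMSEQ[OF q(1)])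
    from tendsto_minus[OF tendsto_mult[OF 1 LIMSEQ_Suc[OF 1]]] show ?thesis unfolding G_def by simp
  qed
  ultimately have "theta' 1 q / qpoch q q = - (qpoch q q * qpoch q q)" by (rule LIMSEQ_unique)
  then show ?thesis using nz by (simp add: field_simps power3_eq_cube)
qed

text \<open>The logarithmic derivative, with respect to \<open>z d/dz\<close>, of the triple product.\<close>

definition theta_logderiv :: "complex \<Rightarrow> complex \<Rightarrow> complex" where
  "theta_logderiv z q = (\<Sum>i. (q / z * q ^ i) / (1 - q / z * q ^ i) - (z * q ^ i) / (1 - z * q ^ i))"

lemma lambert_abs_summable:
  fixes q z :: complex
  assumes q: "norm q < 1"
  shows "summable (\<lambda>i. norm ((z * q ^ i) / (1 - z * q ^ i)))"
proof (rule summable_comparison_test_ev)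
  have l: "(\<lambda>i. z * q ^ i) \<longlonglongrightarrow> z * 0" by (intro tendsto_mult_left LIMSEQ_power_zero q)
  then have "\<forall>\<^sub>F i in sequentially. norm (z * q ^ i - z * 0) < 1/2"
    using tendstoD[OF l, of "1/2"] by (simp add: dist_norm)
  then show "\<forall>\<^sub>F i in sequentially. norm (norm ((z * q ^ i) / (1 - z * q ^ i))) \<le> 2 * norm z * norm q ^ i"
  proof eventually_elim
    case (elim i)
    have "1 - norm (z * q ^ i) \<le> norm (1 - z * q ^ i)" using norm_triangle_ineq2[of 1 "z * q ^ i"] by simp
    with elim have b: "1/2 \<le> norm (1 - z * q ^ i)" by simp
    have "norm ((z * q ^ i) / (1 - z * q ^ i)) \<le> norm (z * q ^ i) / (1/2)"
      unfolding norm_divide using b by (intro divide_left_mono) auto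
    then show ?case by (simp add: norm_mult norm_power)
  qed
  show "summable (\<lambda>i. 2 * norm z * norm q ^ i)"
    using q by (intro summable_mult summable_geometric) simp
qed

text \<open>The finite triple product is differentiated on both sides and the limit is taken afterwards, which avoids
differentiating an infinite product.\<close>

theorem theta'_eq_logderiv:
  assumes q: "norm q < 1" "q \<noteq> 0" and z: "z \<noteq> 0"
    and nz: "\<And>i. z * q ^ i \<noteq> 1" "\<And>i. q / z * q ^ i \<noteq> 1"
  shows "theta' z q = theta z q * theta_logderiv z q"
proof -
  have nzE: "qpoch q q \<noteq> 0" by (rule qpoch_nonzero_small) (use q in auto)
  define L where "L = (\<lambda>N. \<Sum>i<N. (q / z * q ^ i) / (1 - q / z * q ^ i) - (z * q ^ i) / (1 - z * q ^ i))"
  define F where "F = (\<lambda>N z. (\<Prod>i<N. 1 - z * q ^ i) * (\<Prod>i<N. 1 - q / z * q ^ i))"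
  have der: "(F N has_field_derivative F N z * L N / z) (at z)" for N
  proof (induction N)
    case 0
    then show ?case by (simp add: F_def L_def)
  next
    case (Suc N)
    have nz': "1 - z * q ^ N \<noteq> 0" "1 - q / z * q ^ N \<noteq> 0" using nz by (metis eq_iff_diff_eq_0)+
    let ?u = "\<lambda>z. (1 - z * q ^ N) * (1 - q / z * q ^ N)"
    have F: "F (Suc N) = (\<lambda>z. F N z * ?u z)" by (auto simp: F_def mult_ac)
    have "(?u has_field_derivative (- (q ^ N) * (1 - q / z * q ^ N) + (1 - z * q ^ N) * (q / z\<^sup>2 * q ^ N))) (at z)"
      by (rule derivative_eq_intros refl | use z in \<open>simp add: power2_eq_square\<close>)+
    from DERIV_mult[OF Suc.IH this]
    have "(F (Suc N) has_field_derivative (F N z * L N / z * ?u z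
       + (- (q ^ N) * (1 - q / z * q ^ N) + (1 - z * q ^ N) * (q / z\<^sup>2 * q ^ N)) * F N z)) (at z)"
      unfolding F by (simp add: add_ac mult_ac)
    moreover have "F (Suc N) z * L (Suc N) / z = F N z * L N / z * ?u z
       + (- (q ^ N) * (1 - q / z * q ^ N) + (1 - z * q ^ N) * (q / z\<^sup>2 * q ^ N)) * F N z"
    proof -
      define a b where "a = z * q ^ N" and "b = q / z * q ^ N"
      have ab: "1 - a \<noteq> 0" "1 - b \<noteq> 0" using nz' by (auto simp: a_def b_def)
      have r: "- (q ^ N) * (1 - q / z * q ^ N) + (1 - z * q ^ N) * (q / z\<^sup>2 * q ^ N)
          = (- a * (1 - b) + (1 - a) * b) / z"
        unfolding a_def b_def using z by (simp add: field_simps power2_eq_square)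
      have "(1 - a) * (1 - b) * (b / (1 - b) - a / (1 - a)) = - a * (1 - b) + (1 - a) * b"
      proof -
        have "(1 - a) * (1 - b) * (x - y) = (1 - a) * ((1 - b) * x) - (1 - b) * ((1 - a) * y)" for x y
          by (simp add: algebra_simps)
        moreover have "(1 - b) * (b / (1 - b)) = b" "(1 - a) * (a / (1 - a)) = a" using ab by auto
        ultimately show ?thesis by simp
      qed
      moreover have "F (Suc N) z * L (Suc N) = F N z * ((1 - a) * (1 - b)) * L N
         + F N z * ((1 - a) * (1 - b) * (b / (1 - b) - a / (1 - a)))"
      proof -
        have L': "L (Suc N) = L N + (b / (1 - b) - a / (1 - a))" by (simp add: L_def a_def b_def)
        have "f * u * (l + v) = f * u * l + f * (u * v)" for f u l v :: complex by (simp add: algebra_simps)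
        then show ?thesis unfolding F L' a_def[symmetric] b_def[symmetric] .
      qed
      ultimately show ?thesis unfolding r unfolding a_def[symmetric] b_def[symmetric]
        by (simp add: add_divide_distrib mult_ac)
    qed
    ultimately show ?case by simp
  qed
  have "(\<Sum>k=-int N..int N. central_qbinom q N k * (of_int k * theta_term z q k)) = F N z * L N" for N
  proof -
    have ev: "\<forall>\<^sub>F z in nhds z. F N z = (\<Sum>k=-int N..int N. central_qbinom q N k * theta_term z q k)"
    proof -
      have "\<forall>\<^sub>F x in nhds z. x \<noteq> 0" by (rule t1_space_nhds) (use z in auto)
      then show ?thesis
        unfolding F_def by eventually_elim (rule finite_Jacobi_triple_product[OF q])
    qed
    from DERIV_unique[OF DERIV_cong_ev[OF refl ev refl, THEN iffD1, OF der] finite_theta_has_derivative[OF q(2) z]]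
    show ?thesis using z by simp
  qed
  moreover have "(\<lambda>N. \<Sum>k=-int N..int N. central_qbinom q N k * (of_int k * theta_term z q k))
     \<longlonglongrightarrow> theta' z q / qpoch q q"
    unfolding theta'_def by (rule theta_finite_sum_LIMSEQ[OF q z]) auto
  ultimately have "(\<lambda>N. F N z * L N) \<longlonglongrightarrow> theta' z q / qpoch q q" by simp
  moreover have "(\<lambda>N. F N z * L N) \<longlonglongrightarrow> qpoch z q * qpoch (q / z) q * theta_logderiv z q"
  proof -
    have "L \<longlonglongrightarrow> theta_logderiv z q"
      unfolding L_def theta_logderiv_def
      by (intro summable_LIMSEQ summable_diff summable_norm_cancel[OF lambert_abs_summable[OF q(1)]])
    then show ?thesis unfolding F_def by (intro tendsto_mult qpoch_LIMSEQ q)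
  qed
  ultimately have "theta' z q / qpoch q q = qpoch z q * qpoch (q / z) q * theta_logderiv z q"
    by (rule LIMSEQ_unique)
  then show ?thesis using nzE unfolding Jacobi_triple_product[OF q z] by (simp add: field_simps)
qed

section \<open>Kronecker's Lambert series at a cube root of unity\<close>

text \<open>Partial fractions in the variable \<open>a\<close>. When a node \<open>x m\<close> is added, the coefficient at the new pole is found by evaluating the
induction hypothesis at \<open>a = 1 / x m\<close>.\<close>

lemma partial_fractions_ratio_product:
  fixes x :: "'a \<Rightarrow> complex"
  assumes "finite S" "inj_on x S" "\<And>k. k \<in> S \<Longrightarrow> x k \<noteq> 0" "\<And>k. k \<in> S \<Longrightarrow> a * x k \<noteq> 1"
  shows "(\<Prod>k\<in>S. (1 - b * a * x k) / (1 - a * x k)) = b ^ card S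
     + (\<Sum>k\<in>S. (1 - b) * (\<Prod>j\<in>S - {k}. (x k - b * x j) / (x k - x j)) / (1 - a * x k))"
  using assms
proof (induction S arbitrary: a rule: finite_induct)
  case empty
  then show ?case by simp
next
  case (insert m S)
  define r where "r = (\<lambda>k. (1 - b) * (\<Prod>j\<in>S - {k}. (x k - b * x j) / (x k - x j)))"
  have inj: "inj_on x S" using insert.prems(1) by (auto simp: inj_on_def)
  have ne: "x k \<noteq> x m" if "k \<in> S" for k
    using insert.prems(1) insert.hyps that by (auto simp: inj_on_def)
  have xm: "x m \<noteq> 0" using insert.prems by auto
  have IH: "(\<Prod>k\<in>S. (1 - b * c * x k) / (1 - c * x k)) = b ^ card S + (\<Sum>k\<in>S. r k / (1 - c * x k))"
    if "\<And>k. k \<in> S \<Longrightarrow> c * x k \<noteq> 1" for c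
    unfolding r_def using insert.IH[of c] inj insert.prems(2) that by auto
  have am: "1 - a * x m \<noteq> 0" using insert.prems(3)[of m] by auto
  have rm: "(1 - b) * (\<Prod>j\<in>S. (x m - b * x j) / (x m - x j))
     = (1 - b) * (b ^ card S + (\<Sum>k\<in>S. r k * x m / (x m - x k)))"
  proof -
    have "(\<Prod>k\<in>S. (1 - b * (1 / x m) * x k) / (1 - 1 / x m * x k))
        = b ^ card S + (\<Sum>k\<in>S. r k / (1 - 1 / x m * x k))"
      by (rule IH) (use ne xm in \<open>auto simp: field_simps\<close>)
    moreover have "(1 - b * (1 / x m) * x k) / (1 - 1 / x m * x k) = (x m - b * x k) / (x m - x k)"
      "r k / (1 - 1 / x m * x k) = r k * x m / (x m - x k)" for k
    proof -
      have e: "x m * (1 - b * (1 / x m) * x k) = x m - b * x k" "x m * (1 - 1 / x m * x k) = x m - x k"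
        using xm by (simp_all add: algebra_simps)
      show "(1 - b * (1 / x m) * x k) / (1 - 1 / x m * x k) = (x m - b * x k) / (x m - x k)"
        unfolding e[symmetric] using xm by simp
      show "r k / (1 - 1 / x m * x k) = r k * x m / (x m - x k)"
        unfolding e[symmetric] using xm by simp
    qed
    ultimately show ?thesis by simp
  qed
  have split: "r k / (1 - a * x k) * ((1 - b * a * x m) / (1 - a * x m))
      = r k * ((x k - b * x m) / (x k - x m)) / (1 - a * x k) + (1 - b) * (r k * x m / (x m - x k)) / (1 - a * x m)"
    if k: "k \<in> S" for k
  proof -
    have nz: "1 - a * x k \<noteq> 0" "x k - x m \<noteq> 0" "x m - x k \<noteq> 0"
      using insert.prems(3)[of k] ne[OF k] k by auto
    have "(1 - b * a * x m) / ((1 - a * x k) * (1 - a * x m))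
       = (x k - b * x m) / ((x k - x m) * (1 - a * x k)) - (1 - b) * x m / ((x k - x m) * (1 - a * x m))"
    proof -
      have "(x k - b * x m) * (1 - a * x m) - (1 - b) * x m * (1 - a * x k) = (1 - b * a * x m) * (x k - x m)"
        by (simp add: algebra_simps)
      moreover have "(x k - b * x m) / ((x k - x m) * (1 - a * x k)) - (1 - b) * x m / ((x k - x m) * (1 - a * x m))
         = ((x k - b * x m) * (1 - a * x m) - (1 - b) * x m * (1 - a * x k))
           / ((x k - x m) * (1 - a * x k) * (1 - a * x m))"
        using nz am by (simp add: diff_divide_distrib)
      ultimately show ?thesis using nz by simp
    qed
    moreover have "(1 - b) * x m / ((x k - x m) * (1 - a * x m)) = - ((1 - b) * (x m / (x m - x k)) / (1 - a * x m))"
    proof -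
      have "x m / (x m - x k) = - (x m / (x k - x m))" by (metis minus_diff_eq divide_minus_right)
      then show ?thesis by simp
    qed
    ultimately have "(1 - b * a * x m) / ((1 - a * x k) * (1 - a * x m))
       = (x k - b * x m) / ((x k - x m) * (1 - a * x k)) + (1 - b) * (x m / (x m - x k)) / (1 - a * x m)"
      by simp
    from arg_cong[OF this, of "\<lambda>t. r k * t"] show ?thesis
      by (simp add: distrib_left mult_ac)
  qed
  have "(\<Prod>k\<in>insert m S. (1 - b * a * x k) / (1 - a * x k))
     = (b ^ card S + (\<Sum>k\<in>S. r k / (1 - a * x k))) * ((1 - b * a * x m) / (1 - a * x m))"
    using insert.hyps IH[of a] insert.prems by (simp add: mult_ac)
  also have "\<dots> = b ^ card S * ((1 - b * a * x m) / (1 - a * x m))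
     + (\<Sum>k\<in>S. r k * ((x k - b * x m) / (x k - x m)) / (1 - a * x k) + (1 - b) * (r k * x m / (x m - x k)) / (1 - a * x m))"
    unfolding distrib_right sum_distrib_right using split by (simp cong: sum.cong)
  also have "(1 - b * a * x m) / (1 - a * x m) = b + (1 - b) / (1 - a * x m)"
    using am by (simp add: field_simps)
  also have "b ^ card S * (b + (1 - b) / (1 - a * x m))
     + (\<Sum>k\<in>S. r k * ((x k - b * x m) / (x k - x m)) / (1 - a * x k) + (1 - b) * (r k * x m / (x m - x k)) / (1 - a * x m))
     = b ^ Suc (card S) + (1 - b) * (b ^ card S + (\<Sum>k\<in>S. r k * x m / (x m - x k))) / (1 - a * x m)
      + (\<Sum>k\<in>S. r k * ((x k - b * x m) / (x k - x m)) / (1 - a * x k))"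
    by (simp add: sum.distrib sum_divide_distrib sum_distrib_left add_divide_distrib ring_distribs mult_ac)
  also have "(\<Sum>k\<in>S. r k * ((x k - b * x m) / (x k - x m)) / (1 - a * x k))
     = (\<Sum>k\<in>S. (1 - b) * (\<Prod>j\<in>insert m S - {k}. (x k - b * x j) / (x k - x j)) / (1 - a * x k))"
  proof (intro sum.cong refl)
    fix k assume k: "k \<in> S"
    have "insert m S - {k} = insert m (S - {k})" using insert.hyps k by auto
    then show "r k * ((x k - b * x m) / (x k - x m)) / (1 - a * x k)
      = (1 - b) * (\<Prod>j\<in>insert m S - {k}. (x k - b * x j) / (x k - x j)) / (1 - a * x k)"
      using insert.hyps by (simp add: r_def mult_ac)
  qed
  also have "(1 - b) * (b ^ card S + (\<Sum>k\<in>S. r k * x m / (x m - x k)))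
     = (1 - b) * (\<Prod>j\<in>insert m S - {m}. (x m - b * x j) / (x m - x j))"
  proof -
    have "insert m S - {m} = S" using insert.hyps by auto
    then show ?thesis by (simp only: rm)
  qed
  finally show ?case using insert.hyps by (simp add: add_ac)
qed

text \<open>The finite analogue of \<open>(- q; q) / (q; q)\<close>.\<close>

definition overqfact :: "complex \<Rightarrow> nat \<Rightarrow> complex" where
  "overqfact q n = (\<Prod>i<n. (1 + q ^ Suc i) / (1 - q ^ Suc i))"

lemma sum_symmetric_interval:
  "(\<Sum>k=-int N..int N. f k) = f 0 + (\<Sum>m<N. f (int (Suc m)) + f (- int (Suc m)))"
  for f :: "int \<Rightarrow> complex"
proof (induction N)
  case (Suc N)
  have "{-int (Suc N)..int (Suc N)} = insert (int (Suc N)) (insert (- int (Suc N)) {-int N..int N})" by auto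
  then show ?case using Suc by simp
qed simp

lemma prod_symmetric_interval:
  "(\<Prod>k=-int N..int N. f k) = f 0 * (\<Prod>m<N. f (int (Suc m)) * f (- int (Suc m)))"
  for f :: "int \<Rightarrow> complex"
proof (induction N)
  case (Suc N)
  have "{-int (Suc N)..int (Suc N)} = insert (int (Suc N)) (insert (- int (Suc N)) {-int N..int N})" by auto
  then show ?case using Suc by simp
qed simp

text \<open>The products over \<open>j < k\<close> and \<open>j > k\<close> depend only on the differences \<open>\<bar>k - j\<bar>\<close>; reversing the sign of
the difference costs a factor \<open>-1\<close>.\<close>

lemma residue_product:
  assumes q: "norm q < 1" "q \<noteq> 0" and k: "k \<in> {-int N..int N}"
  shows "(\<Prod>j\<in>{-int N..int N} - {k}. (q powi k + q powi j) / (q powi k - q powi j))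
     = (-1) ^ nat (int N + k) * overqfact q (nat (int N - k)) * overqfact q (nat (int N + k))"
proof -
  let ?f = "\<lambda>j. (q powi k + q powi j) / (q powi k - q powi j)"
  have nz: "q powi k \<noteq> 0" using q by simp
  have up: "(\<Prod>j\<in>{k<..int N}. ?f j) = overqfact q (nat (int N - k))"
  proof -
    have "(\<Prod>j\<in>{k<..int N}. ?f j) = (\<Prod>i<nat (int N - k). (1 + q ^ Suc i) / (1 - q ^ Suc i))"
    proof (rule prod.reindex_bij_witness[of _ "\<lambda>i. k + int (Suc i)" "\<lambda>j. nat (j - k - 1)"])
      fix j assume j: "j \<in> {k<..int N}"
      define i where "i = nat (j - k - 1)"
      have ji: "j = k + int (Suc i)" using j by (simp add: i_def)
      have "q powi j = q powi k * q ^ Suc i"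
        unfolding ji using q(2) by (subst power_int_add) (auto simp only: power_int_of_nat)
      then have "?f j = (q powi k * (1 + q ^ Suc i)) / (q powi k * (1 - q ^ Suc i))"
        by (simp add: algebra_simps)
      then show "(1 + q ^ Suc (nat (j - k - 1))) / (1 - q ^ Suc (nat (j - k - 1))) = ?f j"
        using nz by (simp add: i_def)
    qed auto
    then show ?thesis by (simp add: overqfact_def)
  qed
  have down: "(\<Prod>j\<in>{-int N..<k}. ?f j) = (-1) ^ nat (int N + k) * overqfact q (nat (int N + k))"
  proof -
    have "(\<Prod>j\<in>{-int N..<k}. ?f j) = (\<Prod>i<nat (int N + k). (- 1) * ((1 + q ^ Suc i) / (1 - q ^ Suc i)))"
    proof (rule prod.reindex_bij_witness[of _ "\<lambda>i. k - int (Suc i)" "\<lambda>j. nat (k - j - 1)"])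
      fix j assume j: "j \<in> {-int N..<k}"
      define i where "i = nat (k - j - 1)"
      have ji: "k = j + int (Suc i)" using j by (simp add: i_def)
      have nzj: "q powi j \<noteq> 0" using q by simp
      have "q powi k = q powi j * q ^ Suc i"
        unfolding ji using q(2) by (subst power_int_add) (auto simp only: power_int_of_nat)
      then have "?f j = (q powi j * (1 + q ^ Suc i)) / (q powi j * - (1 - q ^ Suc i))"
        by (simp add: algebra_simps)
      also have "\<dots> = (1 + q ^ Suc i) / - (1 - q ^ Suc i)" using nzj by (rule mult_divide_mult_cancel_left)
      also have "\<dots> = - 1 * ((1 + q ^ Suc i) / (1 - q ^ Suc i))" by (simp only: divide_minus_right mult_minus1)
      finally show "- 1 * ((1 + q ^ Suc (nat (k - j - 1))) / (1 - q ^ Suc (nat (k - j - 1)))) = ?f j"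
        by (simp only: i_def)
    qed auto
    then show ?thesis unfolding prod.distrib by (simp add: overqfact_def)
  qed
  have "{-int N..int N} - {k} = {-int N..<k} \<union> {k<..int N}" using k by auto
  then have "(\<Prod>j\<in>{-int N..int N} - {k}. ?f j) = (\<Prod>j\<in>{-int N..<k}. ?f j) * (\<Prod>j\<in>{k<..int N}. ?f j)"
    by (simp add: prod.union_disjoint disjoint_iff)
  then show ?thesis unfolding up down by (simp add: mult_ac)
qed

text \<open>The last equation says that \<open>w - w\<^sup>2\<close> is a square root of \<open>-3\<close>.\<close>

lemma cube_root:
  fixes w :: complex
  assumes w: "w\<^sup>2 + w + 1 = 0"
  shows "w ^ 3 = 1" "norm w = 1" "w \<noteq> 0" "w \<noteq> 1" "w - w\<^sup>2 \<noteq> 0" "(w - w\<^sup>2)\<^sup>2 = - 3"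
proof -
  have "w ^ 3 - 1 = (w - 1) * (w\<^sup>2 + w + 1)" by (simp add: algebra_simps power2_eq_square power3_eq_cube)
  then show w3: "w ^ 3 = 1" using w by simp
  show "norm w = 1"
  proof (rule power_eq_imp_eq_base[of _ 3])
    show "norm w ^ 3 = 1 ^ 3" using w3 by (metis norm_one norm_power power_one)
  qed auto
  show "w \<noteq> 0" "w \<noteq> 1" using w by auto
  have "(w - w\<^sup>2)\<^sup>2 = (w\<^sup>2 + w + 1) * (w\<^sup>2 - 3 * w + 3) - 3" by (simp add: algebra_simps power2_eq_square)
  then show "(w - w\<^sup>2)\<^sup>2 = - 3" using w by simp
  then show "w - w\<^sup>2 \<noteq> 0" by auto
qed

lemma cis_cube_root: "(cis (2 * pi / 3))\<^sup>2 + cis (2 * pi / 3) + 1 = 0"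
  by (auto simp: complex_eq_iff power2_eq_square cos_120 sin_120)

lemma cube_root_quadratic:
  fixes w y :: complex
  assumes w: "w\<^sup>2 + w + 1 = 0"
  shows "(1 - w * y) * (1 - w\<^sup>2 * y) = 1 + y + y\<^sup>2" "(1 + w * y) * (1 + w\<^sup>2 * y) = 1 - y + y\<^sup>2"
proof -
  have "(1 - w * y) * (1 - w\<^sup>2 * y) = 1 + y + y\<^sup>2 + (w ^ 3 - 1) * y\<^sup>2 - (w\<^sup>2 + w + 1) * y"
    by (simp add: algebra_simps power2_eq_square power3_eq_cube)
  then show "(1 - w * y) * (1 - w\<^sup>2 * y) = 1 + y + y\<^sup>2" unfolding w cube_root(1)[OF w] by simp
  have "(1 + w * y) * (1 + w\<^sup>2 * y) = 1 - y + y\<^sup>2 + (w ^ 3 - 1) * y\<^sup>2 + (w\<^sup>2 + w + 1) * y"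
    by (simp add: algebra_simps power2_eq_square power3_eq_cube)
  then show "(1 + w * y) * (1 + w\<^sup>2 * y) = 1 - y + y\<^sup>2" unfolding w cube_root(1)[OF w] by simp
qed

lemma lambert_cube_root:
  fixes w y :: complex
  assumes w: "w\<^sup>2 + w + 1 = 0" and y: "norm y < 1"
  shows "w * y / (1 - w * y) - w\<^sup>2 * y / (1 - w\<^sup>2 * y) = (w - w\<^sup>2) * (y / (1 + y + y\<^sup>2))"
proof -
  have "norm (w * y) < 1" "norm (w\<^sup>2 * y) < 1"
    using y cube_root(2)[OF w] by (auto simp: norm_mult norm_power)
  then have nz: "1 - w * y \<noteq> 0" "1 - w\<^sup>2 * y \<noteq> 0" by auto
  have "w * y / (1 - w * y) - w\<^sup>2 * y / (1 - w\<^sup>2 * y)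
     = (w * y * (1 - w\<^sup>2 * y) - w\<^sup>2 * y * (1 - w * y)) / ((1 - w * y) * (1 - w\<^sup>2 * y))"
    using nz by (rule diff_frac_eq)
  also have "w * y * (1 - w\<^sup>2 * y) - w\<^sup>2 * y * (1 - w * y) = (w - w\<^sup>2) * y"
    by (simp add: algebra_simps)
  finally show ?thesis unfolding cube_root_quadratic[OF w] by simp
qed

text \<open>This is the partial fraction decomposition with nodes \<open>q\<^sup>k\<close>, \<open>\<bar>k\<bar> \<le> N\<close>, and \<open>b = -1\<close>, evaluated at \<open>a = w\<close>. The
nodes \<open>q\<^sup>k\<close> and \<open>q\<^sup>-\<^sup>k\<close> are paired; since \<open>w\<close> is a cube root of unity, both the product and the sum of such a pair are
rational functions with denominator \<open>1 + y + y\<^sup>2\<close>.\<close>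

lemma finite_Kronecker:
  fixes q w :: complex
  assumes q: "norm q < 1" "q \<noteq> 0" and w: "w\<^sup>2 + w + 1 = 0"
  shows "(\<Prod>m<N. (1 - q ^ Suc m + (q ^ Suc m)\<^sup>2) / (1 + q ^ Suc m + (q ^ Suc m)\<^sup>2))
    = overqfact q N ^ 2 + 6 * (\<Sum>m<N. (-1) ^ Suc m * overqfact q (N - Suc m) * overqfact q (N + Suc m)
         * (q ^ Suc m / (1 + q ^ Suc m + (q ^ Suc m)\<^sup>2)))"
proof -
  note w3 = cube_root(1)[OF w] and nw = cube_root(2)[OF w] and w0 = cube_root(3)[OF w] and w1 = cube_root(4)[OF w]
  define S where "S = {-int N..int N}"
  define x where "x = (\<lambda>k::int. q powi k)"
  define r where "r = (\<lambda>k. 2 * (\<Prod>j\<in>S - {k}. (x k + x j) / (x k - x j)))"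
  define h where "h = (\<lambda>k. (1 + w * x k) / (1 - w * x k))"
  have inj: "inj_on x S"
  proof (rule inj_onI)
    fix k j assume "x k = x j"
    then have "norm q powi k = norm q powi j" unfolding x_def norm_power_int[symmetric] by simp
    moreover have "norm q powi i \<noteq> norm q powi l" if "i < l" for i l
      using power_int_strict_decreasing[OF that, of "norm q"] q by auto
    ultimately show "k = j" using linorder_neqE[of k j] by metis
  qed
  have x0: "x k \<noteq> 0" for k using q by (simp add: x_def)
  have wx: "w * x k \<noteq> 1" for k
  proof
    assume e: "w * x k = 1"
    then have "norm w * norm (x k) = 1" by (metis norm_mult norm_one)
    then have "norm q powi k = 1" unfolding nw by (simp add: x_def norm_power_int)
    moreover have "norm q powi i \<noteq> 1" if "i > 0" for i
      using power_int_strict_decreasing[OF that, of "norm q"] q by auto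
    moreover have "norm q powi i \<noteq> 1" if "i < 0" for i
      using power_int_strict_decreasing[OF that, of "norm q"] q by auto
    ultimately have "k = 0" using linorder_neqE[of k 0] by metis
    then show False using e w1 by (simp add: x_def)
  qed
  have card: "card S = 2 * N + 1" by (simp add: S_def)
  have pf: "(\<Prod>k\<in>S. (1 + a * x k) / (1 - a * x k)) = - 1 + (\<Sum>k\<in>S. r k / (1 - a * x k))"
    if "\<And>k. a * x k \<noteq> 1" for a
    using partial_fractions_ratio_product[of S x a "-1", OF _ inj x0 that] card by (simp add: S_def r_def)
  \<comment> \<open>At \<open>a = 0\<close> the product is \<open>1\<close> and its constant part is \<open>(-1)\<close> to the odd power \<open>2 N + 1\<close>.\<close>
  have tot: "(\<Sum>k\<in>S. r k) = 2" using pf[of 0] by simp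
  have full: "(\<Prod>k\<in>S. h k) = (\<Sum>k\<in>S. r k / 2 * h k)"
  proof -
    have "(\<Prod>k\<in>S. h k) = - ((\<Sum>k\<in>S. r k) / 2) + (\<Sum>k\<in>S. r k / (1 - w * x k))"
      unfolding tot using pf[of w] wx by (simp add: h_def)
    also have "\<dots> = (\<Sum>k\<in>S. r k / (1 - w * x k) - r k / 2)"
      by (simp add: sum_subtractf sum_divide_distrib)
    also have "\<dots> = (\<Sum>k\<in>S. r k / 2 * h k)"
    proof (intro sum.cong refl)
      fix k
      have "1 - w * x k \<noteq> 0" using wx[of k] by auto
      then have "1 / (1 - w * x k) - 1 / 2 = h k / 2" by (simp add: h_def field_simps)
      from arg_cong[OF this, of "\<lambda>t. r k * t"] show "r k / (1 - w * x k) - r k / 2 = r k / 2 * h k"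
        by (simp add: right_diff_distrib)
    qed
    finally show ?thesis .
  qed
  have r: "r k / 2 = (-1) ^ nat (int N + k) * overqfact q (nat (int N - k)) * overqfact q (nat (int N + k))"
    if "k \<in> S" for k
    using residue_product[OF q that[unfolded S_def]] unfolding r_def S_def x_def by simp
  have neg: "h (- int (Suc m)) = - ((1 + w\<^sup>2 * q ^ Suc m) / (1 - w\<^sup>2 * q ^ Suc m))" for m
  proof -
    have y: "x (- int (Suc m)) = 1 / q ^ Suc m" unfolding x_def by (simp only: power_int_minus power_int_of_nat inverse_eq_divide)
    define y where "y = q ^ Suc m"
    have y0: "y \<noteq> 0" using q by (simp add: y_def)
    have "h (- int (Suc m)) = (1 + w / y) / (1 - w / y)" unfolding h_def y y_def by simp
    also have "\<dots> = (w\<^sup>2 * y * (1 + w / y)) / (w\<^sup>2 * y * (1 - w / y))" using y0 w0 by simp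
    also have "w\<^sup>2 * y * (1 + w / y) = 1 + w\<^sup>2 * y"
      using w3 y0 by (simp add: algebra_simps power2_eq_square power3_eq_cube)
    also have "w\<^sup>2 * y * (1 - w / y) = - (1 - w\<^sup>2 * y)"
      using w3 y0 by (simp add: algebra_simps power2_eq_square power3_eq_cube)
    finally show ?thesis unfolding y_def by (simp only: divide_minus_right)
  qed
  have pos: "h (int (Suc m)) = (1 + w * q ^ Suc m) / (1 - w * q ^ Suc m)" for m
    unfolding h_def x_def by (simp only: power_int_of_nat)
  have nzy: "1 - w * q ^ Suc m \<noteq> 0" "1 - w\<^sup>2 * q ^ Suc m \<noteq> 0" for m
  proof -
    have "norm (w * q ^ Suc m) < 1" "norm (w\<^sup>2 * q ^ Suc m) < 1"
      using norm_power_less_1[OF q(1), of "Suc m"] nw by (auto simp: norm_mult norm_power)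
    then show "1 - w * q ^ Suc m \<noteq> 0" "1 - w\<^sup>2 * q ^ Suc m \<noteq> 0" by auto
  qed
  note D = cube_root_quadratic[OF w]
  have hsum: "h (int (Suc m)) + h (- int (Suc m)) = 2 * (w - w\<^sup>2) * (q ^ Suc m / (1 + q ^ Suc m + (q ^ Suc m)\<^sup>2))" for m
  proof -
    define y where "y = q ^ Suc m"
    have nz: "1 - w * y \<noteq> 0" "1 - w\<^sup>2 * y \<noteq> 0" using nzy[of m] by (auto simp: y_def)
    have "(1 + w * y) / (1 - w * y) - (1 + w\<^sup>2 * y) / (1 - w\<^sup>2 * y)
       = ((1 + w * y) * (1 - w\<^sup>2 * y) - (1 + w\<^sup>2 * y) * (1 - w * y)) / ((1 - w * y) * (1 - w\<^sup>2 * y))"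
      using nz by (rule diff_frac_eq)
    also have "(1 + w * y) * (1 - w\<^sup>2 * y) - (1 + w\<^sup>2 * y) * (1 - w * y) = 2 * (w - w\<^sup>2) * y"
      by (simp add: algebra_simps)
    finally show ?thesis unfolding pos neg y_def[symmetric] D by simp
  qed
  have hprod: "h (int (Suc m)) * h (- int (Suc m)) = - ((1 - q ^ Suc m + (q ^ Suc m)\<^sup>2) / (1 + q ^ Suc m + (q ^ Suc m)\<^sup>2))" for m
    unfolding pos neg D[symmetric] by simp
  have h0: "h 0 = (1 + w) / (1 - w)" by (simp add: h_def x_def)
  have h0nz: "h 0 \<noteq> 0"
  proof -
    have "1 + w = (w\<^sup>2 + w + 1) - w\<^sup>2" by simp
    then have "1 + w = - (w\<^sup>2)" unfolding w by simp
    then show ?thesis unfolding h0 using w0 w1 by simp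
  qed
  \<comment> \<open>The value \<open>h 0\<close> is \<open>(1 + w) / (1 - w)\<close>, a rational multiple of \<open>w - w\<^sup>2\<close>; this is where the factor \<open>6\<close> comes from.\<close>
  have six: "2 * (w - w\<^sup>2) = 6 * h 0"
  proof -
    have "2 * (w - w\<^sup>2) * (1 - w) - 6 * (1 + w) = 2 * (w ^ 3 - 1) - 4 * (w\<^sup>2 + w + 1)"
      by (simp add: power2_eq_square power3_eq_cube algebra_simps)
    then have "2 * (w - w\<^sup>2) * (1 - w) = 6 * (1 + w)" unfolding w w3 by simp
    then show ?thesis unfolding h0 using w1 by (simp add: field_simps)
  qed
  have sgn: "(-1) ^ (N + k) = (-1) ^ N * (-1 :: complex) ^ k" for k by (rule power_add)
  have lhs: "(\<Prod>k\<in>S. h k) = h 0 * ((-1) ^ N * (\<Prod>m<N. (1 - q ^ Suc m + (q ^ Suc m)\<^sup>2) / (1 + q ^ Suc m + (q ^ Suc m)\<^sup>2)))"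
  proof -
    have "(\<Prod>m<N. - g m) = (-1) ^ N * (\<Prod>m<N. g m)" for g :: "nat \<Rightarrow> complex"
      using prod.distrib[of "\<lambda>_. -1" g "{..<N}"] by simp
    then show ?thesis unfolding S_def prod_symmetric_interval hprod by simp
  qed
  have rhs: "(\<Sum>k\<in>S. r k / 2 * h k) = h 0 * ((-1) ^ N * (overqfact q N ^ 2
      + 6 * (\<Sum>m<N. (-1) ^ Suc m * overqfact q (N - Suc m) * overqfact q (N + Suc m)
         * (q ^ Suc m / (1 + q ^ Suc m + (q ^ Suc m)\<^sup>2)))))"
  proof -
    have "r 0 / 2 = (-1) ^ N * overqfact q N ^ 2" by (subst r) (auto simp: S_def power2_eq_square)
    moreover have "r (int (Suc m)) / 2 * h (int (Suc m)) + r (- int (Suc m)) / 2 * h (- int (Suc m))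
        = h 0 * ((-1) ^ N * (6 * ((-1) ^ Suc m * overqfact q (N - Suc m) * overqfact q (N + Suc m)
         * (q ^ Suc m / (1 + q ^ Suc m + (q ^ Suc m)\<^sup>2)))))" if "m < N" for m
    proof -
      have e: "nat (int N + int (Suc m)) = N + Suc m" "nat (int N - int (Suc m)) = N - Suc m"
        "nat (int N - - int (Suc m)) = N + Suc m" "nat (int N + - int (Suc m)) = N - Suc m" using that by auto
      have s: "(-1 :: complex) ^ (N - Suc m) = (-1) ^ N * (-1) ^ Suc m"
      proof -
        have "N + Suc m = (N - Suc m) + 2 * Suc m" using that by simp
        then have "(-1 :: complex) ^ (N + Suc m) = (-1) ^ (N - Suc m) * ((-1) ^ 2) ^ Suc m"
          by (simp only: power_add power_mult)
        then show ?thesis by (simp add: power_add)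
      qed
      have rp: "r (int (Suc m)) / 2 = (-1) ^ N * ((-1) ^ Suc m * overqfact q (N - Suc m) * overqfact q (N + Suc m))"
        by (subst r) (use that in \<open>auto simp: S_def e sgn simp del: of_nat_Suc power_Suc add_Suc_right\<close>)
      have rn: "r (- int (Suc m)) / 2 = (-1) ^ N * ((-1) ^ Suc m * overqfact q (N - Suc m) * overqfact q (N + Suc m))"
        by (subst r) (use that in \<open>auto simp: S_def e s simp del: of_nat_Suc power_Suc add_Suc_right add_uminus_conv_diff\<close>)
      show ?thesis unfolding rp rn distrib_left[symmetric] hsum six by (simp only: mult_ac)
    qed
    ultimately show ?thesis
      unfolding S_def sum_symmetric_interval
      by (simp add: sum_distrib_left distrib_left mult_ac)
  qed
  show ?thesis using full unfolding lhs rhs using h0nz by simp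
qed

lemma lambert3_summable:
  fixes q w :: complex
  assumes q: "norm q < 1" and w: "w\<^sup>2 + w + 1 = 0"
  shows "summable (\<lambda>m. norm (q ^ Suc m / (1 + q ^ Suc m + (q ^ Suc m)\<^sup>2)))"
proof -
  let ?a = "\<lambda>m. (w * q * q ^ m) / (1 - w * q * q ^ m)" and ?b = "\<lambda>m. (w\<^sup>2 * q * q ^ m) / (1 - w\<^sup>2 * q * q ^ m)"
  have e: "?a m - ?b m = (w - w\<^sup>2) * (q ^ Suc m / (1 + q ^ Suc m + (q ^ Suc m)\<^sup>2))" for m
    using lambert_cube_root[OF w norm_power_less_1[OF q(1), of "Suc m"]] by (simp add: mult.assoc)
  have "summable (\<lambda>m. norm (?a m) + norm (?b m))"
    by (intro summable_add lambert_abs_summable q)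
  then have "summable (\<lambda>m. norm (?a m - ?b m))"
    by (rule summable_comparison_test') (simp add: norm_triangle_ineq4)
  then have "summable (\<lambda>m. norm (w - w\<^sup>2) * norm (q ^ Suc m / (1 + q ^ Suc m + (q ^ Suc m)\<^sup>2)))"
    unfolding e norm_mult .
  then show ?thesis by (rule summable_mult_D) (use cube_root(5)[OF w] in simp)
qed

text \<open>The limit of the finite identity. Its left-hand side becomes a quotient of products at \<open>\<plusminus> w q\<close> and \<open>\<plusminus> w\<^sup>2 q\<close>, which the cubic
relation of \<open>qpoch\<close> turns into Euler products in \<open>q, q\<^sup>2, q\<^sup>3, q\<^sup>6\<close>.\<close>

theorem Kronecker_lambert_series:
  fixes q w :: complex
  assumes q: "norm q < 1" "q \<noteq> 0" and w: "w\<^sup>2 + w + 1 = 0"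
  shows "qpoch q q ^ 6 * qpoch (q ^ 6) (q ^ 6) =
     qpoch (q\<^sup>2) (q\<^sup>2) ^ 3 * qpoch (q ^ 3) (q ^ 3) ^ 2 *
      (1 + 6 * (\<Sum>\<^sub>\<infinity>m. (-1) ^ Suc m * (q ^ Suc m / (1 + q ^ Suc m + (q ^ Suc m)\<^sup>2))))"
proof -
  let ?E = "\<lambda>n. qpoch (q ^ n) (q ^ n)"
  let ?l = "\<lambda>m. q ^ Suc m / (1 + q ^ Suc m + (q ^ Suc m)\<^sup>2)"
  have nzp: "qpoch (q ^ n) (q ^ n) \<noteq> 0" if "n > 0" for n
    using norm_power_less_1[OF q(1) that] by (intro qpoch_nonzero_small) auto
  have nzE: "qpoch q q \<noteq> 0" using nzp[of 1] by simp
  note nw = cube_root(2)[OF w]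
  define g where "g = qpoch (- q) q / qpoch q q"
  have G: "overqfact q \<longlonglongrightarrow> g"
  proof -
    have "(\<lambda>n. (\<Prod>i<n. 1 - (- q) * q ^ i) / (\<Prod>i<n. 1 - q * q ^ i)) \<longlonglongrightarrow> g"
      unfolding g_def using nzE by (intro tendsto_divide qpoch_LIMSEQ q)
    moreover have "overqfact q = (\<lambda>n. (\<Prod>i<n. 1 - (- q) * q ^ i) / (\<Prod>i<n. 1 - q * q ^ i))"
      by (simp add: overqfact_def prod_dividef fun_eq_iff)
    ultimately show ?thesis by simp
  qed
  have "Bseq (overqfact q)" by (rule convergent_imp_Bseq) (use G in \<open>auto simp: convergent_def\<close>)
  then obtain B where B: "B > 0" "\<And>n. norm (overqfact q n) \<le> B" by (auto simp: Bseq_def)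
  define f where "f = (\<lambda>N m. if m < N then (-1) ^ Suc m * overqfact q (N - Suc m) * overqfact q (N + Suc m) * ?l m else 0)"
  have sh: "(\<lambda>m. norm (?l m)) summable_on UNIV"
    using lambert3_summable[OF q(1) w] by (intro summable_nonneg_imp_summable_on) auto
  have "(\<lambda>N. \<Sum>\<^sub>\<infinity>m. f N m) \<longlonglongrightarrow> (\<Sum>\<^sub>\<infinity>m. (-1) ^ Suc m * g * g * ?l m)"
  proof (rule infsum_dominated_LIMSEQ)
    fix m
    have "(\<lambda>N. (-1) ^ Suc m * overqfact q (N - Suc m) * overqfact q (N + Suc m) * ?l m) \<longlonglongrightarrow> (-1) ^ Suc m * g * g * ?l m"
    proof (intro tendsto_mult tendsto_const)
      show "(\<lambda>N. overqfact q (N - Suc m)) \<longlonglongrightarrow> g"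
        by (rule LIMSEQ_offset[of _ "Suc m"]) (use G in simp)
      show "(\<lambda>N. overqfact q (N + Suc m)) \<longlonglongrightarrow> g"
        by (rule LIMSEQ_ignore_initial_segment[OF G])
    qed
    moreover have "\<forall>\<^sub>F N in sequentially. (-1) ^ Suc m * overqfact q (N - Suc m) * overqfact q (N + Suc m) * ?l m = f N m"
      unfolding eventually_sequentially f_def by (rule exI[of _ "Suc m"]) auto
    ultimately show "(\<lambda>N. f N m) \<longlonglongrightarrow> (-1) ^ Suc m * g * g * ?l m" by (rule Lim_transform_eventually)
  next
    show "norm (f N m) \<le> B * B * norm (?l m)" for N m
    proof (cases "m < N")
      case True
      have "norm (overqfact q (N - Suc m)) * norm (overqfact q (N + Suc m)) * norm (?l m) \<le> B * B * norm (?l m)"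
        using B by (intro mult_mono mult_nonneg_nonneg) auto
      then show ?thesis using True unfolding f_def by (simp only: if_True norm_mult norm_power norm_minus_cancel norm_one power_one mult_1)
    next
      case False
      then show ?thesis using B by (simp add: f_def)
    qed
    show "(\<lambda>m. B * B * norm (?l m)) summable_on UNIV" using sh by (rule summable_on_cmult_right)
  qed
  moreover have "(\<Sum>\<^sub>\<infinity>m. f N m) = (\<Sum>m<N. (-1) ^ Suc m * overqfact q (N - Suc m) * overqfact q (N + Suc m) * ?l m)" for N
  proof -
    have "(\<Sum>\<^sub>\<infinity>m. f N m) = (\<Sum>\<^sub>\<infinity>m\<in>{..<N}. f N m)" by (rule infsum_cong_neutral) (auto simp: f_def)
    then show ?thesis by (simp add: f_def)
  qed
  ultimately have lim: "(\<lambda>N. \<Sum>m<N. (-1) ^ Suc m * overqfact q (N - Suc m) * overqfact q (N + Suc m) * ?l m)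
      \<longlonglongrightarrow> (\<Sum>\<^sub>\<infinity>m. (-1) ^ Suc m * g * g * ?l m)" by simp
  have "(\<Sum>\<^sub>\<infinity>m. (-1) ^ Suc m * g * g * ?l m) = (\<Sum>\<^sub>\<infinity>m. g\<^sup>2 * ((-1) ^ Suc m * ?l m))"
    by (simp add: power2_eq_square mult_ac)
  also have "\<dots> = g\<^sup>2 * (\<Sum>\<^sub>\<infinity>m. (-1) ^ Suc m * ?l m)" by (rule infsum_cmult_right')
  finally have S: "(\<Sum>\<^sub>\<infinity>m. (-1) ^ Suc m * g * g * ?l m) = g\<^sup>2 * (\<Sum>\<^sub>\<infinity>m. (-1) ^ Suc m * ?l m)" .
  have R: "(\<lambda>N. \<Prod>m<N. (1 - q ^ Suc m + (q ^ Suc m)\<^sup>2) / (1 + q ^ Suc m + (q ^ Suc m)\<^sup>2))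
      \<longlonglongrightarrow> g\<^sup>2 + 6 * (g\<^sup>2 * (\<Sum>\<^sub>\<infinity>m. (-1) ^ Suc m * ?l m))"
    unfolding finite_Kronecker[OF q w]
    using lim unfolding S by (intro tendsto_add tendsto_mult_left tendsto_power G)
  note D = cube_root_quadratic[OF w]
  have nzw: "qpoch (w * q) q \<noteq> 0" "qpoch (w\<^sup>2 * q) q \<noteq> 0" "qpoch (- q) q \<noteq> 0"
    by (rule qpoch_nonzero_small[OF q(1)]; simp add: norm_mult norm_power nw q)+
  have L: "(\<lambda>N. \<Prod>m<N. (1 - q ^ Suc m + (q ^ Suc m)\<^sup>2) / (1 + q ^ Suc m + (q ^ Suc m)\<^sup>2))
      \<longlonglongrightarrow> (qpoch (w * - q) q * qpoch (w\<^sup>2 * - q) q) / (qpoch (w * q) q * qpoch (w\<^sup>2 * q) q)"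
  proof -
    have "(\<lambda>N. ((\<Prod>m<N. 1 - (w * - q) * q ^ m) * (\<Prod>m<N. 1 - (w\<^sup>2 * - q) * q ^ m)) /
       ((\<Prod>m<N. 1 - (w * q) * q ^ m) * (\<Prod>m<N. 1 - (w\<^sup>2 * q) * q ^ m)))
      \<longlonglongrightarrow> (qpoch (w * - q) q * qpoch (w\<^sup>2 * - q) q) / (qpoch (w * q) q * qpoch (w\<^sup>2 * q) q)"
      using nzw by (intro tendsto_divide tendsto_mult qpoch_LIMSEQ q) auto
    moreover have "((\<Prod>m<N. 1 - (w * - q) * q ^ m) * (\<Prod>m<N. 1 - (w\<^sup>2 * - q) * q ^ m)) /
       ((\<Prod>m<N. 1 - (w * q) * q ^ m) * (\<Prod>m<N. 1 - (w\<^sup>2 * q) * q ^ m))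
       = (\<Prod>m<N. (1 - q ^ Suc m + (q ^ Suc m)\<^sup>2) / (1 + q ^ Suc m + (q ^ Suc m)\<^sup>2))" for N
      unfolding D[symmetric] by (simp add: prod_dividef prod.distrib mult.assoc)
    ultimately show ?thesis by simp
  qed
  have key: "(qpoch (w * - q) q * qpoch (w\<^sup>2 * - q) q) / (qpoch (w * q) q * qpoch (w\<^sup>2 * q) q)
      = g\<^sup>2 * (1 + 6 * (\<Sum>\<^sub>\<infinity>m. (-1) ^ Suc m * ?l m))"
    using LIMSEQ_unique[OF L R] by (simp only: distrib_left mult_1_right) (simp only: mult.left_commute)
  have m1: "qpoch (- q) q * ?E 1 = ?E 2" using qpoch_minus[OF q(1), of q] by (simp add: mult.commute)
  have q3: "norm (q ^ 3) < 1" using norm_power_less_1[OF q(1)] by simp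
  have m3: "qpoch (- (q ^ 3)) (q ^ 3) * ?E 3 = ?E 6"
    using qpoch_minus[OF q3, of "q ^ 3"] by (simp add: mult.commute flip: power_mult)
  have c1: "?E 1 * (qpoch (w * q) q * qpoch (w\<^sup>2 * q) q) = ?E 3"
    using qpoch_cubic[OF q(1) w, of q] by (simp add: mult.assoc)
  have c2: "qpoch (- q) q * (qpoch (w * - q) q * qpoch (w\<^sup>2 * - q) q) = qpoch (- (q ^ 3)) (q ^ 3)"
    using qpoch_cubic[OF q(1) w, of "- q"] by (simp add: mult.assoc)
  define a b c d e where "a = qpoch (- q) q" and "b = qpoch (w * - q) q * qpoch (w\<^sup>2 * - q) q"
    and "c = qpoch (w * q) q * qpoch (w\<^sup>2 * q) q" and "d = ?E 1"
    and "e = 1 + 6 * (\<Sum>\<^sub>\<infinity>m. (-1) ^ Suc m * ?l m)"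
  have nz: "a \<noteq> 0" "c \<noteq> 0" "d \<noteq> 0" using nzw nzE by (auto simp: a_def c_def d_def)
  have k: "b / c = (a / d)\<^sup>2 * e" using key by (simp add: a_def b_def c_def d_def e_def g_def)
  have E2: "?E 2 = a * d" and E3: "?E 3 = d * c" and E6: "?E 6 = a * b * (d * c)"
    using m1 c1 m3 c2 by (auto simp: a_def b_def c_def d_def)
  have b: "b = a\<^sup>2 * e * c / d\<^sup>2" using k nz by (simp add: field_simps)
  have "d ^ 6 * ?E 6 = ?E 2 ^ 3 * ?E 3 ^ 2 * e"
    unfolding E6 unfolding E2 E3 b using nz by (simp add: field_simps power_mult_distrib eval_nat_numeral)
  then show ?thesis by (simp add: d_def e_def)
qed

section \<open>Products of two theta series\<close>

lemma abs_summable_on_product: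
  fixes f :: "'a \<Rightarrow> complex" and g :: "'b \<Rightarrow> complex"
  assumes f: "(\<lambda>x. norm (f x)) summable_on UNIV" and g: "(\<lambda>y. norm (g y)) summable_on UNIV"
  shows "(\<lambda>z. norm (case z of (x, y) \<Rightarrow> f x * g y)) summable_on UNIV \<times> UNIV"
proof -
  have nn: "0 \<le> (\<Sum>\<^sub>\<infinity>y. norm (g y))" by (rule infsum_nonneg) auto
  show ?thesis
    unfolding Infinite_Sum.abs_summable_on_Sigma_iff
    using assms nn
    by (auto simp: norm_mult abs_mult infsum_cmult_right' intro!: summable_on_cmult_right summable_on_cmult_left)
qed

lemma has_sum_product:
  fixes f :: "'a \<Rightarrow> complex" and g :: "'b \<Rightarrow> complex"
  assumes f: "(\<lambda>x. norm (f x)) summable_on UNIV" and g: "(\<lambda>y. norm (g y)) summable_on UNIV"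
  shows "((\<lambda>(x, y). f x * g y) has_sum (infsum f UNIV * infsum g UNIV)) UNIV"
proof -
  note abs_summable_on_product[OF assms]
  then have s: "(\<lambda>(x, y). f x * g y) summable_on UNIV \<times> UNIV" by (rule abs_summable_summable)
  have "((\<lambda>(x, y). f x * g y) has_sum (infsum f UNIV * infsum g UNIV)) (UNIV \<times> UNIV)"
  proof (rule has_sum_SigmaI[OF _ _ s])
    show "((\<lambda>y. case (x, y) of (x, y) \<Rightarrow> f x * g y) has_sum f x * infsum g UNIV) UNIV" for x
      using has_sum_cmult_right[OF has_sum_infsum[OF abs_summable_summable[OF g]], of "f x"] by simp
    show "((\<lambda>x. f x * infsum g UNIV) has_sum infsum f UNIV * infsum g UNIV) UNIV"
      using has_sum_cmult_left[OF has_sum_infsum[OF abs_summable_summable[OF f]], of "infsum g UNIV"] by simp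
  qed
  then show ?thesis by simp
qed

context
  fixes z q :: complex
  assumes z: "z \<noteq> 0" and q: "q \<noteq> 0" "norm q < 1"
begin

lemma theta_term_abs_summable: "(\<lambda>k. norm (theta_term z q k)) summable_on UNIV"
  by (rule summable_on_comparison_test[OF theta_term_weighted_summable[OF z q]])
    (auto simp: mult_le_cancel_right1)

lemma theta'_term_abs_summable: "(\<lambda>k. norm (of_int k * theta_term z q k)) summable_on UNIV"
  by (rule summable_on_comparison_test[OF theta_term_weighted_summable[OF z q]])
    (auto simp: norm_mult intro!: mult_right_mono)

lemma has_sum_theta: "(theta_term z q has_sum theta z q) UNIV"
  unfolding theta_def by (rule has_sum_infsum[OF abs_summable_summable[OF theta_term_abs_summable]])

end

lemma
  assumes "z1 \<noteq> 0" "q1 \<noteq> 0" "norm q1 < 1" "z2 \<noteq> 0" "q2 \<noteq> 0" "norm q2 < 1"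
  shows has_sum_theta_theta:
      "((\<lambda>(j, k). theta_term z1 q1 j * theta_term z2 q2 k) has_sum theta z1 q1 * theta z2 q2) UNIV"
    and has_sum_theta'_theta:
      "((\<lambda>(j, k). of_int j * theta_term z1 q1 j * theta_term z2 q2 k) has_sum theta' z1 q1 * theta z2 q2) UNIV"
    and has_sum_theta_theta':
      "((\<lambda>(j, k). theta_term z1 q1 j * (of_int k * theta_term z2 q2 k)) has_sum theta z1 q1 * theta' z2 q2) UNIV"
  unfolding theta_def theta'_def
  by (intro has_sum_product theta_term_abs_summable theta'_term_abs_summable assms)+

lemma theta_1: "norm q < 1 \<Longrightarrow> q \<noteq> 0 \<Longrightarrow> theta 1 q = 0"
  using Jacobi_triple_product[of q 1] qpoch_rec[of q 1] by simp

lemma theta_term_square: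
  assumes "q \<noteq> 0"
  shows "theta_term (- (z * q)) (q\<^sup>2) k = z powi k * q powi (k * k)"
    and "theta_term (- z) (q\<^sup>2) k = z powi k * q powi (k * k - k)"
proof -
  have ev: "2 * (k * (k - 1) div 2) = k * (k - 1)" by simp
  have e: "(q\<^sup>2) powi (k * (k - 1) div 2) = q powi (k * k - k)"
  proof -
    have "(q\<^sup>2) powi n = q powi (2 * n)" for n by (simp add: power_int_mult)
    then show ?thesis by (simp only: ev) (simp add: algebra_simps)
  qed
  show "theta_term (- z) (q\<^sup>2) k = z powi k * q powi (k * k - k)"
    unfolding theta_term_def e by simp
  have "q powi (k * k) = q powi k * q powi (k * k - k)"
    using assms by (simp flip: power_int_add)
  then show "theta_term (- (z * q)) (q\<^sup>2) k = z powi k * q powi (k * k)"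
    unfolding theta_term_def e by (simp add: power_int_mult_distrib)
qed

text \<open>In the double series over \<open>(j, k)\<close> the exponents of \<open>q\<close> are diagonalised by a rotation by 45 degrees: pairs of equal
parity are \<open>(m - t, m + t)\<close> and pairs of different parity are \<open>(m - t, m + 1 + t)\<close>. Since \<open>theta 1 q = 0\<close>, the weight \<open>j\<close> may
be replaced by \<open>j + k\<close>, which depends on \<open>m\<close> alone, so both parts are again products of two series.\<close>

lemma theta'_theta_rotation:
  assumes q: "norm q < 1" "q \<noteq> 0" and w: "w \<noteq> 0"
  shows "theta' 1 q * theta w q =
      2 * theta' (- w) (q\<^sup>2) * theta (- (w * q)) (q\<^sup>2)
      - w * (2 * theta' (- (w * q)) (q\<^sup>2) + theta (- (w * q)) (q\<^sup>2)) * theta (- (w * q\<^sup>2)) (q\<^sup>2)"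
proof -
  have q2: "norm (q\<^sup>2) < 1" "q\<^sup>2 \<noteq> 0" using q norm_power_less_1[OF q(1)] by auto
  have nz: "1 \<noteq> (0::complex)" "- w \<noteq> 0" "- (w * q) \<noteq> 0" "- (w * q\<^sup>2) \<noteq> 0" using w q by auto
  define F where "F = (\<lambda>(j, k). of_int (j + k) * (theta_term 1 q j * theta_term w q k))"
  have "((\<lambda>(j, k). of_int j * theta_term 1 q j * theta_term w q k + theta_term 1 q j * (of_int k * theta_term w q k))
      has_sum theta' 1 q * theta w q + theta 1 q * theta' w q) UNIV"
    using has_sum_add[OF has_sum_theta'_theta[OF nz(1) q(2,1) w q(2,1)] has_sum_theta_theta'[OF nz(1) q(2,1) w q(2,1)]]
    by (simp add: case_prod_unfold)
  then have F: "(F has_sum theta' 1 q * theta w q) UNIV"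
    unfolding theta_1[OF q] F_def by (simp add: case_prod_unfold ring_distribs mult_ac)
  have val: "F (j, k) = of_int (j + k) * ((-1) powi (j + k) * w powi k * q powi ((j * (j - 1) + k * (k - 1)) div 2))" for j k
  proof -
    have "(j * (j - 1) + k * (k - 1)) div 2 = j * (j - 1) div 2 + k * (k - 1) div 2" by simp
    moreover have "(- w) powi k = (-1) powi k * w powi k"
      using power_int_mult_distrib[of "-1" w k] by simp
    ultimately show ?thesis using q unfolding F_def theta_term_def
      by (simp add: power_int_add mult_ac)
  qed
  have ev: "F (m - t, m + t) = 2 * of_int m * theta_term (- w) (q\<^sup>2) m * theta_term (- (w * q)) (q\<^sup>2) t" for m t
  proof -
    have "((m - t) * (m - t - 1) + (m + t) * (m + t - 1)) = 2 * ((m * m - m) + t * t)" by (simp add: algebra_simps)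
    then have e: "((m - t) * (m - t - 1) + (m + t) * (m + t - 1)) div 2 = (m * m - m) + t * t" by simp
    have "F (m - t, m + t) = of_int (2 * m) * ((-1) powi (2 * m) * w powi (m + t) * q powi ((m * m - m) + t * t))"
      unfolding val e by simp
    moreover have "w powi (m + t) = w powi m * w powi t"
      "q powi ((m * m - m) + t * t) = q powi (m * m - m) * q powi (t * t)"
      using w q by (auto intro: power_int_add)
    moreover have "(-1 :: complex) powi (2 * m) = 1" by simp
    ultimately show ?thesis
      unfolding theta_term_square(1)[OF q(2), of w] theta_term_square(2)[OF q(2), of w] by (simp add: mult_ac)
  qed
  have od: "F (m - t, m + 1 + t) = - (w * ((2 * of_int m + 1) * theta_term (- (w * q)) (q\<^sup>2) m)) * theta_term (- (w * q\<^sup>2)) (q\<^sup>2) t" for m t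
  proof -
    have "((m - t) * (m - t - 1) + (m + 1 + t) * (m + 1 + t - 1)) = 2 * (m * m + (t * t + t))" by (simp add: algebra_simps)
    then have e: "((m - t) * (m - t - 1) + (m + 1 + t) * (m + 1 + t - 1)) div 2 = m * m + (t * t + t)" by simp
    have "F (m - t, m + 1 + t) = of_int (2 * m + 1) * ((-1) powi (2 * m + 1) * w powi (m + 1 + t) * q powi (m * m + (t * t + t)))"
      unfolding val e by simp
    moreover have "theta_term (- (w * q\<^sup>2)) (q\<^sup>2) t = w powi t * q powi (t * t + t)"
    proof -
      have "(w * q) powi t * q powi (t * t) = w powi t * q powi (t * t + t)"
        using q by (simp add: power_int_add power_int_mult_distrib mult_ac)
      then show ?thesis using theta_term_square(1)[OF q(2), of "w * q" t] by (simp add: power2_eq_square mult_ac)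
    qed
    moreover have "w powi (m + 1 + t) = w * w powi m * w powi t"
      "q powi (m * m + (t * t + t)) = q powi (m * m) * q powi (t * t + t)"
      using w q by (auto simp: power_int_add)
    moreover have "(-1 :: complex) powi (2 * m + 1) = -1" by simp
    ultimately show ?thesis
      unfolding theta_term_square(1)[OF q(2), of w] by (simp add: mult_ac)
  qed
  define Ev Od where "Ev = {x :: int \<times> int. even (fst x + snd x)}" and "Od = {x :: int \<times> int. odd (fst x + snd x)}"
  have bev: "bij_betw (\<lambda>(m, t). (m - t, m + t)) UNIV Ev"
    by (rule bij_betwI[of _ _ _ "\<lambda>(j, k). ((j + k) div 2, (k - j) div 2)"]) (auto simp: Ev_def; presburger)+
  have bod: "bij_betw (\<lambda>(m, t). (m - t, m + 1 + t)) UNIV Od"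
    by (rule bij_betwI[of _ _ _ "\<lambda>(j, k). ((j + k - 1) div 2, (k - j - 1) div 2)"]) (auto simp: Od_def; presburger)+
  have "((\<lambda>x. F (case x of (m, t) \<Rightarrow> (m - t, m + t))) has_sum 2 * theta' (- w) (q\<^sup>2) * theta (- (w * q)) (q\<^sup>2)) UNIV"
  proof -
    have "((\<lambda>x. 2 * (case x of (m, t) \<Rightarrow> of_int m * theta_term (- w) (q\<^sup>2) m * theta_term (- (w * q)) (q\<^sup>2) t))
       has_sum 2 * (theta' (- w) (q\<^sup>2) * theta (- (w * q)) (q\<^sup>2))) UNIV"
      by (intro has_sum_cmult_right has_sum_theta'_theta nz q2)
    then show ?thesis by (simp add: case_prod_unfold ev mult_ac)
  qed
  then have 1: "(F has_sum 2 * theta' (- w) (q\<^sup>2) * theta (- (w * q)) (q\<^sup>2)) Ev"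
    by (subst (asm) has_sum_reindex_bij_betw[OF bev])
  have "((\<lambda>x. F (case x of (m, t) \<Rightarrow> (m - t, m + 1 + t))) has_sum
     - w * (2 * (theta' (- (w * q)) (q\<^sup>2) * theta (- (w * q\<^sup>2)) (q\<^sup>2)) + theta (- (w * q)) (q\<^sup>2) * theta (- (w * q\<^sup>2)) (q\<^sup>2))) UNIV"
  proof -
    have "((\<lambda>x. - w * (2 * (case x of (m, t) \<Rightarrow> of_int m * theta_term (- (w * q)) (q\<^sup>2) m * theta_term (- (w * q\<^sup>2)) (q\<^sup>2) t)
         + (case x of (m, t) \<Rightarrow> theta_term (- (w * q)) (q\<^sup>2) m * theta_term (- (w * q\<^sup>2)) (q\<^sup>2) t)))
       has_sum - w * (2 * (theta' (- (w * q)) (q\<^sup>2) * theta (- (w * q\<^sup>2)) (q\<^sup>2)) + theta (- (w * q)) (q\<^sup>2) * theta (- (w * q\<^sup>2)) (q\<^sup>2))) UNIV"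
      by (intro has_sum_cmult_right has_sum_add has_sum_theta'_theta has_sum_theta_theta nz q2)
    then show ?thesis by (simp add: case_prod_unfold od ring_distribs mult_ac)
  qed
  then have 2: "(F has_sum - w * (2 * (theta' (- (w * q)) (q\<^sup>2) * theta (- (w * q\<^sup>2)) (q\<^sup>2)) + theta (- (w * q)) (q\<^sup>2) * theta (- (w * q\<^sup>2)) (q\<^sup>2))) Od"
    by (subst (asm) has_sum_reindex_bij_betw[OF bod])
  have U: "UNIV = Ev \<union> Od" "Ev \<inter> Od = {}" by (auto simp: Ev_def Od_def)
  have "(F has_sum (2 * theta' (- w) (q\<^sup>2) * theta (- (w * q)) (q\<^sup>2) + - w * (2 * (theta' (- (w * q)) (q\<^sup>2) * theta (- (w * q\<^sup>2)) (q\<^sup>2)) + theta (- (w * q)) (q\<^sup>2) * theta (- (w * q\<^sup>2)) (q\<^sup>2)))) UNIV"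
    unfolding U(1) by (rule has_sum_Un_disjoint[OF 1 2 U(2)])
  from has_sum_unique[OF F this] show ?thesis by (simp add: algebra_simps)
qed

text \<open>Both sides are the sum over \<open>i\<close> and \<open>m\<close> of \<open>y\<close> to the power \<open>(3 i + 1) (m + 1)\<close> minus \<open>y\<close> to the power \<open>(3 i + 2) (m + 1)\<close>,
summed in the two possible orders.\<close>

lemma lambert_series_mod3:
  fixes y :: complex
  assumes y: "norm y < 1"
  shows "(\<Sum>\<^sub>\<infinity>i. y ^ (3*i+1) / (1 - y ^ (3*i+1)) - y ^ (3*i+2) / (1 - y ^ (3*i+2)))
       = (\<Sum>\<^sub>\<infinity>m. y ^ Suc m / (1 + y ^ Suc m + (y ^ Suc m)\<^sup>2))"
proof -
  define f where "f = (\<lambda>i m. y ^ ((3*i+1) * Suc m) - y ^ ((3*i+2) * Suc m))"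
  have geo: "(\<lambda>n. norm (y ^ n)) summable_on UNIV"
    by (rule summable_nonneg_imp_summable_on) (use y in \<open>auto simp: norm_power intro!: summable_geometric\<close>)
  have "(\<lambda>z. norm (2 * (case z of (i, m) \<Rightarrow> y ^ i * y ^ m))) summable_on UNIV \<times> UNIV"
    unfolding norm_mult by (intro summable_on_cmult_right abs_summable_on_product[OF geo geo, unfolded norm_mult])
  then have "(\<lambda>z. norm (case z of (i, m) \<Rightarrow> f i m)) summable_on UNIV \<times> UNIV"
  proof (rule summable_on_comparison_test)
    fix z :: "nat \<times> nat"
    obtain i m where z: "z = (i, m)" by (cases z)
    have "norm (f i m) \<le> norm y ^ ((3*i+1) * Suc m) + norm y ^ ((3*i+2) * Suc m)"
      unfolding f_def norm_power[symmetric] by (rule norm_triangle_ineq4)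
    also have "\<dots> \<le> norm y ^ (i + m) + norm y ^ (i + m)"
      by (intro add_mono power_decreasing) (use y in auto)
    finally show "norm (case z of (i, m) \<Rightarrow> f i m) \<le> norm (2 * (case z of (i, m) \<Rightarrow> y ^ i * y ^ m))"
      by (simp add: z norm_mult norm_power power_add)
  qed auto
  then have "(\<lambda>(i, m). f i m) summable_on UNIV \<times> UNIV" by (rule abs_summable_summable)
  then have "(\<Sum>\<^sub>\<infinity>i. \<Sum>\<^sub>\<infinity>m. f i m) = (\<Sum>\<^sub>\<infinity>m. \<Sum>\<^sub>\<infinity>i. f i m)" by (rule infsum_swap_banach)
  moreover have geo1: "((\<lambda>m. x ^ m) has_sum 1 / (1 - x)) UNIV" if "norm x < 1" for x :: complex
    by (rule norm_summable_imp_has_sum) (use that in \<open>auto simp: norm_power intro!: summable_geometric geometric_sums\<close>)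
  have "(\<Sum>\<^sub>\<infinity>m. f i m) = y ^ (3*i+1) / (1 - y ^ (3*i+1)) - y ^ (3*i+2) / (1 - y ^ (3*i+2))" for i
  proof (rule infsumI)
    have g: "((\<lambda>m. y ^ (n * Suc m)) has_sum y ^ n / (1 - y ^ n)) UNIV" if "n > 0" for n
      using has_sum_cmult_right[OF geo1[OF norm_power_less_1[OF y that]], of "y ^ n"]
      by (simp add: power_mult power_add)
    show "(f i has_sum y ^ (3*i+1) / (1 - y ^ (3*i+1)) - y ^ (3*i+2) / (1 - y ^ (3*i+2))) UNIV"
      unfolding f_def
      using has_sum_add[OF g has_sum_uminusI[OF g], of "3*i+1" "3*i+2"] by simp
  qed
  moreover have "(\<Sum>\<^sub>\<infinity>i. f i m) = y ^ Suc m / (1 + y ^ Suc m + (y ^ Suc m)\<^sup>2)" for m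
  proof (rule infsumI)
    define x where "x = y ^ Suc m"
    have x: "norm x < 1" unfolding x_def by (rule norm_power_less_1[OF y]) simp
    then have x1: "1 - x \<noteq> 0" by auto
    have x3: "norm (x ^ 3) < 1" by (rule norm_power_less_1[OF x]) simp
    have fx: "f i m = (x - x\<^sup>2) * (x ^ 3) ^ i" for i
    proof -
      have "y ^ ((3*i+1) * Suc m) = x * (x ^ 3) ^ i" "y ^ ((3*i+2) * Suc m) = x\<^sup>2 * (x ^ 3) ^ i"
        unfolding x_def by (simp_all flip: power_mult power_add power_Suc add: algebra_simps)
      then show ?thesis by (simp add: f_def algebra_simps)
    qed
    have "(x - x\<^sup>2) * (1 / (1 - x ^ 3)) = ((1 - x) * x) / ((1 - x) * (1 + x + x\<^sup>2))"
      by (simp add: algebra_simps power2_eq_square power3_eq_cube)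
    also have "\<dots> = x / (1 + x + x\<^sup>2)" using x1 by simp
    finally show "((\<lambda>i. f i m) has_sum y ^ Suc m / (1 + y ^ Suc m + (y ^ Suc m)\<^sup>2)) UNIV"
      unfolding fx using has_sum_cmult_right[OF geo1[OF x3], of "x - x\<^sup>2"] by (simp add: x_def)
  qed
  ultimately show ?thesis by simp
qed

section \<open>Eta quotients as products of theta series\<close>

text \<open>The parameter \<open>w\<close> does not occur in the eta quotients; it enters as an argument of auxiliary theta series.\<close>

locale nome =
  fixes q w :: complex
  assumes q: "norm q < 1" "q \<noteq> 0" and w: "w\<^sup>2 + w + 1 = 0"
begin

text \<open>The Euler product whose \<open>q\<close>-power multiple is the eta function at \<open>n \<tau>\<close>.\<close>

abbreviation eul :: "nat \<Rightarrow> complex" where "eul n \<equiv> qpoch (q ^ n) (q ^ n)"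

lemma nome_power: "0 < n \<Longrightarrow> norm (q ^ n) < 1" "q ^ n \<noteq> 0"
  using norm_power_less_1[OF q(1)] q by auto

lemma eul_nonzero: "0 < n \<Longrightarrow> eul n \<noteq> 0"
  by (intro qpoch_nonzero_small nome_power)

lemma qpoch_neg_power_nonzero: "qpoch (- (q ^ n)) (q ^ m) \<noteq> 0" if "n > 0" "m > 0"
  using that nome_power by (intro qpoch_nonzero_small) auto

lemma euler_products_at_negative_powers:
  "qpoch (- q) (q\<^sup>2) * qpoch (- (q\<^sup>2)) (q\<^sup>2) * eul 1 = eul 2"
  "qpoch (- (q ^ 3)) (q ^ 6) * qpoch (- (q ^ 6)) (q ^ 6) * eul 3 = eul 6"
proof -
  show "qpoch (- q) (q\<^sup>2) * qpoch (- (q\<^sup>2)) (q\<^sup>2) * eul 1 = eul 2"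
    using qpoch_minus[OF q(1), of q] qpoch_dissect2[OF q(1), of "- q"] by (simp add: power2_eq_square mult_ac)
  have "(q ^ 3)\<^sup>2 = q ^ 6" "q ^ 3 * q ^ 3 = q ^ 6" by (simp_all flip: power_mult power_add)
  then show "qpoch (- (q ^ 3)) (q ^ 6) * qpoch (- (q ^ 6)) (q ^ 6) * eul 3 = eul 6"
    using qpoch_minus[OF nome_power(1), of 3 "q ^ 3"] qpoch_dissect2[OF nome_power(1), of 3 "- (q ^ 3)"]
    by (simp add: mult_ac)
qed

text \<open>By the triple product and \<open>qpoch_cubic\<close>, both sides are products of shifted factorials to the bases \<open>q\<^sup>2\<close> and \<open>q\<^sup>6\<close>,
which agree after sorting exponents by their residues modulo \<open>6\<close>.\<close>

lemma theta_cube_root_even: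
  "eul 3 * theta (- (w * q)) (q\<^sup>2) = eul 1 * theta (- (q ^ 4)) (q ^ 6)"
proof -
  let ?A = "qpoch (- q) (q\<^sup>2)" and ?B = "qpoch (- (q\<^sup>2)) (q\<^sup>2)"
  let ?A3 = "qpoch (- (q ^ 3)) (q ^ 6)" and ?B3 = "qpoch (- (q ^ 6)) (q ^ 6)"
  note cr = cube_root[OF w]
  have w1: "w * w\<^sup>2 = 1" using cr(1) by (simp add: power3_eq_cube power2_eq_square mult.assoc)
  have d: "q\<^sup>2 / (- (w * q)) = - (w\<^sup>2 * q)"
    using w1 cr(3) q by (simp add: field_simps power2_eq_square)
  have d': "q ^ 6 / (- (q ^ 4)) = - (q\<^sup>2)" using q by (simp add: field_simps flip: power_add)
  have t1: "theta (- (w * q)) (q\<^sup>2) = eul 2 * qpoch (w * - q) (q\<^sup>2) * qpoch (w\<^sup>2 * - q) (q\<^sup>2)"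
    using Jacobi_triple_product[OF nome_power(1)[of 2] nome_power(2)[of 2], of "- (w * q)"] cr(3) q unfolding d by simp
  have t2: "theta (- (q ^ 4)) (q ^ 6) = eul 6 * qpoch (- (q ^ 4)) (q ^ 6) * qpoch (- (q\<^sup>2)) (q ^ 6)"
    using Jacobi_triple_product[OF nome_power(1)[of 6] nome_power(2)[of 6], of "- (q ^ 4)"] q unfolding d' by simp
  have c: "?A * (qpoch (w * - q) (q\<^sup>2) * qpoch (w\<^sup>2 * - q) (q\<^sup>2)) = ?A3"
    using qpoch_cubic[OF nome_power(1)[of 2] w, of "- q"] by (simp add: mult.assoc flip: power_mult)
  have b: "?B = qpoch (- (q\<^sup>2)) (q ^ 6) * qpoch (- (q ^ 4)) (q ^ 6) * ?B3"
    using qpoch_dissect3[OF nome_power(1)[of 2], of "- (q\<^sup>2)"] by (simp flip: power_mult power_add)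
  have nz: "?A \<noteq> 0" "?B3 \<noteq> 0"
    using qpoch_neg_power_nonzero[of 1 2] qpoch_neg_power_nonzero[of 6 6] by simp_all
  have "?A * ?B3 * (eul 3 * theta (- (w * q)) (q\<^sup>2)) = eul 3 * eul 2 * ?B3 * ?A3"
    unfolding t1 c[symmetric] by (simp add: mult_ac)
  also have "\<dots> = eul 2 * eul 6" unfolding euler_products_at_negative_powers(2)[symmetric] by (simp add: mult_ac)
  also have "\<dots> = ?A * ?B * eul 1 * eul 6" unfolding euler_products_at_negative_powers(1) by simp
  also have "\<dots> = ?A * ?B3 * (eul 1 * theta (- (q ^ 4)) (q ^ 6))" unfolding t2 b by (simp add: mult_ac)
  finally show ?thesis using nz by simp
qed

text \<open>As for the even case; the factor \<open>- w\<close> is \<open>1 + w\<^sup>2\<close>, the first factor of the shifted factorial at \<open>- w\<^sup>2\<close>.\<close>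

lemma theta_cube_root_odd:
  "eul 3 * theta (- (w * q\<^sup>2)) (q\<^sup>2) = - w * eul 1 * theta (- (q ^ 5)) (q ^ 6)"
proof -
  let ?A = "qpoch (- q) (q\<^sup>2)" and ?B = "qpoch (- (q\<^sup>2)) (q\<^sup>2)"
  let ?A3 = "qpoch (- (q ^ 3)) (q ^ 6)" and ?B3 = "qpoch (- (q ^ 6)) (q ^ 6)"
  note cr = cube_root[OF w]
  have w1: "w * w\<^sup>2 = 1" using cr(1) by (simp add: power3_eq_cube power2_eq_square mult.assoc)
  have d: "q\<^sup>2 / (- (w * q\<^sup>2)) = - (w\<^sup>2)"
    using w1 cr(3) q by (simp add: field_simps power2_eq_square)
  have d': "q ^ 6 / (- (q ^ 5)) = - q" using q by (simp add: field_simps flip: power_Suc)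
  have "w\<^sup>2 + 1 = (w\<^sup>2 + w + 1) - w" by simp
  then have ww: "1 - - (w\<^sup>2) = - w" unfolding w by (simp add: add.commute)
  have t1: "theta (- (w * q\<^sup>2)) (q\<^sup>2) = - w * eul 2 * qpoch (w * - (q\<^sup>2)) (q\<^sup>2) * qpoch (w\<^sup>2 * - (q\<^sup>2)) (q\<^sup>2)"
    using Jacobi_triple_product[OF nome_power(1)[of 2] nome_power(2)[of 2], of "- (w * q\<^sup>2)"] cr(3) q
      qpoch_rec[OF nome_power(1)[of 2], of "- (w\<^sup>2)"] unfolding d ww by simp
  have t2: "theta (- (q ^ 5)) (q ^ 6) = eul 6 * qpoch (- (q ^ 5)) (q ^ 6) * qpoch (- q) (q ^ 6)"
    using Jacobi_triple_product[OF nome_power(1)[of 6] nome_power(2)[of 6], of "- (q ^ 5)"] q unfolding d' by simp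
  have c: "?B * (qpoch (w * - (q\<^sup>2)) (q\<^sup>2) * qpoch (w\<^sup>2 * - (q\<^sup>2)) (q\<^sup>2)) = ?B3"
    using qpoch_cubic[OF nome_power(1)[of 2] w, of "- (q\<^sup>2)"] by (simp add: mult.assoc flip: power_mult)
  have b: "?A = qpoch (- q) (q ^ 6) * ?A3 * qpoch (- (q ^ 5)) (q ^ 6)"
    using qpoch_dissect3[OF nome_power(1)[of 2], of "- q"] by (simp flip: power_mult power_add power_Suc)
  have nz: "?B \<noteq> 0" "?A3 \<noteq> 0"
    using qpoch_neg_power_nonzero[of 2 2] qpoch_neg_power_nonzero[of 3 6] by simp_all
  have "?B * ?A3 * (eul 3 * theta (- (w * q\<^sup>2)) (q\<^sup>2)) = - w * (eul 3 * eul 2 * ?A3 * ?B3)"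
    unfolding t1 c[symmetric] by (simp add: mult_ac)
  also have "\<dots> = - w * (eul 2 * eul 6)" unfolding euler_products_at_negative_powers(2)[symmetric] by (simp add: mult_ac)
  also have "\<dots> = - w * (?A * ?B * eul 1 * eul 6)" unfolding euler_products_at_negative_powers(1) by simp
  also have "\<dots> = ?B * ?A3 * (- w * eul 1 * theta (- (q ^ 5)) (q ^ 6))" unfolding t2 b by (simp add: mult_ac)
  finally show ?thesis using nz by (simp only: mult_cancel_left) simp
qed

text \<open>Here \<open>eul 1\<^sup>2 eul 3\<^sup>2\<close> is \<open>eul 3 / eul 1\<close> times \<open>eul 1\<^sup>3\<close> times \<open>eul 3\<close>, and the last two factors are, up to constants,
\<open>theta' 1 q\<close> and \<open>theta w q\<close>. The rotation separates variables in their product, and the factor \<open>eul 3 / eul 1\<close> then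
turns the series in the second variable into theta series whose coefficients are constant up to powers of \<open>q\<close>.\<close>

lemma eta_1_2_3_2_theta:
  "- ((1 - w) * eul 1 ^ 2 * eul 3 ^ 2) =
     2 * theta' (- w) (q\<^sup>2) * theta (- (q ^ 4)) (q ^ 6)
     + w\<^sup>2 * (2 * theta' (- (w * q)) (q\<^sup>2) + theta (- (w * q)) (q\<^sup>2)) * theta (- (q ^ 5)) (q ^ 6)"
proof -
  note cr = cube_root[OF w]
  have w1: "w * w\<^sup>2 = 1" using cr(1) by (simp add: power3_eq_cube power2_eq_square mult.assoc)
  have qw: "q / w = w\<^sup>2 * q" using w1 cr(3) by (simp add: field_simps)
  have tw: "theta w q = (1 - w) * eul 3"
    using Jacobi_triple_product[OF q cr(3)] qpoch_rec[OF q(1), of w] qpoch_cubic[OF q(1) w, of q]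
    unfolding qw by (simp add: mult_ac)
  have "eul 1 * - ((1 - w) * eul 1 ^ 2 * eul 3 ^ 2) = eul 3 * (theta' 1 q * theta w q)"
    unfolding theta'_1[OF q] tw by (simp add: power2_eq_square power3_eq_cube mult_ac)
  also have "\<dots> = 2 * theta' (- w) (q\<^sup>2) * (eul 3 * theta (- (w * q)) (q\<^sup>2))
      - w * (2 * theta' (- (w * q)) (q\<^sup>2) + theta (- (w * q)) (q\<^sup>2)) * (eul 3 * theta (- (w * q\<^sup>2)) (q\<^sup>2))"
    unfolding theta'_theta_rotation[OF q cr(3)] by (simp add: algebra_simps)
  also have "\<dots> = eul 1 * (2 * theta' (- w) (q\<^sup>2) * theta (- (q ^ 4)) (q ^ 6)
     + w\<^sup>2 * (2 * theta' (- (w * q)) (q\<^sup>2) + theta (- (w * q)) (q\<^sup>2)) * theta (- (q ^ 5)) (q ^ 6))"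
    unfolding theta_cube_root_even theta_cube_root_odd by (simp add: algebra_simps power2_eq_square)
  finally show ?thesis using eul_nonzero[of 1] by (simp only: mult_cancel_left) simp
qed

text \<open>Euler's pentagonal number series for \<open>eul 1\<close> times Jacobi's series for \<open>eul 1\<^sup>3\<close>.\<close>

lemma eta_1_4_theta: "eul 1 ^ 4 = - (theta q (q ^ 3) * theta' 1 q)"
proof -
  have "q ^ 3 / q = q\<^sup>2" using q by (simp add: power2_eq_square power3_eq_cube)
  then have "theta q (q ^ 3) = eul 1"
    using Jacobi_triple_product[OF nome_power(1)[of 3] nome_power(2)[of 3] q(2)] qpoch_dissect3[OF q(1), of q]
    by (simp add: mult_ac power2_eq_square power3_eq_cube)
  then show ?thesis unfolding theta'_1[OF q] by (simp add: eval_nat_numeral)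
qed

text \<open>The poles at \<open>w y\<close> and \<open>w\<^sup>2 y\<close> combine to denominators \<open>1 + y + y\<^sup>2\<close>, where \<open>y\<close> runs over the odd powers of \<open>q\<close>.\<close>

lemma theta_logderiv_cube_root:
  "theta_logderiv (w\<^sup>2 * q) (q\<^sup>2) = (w - w\<^sup>2) * (\<Sum>\<^sub>\<infinity>i. q ^ (2*i+1) / (1 + q ^ (2*i+1) + (q ^ (2*i+1))\<^sup>2))"
  (is "_ = _ * (\<Sum>\<^sub>\<infinity>i. ?l i)")
proof -
  note cr = cube_root[OF w]
  have w1: "w * w\<^sup>2 = 1" using cr(1) by (simp add: power3_eq_cube power2_eq_square mult.assoc)
  have qw: "q\<^sup>2 / (w\<^sup>2 * q) = w * q" using w1 cr(3) q by (simp add: field_simps power2_eq_square)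
  have e: "(w * q * (q\<^sup>2) ^ i) / (1 - w * q * (q\<^sup>2) ^ i) - (w\<^sup>2 * q * (q\<^sup>2) ^ i) / (1 - w\<^sup>2 * q * (q\<^sup>2) ^ i)
      = (w - w\<^sup>2) * ?l i" for i
    using lambert_cube_root[OF w nome_power(1)[of "2*i+1"]] by (simp add: power_mult mult.assoc)
  have "summable (\<lambda>m. norm (q ^ Suc m / (1 + q ^ Suc m + (q ^ Suc m)\<^sup>2)))" by (rule lambert3_summable[OF q(1) w])
  then have "(\<lambda>m. norm (q ^ Suc m / (1 + q ^ Suc m + (q ^ Suc m)\<^sup>2))) summable_on UNIV"
    by (intro summable_nonneg_imp_summable_on) auto
  then have "(\<lambda>m. norm (q ^ Suc m / (1 + q ^ Suc m + (q ^ Suc m)\<^sup>2))) summable_on range (\<lambda>i. 2*i)"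
    by (rule summable_on_subset) auto
  then have s: "(\<lambda>i. norm (?l i)) summable_on UNIV"
    by (subst (asm) summable_on_reindex) (auto simp: inj_def o_def)
  have "theta_logderiv (w\<^sup>2 * q) (q\<^sup>2) = (\<Sum>i. (w - w\<^sup>2) * ?l i)"
    unfolding theta_logderiv_def qw e ..
  also have "\<dots> = (\<Sum>\<^sub>\<infinity>i. (w - w\<^sup>2) * ?l i)"
    by (rule sums_unique[symmetric], rule has_sum_imp_sums, rule has_sum_infsum,
        rule summable_on_cmult_right, rule abs_summable_summable[OF s])
  finally show ?thesis by (simp only: infsum_cmult_right')
qed

text \<open>Here \<open>y\<close> runs over the even powers of \<open>q\<close>, which complement those in \<open>theta_logderiv_cube_root\<close>.\<close>

lemma theta_logderiv_mod3:
  "theta_logderiv (q ^ 4) (q ^ 6) = (\<Sum>\<^sub>\<infinity>m. q ^ (2 * Suc m) / (1 + q ^ (2 * Suc m) + (q ^ (2 * Suc m))\<^sup>2))"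
proof -
  define y where "y = q\<^sup>2"
  have y: "norm y < 1" unfolding y_def by (rule nome_power) simp
  have q64: "q ^ 6 / q ^ 4 = q\<^sup>2" using q by (simp add: field_simps flip: power_add)
  let ?a = "\<lambda>i. (q\<^sup>2 * (q ^ 6) ^ i) / (1 - q\<^sup>2 * (q ^ 6) ^ i)" and ?b = "\<lambda>i. (q ^ 4 * (q ^ 6) ^ i) / (1 - q ^ 4 * (q ^ 6) ^ i)"
  have p: "q\<^sup>2 * (q ^ 6) ^ i = y ^ (3*i+1)" "q ^ 4 * (q ^ 6) ^ i = y ^ (3*i+2)" for i
  proof -
    have e: "q ^ 6 = y ^ 3" "q ^ 4 = y\<^sup>2" "q\<^sup>2 = y" by (simp_all add: y_def flip: power_mult)
    show "q\<^sup>2 * (q ^ 6) ^ i = y ^ (3*i+1)" "q ^ 4 * (q ^ 6) ^ i = y ^ (3*i+2)"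
      unfolding e power_add power_mult power_one_right by (rule mult.commute)+
  qed
  have "summable (\<lambda>i. norm (?a i) + norm (?b i))"
    by (intro summable_add lambert_abs_summable nome_power) auto
  then have "summable (\<lambda>i. norm (?a i - ?b i))"
    by (rule summable_comparison_test') (simp add: norm_triangle_ineq4)
  then have s: "(\<lambda>i. norm (?a i - ?b i)) summable_on UNIV"
    by (intro summable_nonneg_imp_summable_on) auto
  have "theta_logderiv (q ^ 4) (q ^ 6) = (\<Sum>i. ?a i - ?b i)"
    unfolding theta_logderiv_def q64 ..
  also have "\<dots> = (\<Sum>\<^sub>\<infinity>i. ?a i - ?b i)"
    by (rule sums_unique[symmetric], rule has_sum_imp_sums, rule has_sum_infsum, rule abs_summable_summable[OF s])
  also have "\<dots> = (\<Sum>\<^sub>\<infinity>m. y ^ Suc m / (1 + y ^ Suc m + (y ^ Suc m)\<^sup>2))"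
    unfolding p by (rule lambert_series_mod3[OF y])
  finally show ?thesis unfolding y_def power_mult .
qed

lemma lambert3_parity:
  "(\<Sum>\<^sub>\<infinity>m. (-1) ^ Suc m * (q ^ Suc m / (1 + q ^ Suc m + (q ^ Suc m)\<^sup>2)))
   = (\<Sum>\<^sub>\<infinity>m. q ^ (2 * Suc m) / (1 + q ^ (2 * Suc m) + (q ^ (2 * Suc m))\<^sup>2))
     - (\<Sum>\<^sub>\<infinity>i. q ^ (2*i+1) / (1 + q ^ (2*i+1) + (q ^ (2*i+1))\<^sup>2))"
proof -
  let ?l = "\<lambda>n. q ^ n / (1 + q ^ n + (q ^ n)\<^sup>2)"
  let ?f = "\<lambda>m. (-1) ^ Suc m * ?l (Suc m)"
  have "summable (\<lambda>m. norm (?f m))" using lambert3_summable[OF q(1) w] by (simp add: norm_mult norm_divide norm_power)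
  then have "(\<lambda>m. norm (?f m)) summable_on UNIV"
    by (intro summable_nonneg_imp_summable_on) auto
  then have s: "?f summable_on UNIV" by (rule abs_summable_summable)
  have U: "UNIV = range (\<lambda>i::nat. 2*i+1) \<union> range (\<lambda>i. 2*i)"
  proof -
    have "n \<in> range (\<lambda>i::nat. 2*i+1) \<union> range (\<lambda>i. 2*i)" for n
      by (cases "even n") (auto elim!: evenE oddE)
    then show ?thesis by blast
  qed
  have disj: "range (\<lambda>i::nat. 2*i+1) \<inter> range (\<lambda>i. 2*i) = {}" by auto presburger
  have "infsum ?f UNIV = infsum ?f (range (\<lambda>i. 2*i+1)) + infsum ?f (range (\<lambda>i. 2*i))"
    by (subst U, rule infsum_Un_disjoint[OF summable_on_subset[OF s] summable_on_subset[OF s] disj]) auto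
  also have "infsum ?f (range (\<lambda>i. 2*i+1)) = (\<Sum>\<^sub>\<infinity>i. ?l (2 * Suc i))"
    by (subst infsum_reindex) (auto simp: inj_def o_def)
  also have "infsum ?f (range (\<lambda>i. 2*i)) = (\<Sum>\<^sub>\<infinity>i. - ?l (2*i+1))"
    by (subst infsum_reindex) (auto simp: inj_def o_def)
  finally show ?thesis by (simp add: infsum_uminus)
qed

text \<open>The right-hand side is \<open>A C (1 + 6 L\<^sub>A + 2 (w - w\<^sup>2) L\<^sub>C)\<close> for the theta series \<open>A\<close> and \<open>C\<close> and their logarithmic
derivatives. The latter are the even and the odd part of Kronecker's Lambert series, and \<open>(w - w\<^sup>2)\<^sup>2 = - 3\<close> gives them opposite signs;
so the bracket is an eta quotient by \<open>Kronecker_lambert_series\<close>.\<close>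

lemma eta_1_5_3_theta:
  "eul 1 ^ 5 / eul 3 =
     (6 * theta' (q ^ 4) (q ^ 6) + theta (q ^ 4) (q ^ 6)) * theta (w\<^sup>2 * q) (q\<^sup>2)
     + 2 * (w - w\<^sup>2) * theta (q ^ 4) (q ^ 6) * theta' (w\<^sup>2 * q) (q\<^sup>2)"
proof -
  note cr = cube_root[OF w]
  have w1: "w * w\<^sup>2 = 1" using cr(1) by (simp add: power3_eq_cube power2_eq_square mult.assoc)
  have qw: "q\<^sup>2 / (w\<^sup>2 * q) = w * q" using w1 cr(3) q by (simp add: field_simps power2_eq_square)
  have q64: "q ^ 6 / q ^ 4 = q\<^sup>2" using q by (simp add: field_simps flip: power_add)
  have not1: "x \<noteq> 1" if "norm x < 1" for x :: complex using that by auto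
  have small: "norm (x * q ^ n * (q ^ m) ^ i) < 1" if "norm x = 1" "n > 0" for x n m i
    using nome_power(1)[of "n + m * i"] that by (simp add: norm_mult power_add power_mult)
  have A: "theta (q ^ 4) (q ^ 6) = eul 2"
    using Jacobi_triple_product[OF nome_power(1)[of 6] nome_power(2)[of 6] nome_power(2)[of 4]]
      qpoch_dissect3[OF nome_power(1)[of 2], of "q\<^sup>2"]
    by (simp add: q64 mult_ac flip: power_mult power_add)
  have A': "theta' (q ^ 4) (q ^ 6) = eul 2 * theta_logderiv (q ^ 4) (q ^ 6)"
    unfolding A[symmetric]
    using theta'_eq_logderiv[OF nome_power(1)[of 6] nome_power(2)[of 6] nome_power(2)[of 4]]
      not1[OF small[of 1 4 6]] not1[OF small[of 1 2 6]] by (simp add: q64)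
  define C where "C = theta (w\<^sup>2 * q) (q\<^sup>2)"
  have wq: "w\<^sup>2 * q \<noteq> 0" using cr q by simp
  have C': "theta' (w\<^sup>2 * q) (q\<^sup>2) = C * theta_logderiv (w\<^sup>2 * q) (q\<^sup>2)"
    unfolding C_def
    using theta'_eq_logderiv[OF nome_power(1)[of 2] nome_power(2)[of 2] wq]
      not1[OF small[of w 1 2]] not1[OF small[of "w\<^sup>2" 1 2]] cr(2) by (simp add: qw norm_power)
  have C1: "C = eul 2 * qpoch (w\<^sup>2 * q) (q\<^sup>2) * qpoch (w * q) (q\<^sup>2)"
    unfolding C_def using Jacobi_triple_product[OF nome_power(1)[of 2] nome_power(2)[of 2] wq] by (simp add: qw)
  have c: "qpoch q (q\<^sup>2) * (qpoch (w * q) (q\<^sup>2) * qpoch (w\<^sup>2 * q) (q\<^sup>2)) = qpoch (q ^ 3) (q ^ 6)"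
    using qpoch_cubic[OF nome_power(1)[of 2] w, of q] by (simp add: mult.assoc flip: power_mult)
  have e1: "eul 1 = qpoch q (q\<^sup>2) * eul 2"
    using qpoch_dissect2[OF q(1), of q] by (simp add: power2_eq_square)
  have e3: "eul 3 = qpoch (q ^ 3) (q ^ 6) * eul 6"
    using qpoch_dissect2[OF nome_power(1)[of 3], of "q ^ 3"] by (simp flip: power_mult power_add)
  have C2: "C * eul 1 * eul 6 = eul 2 ^ 2 * eul 3"
    unfolding C1 e1 e3 c[symmetric] by (simp add: power2_eq_square mult_ac)
  define L1 where "L1 = (\<Sum>\<^sub>\<infinity>m. q ^ (2 * Suc m) / (1 + q ^ (2 * Suc m) + (q ^ (2 * Suc m))\<^sup>2))"
  define L2 where "L2 = (\<Sum>\<^sub>\<infinity>i. q ^ (2*i+1) / (1 + q ^ (2*i+1) + (q ^ (2*i+1))\<^sup>2))"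
  have K: "eul 1 ^ 6 * eul 6 = eul 2 ^ 3 * eul 3 ^ 2 * (1 + 6 * (L1 - L2))"
    using Kronecker_lambert_series[OF q w] unfolding lambert3_parity L1_def L2_def by simp
  have s2: "2 * (w - w\<^sup>2) * (C * ((w - w\<^sup>2) * L2)) = - 6 * C * L2"
  proof -
    have "2 * (w - w\<^sup>2) * (C * ((w - w\<^sup>2) * L2)) = 2 * (w - w\<^sup>2)\<^sup>2 * C * L2" by (simp add: power2_eq_square mult_ac)
    then show ?thesis unfolding cr(6) by simp
  qed
  have "(6 * theta' (q ^ 4) (q ^ 6) + theta (q ^ 4) (q ^ 6)) * theta (w\<^sup>2 * q) (q\<^sup>2)
     + 2 * (w - w\<^sup>2) * theta (q ^ 4) (q ^ 6) * theta' (w\<^sup>2 * q) (q\<^sup>2)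
     = eul 2 * C * (1 + 6 * L1) + eul 2 * (2 * (w - w\<^sup>2) * (C * ((w - w\<^sup>2) * L2)))"
    unfolding A A' C' C_def[symmetric] theta_logderiv_mod3 theta_logderiv_cube_root L1_def[symmetric] L2_def[symmetric]
    by (simp add: algebra_simps)
  also have "\<dots> = eul 2 * C * (1 + 6 * (L1 - L2))" unfolding s2 by (simp add: algebra_simps)
  also have "\<dots> = eul 1 ^ 5 / eul 3"
  proof -
    have "eul 2 * C * (1 + 6 * (L1 - L2)) * eul 3 * (eul 1 * eul 6)
        = (C * eul 1 * eul 6) * eul 2 * eul 3 * (1 + 6 * (L1 - L2))" by (simp only: mult_ac)
    also have "\<dots> = eul 2 ^ 3 * eul 3 ^ 2 * (1 + 6 * (L1 - L2))"
      unfolding C2 by (simp add: power2_eq_square power3_eq_cube mult_ac)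
    also have "\<dots> = eul 1 ^ 5 * (eul 1 * eul 6)" unfolding K[symmetric] by (simp add: eval_nat_numeral mult_ac)
    finally have "eul 2 * C * (1 + 6 * (L1 - L2)) * eul 3 = eul 1 ^ 5"
      using eul_nonzero[of 1] eul_nonzero[of 6] by simp
    then show ?thesis using eul_nonzero[of 3] by (simp add: field_simps)
  qed
  finally show ?thesis ..
qed

end

section \<open>Fourier expansions of the eigenforms\<close>

text \<open>A double theta series becomes a power series in \<open>q\<close> by collecting the finitely many terms with a given exponent.\<close>

lemma has_sum_collect_powers:
  fixes c :: "'a \<Rightarrow> complex"
  assumes s: "((\<lambda>x. c x * q ^ e x) has_sum S) UNIV" and fin: "\<And>n. finite {x. e x = n}"
  shows "(\<lambda>n. (\<Sum>x | e x = n. c x) * q ^ n) sums S"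
proof -
  have b: "bij_betw snd (Sigma UNIV (\<lambda>n. {x. e x = n})) (UNIV :: 'a set)"
    by (rule bij_betwI[of _ _ _ "\<lambda>x. (e x, x)"]) auto
  have "((\<lambda>z. c (snd z) * q ^ e (snd z)) has_sum S) (Sigma UNIV (\<lambda>n. {x. e x = n}))"
    using s by (subst has_sum_reindex_bij_betw[OF b])
  moreover have "((\<lambda>x. c (snd (n, x)) * q ^ e (snd (n, x))) has_sum (\<Sum>x | e x = n. c x) * q ^ n) {x. e x = n}" for n
    by (rule has_sum_finiteI[OF fin]) (simp add: sum_distrib_right)
  ultimately have "((\<lambda>n. (\<Sum>x | e x = n. c x) * q ^ n) has_sum S) UNIV"
    by (rule has_sum_SigmaD)
  then show ?thesis by (rule has_sum_imp_sums)
qed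

text \<open>The definite description needs uniqueness of the coefficients. Every nonzero \<open>q\<close> in the unit disc has the form
\<open>exp (2 \<pi> \<i> \<tau>)\<close>, so the difference of two expansions vanishes on the punctured disc.\<close>

lemma fourier_coeff_eqI:
  assumes "\<And>\<tau>. Im \<tau> > 0 \<Longrightarrow> (\<lambda>n. a n * exp (2 * of_real pi * \<i> * \<tau>) ^ n) sums f \<tau>"
  shows "fourier_coeff f = a"
  unfolding fourier_coeff_def
proof (rule the_equality)
  show "\<forall>\<tau>. Im \<tau> > 0 \<longrightarrow> (\<lambda>n. a n * exp (2 * of_real pi * \<i> * \<tau>) ^ n) sums f \<tau>"
    using assms by blast
  fix b
  assume b: "\<forall>\<tau>. Im \<tau> > 0 \<longrightarrow> (\<lambda>n. b n * exp (2 * of_real pi * \<i> * \<tau>) ^ n) sums f \<tau>"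
  \<comment> \<open>Shifting the coefficients by one makes the series vanish at the origin as well, where no \<open>\<tau>\<close> is available.\<close>
  define d where "d = (\<lambda>n. case n of 0 \<Rightarrow> 0 | Suc m \<Rightarrow> b m - a m)"
  have ds: "(\<lambda>n. d n * (x - 0) ^ n) sums 0" if "norm (x - 0) < 1" for x
  proof (cases "x = 0")
    case True
    have "(\<lambda>n. d n * (x - 0) ^ n) = (\<lambda>_. 0)"
    proof
      fix n show "d n * (x - 0) ^ n = 0" using True by (cases n) (auto simp: d_def)
    qed
    then show ?thesis by (simp only: sums_zero)
  next
    case False
    define \<tau> where "\<tau> = Ln x / (2 * of_real pi * \<i>)"
    have ex: "exp (2 * of_real pi * \<i> * \<tau>) = x" using False by (simp add: \<tau>_def)
    have "Im \<tau> = - ln (norm x) / (2 * pi)"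
      using False by (simp add: \<tau>_def Im_divide power2_eq_square field_simps)
    moreover have "ln (norm x) < 0" using that False by simp
    ultimately have "Im \<tau> > 0" by (simp add: divide_neg_pos)
    then have "(\<lambda>n. b n * x ^ n - a n * x ^ n) sums (f \<tau> - f \<tau>)"
      using b assms[of \<tau>] unfolding ex by (intro sums_diff) (auto simp: ex)
    then have "(\<lambda>n. x * (b n * x ^ n - a n * x ^ n)) sums (x * 0)" by (intro sums_mult) simp
    then have "(\<lambda>n. d (Suc n) * x ^ Suc n) sums 0" by (simp add: d_def algebra_simps)
    then show ?thesis by (subst (asm) sums_Suc_iff) (simp add: d_def)
  qed
  show "b = a"
  proof (rule ccontr)
    assume "b \<noteq> a"
    then obtain m where "b m \<noteq> a m" by auto
    then have "d (Suc m) \<noteq> 0" by (simp add: d_def)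
    from powser_0_nonzero[of 1 0 d "\<lambda>_. 0", OF _ ds refl this]
    obtain s where "0 < s" "\<And>z::complex. z \<in> cball 0 s - {0} \<Longrightarrow> False" by auto
    from this(2)[of "of_real s"] this(1) show False by simp
  qed
qed

lemma dedekind_eta_eq_qpoch:
  "dedekind_eta (of_nat k * \<tau>) = exp (2 * of_real pi * \<i> * \<tau> / 24) ^ k
     * qpoch (exp (2 * of_real pi * \<i> * \<tau>) ^ k) (exp (2 * of_real pi * \<i> * \<tau>) ^ k)"
proof -
  have "exp (2 * of_real pi * \<i> * (of_nat k * \<tau>)) = exp (2 * of_real pi * \<i> * \<tau>) ^ k"
    "exp (2 * of_real pi * \<i> * (of_nat k * \<tau>) / 24) = exp (2 * of_real pi * \<i> * \<tau> / 24) ^ k"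
    unfolding exp_of_nat_mult[symmetric] by (simp_all add: mult_ac)
  then show ?thesis unfolding dedekind_eta_def qpoch_def by simp
qed

context
  fixes \<tau> q x :: complex
  assumes tau: "Im \<tau> > 0"
  defines "q \<equiv> exp (2 * of_real pi * \<i> * \<tau>)" and "x \<equiv> exp (2 * of_real pi * \<i> * \<tau> / 24)"
begin

lemma nome_of_upper_half_plane: "norm q < 1" "q \<noteq> 0" "x ^ 24 = q" "x \<noteq> 0"
proof -
  show "norm q < 1" using tau by (simp add: q_def)
  show "q \<noteq> 0" "x \<noteq> 0" by (simp_all add: q_def x_def)
  have "of_nat 24 * (2 * of_real pi * \<i> * \<tau> / 24) = 2 * of_real pi * \<i> * \<tau>" by simp
  then show "x ^ 24 = q" unfolding x_def q_def exp_of_nat_mult[symmetric] by (simp only:)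
qed

lemma f_36_2_a_a_eq: "f_36_2_a_a \<tau> = q * qpoch (q ^ 6) (q ^ 6) ^ 4"
proof -
  have "f_36_2_a_a \<tau> = dedekind_eta (of_nat 6 * \<tau>) ^ 4"
    by (simp add: f_36_2_a_a_def K5_def)
  also have "\<dots> = x ^ 24 * qpoch (q ^ 6) (q ^ 6) ^ 4"
    unfolding dedekind_eta_eq_qpoch q_def[symmetric] x_def[symmetric]
    by (simp add: power_mult_distrib flip: power_mult)
  finally show ?thesis unfolding nome_of_upper_half_plane(3) .
qed

lemma f_27_2_a_a_eq: "f_27_2_a_a \<tau> = q * (qpoch (q ^ 3) (q ^ 3) ^ 2 * qpoch (q ^ 9) (q ^ 9) ^ 2)"
proof -
  have "f_27_2_a_a \<tau> = dedekind_eta (of_nat 9 * \<tau>) ^ 2 * dedekind_eta (of_nat 3 * \<tau>) ^ 2"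
    by (simp add: f_27_2_a_a_def K5_def)
  also have "\<dots> = x ^ 24 * (qpoch (q ^ 3) (q ^ 3) ^ 2 * qpoch (q ^ 9) (q ^ 9) ^ 2)"
    unfolding dedekind_eta_eq_qpoch q_def[symmetric] x_def[symmetric]
    by (simp add: power_mult_distrib mult_ac flip: power_mult power_add)
  finally show ?thesis unfolding nome_of_upper_half_plane(3) .
qed

lemma f_432_2_c_a_eq:
  "f_432_2_c_a \<tau> = q * (qpoch (q ^ 12) (q ^ 12) ^ 5 / qpoch (q ^ 36) (q ^ 36))
     - 3 * (\<i> * of_real (sqrt 3)) * (q ^ 7 * (qpoch (q ^ 36) (q ^ 36) ^ 5 / qpoch (q ^ 12) (q ^ 12)))"
proof -
  have "f_432_2_c_a \<tau> = dedekind_eta (of_nat 12 * \<tau>) ^ 5 / dedekind_eta (of_nat 36 * \<tau>)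
      - 3 * (\<i> * of_real (sqrt 3)) * (dedekind_eta (of_nat 36 * \<tau>) ^ 5 / dedekind_eta (of_nat 12 * \<tau>))"
  proof -
    have fl: "\<lfloor>12 * (1/12) - 2 :: rat\<rfloor> = - 1" "\<lfloor>- 12 * (1/12) + 6 :: rat\<rfloor> = 5"
      "\<lfloor>12 * (7/12) - 2 :: rat\<rfloor> = 5" "\<lfloor>- 12 * (7/12) + 6 :: rat\<rfloor> = - 1" by linarith+
    have a: "3 * (of_nat 12 * \<tau>) = of_nat 36 * \<tau>" "12 * \<tau> = of_nat 12 * \<tau>" by simp_all
    have p: "z powi (- 1) = inverse z" "z powi 5 = z ^ 5" for z :: complex
      by (simp_all add: power_int_minus)
    have "f_432_2_c_a \<tau> = inverse (dedekind_eta (of_nat 36 * \<tau>)) * dedekind_eta (of_nat 12 * \<tau>) ^ 5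
      - 3 * (\<i> * of_real (sqrt 3)) * (dedekind_eta (of_nat 36 * \<tau>) ^ 5 * inverse (dedekind_eta (of_nat 12 * \<tau>)))"
      unfolding f_432_2_c_a_def K5_def fl a p ..
    then show ?thesis by (simp only: divide_inverse mult.commute)
  qed
  also have "dedekind_eta (of_nat 12 * \<tau>) ^ 5 / dedekind_eta (of_nat 36 * \<tau>)
      = x ^ 24 * (qpoch (q ^ 12) (q ^ 12) ^ 5 / qpoch (q ^ 36) (q ^ 36))"
  proof -
    have e: "(x ^ 12) ^ 5 = x ^ 36 * x ^ 24" by (simp flip: power_add power_mult)
    have "(x ^ 36 * r * c) / (x ^ 36 * b) = r * (c / b)" for r c b
      using nome_of_upper_half_plane(4) by simp
    then have "(x ^ 12 * a) ^ 5 / (x ^ 36 * b) = x ^ 24 * (a ^ 5 / b)" for a b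
      unfolding power_mult_distrib e .
    then show ?thesis
      unfolding dedekind_eta_eq_qpoch q_def[symmetric] x_def[symmetric] .
  qed
  also have "dedekind_eta (of_nat 36 * \<tau>) ^ 5 / dedekind_eta (of_nat 12 * \<tau>)
      = (x ^ 24) ^ 7 * (qpoch (q ^ 36) (q ^ 36) ^ 5 / qpoch (q ^ 12) (q ^ 12))"
  proof -
    have e: "(x ^ 36) ^ 5 = x ^ 12 * (x ^ 24) ^ 7" by (simp flip: power_add power_mult)
    have "(x ^ 12 * r * c) / (x ^ 12 * b) = r * (c / b)" for r c b
      using nome_of_upper_half_plane(4) by simp
    then have "(x ^ 36 * a) ^ 5 / (x ^ 12 * b) = (x ^ 24) ^ 7 * (a ^ 5 / b)" for a b
      unfolding power_mult_distrib e .
    then show ?thesis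
      unfolding dedekind_eta_eq_qpoch q_def[symmetric] x_def[symmetric] .
  qed
  finally show ?thesis unfolding nome_of_upper_half_plane(3) .
qed

end

text \<open>The norm of \<open>(u + v sqrt (- 3)) / 2\<close>. In all uses \<open>u\<close> and \<open>v\<close> have the same parity, so the division is exact. Natural numbers
serve as exponents of power series.\<close>

abbreviation nrm :: "int \<Rightarrow> int \<Rightarrow> nat" where "nrm u v \<equiv> nat ((u\<^sup>2 + 3 * v\<^sup>2) div 4)"

lemma finite_nrm: "finite {(u, v). nrm u v = n}"
proof (rule finite_subset)
  show "{(u, v). nrm u v = n} \<subseteq> {- int (4 * n + 4)..int (4 * n + 4)} \<times> {- int (4 * n + 4)..int (4 * n + 4)}"
  proof clarify
    fix u v :: int assume n: "n = nrm u v"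
    have "(u\<^sup>2 + 3 * v\<^sup>2) div 4 = int n" unfolding n by simp
    then have b: "u\<^sup>2 + 3 * v\<^sup>2 < 4 * int n + 4" by linarith
    have self: "\<bar>y\<bar> \<le> y\<^sup>2" for y :: int
      using mult_left_mono[of 1 "\<bar>y\<bar>" "\<bar>y\<bar>"] by (cases "y = 0") (auto simp: power2_eq_square)
    have "u\<^sup>2 \<ge> 0" "v\<^sup>2 \<ge> 0" by auto
    then have "\<bar>u\<bar> \<le> 4 * int n + 4" "\<bar>v\<bar> \<le> 4 * int n + 4" using self[of u] self[of v] b by linarith+
    then show "u \<in> {- int (4 * nrm u v + 4)..int (4 * nrm u v + 4)} \<and> v \<in> {- int (4 * nrm u v + 4)..int (4 * nrm u v + 4)}"
      unfolding n[symmetric] by auto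
  qed
qed auto

lemma finite_nrm_fibre:
  assumes "inj (\<lambda>(j, k). (f j k, g j k))"
  shows "finite {x. (case x of (j, k) \<Rightarrow> nrm (f j k) (g j k)) = n}"
proof -
  have "{x. (case x of (j, k) \<Rightarrow> nrm (f j k) (g j k)) = n} = (\<lambda>(j, k). (f j k, g j k)) -` {(u, v). nrm u v = n}" by auto
  then show ?thesis using finite_vimageI[OF finite_nrm assms] by simp
qed

lemma has_sum_collect_nrm:
  fixes c :: "'a \<Rightarrow> 'b \<Rightarrow> complex"
  assumes s: "((\<lambda>(j, k). c j k * q ^ nrm (f j k) (g j k)) has_sum S) UNIV"
    and inj: "inj (\<lambda>(j, k). (f j k, g j k))"
  shows "(\<lambda>n. (\<Sum>(j, k) | nrm (f j k) (g j k) = n. c j k) * q ^ n) sums S"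
  using has_sum_collect_powers[of "\<lambda>(j, k). c j k" q "\<lambda>(j, k). nrm (f j k) (g j k)" S] s finite_nrm_fibre[OF inj]
  by (simp add: case_prod_unfold)

lemma powi_nrm:
  fixes q :: complex
  assumes "4 * m = u\<^sup>2 + 3 * v\<^sup>2"
  shows "q powi m = q ^ nrm u v"
proof -
  have m: "m = (u\<^sup>2 + 3 * v\<^sup>2) div 4" using assms by simp
  then have "m \<ge> 0" by (simp add: pos_imp_zdiv_nonneg_iff)
  then show ?thesis unfolding m by (simp add: power_int_def)
qed

context
  fixes q :: complex
  assumes q: "norm q < 1" "q \<noteq> 0"
begin

lemma powi_mult_power: "(q ^ m) powi n = q powi (int m * n)"
  by (simp add: power_int_mult)

lemma theta_term_even_power: "theta_term z (q ^ (2 * m)) k = (- z) powi k * q powi (int m * (k * (k - 1)))"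
proof -
  have "int (2 * m) * (k * (k - 1) div 2) = int m * (k * (k - 1))" by simp
  then show ?thesis unfolding theta_term_def powi_mult_power by (simp only:)
qed

text \<open>The exponents \<open>1 + 6 (\<dots>)\<close> of the pentagonal series times the cubed Euler product are completed to \<open>((6 j - 1)\<^sup>2 + 3 (2 k - 1)\<^sup>2) / 4\<close>.\<close>

lemma f_36_series:
  "(\<lambda>n. (\<Sum>(j, k) | nrm (6*j-1) (2*k-1) = n. - ((-1) powi (j + k) * of_int k)) * q ^ n)
     sums (q * qpoch (q ^ 6) (q ^ 6) ^ 4)"
proof -
  have Q: "norm (q ^ 6) < 1" "q ^ 6 \<noteq> 0" "norm ((q ^ 6) ^ 3) < 1" "(q ^ 6) ^ 3 \<noteq> 0"
    using q norm_power_less_1[OF q(1)] by (auto simp flip: power_mult)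
  interpret nome "q ^ 6" "cis (2 * pi / 3)"
    by standard (use Q cis_cube_root in auto)
  have "((\<lambda>x. - q * (case x of (j, k) \<Rightarrow> theta_term (q ^ 6) ((q ^ 6) ^ 3) j * (of_int k * theta_term 1 (q ^ 6) k)))
      has_sum - q * (theta (q ^ 6) ((q ^ 6) ^ 3) * theta' 1 (q ^ 6))) UNIV"
    by (intro has_sum_cmult_right has_sum_theta_theta' Q) auto
  also have "- q * (theta (q ^ 6) ((q ^ 6) ^ 3) * theta' 1 (q ^ 6)) = q * qpoch (q ^ 6) (q ^ 6) ^ 4"
    using eta_1_4_theta by simp
  also have "(\<lambda>x. - q * (case x of (j, k) \<Rightarrow> theta_term (q ^ 6) ((q ^ 6) ^ 3) j * (of_int k * theta_term 1 (q ^ 6) k)))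
      = (\<lambda>(j, k). - ((-1) powi (j + k) * of_int k) * q ^ nrm (6*j-1) (2*k-1))"
  proof (intro ext, clarify)
    fix j k :: int
    have t1: "theta_term (q ^ 6) ((q ^ 6) ^ 3) j = (-1) powi j * q powi (6 * j + 9 * (j * (j - 1)))"
    proof -
      have "(- (q ^ 6)) powi j = (-1) powi j * q powi (6 * j)"
        using power_int_mult_distrib[of "-1" "q ^ 6" j] by (simp add: powi_mult_power)
      then show ?thesis using theta_term_even_power[of "q ^ 6" 9 j] q
        by (simp add: power_int_add flip: power_mult)
    qed
    have t2: "theta_term 1 (q ^ 6) k = (-1) powi k * q powi (3 * (k * (k - 1)))"
      using theta_term_even_power[of 1 3 k] by simp
    have "q powi (1 + (6 * j + 9 * (j * (j - 1))) + 3 * (k * (k - 1))) = q ^ nrm (6*j-1) (2*k-1)"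
      by (rule powi_nrm) (simp add: power2_eq_square algebra_simps)
    then show "- q * (theta_term (q ^ 6) ((q ^ 6) ^ 3) j * (of_int k * theta_term 1 (q ^ 6) k))
        = - ((-1) powi (j + k) * of_int k) * q ^ nrm (6*j-1) (2*k-1)"
      unfolding t1 t2 using q by (simp add: power_int_add mult_ac)
  qed
  finally show ?thesis
    by (rule has_sum_collect_nrm) (auto simp: inj_def)
qed

text \<open>Two double series, one for each of the two products in \<open>eta_1_2_3_2_theta\<close> at \<open>q\<^sup>3\<close>; their exponents are completed to norms.\<close>

lemma f_27_series:
  assumes w: "w\<^sup>2 + w + 1 = 0"
  shows "(\<lambda>n. (1 / (w - 1) * ((\<Sum>(m, l) | nrm (6*l+1) (2*m-1) = n. 2 * of_int m * w powi m)
      + (\<Sum>(m, l) | nrm (6*l+2) (2*m) = n. (2 * of_int m + 1) * w powi (m + 2)))) * q ^ n)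
     sums (q * (qpoch (q ^ 3) (q ^ 3) ^ 2 * qpoch (q ^ 9) (q ^ 9) ^ 2))"
proof -
  note cr = cube_root[OF w]
  have Q: "norm (q ^ 3) < 1" "q ^ 3 \<noteq> 0" "norm ((q ^ 3) ^ m) < 1" "(q ^ 3) ^ m \<noteq> 0" if "m > 0" for m
    using q norm_power_less_1[OF q(1)] that by (auto simp flip: power_mult)
  interpret nome "q ^ 3" w by standard (use Q[of 1] w in auto)
  have th6: "theta_term (- ((q ^ 3) ^ n)) ((q ^ 3) ^ 6) l = q powi (3 * int n * l + 9 * (l * (l - 1)))" for n l
    using theta_term_even_power[of "- ((q ^ 3) ^ n)" 9 l] q
    by (simp add: power_int_add powi_mult_power flip: power_mult)
  have th2: "theta_term (- w) ((q ^ 3)\<^sup>2) m = w powi m * q powi (3 * (m * m - m))"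
      "theta_term (- (w * q ^ 3)) ((q ^ 3)\<^sup>2) m = w powi m * q powi (3 * (m * m))" for m
    using theta_term_square[of "q ^ 3" w m] q by (simp_all add: powi_mult_power)
  have nz: "- w \<noteq> 0" "- (w * q ^ 3) \<noteq> 0" "- ((q ^ 3) ^ n) \<noteq> 0" for n using cr(3) q by auto
  have 1: "(\<lambda>n. (\<Sum>(m, l) | nrm (6*l+1) (2*m-1) = n. 2 * of_int m * w powi m) * q ^ n)
     sums (q * (2 * (theta' (- w) ((q ^ 3)\<^sup>2) * theta (- ((q ^ 3) ^ 4)) ((q ^ 3) ^ 6))))"
  proof -
    have "((\<lambda>x. q * (2 * (case x of (m, l) \<Rightarrow> of_int m * theta_term (- w) ((q ^ 3)\<^sup>2) m * theta_term (- ((q ^ 3) ^ 4)) ((q ^ 3) ^ 6) l)))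
      has_sum q * (2 * (theta' (- w) ((q ^ 3)\<^sup>2) * theta (- ((q ^ 3) ^ 4)) ((q ^ 3) ^ 6)))) UNIV"
      by (intro has_sum_cmult_right has_sum_theta'_theta Q nz) auto
    also have "(\<lambda>x. q * (2 * (case x of (m, l) \<Rightarrow> of_int m * theta_term (- w) ((q ^ 3)\<^sup>2) m * theta_term (- ((q ^ 3) ^ 4)) ((q ^ 3) ^ 6) l)))
      = (\<lambda>(m, l). 2 * of_int m * w powi m * q ^ nrm (6*l+1) (2*m-1))"
    proof (intro ext, clarify)
      fix m l :: int
      have "q powi (1 + 3 * (m * m - m) + (3 * int 4 * l + 9 * (l * (l - 1)))) = q ^ nrm (6*l+1) (2*m-1)"
        by (rule powi_nrm) (simp add: power2_eq_square algebra_simps)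
      then have pw: "q * (q powi (3 * (m * m - m)) * q powi (3 * int 4 * l + 9 * (l * (l - 1)))) = q ^ nrm (6*l+1) (2*m-1)"
        using q by (simp add: power_int_add mult_ac)
      show "q * (2 * (of_int m * theta_term (- w) ((q ^ 3)\<^sup>2) m * theta_term (- ((q ^ 3) ^ 4)) ((q ^ 3) ^ 6) l))
         = 2 * of_int m * w powi m * q ^ nrm (6*l+1) (2*m-1)"
        unfolding th2 th6 pw[symmetric] by (simp only: mult_ac)
    qed
    finally show ?thesis
      by (rule has_sum_collect_nrm) (auto simp: inj_def)
  qed
  have 2: "(\<lambda>n. (\<Sum>(m, l) | nrm (6*l+2) (2*m) = n. (2 * of_int m + 1) * w powi (m + 2)) * q ^ n)
     sums (q * (w\<^sup>2 * (2 * (theta' (- (w * q ^ 3)) ((q ^ 3)\<^sup>2) * theta (- ((q ^ 3) ^ 5)) ((q ^ 3) ^ 6))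
        + theta (- (w * q ^ 3)) ((q ^ 3)\<^sup>2) * theta (- ((q ^ 3) ^ 5)) ((q ^ 3) ^ 6))))"
  proof -
    let ?t = "theta_term (- (w * q ^ 3)) ((q ^ 3)\<^sup>2)" and ?t5 = "theta_term (- ((q ^ 3) ^ 5)) ((q ^ 3) ^ 6)"
    have "((\<lambda>x. q * (w\<^sup>2 * (2 * (case x of (m, l) \<Rightarrow> of_int m * ?t m * ?t5 l) + (case x of (m, l) \<Rightarrow> ?t m * ?t5 l))))
      has_sum q * (w\<^sup>2 * (2 * (theta' (- (w * q ^ 3)) ((q ^ 3)\<^sup>2) * theta (- ((q ^ 3) ^ 5)) ((q ^ 3) ^ 6))
        + theta (- (w * q ^ 3)) ((q ^ 3)\<^sup>2) * theta (- ((q ^ 3) ^ 5)) ((q ^ 3) ^ 6)))) UNIV"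
      by (intro has_sum_cmult_right has_sum_add has_sum_theta'_theta has_sum_theta_theta Q nz) auto
    also have "(\<lambda>x. q * (w\<^sup>2 * (2 * (case x of (m, l) \<Rightarrow> of_int m * ?t m * ?t5 l) + (case x of (m, l) \<Rightarrow> ?t m * ?t5 l))))
      = (\<lambda>(m, l). (2 * of_int m + 1) * w powi (m + 2) * q ^ nrm (6*l+2) (2*m))"
    proof (intro ext, clarify)
      fix m l :: int
      have "q powi (1 + 3 * (m * m) + (3 * int 5 * l + 9 * (l * (l - 1)))) = q ^ nrm (6*l+2) (2*m)"
        by (rule powi_nrm) (simp add: power2_eq_square algebra_simps)
      then have pw: "q * (q powi (3 * (m * m)) * q powi (3 * int 5 * l + 9 * (l * (l - 1)))) = q ^ nrm (6*l+2) (2*m)"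
        using q by (simp add: power_int_add mult_ac)
      have "w powi (m + 2) = w\<^sup>2 * w powi m" using cr(3) by (simp add: power_int_add)
      then show "q * (w\<^sup>2 * (2 * (of_int m * ?t m * ?t5 l) + ?t m * ?t5 l))
         = (2 * of_int m + 1) * w powi (m + 2) * q ^ nrm (6*l+2) (2*m)"
        unfolding th2 th6 pw[symmetric] by (simp only: ring_distribs mult_ac mult_1_left)
    qed
    finally show ?thesis
      by (rule has_sum_collect_nrm) (auto simp: inj_def)
  qed
  define T1 T2 where "T1 = 2 * (theta' (- w) ((q ^ 3)\<^sup>2) * theta (- ((q ^ 3) ^ 4)) ((q ^ 3) ^ 6))"
    and "T2 = w\<^sup>2 * (2 * (theta' (- (w * q ^ 3)) ((q ^ 3)\<^sup>2) * theta (- ((q ^ 3) ^ 5)) ((q ^ 3) ^ 6))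
        + theta (- (w * q ^ 3)) ((q ^ 3)\<^sup>2) * theta (- ((q ^ 3) ^ 5)) ((q ^ 3) ^ 6))"
  have "T1 + T2 = (w - 1) * (qpoch (q ^ 3) (q ^ 3) ^ 2 * qpoch (q ^ 9) (q ^ 9) ^ 2)"
    using eta_1_2_3_2_theta unfolding T1_def T2_def by (simp add: algebra_simps flip: power_mult)
  then have "1 / (w - 1) * (q * T1 + q * T2) = q * (qpoch (q ^ 3) (q ^ 3) ^ 2 * qpoch (q ^ 9) (q ^ 9) ^ 2)"
    using cr(4) by (simp flip: distrib_left)
  moreover note sums_mult[OF sums_add[OF 1[folded T1_def] 2[folded T2_def]], of "1 / (w - 1)"]
  ultimately show ?thesis by (simp only: distrib_right[symmetric] mult.assoc[symmetric])
qed

text \<open>The weights \<open>6 k + 1\<close> and \<open>2 l\<close> come from the two derivative terms in \<open>eta_1_5_3_theta\<close> at \<open>q\<^sup>1\<^sup>2\<close>; they are the entries of the norm in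
the exponent.\<close>

lemma f_432_series:
  assumes w: "w\<^sup>2 + w + 1 = 0"
  shows "(\<lambda>n. (\<Sum>(k, l) | nrm (2 * (6*k+1)) (2 * (2*l)) = n.
       (-1) powi (k + l) * w powi (2*l) * (of_int (6*k+1) + of_int (2*l) * (w - w\<^sup>2))) * q ^ n)
     sums (q * (qpoch (q ^ 12) (q ^ 12) ^ 5 / qpoch (q ^ 36) (q ^ 36)))"
proof -
  note cr = cube_root[OF w]
  have Q: "norm (q ^ 12) < 1" "q ^ 12 \<noteq> 0" "norm ((q ^ 12) ^ m) < 1" "(q ^ 12) ^ m \<noteq> 0" if "m > 0" for m
    using q norm_power_less_1[OF q(1)] that by (auto simp flip: power_mult)
  interpret nome "q ^ 12" w by standard (use Q[of 1] w in auto)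
  let ?a = "theta_term ((q ^ 12) ^ 4) ((q ^ 12) ^ 6)" and ?b = "theta_term (w\<^sup>2 * q ^ 12) ((q ^ 12)\<^sup>2)"
  have a: "?a k = (-1) powi k * q powi (48 * k + 36 * (k * (k - 1)))" for k
  proof -
    have "(- (q ^ 48)) powi k = (-1) powi k * q powi (48 * k)"
      using power_int_mult_distrib[of "-1" "q ^ 48" k] by (simp add: powi_mult_power)
    then show ?thesis
      using theta_term_even_power[of "q ^ 48" 36 k] q by (simp add: power_int_add flip: power_mult)
  qed
  have b: "?b l = (-1) powi l * w powi (2 * l) * q powi (12 * (l * l))" for l
  proof -
    have "(- (w\<^sup>2)) powi l = (-1) powi l * w powi (2 * l)"
      using power_int_mult_distrib[of "-1" "w\<^sup>2" l] by (simp add: power_int_mult)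
    then show ?thesis
      using theta_term_square(1)[of "q ^ 12" "- (w\<^sup>2)" l] q by (simp add: powi_mult_power)
  qed
  have nz: "(q ^ 12) ^ 4 \<noteq> 0" "w\<^sup>2 * q ^ 12 \<noteq> 0" using cr(3) q by auto
  let ?A = "theta ((q ^ 12) ^ 4) ((q ^ 12) ^ 6)" and ?A' = "theta' ((q ^ 12) ^ 4) ((q ^ 12) ^ 6)"
  let ?B = "theta (w\<^sup>2 * q ^ 12) ((q ^ 12)\<^sup>2)" and ?B' = "theta' (w\<^sup>2 * q ^ 12) ((q ^ 12)\<^sup>2)"
  have "((\<lambda>x. q * (6 * (case x of (k, l) \<Rightarrow> of_int k * ?a k * ?b l) + (case x of (k, l) \<Rightarrow> ?a k * ?b l)
        + 2 * (w - w\<^sup>2) * (case x of (k, l) \<Rightarrow> ?a k * (of_int l * ?b l))))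
      has_sum q * (6 * (?A' * ?B) + ?A * ?B + 2 * (w - w\<^sup>2) * (?A * ?B'))) UNIV"
    by (intro has_sum_cmult_right has_sum_add has_sum_theta'_theta has_sum_theta_theta has_sum_theta_theta' Q nz) auto
  also have "6 * (?A' * ?B) + ?A * ?B + 2 * (w - w\<^sup>2) * (?A * ?B') = qpoch (q ^ 12) (q ^ 12) ^ 5 / qpoch (q ^ 36) (q ^ 36)"
    using eta_1_5_3_theta by (simp add: algebra_simps flip: power_mult)
  also have "(\<lambda>x. q * (6 * (case x of (k, l) \<Rightarrow> of_int k * ?a k * ?b l) + (case x of (k, l) \<Rightarrow> ?a k * ?b l)
        + 2 * (w - w\<^sup>2) * (case x of (k, l) \<Rightarrow> ?a k * (of_int l * ?b l))))
    = (\<lambda>(k, l). (-1) powi (k + l) * w powi (2*l) * (of_int (6*k+1) + of_int (2*l) * (w - w\<^sup>2)) * q ^ nrm (2 * (6*k+1)) (2 * (2*l)))"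
  proof (intro ext, clarify)
    fix k l :: int
    have "q powi (1 + (48 * k + 36 * (k * (k - 1))) + 12 * (l * l)) = q ^ nrm (2 * (6*k+1)) (2 * (2*l))"
      by (rule powi_nrm) (simp add: power2_eq_square algebra_simps)
    then have pw: "q * (q powi (48 * k + 36 * (k * (k - 1))) * q powi (12 * (l * l))) = q ^ nrm (2 * (6*k+1)) (2 * (2*l))"
      using q by (simp add: power_int_add mult_ac)
    have s: "(-1 :: complex) powi (k + l) = (-1) powi k * (-1) powi l" by (simp add: power_int_add)
    have "q * (6 * (K * (x * X) * (y * v * Y)) + x * X * (y * v * Y) + 2 * (w - w\<^sup>2) * (x * X * (L * (y * v * Y))))
       = x * y * v * ((6 * K + 1) + 2 * L * (w - w\<^sup>2)) * (q * (X * Y))" for K L x X y v Y :: complex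
      by (simp add: algebra_simps)
    then show "q * (6 * (of_int k * ?a k * ?b l) + ?a k * ?b l + 2 * (w - w\<^sup>2) * (?a k * (of_int l * ?b l)))
       = (-1) powi (k + l) * w powi (2*l) * (of_int (6*k+1) + of_int (2*l) * (w - w\<^sup>2)) * q ^ nrm (2 * (6*k+1)) (2 * (2*l))"
      unfolding a b pw[symmetric] s by simp
  qed
  finally show ?thesis by (rule has_sum_collect_nrm) (auto simp: inj_def)
qed

end

text \<open>By the pentagonal number theorem the function is given on the whole disc by a single power series.\<close>

lemma euler_product_holomorphic: "(\<lambda>x. qpoch x x) holomorphic_on ball 0 1"
proof (rule power_series_holomorphic)
  fix x :: complex assume "x \<in> ball 0 1"
  then have x: "norm x < 1" by simp
  let ?e = "\<lambda>k::int. nat (k * (3 * k - 1) div 2)"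
  have ev: "2 * (k * (3 * k - 1) div 2) = k * (3 * k - 1)" for k :: int by simp
  have pos: "k * (3 * k - 1) \<ge> \<bar>k\<bar>" for k :: int
  proof (cases "k \<ge> 1")
    case True then show ?thesis using mult_left_mono[of 1 "3*k-1" k] by auto
  next
    case False
    then show ?thesis using mult_left_mono[of 1 "1-3*k" "-k"] by (auto simp: algebra_simps)
  qed
  have fin: "finite {k. ?e k = n}" for n
  proof (rule finite_subset)
    show "{k. ?e k = n} \<subseteq> {- int (2 * n)..int (2 * n)}"
    proof
      fix k assume "k \<in> {k. ?e k = n}"
      then have "k * (3 * k - 1) div 2 \<le> int n" by auto
      then have "k * (3 * k - 1) \<le> 2 * int n" using ev[of k] by linarith
      then show "k \<in> {- int (2 * n)..int (2 * n)}" using pos[of k] by auto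
    qed
  qed auto
  show "(\<lambda>n. (\<Sum>k | ?e k = n. (-1) powi k) * (x - 0) ^ n) sums qpoch x x"
  proof (cases "x = 0")
    case True
    have "{k. ?e k = 0} = {0}"
    proof -
      have "?e k = 0 \<longleftrightarrow> k = 0" for k
      proof
        assume "?e k = 0"
        then have "k * (3 * k - 1) div 2 \<le> 0" by simp
        then have "k * (3 * k - 1) \<le> 0" using ev[of k] by linarith
        then show "k = 0" using pos[of k] by linarith
      qed simp
      then show ?thesis by simp
    qed
    moreover have "qpoch 0 0 = 1" using qpoch_rec[of 0 0] by (simp add: qpoch_def)
    ultimately show ?thesis
      using powser_sums_zero[of "\<lambda>n. \<Sum>k | ?e k = n. (-1) powi k :: complex"] True by simp
  next
    case False
    have x3: "norm (x ^ 3) < 1" "x ^ 3 \<noteq> 0" using norm_power_less_1[OF x] False by auto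
    have "x ^ 3 / x = x\<^sup>2" using False by (simp add: power2_eq_square power3_eq_cube)
    then have th: "theta x (x ^ 3) = qpoch x x"
      using Jacobi_triple_product[OF x3 False] qpoch_dissect3[OF x, of x]
      by (simp add: mult_ac power2_eq_square power3_eq_cube)
    have "theta_term x (x ^ 3) k = (-1) powi k * x ^ ?e k" for k
    proof -
      have "(- x) powi k = (-1) powi k * x powi k"
        using power_int_mult_distrib[of "-1" x k] by simp
      moreover have "(x ^ 3) powi (k * (k - 1) div 2) = x powi (3 * (k * (k - 1) div 2))"
        by (simp add: power_int_mult)
      moreover have "k + 3 * (k * (k - 1) div 2) = k * (3 * k - 1) div 2"
      proof -
        have h: "2 * (k * (k - 1) div 2) = k * (k - 1)" by simp
        have "2 * (k + 3 * (k * (k - 1) div 2)) = 2 * k + 3 * (2 * (k * (k - 1) div 2))" by simp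
        also have "\<dots> = k * (3 * k - 1)" unfolding h by (simp add: algebra_simps)
        finally have "2 * (k + 3 * (k * (k - 1) div 2)) = k * (3 * k - 1)" .
        then show ?thesis by (metis nonzero_mult_div_cancel_left zero_neq_numeral)
      qed
      moreover have "k * (3 * k - 1) div 2 \<ge> 0" using pos[of k] by (simp add: pos_imp_zdiv_nonneg_iff)
      moreover have "x powi k * x powi (3 * (k * (k - 1) div 2)) = x powi (k + 3 * (k * (k - 1) div 2))"
        using False by (simp add: power_int_add)
      ultimately show ?thesis unfolding theta_term_def by (simp add: power_int_def mult.assoc)
    qed
    then have "theta_term x (x ^ 3) = (\<lambda>k. (-1) powi k * x ^ ?e k)" by (rule ext)
    then have "((\<lambda>k. (-1) powi k * x ^ ?e k) has_sum qpoch x x) UNIV"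
      using has_sum_theta[OF False x3(2,1)] unfolding th by metis
    from has_sum_collect_powers[OF this fin] show ?thesis by simp
  qed
qed

text \<open>Only the existence of an expansion matters: this part of the form contributes to exponents that are \<open>7\<close> modulo \<open>12\<close>.\<close>

lemma eta_quotient_5_1_power_series:
  obtains b where "\<And>x. norm x < 1 \<Longrightarrow> (\<lambda>n. b n * x ^ n) sums (qpoch (x ^ 3) (x ^ 3) ^ 5 / qpoch x x)"
proof -
  have "(\<lambda>x. qpoch x x) \<circ> (\<lambda>x. x ^ 3) holomorphic_on ball 0 1"
    by (intro holomorphic_on_compose_gen[OF _ euler_product_holomorphic] holomorphic_intros)
      (auto simp: norm_power_less_1)
  then have "(\<lambda>x. qpoch (x ^ 3) (x ^ 3) ^ 5 / qpoch x x) holomorphic_on ball 0 1"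
    unfolding o_def
    by (intro holomorphic_intros euler_product_holomorphic) (use qpoch_nonzero_small in auto)
  note series = holomorphic_power_series[OF this]
  show ?thesis
  proof (rule that)
    fix x :: complex assume "norm x < 1"
    then show "(\<lambda>n. (deriv ^^ n) (\<lambda>x. qpoch (x ^ 3) (x ^ 3) ^ 5 / qpoch x x) 0 / fact n * x ^ n)
      sums (qpoch (x ^ 3) (x ^ 3) ^ 5 / qpoch x x)"
      using series[of x] by simp
  qed
qed

lemma fourier_coeff_f_36:
  "fourier_coeff f_36_2_a_a n = (\<Sum>(j, k) | nrm (6*j-1) (2*k-1) = n. - ((-1) powi (j + k) * of_int k))"
proof -
  have "fourier_coeff f_36_2_a_a = (\<lambda>n. \<Sum>(j, k) | nrm (6*j-1) (2*k-1) = n. - ((-1) powi (j + k) * of_int k))"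
    by (rule fourier_coeff_eqI, subst f_36_2_a_a_eq, assumption, rule f_36_series)
      (use nome_of_upper_half_plane in auto)
  then show ?thesis by simp
qed

lemma fourier_coeff_f_27:
  assumes w: "w\<^sup>2 + w + 1 = 0"
  shows "fourier_coeff f_27_2_a_a n = 1 / (w - 1) * ((\<Sum>(m, l) | nrm (6*l+1) (2*m-1) = n. 2 * of_int m * w powi m)
      + (\<Sum>(m, l) | nrm (6*l+2) (2*m) = n. (2 * of_int m + 1) * w powi (m + 2)))"
proof -
  have "fourier_coeff f_27_2_a_a = (\<lambda>n. 1 / (w - 1) * ((\<Sum>(m, l) | nrm (6*l+1) (2*m-1) = n. 2 * of_int m * w powi m)
      + (\<Sum>(m, l) | nrm (6*l+2) (2*m) = n. (2 * of_int m + 1) * w powi (m + 2))))"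
    by (rule fourier_coeff_eqI, subst f_27_2_a_a_eq, assumption, rule f_27_series[OF _ _ w])
      (use nome_of_upper_half_plane in auto)
  then show ?thesis by simp
qed

text \<open>The second summand of the form has all its exponents congruent to \<open>7\<close> modulo \<open>12\<close>, so the first one determines the
coefficient.\<close>

lemma fourier_coeff_f_432:
  assumes w: "w\<^sup>2 + w + 1 = 0" and n: "n mod 12 = 1"
  shows "fourier_coeff f_432_2_c_a n = (\<Sum>(k, l) | nrm (2 * (6*k+1)) (2 * (2*l)) = n.
       (-1) powi (k + l) * w powi (2*l) * (of_int (6*k+1) + of_int (2*l) * (w - w\<^sup>2)))"
proof -
  define c where "c = (\<lambda>n. \<Sum>(k, l) | nrm (2 * (6*k+1)) (2 * (2*l)) = n.
       (-1) powi (k + l) * w powi (2*l) * (of_int (6*k+1) + of_int (2*l) * (w - w\<^sup>2)))"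
  obtain b where b: "\<And>x. norm x < 1 \<Longrightarrow> (\<lambda>n. b n * x ^ n) sums (qpoch (x ^ 3) (x ^ 3) ^ 5 / qpoch x x)"
    using eta_quotient_5_1_power_series by blast
  define d where "d = (\<lambda>n::nat. if n mod 12 = 7 then b (n div 12) else 0)"
  define s where "s = 3 * (\<i> * complex_of_real (sqrt 3))"
  have ds: "(\<lambda>n. d n * q ^ n) sums (q ^ 7 * (qpoch (q ^ 36) (q ^ 36) ^ 5 / qpoch (q ^ 12) (q ^ 12)))"
    if q: "norm q < 1" for q :: complex
  proof -
    have "(\<lambda>n. q ^ 7 * (b n * (q ^ 12) ^ n)) sums (q ^ 7 * (qpoch (q ^ 36) (q ^ 36) ^ 5 / qpoch (q ^ 12) (q ^ 12)))"
      using sums_mult[OF b[OF norm_power_less_1[OF q, of 12]], of "q ^ 7"] by (simp flip: power_mult)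
    also have "(\<lambda>n. q ^ 7 * (b n * (q ^ 12) ^ n)) = (\<lambda>n. d (12 * n + 7) * q ^ (12 * n + 7))"
      by (auto simp: d_def fun_eq_iff power_add power_mult)
    finally show ?thesis
    proof (subst (asm) sums_mono_reindex[of "\<lambda>n. 12 * n + 7"])
      fix n assume n: "n \<notin> range (\<lambda>n::nat. 12 * n + 7)"
      have "n mod 12 \<noteq> 7"
      proof
        assume "n mod 12 = 7"
        then have "n = 12 * (n div 12) + 7" by presburger
        then show False using n by blast
      qed
      then show "d n * q ^ n = 0" by (simp add: d_def)
    qed (auto simp: strict_mono_def)
  qed
  have "fourier_coeff f_432_2_c_a = (\<lambda>n. c n - s * d n)"
  proof (rule fourier_coeff_eqI)
    fix \<tau> :: complex assume tau: "Im \<tau> > 0"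
    define q where "q = exp (2 * of_real pi * \<i> * \<tau>)"
    have q: "norm q < 1" "q \<noteq> 0" using nome_of_upper_half_plane[OF tau] by (auto simp: q_def)
    from sums_diff[OF f_432_series[OF q w] sums_mult[OF ds[OF q(1)], of s]]
    show "(\<lambda>n. (c n - s * d n) * exp (2 * of_real pi * \<i> * \<tau>) ^ n) sums f_432_2_c_a \<tau>"
      unfolding f_432_2_c_a_eq[OF tau] q_def[symmetric] c_def[symmetric] s_def[symmetric]
      by (simp add: left_diff_distrib mult.assoc c_def)
  qed
  then show ?thesis using n by (simp add: c_def d_def)
qed

section \<open>Fourier coefficients at primes\<close>

lemma sum_three_squares_four:
  fixes s t :: int
  assumes "s\<^sup>2 + 3 * t\<^sup>2 = 4"
  shows "t = 0 \<and> (s = 2 \<or> s = - 2) \<or> (t = 1 \<or> t = - 1) \<and> (s = 1 \<or> s = - 1)"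
proof -
  have "t\<^sup>2 \<le> 1" using assms zero_le_power2[of s] by linarith
  then have "\<bar>t\<bar> \<le> 1" using abs_le_square_iff[of t 1] by simp
  then consider "t = 0" | "t = 1 \<or> t = - 1" by linarith
  then show ?thesis
  proof cases
    case 1
    then have "s\<^sup>2 = 2\<^sup>2" using assms by simp
    then show ?thesis using 1 by (simp only: power2_eq_iff) auto
  next
    case 2
    then have "s\<^sup>2 = 1\<^sup>2" using assms by auto
    then show ?thesis using 2 by (simp only: power2_eq_iff) auto
  qed
qed

text \<open>The quotient of two elements of norm \<open>p\<close> in the ring of Eisenstein integers is a unit once \<open>p\<close> divides the cross term; here
\<open>(s + t sqrt (- 3)) / 2\<close> is that unit.\<close>

lemma four_p_representation_aux:
  fixes a b u v :: int
  assumes p: "prime p" "odd p" and ab: "a\<^sup>2 + 3 * b\<^sup>2 = 4 * int p" and uv: "u\<^sup>2 + 3 * v\<^sup>2 = 4 * int p"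
    and dvd: "int p dvd u * b - v * a"
  shows "\<exists>s t. s\<^sup>2 + 3 * t\<^sup>2 = 4 \<and> 2 * u = a * s + 3 * b * t \<and> 2 * v = b * s - a * t"
proof -
  have p0: "int p > 0" using p(1) by (simp add: prime_gt_0_nat)
  have par: "even (x + y)" if "x\<^sup>2 + 3 * y\<^sup>2 = 4 * int p" for x y :: int
  proof -
    have "even (x\<^sup>2 + 3 * y\<^sup>2)" unfolding that by simp
    then show ?thesis by (simp add: even_add)
  qed
  have "even (u * b - v * a)" using par[OF ab] par[OF uv] by (auto simp: even_add)
  moreover have "coprime 2 (int p)" using p by simp
  ultimately have "2 * int p dvd u * b - v * a" using dvd by (simp add: divides_mult)
  then obtain t where t: "u * b - v * a = 2 * int p * t" by (auto elim!: dvdE)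
  define X where "X = u * a + 3 * v * b"
  have "X\<^sup>2 + 3 * (u * b - v * a)\<^sup>2 = (a\<^sup>2 + 3 * b\<^sup>2) * (u\<^sup>2 + 3 * v\<^sup>2)"
    unfolding X_def by (simp add: power2_eq_square algebra_simps)
  then have X: "X\<^sup>2 + 3 * (2 * int p * t)\<^sup>2 = 16 * (int p)\<^sup>2"
    unfolding ab uv t by (simp add: power2_eq_square)
  then have X2: "X\<^sup>2 = (2 * int p)\<^sup>2 * (4 - 3 * t\<^sup>2)" by (simp add: power2_eq_square algebra_simps)
  have "(2 * int p)\<^sup>2 > 0" using p0 by simp
  moreover have "(2 * int p)\<^sup>2 * (4 - 3 * t\<^sup>2) \<ge> 0" unfolding X2[symmetric] by simp
  ultimately have "4 - 3 * t\<^sup>2 \<ge> 0" by (simp add: zero_le_mult_iff)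
  then have "t\<^sup>2 \<le> 1" by linarith
  then have "\<bar>t\<bar> \<le> 1" using abs_le_square_iff[of t 1] by simp
  then have tt: "t = 0 \<or> t = 1 \<or> t = - 1" by linarith
  have "\<exists>s. X = 2 * int p * s \<and> s\<^sup>2 + 3 * t\<^sup>2 = 4"
  proof (cases "t = 0")
    case True
    then have "X\<^sup>2 = (2 * int p * 2)\<^sup>2" unfolding X2 by (simp add: power2_eq_square)
    then have "X = 2 * int p * 2 \<or> X = 2 * int p * (- 2)" by (simp only: power2_eq_iff) auto
    then obtain s where "X = 2 * int p * s" "s = 2 \<or> s = - 2" by blast
    then show ?thesis using True by (intro exI[of _ s]) auto
  next
    case False
    then have t1: "t\<^sup>2 = 1" using tt by auto
    then have "X\<^sup>2 = (2 * int p * 1)\<^sup>2" unfolding X2 by simp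
    then have "X = 2 * int p * 1 \<or> X = 2 * int p * (- 1)" by (simp only: power2_eq_iff) auto
    then obtain s where "X = 2 * int p * s" "s = 1 \<or> s = - 1" by blast
    then show ?thesis unfolding t1 by (intro exI[of _ s]) auto
  qed
  then obtain s where s: "X = 2 * int p * s" "s\<^sup>2 + 3 * t\<^sup>2 = 4" by blast
  have "u * (a\<^sup>2 + 3 * b\<^sup>2) = a * X + 3 * b * (u * b - v * a)"
    unfolding X_def by (simp add: power2_eq_square algebra_simps)
  then have "2 * int p * (2 * u) = 2 * int p * (a * s + 3 * b * t)"
    unfolding ab t s(1) by (simp add: algebra_simps)
  then have 1: "2 * u = a * s + 3 * b * t" using p0 by simp
  have "v * (a\<^sup>2 + 3 * b\<^sup>2) = b * X - a * (u * b - v * a)"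
    unfolding X_def by (simp add: power2_eq_square algebra_simps)
  then have "2 * int p * (2 * v) = 2 * int p * (b * s - a * t)"
    unfolding ab t s(1) by (simp add: algebra_simps)
  then have 2: "2 * v = b * s - a * t" using p0 by simp
  show ?thesis using 1 2 s(2) by blast
qed

text \<open>Since \<open>p\<close> is prime it divides one of the two cross terms \<open>u b \<plusminus> v a\<close>; the sign \<open>e\<close> records whether conjugation is needed.\<close>

lemma four_p_representation_unique:
  fixes a b u v :: int
  assumes p: "prime p" "odd p" and ab: "a\<^sup>2 + 3 * b\<^sup>2 = 4 * int p" and uv: "u\<^sup>2 + 3 * v\<^sup>2 = 4 * int p"
  obtains e s t where "e = 1 \<or> e = (- 1 :: int)"
    "t = 0 \<and> (s = 2 \<or> s = - 2) \<or> (t = 1 \<or> t = - 1) \<and> (s = 1 \<or> s = - 1)"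
    "2 * u = a * s + 3 * (e * b) * t" "2 * v = e * b * s - a * t"
proof -
  have "(u * b - v * a) * (u * b + v * a) = u\<^sup>2 * b\<^sup>2 - v\<^sup>2 * a\<^sup>2"
    by (simp add: power2_eq_square algebra_simps)
  also have "\<dots> = (4 * int p - 3 * v\<^sup>2) * b\<^sup>2 - v\<^sup>2 * (4 * int p - 3 * b\<^sup>2)"
    unfolding ab[symmetric] uv[symmetric] by simp (simp add: ab uv algebra_simps)
  also have "\<dots> = int p * (4 * b\<^sup>2 - 4 * v\<^sup>2)" by (simp add: algebra_simps)
  finally have "int p dvd (u * b - v * a) * (u * b + v * a)" by simp
  then have "int p dvd u * b - v * a \<or> int p dvd u * b + v * a"
    using p(1) by (simp add: prime_dvd_mult_iff)
  then show ?thesis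
  proof
    assume "int p dvd u * b - v * a"
    from four_p_representation_aux[OF p ab uv this] obtain s t
      where "s\<^sup>2 + 3 * t\<^sup>2 = 4" "2 * u = a * s + 3 * b * t" "2 * v = b * s - a * t" by blast
    then show ?thesis using sum_three_squares_four by (intro that[of 1 t s]) auto
  next
    assume "int p dvd u * b + v * a"
    moreover have "u * - b - v * a = - (u * b + v * a)" by simp
    ultimately have d: "int p dvd u * - b - v * a" by (simp only: dvd_minus_iff)
    from four_p_representation_aux[OF p _ uv d] ab obtain s t
      where "s\<^sup>2 + 3 * t\<^sup>2 = 4" "2 * u = a * s + 3 * - b * t" "2 * v = - b * s - a * t" by auto
    then show ?thesis using sum_three_squares_four by (intro that[of "-1" t s]) auto
  qed
qed

text \<open>The six units of the Eisenstein integers give three pairs \<open>(\<bar>u\<bar>, \<bar>v\<bar>)\<close>.\<close>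

lemma four_p_representation_cases:
  fixes a b u v :: int
  assumes p: "prime p" "odd p" and ab: "a\<^sup>2 + 3 * b\<^sup>2 = 4 * int p" and uv: "u\<^sup>2 + 3 * v\<^sup>2 = 4 * int p"
  shows "(u = a \<or> u = - a) \<and> (v = b \<or> v = - b)
    \<or> (2 * u = a + 3 * b \<or> 2 * u = - (a + 3 * b)) \<and> (2 * v = a - b \<or> 2 * v = - (a - b))
    \<or> (2 * u = a - 3 * b \<or> 2 * u = - (a - 3 * b)) \<and> (2 * v = a + b \<or> 2 * v = - (a + b))"
proof -
  obtain e s t where st: "e = 1 \<or> e = (- 1 :: int)"
    "t = 0 \<and> (s = 2 \<or> s = - 2) \<or> (t = 1 \<or> t = - 1) \<and> (s = 1 \<or> s = - 1)"
    "2 * u = a * s + 3 * (e * b) * t" "2 * v = e * b * s - a * t"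
    by (rule four_p_representation_unique[OF p ab uv])
  have tri: "t = 0 \<or> e * s * t = 1 \<or> e * s * t = - 1" using st(1,2) by (elim disjE conjE) simp_all
  consider (zero) "t = 0" "s = 2 \<or> s = - 2" | (pos) "t = 1 \<or> t = - 1" "s = 1 \<or> s = - 1" "e * s * t = 1"
      | (neg) "t = 1 \<or> t = - 1" "s = 1 \<or> s = - 1" "e * s * t = - 1"
  proof (cases "t = 0")
    case True
    then have "s = 2 \<or> s = - 2" using st(2) by simp
    with True show ?thesis by (rule zero)
  next
    case False
    then have t: "t = 1 \<or> t = - 1" and s: "s = 1 \<or> s = - 1" using st(2) by blast+
    show ?thesis using tri False pos[OF t s] neg[OF t s] by blast
  qed
  then show ?thesis
  proof cases
    case zero
    then have "u = a \<or> u = - a" "v = b \<or> v = - b" using st by auto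
    then show ?thesis by blast
  next
    case pos
    then have "e = s * t" using st(1) by auto
    then have "2 * u = s * (a + 3 * b)" "2 * v = - t * (a - b)"
      using pos(1,2) st(3,4) by (auto simp: algebra_simps)
    then have "2 * u = a + 3 * b \<or> 2 * u = - (a + 3 * b)" "2 * v = a - b \<or> 2 * v = - (a - b)"
      using pos by auto
    then show ?thesis by blast
  next
    case neg
    then have "e = - (s * t)" using st(1) by auto
    then have "2 * u = s * (a - 3 * b)" "2 * v = - t * (a + b)"
      using neg(1,2) st(3,4) by (auto simp: algebra_simps)
    then have "2 * u = a - 3 * b \<or> 2 * u = - (a - 3 * b)" "2 * v = a + b \<or> 2 * v = - (a + b)"
      using neg by auto
    then show ?thesis by blast
  qed
qed

lemma prime_not_square: "prime p \<Longrightarrow> int p \<noteq> x\<^sup>2"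
proof
  assume p: "prime p" and x: "int p = x\<^sup>2"
  then have "p = (nat \<bar>x\<bar>)\<^sup>2" by (metis nat_int nat_power_eq abs_ge_zero power2_abs)
  then show False using p by (simp add: prime_power_iff)
qed

lemma nrm_eq_iff:
  assumes "even (u + v)"
  shows "nrm u v = p \<longleftrightarrow> u\<^sup>2 + 3 * v\<^sup>2 = 4 * int p"
proof -
  have "4 dvd u\<^sup>2 + 3 * v\<^sup>2"
  proof -
    obtain k where "u + v = 2 * k" using assms by (rule evenE)
    then have u: "u = 2 * k - v" by simp
    have "u\<^sup>2 + 3 * v\<^sup>2 = 4 * (k\<^sup>2 - k * v + v\<^sup>2)" unfolding u by (simp add: power2_eq_square algebra_simps)
    then show ?thesis by simp
  qed
  then obtain m where m: "u\<^sup>2 + 3 * v\<^sup>2 = 4 * m" by (auto elim: dvdE)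
  moreover have "u\<^sup>2 + 3 * v\<^sup>2 \<ge> 0" by simp
  ultimately show ?thesis by auto
qed

text \<open>Of the solutions of \<open>u\<^sup>2 + 3 v\<^sup>2 = 4 p\<close> exactly four have \<open>u \<equiv> -1\<close> modulo \<open>6\<close>, namely those with \<open>u, v\<close> odd and the right sign
of \<open>u\<close>; their contributions are added.\<close>

theorem coeff_f_36:
  fixes a b :: int
  assumes p: "prime p" "odd p" and ab: "int p = (3 * a + 3 * b + 1)\<^sup>2 + 3 * (a - b)\<^sup>2"
  shows "fourier_coeff f_36_2_a_a p = 2 * of_int (3 * a + 3 * b + 1)"
proof -
  have ne: "a \<noteq> b" using prime_not_square[OF p(1), of "6 * b + 1"] ab by auto
  have base: "(2 * (3 * a + 3 * b + 1))\<^sup>2 + 3 * (2 * (a - b))\<^sup>2 = 4 * int p"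
    unfolding ab by (simp add: power2_eq_square algebra_simps)
  have S: "{(j, k). nrm (6*j-1) (2*k-1) = p}
     = {(- a, a + 2 * b + 1), (- a, - (a + 2 * b)), (- b, 2 * a + b + 1), (- b, - (2 * a + b))}" (is "?S = ?T")
  proof (intro equalityI subsetI)
    fix x assume "x \<in> ?S"
    then obtain j k where x: "x = (j, k)" and "nrm (6*j-1) (2*k-1) = p" by auto
    then have "(6*j-1)\<^sup>2 + 3 * (2*k-1)\<^sup>2 = 4 * int p" by (subst (asm) nrm_eq_iff) auto
    from four_p_representation_cases[OF p base this] show "x \<in> ?T"
    proof (elim disjE[of "_ \<and> _"] conjE)
      assume "6*j-1 = 2 * (3 * a + 3 * b + 1) \<or> 6*j-1 = - (2 * (3 * a + 3 * b + 1))"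
      then have False by presburger
      then show ?thesis ..
    next
      assume u: "2 * (6*j-1) = 2 * (3 * a + 3 * b + 1) + 3 * (2 * (a - b)) \<or> 2 * (6*j-1) = - (2 * (3 * a + 3 * b + 1) + 3 * (2 * (a - b)))"
        and v: "2 * (2*k-1) = 2 * (3 * a + 3 * b + 1) - 2 * (a - b) \<or> 2 * (2*k-1) = - (2 * (3 * a + 3 * b + 1) - 2 * (a - b))"
      have "j = - a" using u by presburger
      moreover have "k = a + 2 * b + 1 \<or> k = - (a + 2 * b)" using v by presburger
      ultimately show ?thesis unfolding x by auto
    next
      assume u: "2 * (6*j-1) = 2 * (3 * a + 3 * b + 1) - 3 * (2 * (a - b)) \<or> 2 * (6*j-1) = - (2 * (3 * a + 3 * b + 1) - 3 * (2 * (a - b)))"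
        and v: "2 * (2*k-1) = 2 * (3 * a + 3 * b + 1) + 2 * (a - b) \<or> 2 * (2*k-1) = - (2 * (3 * a + 3 * b + 1) + 2 * (a - b))"
      have "j = - b" using u by presburger
      moreover have "k = 2 * a + b + 1 \<or> k = - (2 * a + b)" using v by presburger
      ultimately show ?thesis unfolding x by auto
    qed
  next
    fix x assume "x \<in> ?T"
    then obtain j k where x: "x = (j, k)" by (cases x)
    have "j = - a \<and> (k = a + 2 * b + 1 \<or> k = - (a + 2 * b)) \<or> j = - b \<and> (k = 2 * a + b + 1 \<or> k = - (2 * a + b))"
      using \<open>x \<in> ?T\<close> unfolding x by auto
    then have "(6*j-1)\<^sup>2 + 3 * (2*k-1)\<^sup>2 = 4 * int p"
      unfolding ab by (elim disjE conjE; hypsubst; simp add: power2_eq_square algebra_simps)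
    then show "x \<in> ?S" unfolding x by (subst (asm) nrm_eq_iff[symmetric]) auto
  qed
  define g :: "int \<times> int \<Rightarrow> complex" where "g = (\<lambda>(j, k). - ((-1) powi (j + k) * of_int k))"
  have "a + 2 * b + 1 \<noteq> - (a + 2 * b)" "2 * a + b + 1 \<noteq> - (2 * a + b)" by presburger+
  then have "(\<Sum>x\<in>?T. g x)
      = g (- a, a + 2 * b + 1) + g (- a, - (a + 2 * b)) + g (- b, 2 * a + b + 1) + g (- b, - (2 * a + b))"
    using ne by simp
  also have "\<dots> = 2 * of_int (3 * a + 3 * b + 1)"
  proof -
    have e: "- a + (a + 2 * b + 1) = 2 * b + 1" "- a + - (a + 2 * b) = 2 * (- a - b)"
      "- b + (2 * a + b + 1) = 2 * a + 1" "- b + - (2 * a + b) = 2 * (- a - b)" by simp_all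
    have "(-1 :: complex) powi (2 * n) = 1" "(-1 :: complex) powi (2 * n + 1) = - 1" for n by simp_all
    then show ?thesis unfolding g_def prod.case e by simp
  qed
  finally show ?thesis unfolding fourier_coeff_f_36 S g_def .
qed

text \<open>The two sums are reindexed to run over the solutions of \<open>u\<^sup>2 + 3 v\<^sup>2 = 4 p\<close> with \<open>u \<equiv> 1\<close> modulo \<open>3\<close>, with odd and even \<open>u\<close>
respectively. There are six of them, and powers of \<open>w\<close> sort them by the residue of \<open>v\<close> modulo \<open>3\<close>.\<close>

theorem coeff_f_27:
  fixes y m :: int
  assumes p: "prime p" "odd p" and ym: "int p = y\<^sup>2 + 3 * y * m + 9 * m\<^sup>2" "y mod 3 = 1"
  shows "fourier_coeff f_27_2_a_a p = of_int (2 * y + 3 * m)"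
proof -
  define w where "w = cis (2 * pi / 3)"
  have w: "w\<^sup>2 + w + 1 = 0" unfolding w_def by (rule cis_cube_root)
  note cr = cube_root[OF w]
  have m0: "m \<noteq> 0" using prime_not_square[OF p(1), of y] ym by auto
  have y0: "y \<noteq> 0" using ym(2) by auto
  have ym0: "y + 3 * m \<noteq> 0" using ym(2) by presburger
  have base: "(2 * y + 3 * m)\<^sup>2 + 3 * (3 * m)\<^sup>2 = 4 * int p"
    unfolding ym by (simp add: power2_eq_square algebra_simps)
  \<comment> \<open>The solutions with \<open>u \<equiv> 1\<close> modulo \<open>3\<close>, obtained from \<open>(2 y + 3 m, 3 m)\<close> by units and conjugation.\<close>
  define R where "R = {(- (2 * y + 3 * m), 3 * m), (- (2 * y + 3 * m), - (3 * m)), (y + 6 * m, y), (y + 6 * m, - y),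
      (y - 3 * m, y + 3 * m), (y - 3 * m, - (y + 3 * m))}"
  have R: "(u, v) \<in> R \<longleftrightarrow> u mod 3 = 1 \<and> u\<^sup>2 + 3 * v\<^sup>2 = 4 * int p" for u v
  proof
    assume "(u, v) \<in> R"
    then have c: "u = - (2 * y + 3 * m) \<and> (v = 3 * m \<or> v = - (3 * m)) \<or> u = y + 6 * m \<and> (v = y \<or> v = - y)
        \<or> u = y - 3 * m \<and> (v = y + 3 * m \<or> v = - (y + 3 * m))"
      unfolding R_def by auto
    then have "u\<^sup>2 + 3 * v\<^sup>2 = 4 * int p"
      unfolding ym(1) by (elim disjE conjE; hypsubst; simp add: power2_eq_square algebra_simps)
    moreover have "u mod 3 = 1"
    proof -
      have "u = - (2 * y + 3 * m) \<or> u = y + 6 * m \<or> u = y - 3 * m" using c by blast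
      then show ?thesis using ym(2) by presburger
    qed
    ultimately show "u mod 3 = 1 \<and> u\<^sup>2 + 3 * v\<^sup>2 = 4 * int p" by blast
  next
    assume "u mod 3 = 1 \<and> u\<^sup>2 + 3 * v\<^sup>2 = 4 * int p"
    then have u: "u mod 3 = 1" "u\<^sup>2 + 3 * v\<^sup>2 = 4 * int p" by auto
    obtain t r where tr: "y = 3 * t + 1" "u = 3 * r + 1"
      using ym(2) u(1) by (metis mult_div_mod_eq)
    have no: "3 * n \<noteq> (- 2 :: int)" and no3: "3 * n \<noteq> (1 :: int)" for n by presburger+
    from four_p_representation_cases[OF p base u(2)] show "(u, v) \<in> R"
    proof (elim disjE[of "_ \<and> _"] conjE)
      assume u': "u = 2 * y + 3 * m \<or> u = - (2 * y + 3 * m)" and v: "v = 3 * m \<or> v = - (3 * m)"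
      from u' have "u = - (2 * y + 3 * m)"
      proof
        assume "u = 2 * y + 3 * m"
        then have "3 * (r - 2 * t - m) = 1" unfolding tr by (simp add: algebra_simps)
        then show ?thesis using no3 by blast
      qed
      then show ?thesis using v unfolding R_def by auto
    next
      assume u': "2 * u = 2 * y + 3 * m + 3 * (3 * m) \<or> 2 * u = - (2 * y + 3 * m + 3 * (3 * m))"
        and v: "2 * v = 2 * y + 3 * m - 3 * m \<or> 2 * v = - (2 * y + 3 * m - 3 * m)"
      from u' have "u = y + 6 * m"
      proof
        assume "2 * u = - (2 * y + 3 * m + 3 * (3 * m))"
        then have "3 * (r + t + 2 * m) = - 2" unfolding tr by (simp add: algebra_simps)
        then show ?thesis using no by blast
      qed simp
      then show ?thesis using v unfolding R_def by auto
    next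
      assume u': "2 * u = 2 * y + 3 * m - 3 * (3 * m) \<or> 2 * u = - (2 * y + 3 * m - 3 * (3 * m))"
        and v: "2 * v = 2 * y + 3 * m + 3 * m \<or> 2 * v = - (2 * y + 3 * m + 3 * m)"
      from u' have "u = y - 3 * m"
      proof
        assume "2 * u = - (2 * y + 3 * m - 3 * (3 * m))"
        then have "3 * (r + t - m) = - 2" unfolding tr by (simp add: algebra_simps)
        then show ?thesis using no by blast
      qed simp
      then show ?thesis using v unfolding R_def by auto
    qed
  qed
  \<comment> \<open>The common form of the two summands: \<open>v = 2 n - 1\<close> in the odd and \<open>v = 2 n\<close> in the even case.\<close>
  define h where "h = (\<lambda>v::int. (of_int v + 1) * w powi (2 * v + 2))"
  have wp: "w powi (3 * n + r) = w powi r" for n r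
    using cr by (simp add: power_int_add power_int_mult)
  have 1: "(\<Sum>(n, l) | nrm (6*l+1) (2*n-1) = p. 2 * of_int n * w powi n) = (\<Sum>(u, v) | (u, v) \<in> R \<and> odd u. h v)"
  proof (rule sum.reindex_bij_witness[of _ "\<lambda>(u, v). ((v + 1) div 2, (u - 1) div 6)" "\<lambda>(n, l). (6*l+1, 2*n-1)"])
    fix x assume x: "x \<in> {(n, l). nrm (6*l+1) (2*n-1) = p}"
    obtain n l where nl: "x = (n, l)" by (cases x)
    have "(6*l+1)\<^sup>2 + 3 * (2*n-1)\<^sup>2 = 4 * int p" using x unfolding nl mem_Collect_eq prod.case by (subst (asm) nrm_eq_iff) auto
    then show "(case x of (n, l) \<Rightarrow> (6*l+1, 2*n-1)) \<in> {(u, v). (u, v) \<in> R \<and> odd u}"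
      unfolding nl by (simp add: R; presburger)
    have "2 * (2*n-1) + 2 = 3 * n + n" by simp
    then have "w powi (2 * (2*n-1) + 2) = w powi n" using wp[of n n] by (simp only:)
    then show "(case (case x of (n, l) \<Rightarrow> (6*l+1, 2*n-1)) of (u, v) \<Rightarrow> h v) = (case x of (n, l) \<Rightarrow> 2 * of_int n * w powi n)"
      unfolding nl h_def by simp
  next
    fix x assume x: "x \<in> {(u, v). (u, v) \<in> R \<and> odd u}"
    obtain u v where uv: "x = (u, v)" by (cases x)
    then have r: "u mod 3 = 1" "u\<^sup>2 + 3 * v\<^sup>2 = 4 * int p" "odd u" using x R by auto
    have "even (u\<^sup>2 + 3 * v\<^sup>2)" unfolding r(2) by simp
    then have "odd v" using r(3) by (simp add: even_add)
    then have e: "6 * ((u - 1) div 6) + 1 = u" "2 * ((v + 1) div 2) - 1 = v" using r by presburger+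
    then show "(case (case x of (u, v) \<Rightarrow> ((v + 1) div 2, (u - 1) div 6)) of (n, l) \<Rightarrow> (6*l+1, 2*n-1)) = x"
      unfolding uv by simp
    have "nrm u v = p" using r(2,3) \<open>odd v\<close> by (subst nrm_eq_iff) auto
    then show "(case x of (u, v) \<Rightarrow> ((v + 1) div 2, (u - 1) div 6)) \<in> {(n, l). nrm (6*l+1) (2*n-1) = p}"
      unfolding uv using e by simp
  qed auto
  have 2: "(\<Sum>(n, l) | nrm (6*l+2) (2*n) = p. (2 * of_int n + 1) * w powi (n + 2)) = (\<Sum>(u, v) | (u, v) \<in> R \<and> even u. h v)"
  proof (rule sum.reindex_bij_witness[of _ "\<lambda>(u, v). (v div 2, (- u - 2) div 6)" "\<lambda>(n, l). (- (6*l+2), 2*n)"])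
    fix x assume x: "x \<in> {(n, l). nrm (6*l+2) (2*n) = p}"
    obtain n l where nl: "x = (n, l)" by (cases x)
    have "(6*l+2)\<^sup>2 + 3 * (2*n)\<^sup>2 = 4 * int p" using x unfolding nl mem_Collect_eq prod.case by (subst (asm) nrm_eq_iff) auto
    then have "(- (6*l+2))\<^sup>2 + 3 * (2*n)\<^sup>2 = 4 * int p" by (simp only: power2_minus)
    then show "(case x of (n, l) \<Rightarrow> (- (6*l+2), 2*n)) \<in> {(u, v). (u, v) \<in> R \<and> even u}"
      unfolding nl by (simp only: R mem_Collect_eq prod.case) presburger
    have "2 * (2*n) + 2 = 3 * n + (n + 2)" by simp
    then have "w powi (2 * (2*n) + 2) = w powi (n + 2)" using wp[of n "n + 2"] by (simp only:)
    then show "(case (case x of (n, l) \<Rightarrow> (- (6*l+2), 2*n)) of (u, v) \<Rightarrow> h v) = (case x of (n, l) \<Rightarrow> (2 * of_int n + 1) * w powi (n + 2))"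
      unfolding nl h_def by simp
  next
    fix x assume x: "x \<in> {(u, v). (u, v) \<in> R \<and> even u}"
    obtain u v where uv: "x = (u, v)" by (cases x)
    then have r: "u mod 3 = 1" "u\<^sup>2 + 3 * v\<^sup>2 = 4 * int p" "even u" using x R by auto
    have "even (u\<^sup>2 + 3 * v\<^sup>2)" unfolding r(2) by simp
    then have "even v" using r(3) by (simp add: even_add)
    then have e: "6 * ((- u - 2) div 6) + 2 = - u" "2 * (v div 2) = v" using r by presburger+
    then show "(case (case x of (u, v) \<Rightarrow> (v div 2, (- u - 2) div 6)) of (n, l) \<Rightarrow> (- (6*l+2), 2*n)) = x"
      unfolding uv by simp
    have "nrm (- u) v = p" using r(2,3) \<open>even v\<close> by (subst nrm_eq_iff) auto
    then show "(case x of (u, v) \<Rightarrow> (v div 2, (- u - 2) div 6)) \<in> {(n, l). nrm (6*l+2) (2*n) = p}"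
      unfolding uv by (simp only: e mem_Collect_eq prod.case)
  qed auto
  have fR: "finite R" by (simp add: R_def)
  have "(\<Sum>(u, v) | (u, v) \<in> R \<and> odd u. h v) + (\<Sum>(u, v) | (u, v) \<in> R \<and> even u. h v) = (\<Sum>(u, v)\<in>R. h v)"
  proof -
    have "R = {(u, v). (u, v) \<in> R \<and> odd u} \<union> {(u, v). (u, v) \<in> R \<and> even u}" by auto
    moreover have "finite {(u, v). (u, v) \<in> R \<and> odd u}" "finite {(u, v). (u, v) \<in> R \<and> even u}"
      by (rule finite_subset[OF _ fR], auto)+
    moreover have "{(u, v). (u, v) \<in> R \<and> odd u} \<inter> {(u, v). (u, v) \<in> R \<and> even u} = {}" by auto
    ultimately show ?thesis by (metis (no_types, lifting) sum.union_disjoint)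
  qed
  also have "(\<Sum>(u, v)\<in>R. h v) = h (3 * m) + h (- (3 * m)) + h y + h (- y) + h (y + 3 * m) + h (- (y + 3 * m))"
  proof -
    have "- (2 * y + 3 * m) \<noteq> y + 6 * m" "- (2 * y + 3 * m) \<noteq> y - 3 * m" "y + 6 * m \<noteq> y - 3 * m"
      using m0 y0 ym0 by presburger+
    moreover have "x \<noteq> - x" if "x \<noteq> 0" for x :: int using that by auto
    ultimately show ?thesis unfolding R_def using m0 y0 ym0 by (simp add: add_ac)
  qed
  also have "\<dots> = (w - 1) * of_int (2 * y + 3 * m)"
  proof -
    obtain t where t: "y = 3 * t + 1" using ym(2) by (metis mult_div_mod_eq add.commute)
    have e: "w powi (2 * (3 * m) + 2) = w\<^sup>2" "w powi (2 * (- (3 * m)) + 2) = w\<^sup>2"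
      "w powi (2 * y + 2) = w" "w powi (2 * (- y) + 2) = 1"
      "w powi (2 * (y + 3 * m) + 2) = w" "w powi (2 * (- (y + 3 * m)) + 2) = 1"
    proof -
      have r: "2 * (3 * m) + 2 = 3 * (2 * m) + 2" "2 * (- (3 * m)) + 2 = 3 * (- 2 * m) + 2"
        "2 * y + 2 = 3 * (2 * t + 1) + 1" "2 * (- y) + 2 = 3 * (- 2 * t) + 0"
        "2 * (y + 3 * m) + 2 = 3 * (2 * t + 2 * m + 1) + 1" "2 * (- (y + 3 * m)) + 2 = 3 * (- 2 * t - 2 * m) + 0"
        unfolding t by simp_all
      show "w powi (2 * (3 * m) + 2) = w\<^sup>2" "w powi (2 * (- (3 * m)) + 2) = w\<^sup>2"
        "w powi (2 * y + 2) = w" "w powi (2 * (- y) + 2) = 1"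
        "w powi (2 * (y + 3 * m) + 2) = w" "w powi (2 * (- (y + 3 * m)) + 2) = 1"
        unfolding r wp by simp_all
    qed
    have "(h (3 * m) + h (- (3 * m)) + h y + h (- y) + h (y + 3 * m) + h (- (y + 3 * m)))
      = 2 * (w\<^sup>2 + w + 1) + (w - 1) * of_int (2 * y + 3 * m)"
      unfolding h_def e by (simp add: algebra_simps)
    then show ?thesis unfolding w by simp
  qed
  finally show ?thesis
    unfolding fourier_coeff_f_27[OF w] 1 2 using cr(4) by simp
qed

text \<open>Only the solutions with \<open>u \<equiv> 2\<close> modulo \<open>12\<close> and \<open>4\<close> dividing \<open>v\<close> occur, and these are one solution and its conjugate. The factor
\<open>w\<close> to the power \<open>2 l\<close> multiplies \<open>6 k + 1 + 2 l (w - w\<^sup>2)\<close> by the unit that makes its trace congruent to \<open>2\<close> and its other entry to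
\<open>0\<close> modulo \<open>3\<close>; this trace is \<open>L\<close>.\<close>

theorem coeff_f_432:
  fixes k l L m :: int
  assumes p: "prime p" "p mod 12 = 1" and kl: "int p = (6 * k + 1)\<^sup>2 + 3 * (2 * l)\<^sup>2"
    and L: "4 * int p = L\<^sup>2 + 27 * m\<^sup>2" "L mod 3 = 2"
  shows "fourier_coeff f_432_2_c_a p = (-1) powi (k + l) * of_int L"
proof -
  define w where "w = cis (2 * pi / 3)"
  have w: "w\<^sup>2 + w + 1 = 0" unfolding w_def by (rule cis_cube_root)
  note cr = cube_root[OF w]
  have op: "odd p" using p(2) by presburger
  have l0: "l \<noteq> 0" using prime_not_square[OF p(1), of "6 * k + 1"] kl by auto
  have base: "(2 * (6 * k + 1))\<^sup>2 + 3 * (2 * (2 * l))\<^sup>2 = 4 * int p"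
    unfolding kl by (simp add: power2_eq_square algebra_simps)
  have S: "{(i, j). nrm (2 * (6*i+1)) (2 * (2*j)) = p} = {(k, l), (k, - l)}" (is "?S = ?T")
  proof (intro equalityI subsetI)
    fix x assume "x \<in> ?S"
    then obtain i j where x: "x = (i, j)" and "nrm (2 * (6*i+1)) (2 * (2*j)) = p" by auto
    then have "(2 * (6*i+1))\<^sup>2 + 3 * (2 * (2*j))\<^sup>2 = 4 * int p" by (subst (asm) nrm_eq_iff) auto
    from four_p_representation_cases[OF p(1) op base this] show "x \<in> ?T"
    proof (elim disjE[of "_ \<and> _"] conjE)
      assume u: "2 * (6*i+1) = 2 * (6 * k + 1) \<or> 2 * (6*i+1) = - (2 * (6 * k + 1))"
        and v: "2 * (2*j) = 2 * (2 * l) \<or> 2 * (2*j) = - (2 * (2 * l))"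
      have "i = k" using u by presburger
      then show ?thesis using v unfolding x by auto
    next
      assume "2 * (2 * (2*j)) = 2 * (6 * k + 1) - 2 * (2 * l) \<or> 2 * (2 * (2*j)) = - (2 * (6 * k + 1) - 2 * (2 * l))"
      then have False by presburger
      then show ?thesis ..
    next
      assume "2 * (2 * (2*j)) = 2 * (6 * k + 1) + 2 * (2 * l) \<or> 2 * (2 * (2*j)) = - (2 * (6 * k + 1) + 2 * (2 * l))"
      then have False by presburger
      then show ?thesis ..
    qed
  next
    fix x assume "x \<in> ?T"
    then obtain i j where x: "x = (i, j)" by (cases x)
    have "(2 * (6*i+1))\<^sup>2 + 3 * (2 * (2*j))\<^sup>2 = 4 * int p"
      using \<open>x \<in> ?T\<close> base unfolding x by (auto simp: power2_eq_square)
    then show "x \<in> ?S" unfolding x by (subst (asm) nrm_eq_iff[symmetric]) auto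
  qed
  \<comment> \<open>The normalised value \<open>L\<close> is unique: the other representations have a second entry that is prime to \<open>3\<close>.\<close>
  have L': "L' = L" if "4 * int p = L'\<^sup>2 + 27 * m'\<^sup>2" "L' mod 3 = 2" for L' m' :: int
  proof -
    have "L\<^sup>2 + 3 * (3 * m)\<^sup>2 = 4 * int p" "L'\<^sup>2 + 3 * (3 * m')\<^sup>2 = 4 * int p"
      using L that by (simp_all add: power2_eq_square)
    from four_p_representation_cases[OF p(1) op this] show ?thesis
    proof (elim disjE[of "_ \<and> _"] conjE)
      assume "L' = L \<or> L' = - L"
      then show ?thesis using L(2) that(2) by presburger
    next
      assume "2 * (3 * m') = L - 3 * m \<or> 2 * (3 * m') = - (L - 3 * m)"
      then show ?thesis using L(2) by presburger
    next
      assume "2 * (3 * m') = L + 3 * m \<or> 2 * (3 * m') = - (L + 3 * m)"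
      then show ?thesis using L(2) by presburger
    qed
  qed
  have sgn: "(-1 :: complex) powi (k + - l) = (-1) powi (k + l)"
    by (cases "even (k + l)") (auto simp: power_int_minus_left_odd power_int_minus_left_even)
  have wp: "w powi (3 * n + r) = w powi r" for n r
    using cr by (simp add: power_int_add power_int_mult)
  have w3: "w * w\<^sup>2 = 1" using cr(1) by (simp add: power3_eq_cube power2_eq_square mult.assoc)
  define c where "c = (of_int (6 * k + 1) :: complex)"
  have g1: "w\<^sup>2 * (c + D * (w - w\<^sup>2)) + w * (c + - D * (w - w\<^sup>2)) = - c + 3 * D" for D
  proof -
    have "w\<^sup>2 * (c + D * (w - w\<^sup>2)) + w * (c + - D * (w - w\<^sup>2)) = c * (w\<^sup>2 + w + 1) - c - D * (w - w\<^sup>2)\<^sup>2"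
      by (simp add: algebra_simps power2_eq_square)
    then show ?thesis unfolding w cr(6) by simp
  qed
  have m: "of_int (2 * - l) = - (of_int (2 * l) :: complex)" by simp
  have tr: "w powi (2 * l) * (c + of_int (2 * l) * (w - w\<^sup>2)) + w powi (2 * - l) * (c + of_int (2 * - l) * (w - w\<^sup>2)) = of_int L"
  proof -
    consider "l mod 3 = 0" | "l mod 3 = 1" | "l mod 3 = 2" by linarith
    then show ?thesis
    proof cases
      case 1
      then obtain t where t: "l = 3 * t" by (metis mult_div_mod_eq add.right_neutral)
      have r: "2 * l = 3 * (2 * t) + 0" "2 * - l = 3 * (- 2 * t) + 0" unfolding t by simp_all
      have "2 * (6 * k + 1) = L"
        by (rule L'[of _ "4 * t"]) (use kl in \<open>simp add: t power2_eq_square algebra_simps\<close>, presburger)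
      then have "of_int (2 * (6 * k + 1)) = (of_int L :: complex)" by (simp only:)
      then have "of_int L = 2 * c" by (simp add: c_def)
      moreover have "w powi (2 * l) = 1" "w powi (2 * - l) = 1" unfolding r wp by simp_all
      ultimately show ?thesis by simp
    next
      case 2
      then obtain t where t: "l = 3 * t + 1" by (metis mult_div_mod_eq)
      have r: "2 * l = 3 * (2 * t) + 2" "2 * - l = 3 * (- 2 * t - 1) + 1" unfolding t by simp_all
      have "- (6 * k + 1) + 3 * (2 * l) = L"
        by (rule L'[of _ "2 * k + 1 + 2 * t"]) (use kl in \<open>simp add: t power2_eq_square algebra_simps\<close>, presburger)
      then have "of_int (- (6 * k + 1) + 3 * (2 * l)) = (of_int L :: complex)" by (simp only:)
      then have "of_int L = - c + 3 * of_int (2 * l)" by (simp add: c_def)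
      moreover have "w powi (2 * l) = w\<^sup>2" "w powi (2 * - l) = w" unfolding r wp by simp_all
      ultimately show ?thesis unfolding m using g1[of "of_int (2 * l)"] by simp
    next
      case 3
      then obtain t where t: "l = 3 * t + 2" by (metis mult_div_mod_eq)
      have r: "2 * l = 3 * (2 * t + 1) + 1" "2 * - l = 3 * (- 2 * t - 2) + 2" unfolding t by simp_all
      have "- (6 * k + 1) - 3 * (2 * l) = L"
        by (rule L'[of _ "2 * k - 1 - 2 * t"]) (use kl in \<open>simp add: t power2_eq_square algebra_simps\<close>, presburger)
      then have "of_int (- (6 * k + 1) - 3 * (2 * l)) = (of_int L :: complex)" by (simp only:)
      then have "of_int L = - c - 3 * of_int (2 * l)" by (simp add: c_def)
      moreover have "w powi (2 * l) = w" "w powi (2 * - l) = w\<^sup>2" unfolding r wp by simp_all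
      ultimately show ?thesis unfolding m using g1[of "- of_int (2 * l)"] by (simp add: add.commute)
    qed
  qed
  have "fourier_coeff f_432_2_c_a p = (-1) powi (k + l) * (w powi (2 * l) * (c + of_int (2 * l) * (w - w\<^sup>2))
       + w powi (2 * - l) * (c + of_int (2 * - l) * (w - w\<^sup>2)))"
    unfolding fourier_coeff_f_432[OF w p(2)] S c_def using l0 sgn by (simp add: ring_distribs mult.assoc)
  then show ?thesis unfolding tr .
qed

section \<open>Multiplicative characters and Jacobi sums modulo a prime\<close>

text \<open>Functions on the field with \<open>p\<close> elements are represented by functions on the integers that are periodic modulo \<open>p\<close>, so
that polynomial substitutions are substitutions of integers.\<close>

locale odd_prime =
  fixes p :: nat
  assumes prime_p: "prime p" and odd_p: "odd p"
begin

abbreviation residues :: "int set" where "residues \<equiv> {0..<int p}"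

definition periodic :: "(int \<Rightarrow> complex) \<Rightarrow> bool" where
  "periodic f \<longleftrightarrow> (\<forall>x y. [x = y] (mod int p) \<longrightarrow> f x = f y)"

lemma periodicI: "(\<And>x y. [x = y] (mod int p) \<Longrightarrow> f x = f y) \<Longrightarrow> periodic f"
  by (simp add: periodic_def)

lemma periodicD: "periodic f \<Longrightarrow> [x = y] (mod int p) \<Longrightarrow> f x = f y"
  unfolding periodic_def by blast

definition mchar :: "(int \<Rightarrow> complex) \<Rightarrow> bool" where
  "mchar A \<longleftrightarrow> periodic A \<and> (\<forall>x y. A (x * y) = A x * A y) \<and> (\<forall>x. A x = 0 \<longleftrightarrow> int p dvd x)"

definition recip :: "int \<Rightarrow> int" where "recip x = x ^ (p - 2)"

lemma p_gt_2: "p > 2"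
  using prime_p odd_p prime_ge_2_nat[OF prime_p] by (cases "p = 2") auto

lemma prime_int_p: "prime (int p)" using prime_p by simp

lemma recip: "\<not> int p dvd x \<Longrightarrow> [x * recip x = 1] (mod int p)"
proof -
  assume x: "\<not> int p dvd x"
  have "[x ^ (p - 1) = 1] (mod int p)"
  proof -
    have p0: "int p > 0" using p_gt_2 by simp
    define a where "a = nat (x mod int p)"
    have a: "int a = x mod int p" using p0 by (simp add: a_def)
    have "\<not> p dvd a" using x by (metis a dvd_mod_iff dvd_refl int_dvd_int_iff)
    then have "[a ^ (p - 1) = 1] (mod p)" using fermat_theorem prime_p by blast
    then have "[(x mod int p) ^ (p - 1) = 1] (mod int p)"
      unfolding a[symmetric] by (metis cong_int_iff of_nat_1 of_nat_power)
    then show ?thesis by (simp add: cong_def power_mod)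
  qed
  moreover have "p - 1 = Suc (p - 2)" using p_gt_2 by simp
  ultimately show ?thesis by (simp add: recip_def)
qed

lemma not_dvd_recip: "\<not> int p dvd x \<Longrightarrow> \<not> int p dvd recip x"
  unfolding recip_def using prime_int_p by (meson prime_dvd_power)

lemma dvd_recip: "int p dvd x \<Longrightarrow> int p dvd recip x"
  unfolding recip_def using p_gt_2 dvd_power[of "p - 2" x] by (auto intro: dvd_trans)

lemma recip_unique:
  assumes "[x * z = 1] (mod int p)"
  shows "[recip x = z] (mod int p)"
proof -
  have "\<not> int p dvd x"
  proof
    assume "int p dvd x"
    then have "int p dvd x * z" by simp
    then have "int p dvd 1" using cong_dvd_iff[OF assms] by simp
    then show False using prime_int_p not_prime_unit by blast
  qed
  then have 1: "[x * recip x * z = 1 * z] (mod int p)" by (intro cong_mult recip) auto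
  have "[recip x * (x * z) = recip x * 1] (mod int p)" using assms by (intro cong_mult) auto
  moreover have "recip x * (x * z) = x * recip x * z" by simp
  ultimately have 2: "[x * recip x * z = recip x] (mod int p)" by (simp only: mult_1_right)
  show ?thesis using cong_trans[OF cong_sym[OF 2] 1] unfolding mult_1_left .
qed

text \<open>All changes of variable below are instances; injectivity is enough since the residues form a finite set.\<close>

lemma sum_residues_bij:
  assumes f: "periodic f" and g: "\<And>x y. [g x = g y] (mod int p) \<Longrightarrow> [x = y] (mod int p)"
  shows "(\<Sum>x\<in>residues. f (g x)) = (\<Sum>x\<in>residues. f x)"
proof -
  have p0: "int p > 0" using p_gt_2 by simp
  let ?h = "\<lambda>x. g x mod int p"
  have inj: "inj_on ?h residues"
  proof (rule inj_onI)
    fix x y assume xy: "x \<in> residues" "y \<in> residues" and "?h x = ?h y"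
    then have "[g x = g y] (mod int p)" by (simp add: cong_def)
    then have "[x = y] (mod int p)" by (rule g)
    then show "x = y" using xy by (simp add: cong_def)
  qed
  have "?h ` residues \<subseteq> residues" using p0 by auto
  then have im: "?h ` residues = residues" using inj by (simp add: endo_inj_surj)
  have "(\<Sum>x\<in>residues. f (g x)) = (\<Sum>x\<in>residues. f (?h x))"
    by (intro sum.cong refl periodicD[OF f]) (simp add: cong_def)
  also have "\<dots> = (\<Sum>x\<in>?h ` residues. f x)" by (rule sum.reindex[OF inj, of f, unfolded o_def, symmetric])
  finally show ?thesis unfolding im .
qed

lemma sum_residues_affine:
  assumes "periodic f" "\<not> int p dvd u"
  shows "(\<Sum>x\<in>residues. f (u * x + c)) = (\<Sum>x\<in>residues. f x)"
proof (rule sum_residues_bij[OF assms(1)])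
  fix x y assume "[u * x + c = u * y + c] (mod int p)"
  then have "[u * x = u * y] (mod int p)" by (simp add: cong_add_rcancel)
  then have "int p dvd u * (x - y)" by (simp add: cong_iff_dvd_diff right_diff_distrib)
  then have "int p dvd x - y" using assms(2) prime_int_p by (simp add: prime_dvd_mult_iff)
  then show "[x = y] (mod int p)" by (simp add: cong_iff_dvd_diff)
qed

lemma sum_residues_recip:
  assumes "periodic f"
  shows "(\<Sum>x\<in>residues. f (recip x)) = (\<Sum>x\<in>residues. f x)"
proof (rule sum_residues_bij[OF assms(1)])
  fix x y assume e: "[recip x = recip y] (mod int p)"
  have d: "int p dvd recip x \<longleftrightarrow> int p dvd x" for x using dvd_recip not_dvd_recip by blast
  have "int p dvd recip x \<longleftrightarrow> int p dvd recip y" using e by (rule cong_dvd_iff)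
  then have "int p dvd x \<longleftrightarrow> int p dvd y" unfolding d .
  show "[x = y] (mod int p)"
  proof (cases "int p dvd x")
    case True
    then show ?thesis using \<open>int p dvd x \<longleftrightarrow> int p dvd y\<close> by (simp add: cong_iff_dvd_diff)
  next
    case False
    then have "\<not> int p dvd y" using \<open>int p dvd x \<longleftrightarrow> int p dvd y\<close> by simp
    have 1: "[x * (y * recip y) = x * 1] (mod int p)"
      using recip[OF \<open>\<not> int p dvd y\<close>] by (intro cong_mult) auto
    have "[x * recip x * y = 1 * y] (mod int p)" using recip[OF False] by (intro cong_mult) auto
    moreover have "x * recip x * y = x * (y * recip x)" by simp
    ultimately have 2: "[x * (y * recip x) = 1 * y] (mod int p)" by (simp only:)
    have 3: "[x * (y * recip x) = x * (y * recip y)] (mod int p)"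
      using e by (intro cong_mult) auto
    show ?thesis using cong_trans[OF cong_sym[OF cong_trans[OF 3 1]] 2] unfolding mult_1_left mult_1_right .
  qed
qed

context
  fixes A :: "int \<Rightarrow> complex"
  assumes A: "mchar A"
begin

lemma mchar_cong: "[x = y] (mod int p) \<Longrightarrow> A x = A y"
  using A unfolding mchar_def by (blast dest: periodicD)

lemma mchar_periodic: "periodic A"
  using A by (simp add: mchar_def)

lemma mchar_mult: "A (x * y) = A x * A y"
  using A by (auto simp: mchar_def)

lemma mchar_zero_iff: "A x = 0 \<longleftrightarrow> int p dvd x"
  using A by (auto simp: mchar_def)

lemma mchar_0: "A 0 = 0" by (simp add: mchar_zero_iff)

lemma mchar_1: "A 1 = 1"
proof -
  have "A 1 * A 1 = A 1" using mchar_mult[of 1 1] by simp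
  moreover have "A 1 \<noteq> 0" using prime_int_p by (auto simp: mchar_zero_iff dest: not_prime_unit)
  ultimately show ?thesis by simp
qed

lemma mchar_power: "A (x ^ n) = A x ^ n"
  by (induction n) (auto simp: mchar_1 mchar_mult)

lemma mchar_recip: "\<not> int p dvd x \<Longrightarrow> A x * A (recip x) = 1"
  using mchar_cong[OF recip[of x]] by (simp add: mchar_mult mchar_1)

lemma norm_mchar: "\<not> int p dvd x \<Longrightarrow> norm (A x) = 1"
proof -
  assume x: "\<not> int p dvd x"
  have "A x ^ (p - 1) = 1"
  proof -
    have "p - 1 = Suc (p - 2)" using p_gt_2 by simp
    then show ?thesis using mchar_recip[OF x] by (simp add: recip_def mchar_power)
  qed
  then have "norm (A x) ^ (p - 1) = 1 ^ (p - 1)" by (metis norm_one norm_power power_one)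
  then show ?thesis using p_gt_2 by (intro power_eq_imp_eq_base[of _ "p - 1" 1]) auto
qed

lemma mchar_cnj_mult: "\<not> int p dvd x \<Longrightarrow> cnj (A x) * A x = 1"
  using norm_mchar[of x] complex_norm_square[of "A x"] by (simp add: mult.commute)

lemma mchar_recip_cnj: "\<not> int p dvd x \<Longrightarrow> A (recip x) = cnj (A x)"
  using mchar_recip[of x] mchar_cnj_mult[of x] mchar_zero_iff[of x]
  by (metis mult.commute mult_cancel_right)

lemma mchar_cnj: "mchar (\<lambda>x. cnj (A x))"
  unfolding mchar_def
  by (intro conjI periodicI arg_cong[of _ _ cnj] mchar_cong) (simp_all add: mchar_mult mchar_zero_iff)

lemma mchar_minus1_sq: "A (- 1) * A (- 1) = 1"
  using mchar_mult[of "-1" "-1"] mchar_1 by simp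

lemma sum_mchar: "\<not> int p dvd g \<Longrightarrow> A g \<noteq> 1 \<Longrightarrow> (\<Sum>x\<in>residues. A x) = 0"
proof -
  assume g: "\<not> int p dvd g" "A g \<noteq> 1"
  have "(\<Sum>x\<in>residues. A (g * x + 0)) = (\<Sum>x\<in>residues. A x)"
    by (rule sum_residues_affine) (use mchar_periodic g in auto)
  then have "A g * (\<Sum>x\<in>residues. A x) = (\<Sum>x\<in>residues. A x)"
    by (simp add: mchar_mult sum_distrib_left)
  then show ?thesis using g(2) by simp
qed

end

lemma mchar_times: "mchar A \<Longrightarrow> mchar B \<Longrightarrow> mchar (\<lambda>x. A x * B x)"
  unfolding mchar_def[of "\<lambda>x. A x * B x"]
  by (intro conjI periodicI arg_cong2[of _ _ _ _ "(*)"] mchar_cong[of A] mchar_cong[of B])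
    (simp_all add: mchar_mult mchar_zero_iff)

lemma mchar_pow: "mchar A \<Longrightarrow> n > 0 \<Longrightarrow> mchar (\<lambda>x. A x ^ n)"
  unfolding mchar_def[of "\<lambda>x. A x ^ n"]
  by (intro conjI periodicI arg_cong[of _ _ "\<lambda>z. z ^ n"] mchar_cong[of A])
    (simp_all add: mchar_mult mchar_zero_iff power_mult_distrib)

definition jac :: "(int \<Rightarrow> complex) \<Rightarrow> (int \<Rightarrow> complex) \<Rightarrow> complex" where
  "jac A B = (\<Sum>x\<in>residues. A x * B (1 - x))"

lemma periodic_jac:
  assumes "mchar A" "mchar B"
  shows "periodic (\<lambda>x. A x * B (1 - x))"
proof (rule periodicI)
  fix x y assume xy: "[x = y] (mod int p)"
  then have "[1 - x = 1 - y] (mod int p)" by (intro cong_diff) auto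
  then show "A x * B (1 - x) = A y * B (1 - y)"
    using mchar_cong[OF assms(1) xy] mchar_cong[OF assms(2)] by metis
qed

lemma jac_commute:
  assumes "mchar A" "mchar B"
  shows "jac A B = jac B A"
proof -
  have "jac A B = (\<Sum>x\<in>residues. A (- 1 * x + 1) * B (1 - (- 1 * x + 1)))"
    unfolding jac_def using prime_int_p
    by (intro sum_residues_affine[symmetric] periodic_jac assms) (auto dest: not_prime_unit)
  then show ?thesis by (simp add: jac_def mult.commute)
qed

lemma jac_cnj: "cnj (jac A B) = jac (\<lambda>x. cnj (A x)) (\<lambda>x. cnj (B x))"
  by (simp add: jac_def)

text \<open>Substitution of \<open>1/x\<close> for \<open>x\<close>.\<close>

lemma jac_inversion:
  assumes A: "mchar A" and B: "mchar B"
  shows "jac A B = B (- 1) * jac (\<lambda>x. cnj (A x * B x)) B"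
proof -
  have "jac A B = (\<Sum>x\<in>residues. A (recip x) * B (1 - recip x))"
    unfolding jac_def by (rule sum_residues_recip[OF periodic_jac[OF A B], symmetric])
  also have "\<dots> = (\<Sum>x\<in>residues. B (- 1) * (cnj (A x * B x) * B (1 - x)))"
  proof (intro sum.cong refl)
    fix x
    show "A (recip x) * B (1 - recip x) = B (- 1) * (cnj (A x * B x) * B (1 - x))"
    proof (cases "int p dvd x")
      case True
      then have "A (recip x) = 0" "A x = 0" using dvd_recip by (auto simp: mchar_zero_iff[OF A])
      then show ?thesis by simp
    next
      case False
      have "[x * (1 - recip x) = x - 1] (mod int p)"
        using cong_diff[OF cong_refl recip[OF False], of x] by (simp add: right_diff_distrib)
      then have "B x * B (1 - recip x) = B (- 1 * (1 - x))"
        using mchar_cong[OF B] by (simp flip: mchar_mult[OF B])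
      then have "cnj (B x) * (B x * B (1 - recip x)) = cnj (B x) * (B (- 1) * B (1 - x))"
        by (simp only: mchar_mult[OF B])
      then have "B (1 - recip x) = cnj (B x) * (B (- 1) * B (1 - x))"
        using mchar_cnj_mult[OF B False] by (simp flip: mult.assoc)
      then show ?thesis using mchar_recip_cnj[OF A False] by (simp add: mult_ac)
    qed
  qed
  finally show ?thesis by (simp add: jac_def sum_distrib_left)
qed

lemma jac_inversion':
  assumes A: "mchar A" and B: "mchar B"
  shows "jac A B = A (- 1) * jac A (\<lambda>x. cnj (A x * B x))"
  using jac_inversion[OF B A] jac_commute[OF A B] jac_commute[OF mchar_cnj[OF mchar_times[OF B A]] A]
  by (simp add: mult.commute)

lemma jac_cong_units:
  assumes "\<And>x. \<not> int p dvd x \<Longrightarrow> A x = A' x" "\<And>x. \<not> int p dvd x \<Longrightarrow> B x = B' x"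
    "mchar A" "mchar A'" "mchar B" "mchar B'"
  shows "jac A B = jac A' B'"
proof -
  have "A x = A' x" "B x = B' x" for x
    using assms mchar_zero_iff[OF assms(3)] mchar_zero_iff[OF assms(4)]
      mchar_zero_iff[OF assms(5)] mchar_zero_iff[OF assms(6)] by metis+
  then show ?thesis by (simp add: jac_def)
qed

lemma sum_residues_unit:
  assumes "\<And>x. int p dvd x \<Longrightarrow> f x = (0::complex)"
  shows "(\<Sum>x\<in>residues. f x) = (\<Sum>x\<in>residues - {0}. f x)"
  using assms by (intro sum.mono_neutral_right) auto

lemma residues_unit: "x \<in> residues - {0} \<longleftrightarrow> x \<in> residues \<and> \<not> int p dvd x"
  using zdvd_imp_le[of "int p" x] by (auto; fastforce)

text \<open>Replacing \<open>y\<close> by \<open>1 - 1/y\<close> turns the summand into \<open>B ((1 - t) y + t)\<close>, so the sum is over a full system of residues apart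
from \<open>y = 0\<close>.\<close>

lemma sum_mchar_pair:
  assumes B: "mchar B" and g: "\<not> int p dvd g" "B g \<noteq> 1"
  shows "(\<Sum>y\<in>residues. B (1 - t * y) * cnj (B (1 - y))) = (if [t = 1] (mod int p) then of_nat p else 0) - B t"
proof -
  let ?f = "\<lambda>y. B (1 - t * y) * cnj (B (1 - y))"
  let ?h = "\<lambda>y. B (1 - t + t * y) * cnj (B y)"
  have per: "periodic ?f" "periodic ?h"
    unfolding periodic_def
    by (auto intro!: arg_cong2[of _ _ _ _ "(*)"] arg_cong[of _ _ cnj] mchar_cong[OF B] cong_diff cong_mult cong_add)
  have m1: "\<not> int p dvd - 1" using prime_int_p by (auto dest: not_prime_unit)
  have "(\<Sum>y\<in>residues. ?f y) = (\<Sum>y\<in>residues. ?f (- 1 * y + 1))"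
    by (rule sum_residues_affine[OF per(1) m1, symmetric])
  also have "\<dots> = (\<Sum>y\<in>residues. ?h y)" by (simp add: algebra_simps)
  also have "\<dots> = (\<Sum>y\<in>residues. ?h (recip y))" by (rule sum_residues_recip[OF per(2), symmetric])
  also have "\<dots> = (\<Sum>y\<in>residues - {0}. ?h (recip y))"
    by (rule sum_residues_unit) (simp add: mchar_zero_iff[OF B] dvd_recip)
  also have "\<dots> = (\<Sum>y\<in>residues - {0}. B ((1 - t) * y + t))"
  proof (intro sum.cong refl)
    fix y assume "y \<in> residues - {0}"
    then have y: "\<not> int p dvd y" using residues_unit by blast
    have "[y * (1 - t + t * recip y) = (1 - t) * y + t] (mod int p)"
    proof -
      have "[(1 - t) * y + t * (y * recip y) = (1 - t) * y + t * 1] (mod int p)"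
        by (intro cong_add cong_mult cong_refl recip y)
      then show ?thesis by (simp add: algebra_simps)
    qed
    then have "B y * B (1 - t + t * recip y) = B ((1 - t) * y + t)"
      using mchar_cong[OF B] by (simp flip: mchar_mult[OF B])
    then show "?h (recip y) = B ((1 - t) * y + t)"
      unfolding mchar_recip_cnj[OF B y] by (simp add: mult.commute)
  qed
  also have "\<dots> = (\<Sum>y\<in>residues. B ((1 - t) * y + t)) - B t"
  proof -
    have "0 \<in> residues" using p_gt_2 by simp
    then show ?thesis by (subst sum_diff1) auto
  qed
  also have "(\<Sum>y\<in>residues. B ((1 - t) * y + t)) = (if [t = 1] (mod int p) then of_nat p else 0)"
  proof (cases "[t = 1] (mod int p)")
    case True
    have "B ((1 - t) * y + t) = 1" for y
    proof -
      have "[(1 - t) * y + t = (1 - 1) * y + 1] (mod int p)"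
        using True by (intro cong_add cong_mult cong_diff) auto
      then show ?thesis using mchar_cong[OF B] mchar_1[OF B] by simp
    qed
    then show ?thesis using True by simp
  next
    case False
    then have "\<not> int p dvd 1 - t" by (simp add: cong_iff_dvd_diff dvd_diff_commute)
    then have "(\<Sum>y\<in>residues. B ((1 - t) * y + t)) = (\<Sum>y\<in>residues. B y)"
      by (intro sum_residues_affine) (use mchar_periodic[OF B] in auto)
    then show ?thesis using False sum_mchar[OF B g] by simp
  qed
  finally show ?thesis .
qed

text \<open>In \<open>cnj J * J\<close> the variable of the second factor is scaled by that of the first; the inner sum is then \<open>sum_mchar_pair\<close>.\<close>

theorem jac_norm:
  assumes A: "mchar A" and B: "mchar B"
    and a: "\<not> int p dvd a" "A a \<noteq> 1" and b: "\<not> int p dvd b" "B b \<noteq> 1" and ab: "\<not> int p dvd c" "A c * B c \<noteq> 1"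
  shows "cnj (jac A B) * jac A B = of_nat p"
proof -
  have inner: "cnj (A y) * jac A B = (\<Sum>t\<in>residues. A t * B (1 - t * y))" if y: "\<not> int p dvd y" for y
  proof -
    have "jac A B = (\<Sum>t\<in>residues. A (y * t + 0) * B (1 - (y * t + 0)))"
      unfolding jac_def by (rule sum_residues_affine[OF periodic_jac[OF A B] y, symmetric])
    also have "\<dots> = (\<Sum>t\<in>residues. A y * (A t * B (1 - t * y)))"
      by (simp add: mchar_mult[OF A] mult_ac)
    finally have "cnj (A y) * jac A B = (cnj (A y) * A y) * (\<Sum>t\<in>residues. A t * B (1 - t * y))"
      by (simp add: sum_distrib_left mult_ac)
    then show ?thesis unfolding mchar_cnj_mult[OF A y] by simp
  qed
  have m: "0 \<in> residues" using p_gt_2 by simp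
  have "cnj (jac A B) * jac A B = (\<Sum>y\<in>residues. cnj (B (1 - y)) * (cnj (A y) * jac A B))"
  proof -
    have "cnj (jac A B) * z = (\<Sum>y\<in>residues. cnj (B (1 - y)) * (cnj (A y) * z))" for z
      unfolding jac_def cnj_sum sum_distrib_right by (intro sum.cong refl) (simp add: mult_ac)
    then show ?thesis .
  qed
  also have "\<dots> = (\<Sum>y\<in>residues - {0}. cnj (B (1 - y)) * (cnj (A y) * jac A B))"
    by (rule sum_residues_unit) (simp add: mchar_zero_iff[OF A])
  also have "\<dots> = (\<Sum>y\<in>residues - {0}. cnj (B (1 - y)) * (\<Sum>t\<in>residues. A t * B (1 - t * y)))"
    by (intro sum.cong refl) (use inner residues_unit in auto)
  also have "\<dots> = (\<Sum>y\<in>residues - {0}. \<Sum>t\<in>residues. A t * (B (1 - t * y) * cnj (B (1 - y))))"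
    by (simp add: sum_distrib_left mult_ac)
  also have "\<dots> = (\<Sum>t\<in>residues. A t * (\<Sum>y\<in>residues - {0}. B (1 - t * y) * cnj (B (1 - y))))"
    by (subst sum.swap) (simp add: sum_distrib_left)
  also have "\<dots> = (\<Sum>t\<in>residues. A t * ((if [t = 1] (mod int p) then of_nat p else 0) - B t - 1))"
    using m by (simp add: sum_diff1 sum_mchar_pair[OF B b] mchar_1[OF B])
  also have "\<dots> = (\<Sum>t\<in>residues. if t = 1 then of_nat p else 0) - (\<Sum>t\<in>residues. A t * B t) - (\<Sum>t\<in>residues. A t)"
  proof -
    have "A t * ((if [t = 1] (mod int p) then of_nat p else 0) - B t - 1)
       = (if t = 1 then of_nat p else 0) - A t * B t - A t" if "t \<in> residues" for t
    proof -
      have "[t = 1] (mod int p) \<longleftrightarrow> t = 1" using that p_gt_2 by (auto simp: cong_def)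
      then show ?thesis using mchar_1[OF A] by (simp add: algebra_simps)
    qed
    then show ?thesis by (simp add: sum_subtractf)
  qed
  also have "\<dots> = of_nat p"
    using sum_mchar[OF A a] sum_mchar[OF mchar_times[OF A B] ab] p_gt_2 by simp
  finally show ?thesis .
qed

text \<open>The product of two nonresidues is a residue by Euler's criterion, so the value at one nonresidue fixes the values at all.\<close>

lemma quadratic_mchar_eq_Legendre:
  assumes F: "mchar F" and sq: "\<And>x. \<not> int p dvd x \<Longrightarrow> F x * F x = 1" and g: "\<not> int p dvd g" "F g \<noteq> 1"
  shows "F x = of_int (Legendre x p)"
proof -
  have QR: "F x = 1" if x: "\<not> int p dvd x" and q: "QuadRes p x" for x
  proof -
    obtain y where y: "[y\<^sup>2 = x] (mod int p)" using q by (auto simp: QuadRes_def)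
    have "\<not> int p dvd y"
    proof
      assume "int p dvd y"
      then have "int p dvd y\<^sup>2" by (simp add: power2_eq_square)
      then show False using x cong_dvd_iff[OF y] by simp
    qed
    then have "F (y\<^sup>2) = 1" using sq by (simp add: power2_eq_square mchar_mult[OF F])
    then show ?thesis using mchar_cong[OF F y] by simp
  qed
  have nz: "\<not> [x = 0] (mod int p) \<longleftrightarrow> \<not> int p dvd x" for x by (simp add: cong_0_iff)
  have gn: "\<not> QuadRes p g" using QR[OF g(1)] g(2) by blast
  have Fg: "F g = - 1" using sq[OF g(1)] g(2) by (simp add: square_eq_1_iff)
  show ?thesis
  proof (cases "int p dvd x")
    case True
    then show ?thesis by (simp add: Legendre_def cong_0_iff mchar_zero_iff[OF F])
  next
    case False
    show ?thesis
    proof (cases "QuadRes p x")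
      case True
      then show ?thesis using False QR by (simp add: Legendre_def cong_0_iff)
    next
      case nq: False
      have L: "Legendre x p = - 1" "Legendre g p = - 1"
        using nq gn False g(1) by (auto simp: Legendre_def cong_0_iff)
      have xg: "\<not> int p dvd x * g" using False g(1) prime_int_p by (simp add: prime_dvd_mult_iff)
      note ec = euler_criterion[OF prime_p p_gt_2]
      have "[Legendre (x * g) p = (x * g) ^ ((p - 1) div 2)] (mod int p)" by (rule ec)
      moreover have "[x ^ ((p - 1) div 2) * g ^ ((p - 1) div 2) = Legendre x p * Legendre g p] (mod int p)"
        by (intro cong_mult cong_sym[OF ec])
      ultimately have c: "[Legendre (x * g) p = 1] (mod int p)"
        unfolding L power_mult_distrib by (simp add: cong_trans)
      have "QuadRes p (x * g)"
      proof (rule ccontr)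
        assume "\<not> QuadRes p (x * g)"
        then have "Legendre (x * g) p = - 1" using xg by (simp add: Legendre_def cong_0_iff)
        then have "int p dvd 2" using c by (simp add: cong_iff_dvd_diff)
        then show False using p_gt_2 zdvd_imp_le[of "int p" 2] by simp
      qed
      then have "F x * F g = 1" using QR[OF xg] by (simp add: mchar_mult[OF F])
      then have "- F x = 1" unfolding Fg by simp
      then have "F x = - 1" by (metis minus_minus)
      then show ?thesis using L by simp
    qed
  qed
qed

text \<open>The residue \<open>v\<close> has \<open>1 + Legendre v p\<close> square roots.\<close>

lemma sum_squares_residues:
  assumes f: "periodic f"
  shows "(\<Sum>y\<in>residues. f (y\<^sup>2)) = (\<Sum>v\<in>residues. f v * (1 + of_int (Legendre v p)))"
proof -
  have p0: "int p > 0" using p_gt_2 by simp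
  have card: "int (card {y \<in> residues. y\<^sup>2 mod int p = v}) = 1 + Legendre v p" if v: "v \<in> residues" for v
  proof (cases "v = 0")
    case True
    have "{y \<in> residues. y\<^sup>2 mod int p = v} = {0}"
    proof (intro equalityI subsetI)
      fix y assume "y \<in> {y \<in> residues. y\<^sup>2 mod int p = v}"
      then have y: "y \<in> residues" "int p dvd y\<^sup>2" using True by auto
      then have "int p dvd y" using prime_int_p prime_dvd_power by blast
      then show "y \<in> {0}" using y(1) residues_unit[of y] by blast
    qed (use True p0 in auto)
    then show ?thesis using True by (simp add: Legendre_def)
  next
    case False
    then have vu: "\<not> int p dvd v" using v residues_unit by blast
    show ?thesis
    proof (cases "QuadRes p v")
      case True
      then obtain y where y: "[y\<^sup>2 = v] (mod int p)" by (auto simp: QuadRes_def)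
      have yu: "\<not> int p dvd y"
      proof
        assume "int p dvd y"
        then have "int p dvd y\<^sup>2" by (simp add: power2_eq_square)
        then show False using vu cong_dvd_iff[OF y] by simp
      qed
      have "{y \<in> residues. y\<^sup>2 mod int p = v} = {y mod int p, (- y) mod int p}"
      proof (intro equalityI subsetI)
        fix z assume "z \<in> {y \<in> residues. y\<^sup>2 mod int p = v}"
        then have z: "z \<in> residues" "z\<^sup>2 mod int p = v" by auto
        then have "[z\<^sup>2 = y\<^sup>2] (mod int p)" using y v by (simp add: cong_def)
        then have "int p dvd z\<^sup>2 - y\<^sup>2" by (simp add: cong_iff_dvd_diff)
        then have "int p dvd (z - y) * (z + y)" by (simp add: power2_eq_square algebra_simps)
        then have "int p dvd z - y \<or> int p dvd z - (- y)" using prime_int_p by (simp add: prime_dvd_mult_iff)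
        then have "[z = y] (mod int p) \<or> [z = - y] (mod int p)" by (simp only: cong_iff_dvd_diff)
        then show "z \<in> {y mod int p, (- y) mod int p}" using z(1) by (auto simp: cong_def)
      next
        fix z assume "z \<in> {y mod int p, (- y) mod int p}"
        then have "z\<^sup>2 mod int p = y\<^sup>2 mod int p" "z \<in> residues"
          using p0 by (auto simp: power_mod)
        then show "z \<in> {y \<in> residues. y\<^sup>2 mod int p = v}" using y v by (simp add: cong_def)
      qed
      moreover have "y mod int p \<noteq> (- y) mod int p"
      proof
        assume "y mod int p = (- y) mod int p"
        then have "int p dvd 2 * y" by (simp flip: cong_def add: cong_iff_dvd_diff)
        then have "int p dvd 2" using yu prime_int_p by (simp add: prime_dvd_mult_iff)
        then show False using p_gt_2 zdvd_imp_le[of "int p" 2] by simp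
      qed
      ultimately show ?thesis using True vu by (simp add: Legendre_def cong_0_iff)
    next
      case False
      have "{y \<in> residues. y\<^sup>2 mod int p = v} = {}"
      proof (rule equals0I)
        fix y assume "y \<in> {y \<in> residues. y\<^sup>2 mod int p = v}"
        then have "[y\<^sup>2 = v] (mod int p)" by (auto simp: cong_def)
        then show False using False by (auto simp: QuadRes_def)
      qed
      then have "card {y \<in> residues. y\<^sup>2 mod int p = v} = 0" by (simp only: card.empty)
      then show ?thesis using False vu by (simp only: Legendre_def cong_0_iff) simp
    qed
  qed
  have "(\<Sum>y\<in>residues. f (y\<^sup>2)) = (\<Sum>v\<in>residues. \<Sum>y\<in>{y \<in> residues. y\<^sup>2 mod int p = v}. f (y\<^sup>2))"
    by (rule sum.group[symmetric]) (use p0 in auto)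
  also have "\<dots> = (\<Sum>v\<in>residues. \<Sum>y\<in>{y \<in> residues. y\<^sup>2 mod int p = v}. f v)"
    by (intro sum.cong refl periodicD[OF f]) (auto simp: cong_def)
  also have "\<dots> = (\<Sum>v\<in>residues. f v * (1 + of_int (Legendre v p)))"
  proof (intro sum.cong refl)
    fix v assume "v \<in> residues"
    from card[OF this]
    have "(of_int (int (card {y \<in> residues. y\<^sup>2 mod int p = v})) :: complex) = of_int (1 + Legendre v p)"
      by (rule arg_cong)
    then have "(of_nat (card {y \<in> residues. y\<^sup>2 mod int p = v}) :: complex) = 1 + of_int (Legendre v p)"
      unfolding of_int_of_nat_eq of_int_add of_int_1 .
    then show "(\<Sum>y\<in>{y \<in> residues. y\<^sup>2 mod int p = v}. f v) = f v * (1 + of_int (Legendre v p))"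
      unfolding sum_constant by (simp only: mult.commute)
  qed
  finally show ?thesis .
qed

lemma not_dvd_minus1: "\<not> int p dvd - 1" and not_dvd_1: "\<not> int p dvd 1" and not_dvd_2: "\<not> int p dvd 2"
  and not_dvd_4: "\<not> int p dvd 4"
proof -
  show "\<not> int p dvd 1" "\<not> int p dvd - 1" using prime_int_p not_prime_unit by auto
  show 2: "\<not> int p dvd 2" using p_gt_2 zdvd_imp_le[of "int p" 2] by auto
  have "(4::int) = 2 * 2" by simp
  then show "\<not> int p dvd 4" using 2 prime_int_p by (metis prime_dvd_mult_iff)
qed

context
  fixes F :: "int \<Rightarrow> complex"
  assumes F: "mchar F" and Fsq: "\<And>x. \<not> int p dvd x \<Longrightarrow> F x * F x = 1"
    and Fnt: "\<exists>g. \<not> int p dvd g \<and> F g \<noteq> 1"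
begin

lemma F_Legendre: "F x = of_int (Legendre x p)"
  using Fnt quadratic_mchar_eq_Legendre[OF F Fsq] by blast

lemma F_cnj: "cnj (F x) = F x"
  unfolding F_Legendre by simp

lemma sum_squares_F: "periodic f \<Longrightarrow> (\<Sum>y\<in>residues. f (y\<^sup>2)) = (\<Sum>v\<in>residues. f v * (1 + F v))"
  unfolding F_Legendre by (rule sum_squares_residues)

lemma periodic_comp_affine:
  assumes "mchar A"
  shows "periodic (\<lambda>x. A (u * x + c))"
  by (intro periodicI mchar_cong[OF assms] cong_add cong_mult) auto

text \<open>The substitution \<open>y = 2 x - 1\<close> turns \<open>4 x (1 - x)\<close> into \<open>1 - y\<^sup>2\<close>, and the sum over squares splits off \<open>J F A\<close>.\<close>

lemma jac_duplication:
  assumes A: "mchar A" and g: "\<not> int p dvd g" "A g \<noteq> 1"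
  shows "A 4 * jac A A = jac F A"
proof -
  have per: "periodic (\<lambda>y. A (1 - y))"
    using periodic_comp_affine[OF A, of "-1" 1] by simp
  have "A 4 * jac A A = (\<Sum>x\<in>residues. A (1 - (2 * x + - 1)\<^sup>2))"
    unfolding jac_def sum_distrib_left mchar_mult[OF A, symmetric]
    by (simp add: power2_eq_square algebra_simps)
  also have "\<dots> = (\<Sum>y\<in>residues. A (1 - y\<^sup>2))"
  proof (rule sum_residues_affine[OF _ not_dvd_2])
    show "periodic (\<lambda>y. A (1 - y\<^sup>2))"
      by (intro periodicI mchar_cong[OF A] cong_diff cong_pow) auto
  qed
  also have "\<dots> = (\<Sum>v\<in>residues. A (1 - v) * (1 + F v))" by (rule sum_squares_F[OF per])
  also have "\<dots> = (\<Sum>v\<in>residues. A (- 1 * v + 1)) + jac F A"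
    by (simp add: jac_def sum.distrib distrib_left mult.commute)
  also have "(\<Sum>v\<in>residues. A (- 1 * v + 1)) = (\<Sum>v\<in>residues. A v)"
    by (rule sum_residues_affine[OF mchar_periodic[OF A] not_dvd_minus1])
  also have "\<dots> = 0" by (rule sum_mchar[OF A g])
  finally show ?thesis by simp
qed

end

end

section \<open>Jacobi sums of cubic characters\<close>

text \<open>The orbits of a map of order three without fixed points have three elements.\<close>

lemma card_dvd_3_if_free_rotation:
  assumes fin: "finite A" and g: "\<And>x. x \<in> A \<Longrightarrow> g x \<in> A" "\<And>x. x \<in> A \<Longrightarrow> g (g (g x)) = x" "\<And>x. x \<in> A \<Longrightarrow> g x \<noteq> x"
  shows "3 dvd card A"
proof -
  define orb where "orb = (\<lambda>x. {x, g x, g (g x)})"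
  have c3: "card (orb x) = 3" if "x \<in> A" for x
  proof -
    have "g x \<noteq> x" "g (g x) \<noteq> g x" using g that by auto
    moreover have "g (g x) \<noteq> x" using g(2)[OF that] \<open>g x \<noteq> x\<close> by auto
    ultimately show ?thesis by (auto simp: orb_def)
  qed
  have orb_eq: "orb y = orb x" if "x \<in> A" "y \<in> orb x" for x y
    using that g(2)[OF that(1)] by (auto simp: orb_def)
  have un: "\<Union> (orb ` A) = A" using g(1) by (auto simp: orb_def)
  have "3 * card (orb ` A) = card (\<Union> (orb ` A))"
  proof (rule card_partition)
    fix c1 c2 assume c: "c1 \<in> orb ` A" "c2 \<in> orb ` A" "c1 \<noteq> c2"
    show "c1 \<inter> c2 = {}"
    proof (rule ccontr)
      assume "c1 \<inter> c2 \<noteq> {}"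
      then obtain z where "z \<in> c1" "z \<in> c2" by auto
      then have "c1 = orb z" "c2 = orb z" using c orb_eq by blast+
      then show False using c by simp
    qed
  qed (use fin c3 un in auto)
  then show ?thesis unfolding un by (metis dvd_triv_left)
qed

lemma int_cube_root_independent:
  fixes w :: complex
  assumes w: "w\<^sup>2 + w + 1 = 0" and e: "of_int a + of_int b * w = 0"
  shows "a = 0" "b = 0"
proof -
  have "Im w \<noteq> 0"
  proof
    assume "Im w = 0"
    then have "Re (w\<^sup>2 + w + 1) = (Re w + 1/2)\<^sup>2 + 3/4" by (simp add: power2_eq_square algebra_simps)
    moreover have "(Re w + 1/2)\<^sup>2 \<ge> 0" by simp
    ultimately show False unfolding w by simp
  qed
  moreover have "Im (of_int a + of_int b * w) = of_int b * Im w" by simp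
  ultimately show "b = 0" unfolding e by simp
  then show "a = 0" using e by simp
qed

lemma cube_root_value:
  fixes w z :: complex
  assumes w: "w\<^sup>2 + w + 1 = 0" and z: "z ^ 3 = 1"
  shows "z = 1 \<or> z = w \<or> z = w\<^sup>2"
proof -
  note w3 = cube_root(1)[OF w]
  have "(z - 1) * ((z - w) * (z - w\<^sup>2)) = z ^ 3 - 1 - (w\<^sup>2 + w + 1) * (z\<^sup>2 - z) + (w ^ 3 - 1) * (z - 1)"
    by (simp add: algebra_simps power2_eq_square power3_eq_cube)
  then have "(z - 1) * ((z - w) * (z - w\<^sup>2)) = 0" unfolding w w3 z by simp
  then show ?thesis by auto
qed

context odd_prime
begin

text \<open>The value is both a square root and a cube root of \<open>1\<close>.\<close>

lemma cubic_mchar_minus1: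
  assumes C: "mchar C" "\<And>x. \<not> int p dvd x \<Longrightarrow> C x ^ 3 = 1"
  shows "C (- 1) = 1"
proof -
  have "C (- 1) * C (- 1) = 1" by (rule mchar_minus1_sq[OF C(1)])
  then have "C (- 1) ^ 3 = C (- 1)" by (simp add: power3_eq_cube)
  then show ?thesis using C(2)[OF not_dvd_minus1] by simp
qed

text \<open>With \<open>B = F cnj C\<close>, both sides are related to sums over squares. First \<open>J C (C L)\<close> equals \<open>J C (C cnj L)\<close> by inversion, so
twice its value is a sum over squares, since \<open>cnj L = L F\<close>; substitutions transform it into a sum of \<open>B v B (1 - v) C (2 v - 1)\<close>, which again becomes a
sum over squares and gives \<open>cnj (C 4) J C (C L) = J B B\<close>. The duplication formula for \<open>B\<close> and for \<open>C\<close> closes the circle, because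
\<open>J F B = J F C\<close> by inversion.\<close>

lemma jac_quartic_twist:
  assumes F: "mchar F" "\<And>x. \<not> int p dvd x \<Longrightarrow> F x * F x = 1" "\<exists>g. \<not> int p dvd g \<and> F g \<noteq> 1" "F (- 1) = 1"
    and C: "mchar C" "\<And>x. \<not> int p dvd x \<Longrightarrow> C x ^ 3 = 1" "\<not> int p dvd g" "C g \<noteq> 1"
    and L: "mchar L" "\<And>x. L x * L x = F x" and CF: "\<not> int p dvd h" "F h * cnj (C h) \<noteq> 1"
  shows "jac C (\<lambda>x. C x * L x) = jac C C"
proof -
  define B where "B = (\<lambda>x. F x * cnj (C x))"
  have mC': "mchar (\<lambda>x. cnj (C x))" by (rule mchar_cnj[OF C(1)])
  have mB: "mchar B" unfolding B_def by (rule mchar_times[OF F(1) mC'])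
  have mCL: "mchar (\<lambda>x. C x * L x)" by (rule mchar_times[OF C(1) L(1)])
  have Fc: "cnj (F x) = F x" for x using F_cnj[OF F(1) F(2)] F(3) by blast
  have unit: "C x * cnj (C x) = 1" "cnj (C x) * C x = 1" if "\<not> int p dvd x" for x
    using mchar_cnj_mult[OF C(1) that] by (simp_all add: mult.commute)
  have Csq: "C x * C x = cnj (C x)" if "\<not> int p dvd x" for x
  proof -
    have "C x * C x = C x * C x * (C x * cnj (C x))" using unit[OF that] by simp
    also have "\<dots> = C x ^ 3 * cnj (C x)" by (simp add: power3_eq_cube)
    finally show ?thesis using C(2)[OF that] by simp
  qed
  have Csq': "cnj (C x) * cnj (C x) = C x" if "\<not> int p dvd x" for x
    using arg_cong[OF Csq[OF that], of cnj] by simp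
  have zero: "C x = 0" "L x = 0" "F x = 0" if "int p dvd x" for x
    using that by (auto simp: mchar_zero_iff[OF C(1)] mchar_zero_iff[OF L(1)] mchar_zero_iff[OF F(1)])
  have L': "cnj (L x) = L x * F x" for x
  proof (cases "int p dvd x")
    case False
    have "cnj (L x) = cnj (L x) * (F x * F x)" using F(2)[OF False] by simp
    also have "\<dots> = (cnj (L x) * L x) * (L x * F x)" unfolding L(2)[of x, symmetric] by (simp add: mult_ac)
    finally show ?thesis using mchar_cnj_mult[OF L(1) False] by simp
  qed (simp add: zero)
  have C1: "C (- 1) = 1" by (rule cubic_mchar_minus1[OF C(1,2)])
  have C4: "C 4 * (C 4 * C 4) = 1" using C(2)[OF not_dvd_4] by (simp add: power3_eq_cube mult.assoc)
  have F4: "F 4 = 1"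
    using F(2)[OF not_dvd_2] mchar_mult[OF F(1), of 2 2] by simp
  have B4: "B 4 = cnj (C 4)" by (simp add: B_def F4)
  have eq: "jac C (\<lambda>x. C x * L x) = jac C (\<lambda>x. C x * cnj (L x))"
  proof -
    have "jac C (\<lambda>x. C x * L x) = jac C (\<lambda>x. cnj (C x * (C x * L x)))"
      using jac_inversion'[OF C(1) mCL] C1 by simp
    also have "\<dots> = jac C (\<lambda>x. C x * cnj (L x))"
    proof (rule jac_cong_units)
      fix x assume x: "\<not> int p dvd x"
      have "cnj (C x * (C x * L x)) = (cnj (C x) * cnj (C x)) * cnj (L x)" by simp
      then show "cnj (C x * (C x * L x)) = C x * cnj (L x)" unfolding Csq'[OF x] .
    qed (intro refl C mchar_cnj mchar_times L)+
    finally show ?thesis .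
  qed
  \<comment> \<open>Both \<open>C L\<close> and \<open>C cnj L = C L F\<close> occur, so the factor \<open>1 + F\<close> makes the sum one over squares.\<close>
  define f where "f = (\<lambda>v. C v * C (1 - v) * L v)"
  have perf: "periodic f" unfolding f_def
    using periodicD[OF periodic_jac[OF C(1) C(1)]] mchar_cong[OF L(1)]
    by (intro periodicI) metis
  have "2 * jac C (\<lambda>x. C x * L x) = jac (\<lambda>x. C x * L x) C + jac (\<lambda>x. C x * cnj (L x)) C"
    using eq jac_commute[OF C(1) mCL] jac_commute[OF C(1) mchar_times[OF C(1) mchar_cnj[OF L(1)]]] by simp
  also have "\<dots> = (\<Sum>v\<in>residues. f v * (1 + F v))"
    unfolding jac_def f_def sum.distrib[symmetric] L' by (simp add: algebra_simps)
  also have "\<dots> = (\<Sum>s\<in>residues. f (s\<^sup>2))"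
    by (rule sum_squares_F[OF F(1,2,3) perf, symmetric])
  also have "\<dots> = (\<Sum>s\<in>residues. B s * (C (1 - s) * C (1 + s)))"
  proof (intro sum.cong refl)
    fix s
    have c: "C (s\<^sup>2) = cnj (C s)"
      using Csq[of s] zero(1)[of s] by (cases "int p dvd s") (auto simp: power2_eq_square mchar_mult[OF C(1)])
    have l: "L (s\<^sup>2) = F s" using L(2) by (simp add: power2_eq_square mchar_mult[OF L(1)])
    have "1 - s\<^sup>2 = (1 - s) * (1 + s)" by (simp add: power2_eq_square algebra_simps)
    then show "f (s\<^sup>2) = B s * (C (1 - s) * C (1 + s))"
      unfolding f_def c l B_def by (simp add: mchar_mult[OF C(1)])
  qed
  also have "\<dots> = (\<Sum>u\<in>residues. B (u - 1) * (C (2 - u) * C u))"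
  proof -
    let ?k = "\<lambda>u. B (u - 1) * (C (2 - u) * C u)"
    have per: "periodic ?k"
    proof (rule periodicI)
      fix x y assume xy: "[x = y] (mod int p)"
      have "[x - 1 = y - 1] (mod int p)" "[2 - x = 2 - y] (mod int p)" using xy by (auto intro: cong_diff)
      then show "?k x = ?k y" using xy mchar_cong[OF mB] mchar_cong[OF C(1)] by metis
    qed
    have "(\<Sum>s\<in>residues. ?k (1 * s + 1)) = (\<Sum>u\<in>residues. ?k u)"
      by (rule sum_residues_affine[OF per not_dvd_1])
    then show ?thesis by (simp add: algebra_simps)
  qed
  \<comment> \<open>The substitution \<open>u = 1/v\<close>.\<close>
  also have "\<dots> = (\<Sum>v\<in>residues. B v * B (1 - v) * C (2 * v - 1))"
  proof -
    let ?k = "\<lambda>u. B (u - 1) * (C (2 - u) * C u)"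
    have per: "periodic ?k"
    proof (rule periodicI)
      fix x y assume xy: "[x = y] (mod int p)"
      have "[x - 1 = y - 1] (mod int p)" "[2 - x = 2 - y] (mod int p)" using xy by (auto intro: cong_diff)
      then show "?k x = ?k y" using xy mchar_cong[OF mB] mchar_cong[OF C(1)] by metis
    qed
    have "?k (recip v) = B v * B (1 - v) * C (2 * v - 1)" for v
    proof (cases "int p dvd v")
      case True
      then show ?thesis using dvd_recip[OF True] by (simp add: zero B_def)
    next
      case False
      have "[v * (recip v - 1) = 1 - v] (mod int p)" "[v * (2 - recip v) = 2 * v - 1] (mod int p)"
        using cong_diff[OF recip[OF False] cong_refl, of v] cong_diff[OF cong_refl recip[OF False], of "2 * v"]
        by (simp_all add: algebra_simps)
      then have b: "B v * B (recip v - 1) = B (1 - v)" and c: "C v * C (2 - recip v) = C (2 * v - 1)"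
        using mchar_cong[OF mB] mchar_cong[OF C(1)] by (simp_all flip: mchar_mult[OF mB] mchar_mult[OF C(1)])
      have Bv: "cnj (B v) * B v = 1" by (rule mchar_cnj_mult[OF mB False])
      have "?k (recip v) = (cnj (B v) * B v) * B (recip v - 1) * ((cnj (C v) * C v) * C (2 - recip v)) * cnj (C v)"
        using Bv unit[OF False] mchar_recip_cnj[OF C(1) False] by simp
      also have "\<dots> = cnj (B v) * cnj (C v) * cnj (C v) * (B v * B (recip v - 1)) * (C v * C (2 - recip v))"
        by (simp only: mult_ac)
      also have "\<dots> = cnj (B v) * (cnj (C v) * cnj (C v)) * B (1 - v) * C (2 * v - 1)" unfolding b c by simp
      also have "cnj (B v) * (cnj (C v) * cnj (C v)) = B v"
        unfolding Csq'[OF False] B_def by (simp add: Fc mult.assoc Csq[OF False])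
      finally show ?thesis .
    qed
    then show ?thesis using sum_residues_recip[OF per] by simp
  qed
  finally have T: "2 * jac C (\<lambda>x. C x * L x) = (\<Sum>v\<in>residues. B v * B (1 - v) * C (2 * v - 1))" .
  have "B 4 * (2 * jac C (\<lambda>x. C x * L x)) = (\<Sum>v\<in>residues. B (1 - (2 * v + - 1)\<^sup>2) * C (2 * v + - 1))"
  proof -
    have "4 * (v * (1 - v)) = 1 - (2 * v + - 1)\<^sup>2" for v :: int by (simp add: power2_eq_square algebra_simps)
    then have e: "B 4 * (B v * B (1 - v) * C (2 * v - 1)) = B (1 - (2 * v + - 1)\<^sup>2) * C (2 * v + - 1)" for v
      by (metis mchar_mult[OF mB] mult.assoc add_uminus_conv_diff)
    show ?thesis unfolding T sum_distrib_left by (intro sum.cong refl e)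
  qed
  also have "\<dots> = (\<Sum>y\<in>residues. B (1 - y\<^sup>2) * C y)"
  proof (rule sum_residues_affine[OF _ not_dvd_2])
    show "periodic (\<lambda>y. B (1 - y\<^sup>2) * C y)"
      by (intro periodicI arg_cong2[of _ _ _ _ "(*)"] mchar_cong[OF mB] mchar_cong[OF C(1)] cong_diff cong_pow) auto
  qed
  also have "\<dots> = (\<Sum>y\<in>residues. cnj (C (y\<^sup>2)) * B (1 - y\<^sup>2))"
  proof (intro sum.cong refl)
    fix y
    have "cnj (C (y\<^sup>2)) = C y"
      using Csq'[of y] zero(1)[of y] by (cases "int p dvd y") (auto simp: power2_eq_square mchar_mult[OF C(1)])
    then show "B (1 - y\<^sup>2) * C y = cnj (C (y\<^sup>2)) * B (1 - y\<^sup>2)" by simp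
  qed
  also have "\<dots> = (\<Sum>v\<in>residues. (cnj (C v) * B (1 - v)) * (1 + F v))"
    by (rule sum_squares_F[OF F(1,2,3) periodic_jac[OF mC' mB]])
  also have "\<dots> = jac (\<lambda>x. cnj (C x)) B + jac B B"
    unfolding jac_def B_def sum.distrib[symmetric] by (intro sum.cong refl) (simp add: algebra_simps)
  also have "jac (\<lambda>x. cnj (C x)) B = jac B B"
  proof -
    have "jac (\<lambda>x. cnj (C x)) B = jac (\<lambda>x. cnj (cnj (C x) * B x)) B"
      using jac_inversion[OF mC' mB] by (simp add: B_def F(4) C1)
    also have "\<dots> = jac B B"
    proof (rule jac_cong_units)
      fix x assume x: "\<not> int p dvd x"
      have "cnj (cnj (C x) * B x) = F x * (C x * C x)" by (simp add: B_def Fc mult_ac)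
      then show "cnj (cnj (C x) * B x) = B x" unfolding Csq[OF x] by (simp add: B_def)
    qed (intro refl mB mchar_cnj mchar_times mC')+
    finally show ?thesis .
  qed
  finally have 1: "cnj (C 4) * jac C (\<lambda>x. C x * L x) = jac B B" unfolding B4 by simp
  have 2: "cnj (C 4) * jac B B = jac F B"
    using jac_duplication[OF F(1,2,3) mB CF(1)] CF(2) unfolding B4 by (simp add: B_def)
  have 3: "jac F B = jac F C"
  proof -
    have "jac F B = jac F (\<lambda>x. cnj (F x * B x))" using jac_inversion'[OF F(1) mB] F(4) by simp
    also have "\<dots> = jac F C"
    proof (rule jac_cong_units)
      fix x assume x: "\<not> int p dvd x"
      have "cnj (F x * B x) = (F x * F x) * C x" by (simp add: B_def Fc mult_ac)
      then show "cnj (F x * B x) = C x" using F(2)[OF x] by simp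
    qed (intro refl mB mchar_cnj mchar_times F C)+
    finally show ?thesis .
  qed
  have 4: "C 4 * jac C C = jac F C" by (rule jac_duplication[OF F(1,2,3) C(1,3,4)])
  have "jac C (\<lambda>x. C x * L x) = (C 4 * C 4) * (cnj (C 4) * (cnj (C 4) * jac C (\<lambda>x. C x * L x)))"
    using unit(1)[OF not_dvd_4] by (simp add: mult_ac) (metis mult.assoc mult.left_commute mult_1_right)
  also have "\<dots> = (C 4 * (C 4 * C 4)) * jac C C" unfolding 1 2 3 4[symmetric] by (simp only: mult_ac)
  finally show ?thesis unfolding C4 by simp
qed

text \<open>The form is the norm of \<open>X + Y w\<close>.\<close>

lemma cubic_norm_form:
  fixes w :: complex
  assumes w: "w\<^sup>2 + w + 1 = 0" and J: "cnj J * J = of_nat p" "J = of_int X + of_int Y * w"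
  shows "int p = X\<^sup>2 - X * Y + Y\<^sup>2"
proof -
  note w3 = cube_root(1)[OF w]
  have "w * cnj w = 1" using complex_norm_square[of w] cube_root(2)[OF w] by simp
  then have "w\<^sup>2 * (w * cnj w) = w\<^sup>2" by simp
  then have "w ^ 3 * cnj w = w\<^sup>2" by (simp add: power2_eq_square power3_eq_cube mult.assoc)
  then have cw: "cnj w = w\<^sup>2" unfolding w3 by simp
  have "cnj J * J = (of_int X + of_int Y * w\<^sup>2) * (of_int X + of_int Y * w)" unfolding J(2) using cw by simp
  also have "\<dots> = of_int (X\<^sup>2 - X * Y + Y\<^sup>2) + (w\<^sup>2 + w + 1) * of_int (X * Y) + (w ^ 3 - 1) * of_int (Y\<^sup>2)"
    by (simp add: algebra_simps power2_eq_square power3_eq_cube)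
  finally have "(of_nat p :: complex) = of_int (X\<^sup>2 - X * Y + Y\<^sup>2)" unfolding w w3 J(1) by simp
  then show ?thesis by (metis of_int_eq_iff of_int_of_nat_eq)
qed

context
  fixes w :: complex and C :: "int \<Rightarrow> complex" and g :: int
  assumes w: "w\<^sup>2 + w + 1 = 0"
    and C: "mchar C" "\<And>x. \<not> int p dvd x \<Longrightarrow> C x ^ 3 = 1" "\<not> int p dvd g" "C g \<noteq> 1"
begin

lemma w_square: "w\<^sup>2 = - 1 - w"
proof -
  have "w\<^sup>2 = (w\<^sup>2 + w + 1) - 1 - w" by simp
  then show ?thesis unfolding w by simp
qed

lemma w_distinct: "w \<noteq> 1" "w\<^sup>2 \<noteq> 1" "w \<noteq> w\<^sup>2" "w \<noteq> 0" "w\<^sup>2 \<noteq> 0"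
proof -
  have i: "a = 0 \<and> b = 0" if "of_int a + of_int b * w = 0" for a b
    using int_cube_root_independent[OF w that] by blast
  note w2 = w_square
  show "w \<noteq> 1" using i[of "-1" 1] by auto
  show "w\<^sup>2 \<noteq> 1"
  proof
    assume "w\<^sup>2 = 1"
    then have "of_int 2 + of_int 1 * w = w\<^sup>2 + w + 1" by simp
    then show False using i[of 2 1] unfolding w by simp
  qed
  show "w \<noteq> w\<^sup>2" unfolding w2 using i[of 1 2] by (auto simp: algebra_simps)
  show "w \<noteq> 0" "w\<^sup>2 \<noteq> 0" using i[of 0 1] by auto
qed

text \<open>Sorting by the values of \<open>C\<close> exhibits such a sum as an element of \<open>\<int>[w]\<close>.\<close>

lemma sum_over_cubic_values:
  fixes h :: "int \<Rightarrow> int" and k :: "int \<Rightarrow> int"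
  assumes "finite S"
  shows "(\<Sum>x\<in>S. C (k x) * of_int (h x)) =
    of_int (\<Sum>x | x \<in> S \<and> C (k x) = 1. h x) + of_int (\<Sum>x | x \<in> S \<and> C (k x) = w. h x) * w
     + of_int (\<Sum>x | x \<in> S \<and> C (k x) = w\<^sup>2. h x) * w\<^sup>2"
proof -
  have v: "C (k x) = 0 \<or> C (k x) = 1 \<or> C (k x) = w \<or> C (k x) = w\<^sup>2" for x
    using cube_root_value[OF w C(2)] mchar_zero_iff[OF C(1)] by blast
  have e: "C (k x) * of_int (h x) = (if C (k x) = 1 then of_int (h x) else 0)
      + (if C (k x) = w then of_int (h x) * w else 0) + (if C (k x) = w\<^sup>2 then of_int (h x) * w\<^sup>2 else 0)" for x
    using v[of x] w_distinct by auto
  have f: "(\<Sum>x\<in>S. if P x then of_int (h x) * z else 0) = of_int (\<Sum>x | x \<in> S \<and> P x. h x) * z" for P and z :: complex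
  proof -
    have "(\<Sum>x\<in>S. if P x then of_int (h x) * z else 0) = (\<Sum>x\<in>{x \<in> S. P x}. of_int (h x) * z)"
      using assms by (simp add: sum.inter_filter)
    then show ?thesis by (simp add: sum_distrib_right)
  qed
  show ?thesis unfolding e sum.distrib f f[of _ 1, unfolded mult_1_right] ..
qed

lemma C_minus1: "C (- 1) = 1"
  by (rule cubic_mchar_minus1[OF C(1,2)])

lemma C_sq_nontrivial: "C g * C g \<noteq> 1"
proof
  assume e: "C g * C g = 1"
  then have "C g ^ 3 = C g" by (simp add: power3_eq_cube)
  then show False using C by simp
qed

text \<open>The map \<open>x \<mapsto> 1 / (1 - x)\<close> has order three and changes \<open>x (1 - x)\<close> by minus a cube. Its fixed points satisfy \<open>x (1 - x) = 1\<close>, so they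
have the value \<open>1\<close>.\<close>

lemma rotation_class_dvd_3:
  assumes v: "v \<noteq> 0" "v \<noteq> 1"
  shows "3 dvd card {x \<in> residues. C (x * (1 - x)) = v}"
proof (rule card_dvd_3_if_free_rotation)
  let ?A = "{x \<in> residues. C (x * (1 - x)) = v}"
  let ?g = "\<lambda>x. recip (1 - x) mod int p"
  have p0: "int p > 0" using p_gt_2 by simp
  show "finite ?A" by (rule finite_subset[of _ residues]) auto
  have A: "x \<in> residues" "\<not> int p dvd x" "\<not> int p dvd 1 - x" "C (x * (1 - x)) = v" if "x \<in> ?A" for x
    using that v(1) mchar_zero_iff[OF C(1), of "x * (1 - x)"] by auto
  have gx: "[?g x * (1 - x) = 1] (mod int p)" if "x \<in> ?A" for x
    using recip[OF A(3)[OF that]] by (simp add: cong_def mod_mult_right_eq mult.commute)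
  have g1: "[(1 - ?g x) * (1 - x) = - x] (mod int p)" if "x \<in> ?A" for x
  proof -
    have "[(1 - x) - ?g x * (1 - x) = (1 - x) - 1] (mod int p)" using gx[OF that] by (intro cong_diff) auto
    then show ?thesis by (simp add: algebra_simps)
  qed
  have inA: "?g x \<in> ?A" if x: "x \<in> ?A" for x
  proof -
    have "[(?g x * (1 - x)) * ((1 - ?g x) * (1 - x)) * (1 - x) = 1 * (- x) * (1 - x)] (mod int p)"
      by (intro cong_mult gx g1 x cong_refl)
    moreover have "z * (1 - x) * ((1 - z) * (1 - x)) * (1 - x) = (z * (1 - z)) * (1 - x) ^ 3" for z
      by (simp only: power3_eq_cube mult_ac)
    moreover have "1 * (- x) * (1 - x) = - 1 * (x * (1 - x))" by simp
    ultimately have "[(?g x * (1 - ?g x)) * (1 - x) ^ 3 = - 1 * (x * (1 - x))] (mod int p)" by (simp only:)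
    then have "C ((?g x * (1 - ?g x)) * (1 - x) ^ 3) = C (- 1 * (x * (1 - x)))"
      by (rule mchar_cong[OF C(1)])
    moreover have "C ((1 - x) ^ 3) = 1" using C(2)[OF A(3)[OF x]] by (simp add: mchar_power[OF C(1)])
    ultimately have "C (?g x * (1 - ?g x)) = C (x * (1 - x))"
      by (simp only: mchar_mult[OF C(1)] C_minus1 mult_1_left mult_1_right)
    then show ?thesis using A(4)[OF x] p0 by simp
  qed
  then show "\<And>x. x \<in> ?A \<Longrightarrow> ?g x \<in> ?A" .
  show "?g (?g (?g x)) = x" if x: "x \<in> ?A" for x
  proof -
    define z where "z = ?g x"
    define y where "y = ?g z"
    have zA: "z \<in> ?A" and yA: "y \<in> ?A" unfolding z_def y_def using inA x by auto
    have 1: "[z * (1 - x) = 1] (mod int p)" and 2: "[(1 - z) * (1 - x) = - x] (mod int p)"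
      using gx[OF x] g1[OF x] unfolding z_def .
    have 3: "[y * (1 - z) = 1] (mod int p)" using gx[OF zA] unfolding y_def .
    have "[y * ((1 - z) * (1 - x)) = y * (- x)] (mod int p)" using 2 by (intro cong_mult) auto
    moreover have "[y * (1 - z) * (1 - x) = 1 * (1 - x)] (mod int p)" using 3 by (intro cong_mult) auto
    moreover have "y * ((1 - z) * (1 - x)) = y * (1 - z) * (1 - x)" by simp
    ultimately have "[1 * (1 - x) = y * (- x)] (mod int p)" by (metis cong_sym cong_trans)
    then have "[x + 1 * (1 - x) = x + y * (- x)] (mod int p)" by (intro cong_add) auto
    then have "[(1 - y) * x = 1] (mod int p)" by (simp add: algebra_simps cong_sym)
    then have "[recip (1 - y) = x] (mod int p)" by (rule recip_unique)
    then show ?thesis using A(1)[OF x] unfolding y_def z_def by (simp add: cong_def)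
  qed
  show "?g x \<noteq> x" if x: "x \<in> ?A" for x
  proof
    assume "?g x = x"
    then have "[x * (1 - x) = 1] (mod int p)" using gx[OF x] by simp
    then have "C (x * (1 - x)) = 1" using mchar_cong[OF C(1)] mchar_1[OF C(1)] by metis
    then show False using A(4)[OF x] v by simp
  qed
qed

text \<open>Let \<open>n v\<close> count the \<open>x\<close> with \<open>C (x (1 - x)) = v\<close>. The counts at \<open>w\<close> and \<open>w\<^sup>2\<close> are divisible by \<open>3\<close>, and all three add up to
\<open>p - 2\<close>; with the norm equation this gives the congruences for the coordinates of the sum.\<close>

theorem cubic_jacobi_sum:
  obtains y m :: int where "y mod 3 = 1" "int p = y\<^sup>2 + 3 * y * m + 9 * m\<^sup>2" "jac C C = - of_int y + 3 * of_int m * w"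
proof -
  define n where "n = (\<lambda>v. int (card {x \<in> residues. C (x * (1 - x)) = v}))"
  note w2 = w_square
  have "jac C C = (\<Sum>x\<in>residues. C (x * (1 - x)) * of_int 1)"
    by (simp add: jac_def mchar_mult[OF C(1)])
  also have "\<dots> = of_int (n 1) + of_int (n w) * w + of_int (n (w\<^sup>2)) * w\<^sup>2"
    by (subst sum_over_cubic_values) (simp_all add: n_def)
  finally have J: "jac C C = of_int (n 1 - n (w\<^sup>2)) + of_int (n w - n (w\<^sup>2)) * w"
    unfolding w2 by (simp add: algebra_simps)
  have "cnj (jac C C) * jac C C = of_nat p"
    by (rule jac_norm[OF C(1,1,3,4,3,4,3)]) (rule C_sq_nontrivial)
  then have N: "int p = (n 1 - n (w\<^sup>2))\<^sup>2 - (n 1 - n (w\<^sup>2)) * (n w - n (w\<^sup>2)) + (n w - n (w\<^sup>2))\<^sup>2"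
    by (rule cubic_norm_form[OF w _ J])
  have d: "3 dvd n w" "3 dvd n (w\<^sup>2)"
    using rotation_class_dvd_3[of w] rotation_class_dvd_3[of "w\<^sup>2"] w_distinct
    unfolding n_def by (metis int_dvd_int_iff of_nat_numeral)+
  have tot: "n 1 + n w + n (w\<^sup>2) = int p - 2"
  proof -
    let ?S = "\<lambda>v. {x \<in> residues. C (x * (1 - x)) = v}"
    have "residues - {0, 1} = ?S 1 \<union> ?S w \<union> ?S (w\<^sup>2)"
    proof (intro equalityI subsetI)
      fix x assume x: "x \<in> residues - {0, 1}"
      have "\<not> int p dvd x" using x zdvd_imp_le[of "int p" x] by auto
      moreover have "\<not> int p dvd x - 1" using x zdvd_imp_le[of "int p" "x - 1"] by auto
      then have "\<not> int p dvd 1 - x" by (simp add: dvd_diff_commute)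
      ultimately have "\<not> int p dvd x * (1 - x)" using prime_int_p by (simp add: prime_dvd_mult_iff)
      then show "x \<in> ?S 1 \<union> ?S w \<union> ?S (w\<^sup>2)" using cube_root_value[OF w C(2)] x by auto
    next
      fix x assume "x \<in> ?S 1 \<union> ?S w \<union> ?S (w\<^sup>2)"
      then have "x \<in> residues" "C (x * (1 - x)) \<noteq> 0" using w_distinct by auto
      then show "x \<in> residues - {0, 1}" using mchar_0[OF C(1)] by auto
    qed
    then have "card (residues - {0, 1}) = card (?S 1) + card (?S w) + card (?S (w\<^sup>2))"
    proof -
      have fin: "finite (?S v)" for v by (rule finite_subset[of _ residues]) auto
      have "?S 1 \<inter> ?S w = {}" "(?S 1 \<union> ?S w) \<inter> ?S (w\<^sup>2) = {}" using w_distinct by auto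
      then have "card (?S 1 \<union> ?S w \<union> ?S (w\<^sup>2)) = card (?S 1) + card (?S w) + card (?S (w\<^sup>2))"
        using fin by (simp only: card_Un_disjoint finite_Un)
      then show ?thesis using \<open>residues - {0, 1} = _\<close> by (simp only:)
    qed
    moreover have "card (residues - {0, 1}) = p - 2" using p_gt_2 by (subst card_Diff_subset) auto
    ultimately show ?thesis using p_gt_2 unfolding n_def by (simp add: of_nat_diff)
  qed
  obtain a b where ab: "n w = 3 * a" "n (w\<^sup>2) = 3 * b" using d by (auto elim!: dvdE)
  define y m where "y = - (n 1 - n (w\<^sup>2))" and "m = a - b"
  have Ny: "int p = y\<^sup>2 + 3 * y * m + 9 * m\<^sup>2"
    using N unfolding y_def m_def ab by (simp add: power2_eq_square algebra_simps)
  have "y mod 3 = (2 - int p) mod 3"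
  proof -
    have "y = 2 - int p + 3 * (a + 2 * b)" using tot unfolding y_def ab by simp
    then show ?thesis by presburger
  qed
  moreover have "int p mod 3 = (y * y) mod 3"
  proof -
    have "int p = y * y + 3 * (y * m + 3 * m\<^sup>2)" unfolding Ny by (simp add: power2_eq_square algebra_simps)
    then show ?thesis by (simp only: mod_mult_self2)
  qed
  ultimately have "y mod 3 = 1"
  proof -
    assume 1: "y mod 3 = (2 - int p) mod 3" and 2: "int p mod 3 = (y * y) mod 3"
    have "y mod 3 = 0 \<or> y mod 3 = 1 \<or> y mod 3 = 2" by presburger
    then have "y mod 3 = 0 \<and> (y * y) mod 3 = 0 \<or> y mod 3 = 1 \<or> y mod 3 = 2 \<and> (y * y) mod 3 = 1"
      by (auto simp: mod_mult_eq[of y 3 y, symmetric])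
    then show ?thesis using 1 2 by presburger
  qed
  moreover have "jac C C = - of_int y + 3 * of_int m * w"
    unfolding J y_def m_def ab by (simp add: algebra_simps)
  ultimately show ?thesis using Ny that by blast
qed

text \<open>The coordinates are sums of Legendre symbols over the classes \<open>S v\<close> where \<open>C = v\<close>. The classes of \<open>w\<close> and \<open>w\<^sup>2\<close> have equally many
elements and every symbol in them is odd, so the coefficient of \<open>w\<close> is even, and the sum lies in \<open>\<int>[sqrt (- 3)]\<close>; the total of all
symbols gives the congruence modulo \<open>3\<close>.\<close>

theorem cubic_quadratic_jacobi_sum:
  assumes F: "mchar F" "\<And>x. \<not> int p dvd x \<Longrightarrow> F x * F x = 1" "\<not> int p dvd k" "F k \<noteq> 1"
    and CF: "\<not> int p dvd l" "C l * F l \<noteq> 1"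
  obtains c d :: int where "c mod 3 = 1" "int p = c\<^sup>2 + 3 * d\<^sup>2" "jac C F = - (of_int c + of_int d * (w - w\<^sup>2))"
proof -
  note w2 = w_square
  define h where "h = (\<lambda>x. Legendre (1 - x) p)"
  have FL: "F x = of_int (Legendre x p)" for x by (rule quadratic_mchar_eq_Legendre[OF F])
  define S where "S = (\<lambda>v. {x \<in> residues. C x = v})"
  define m where "m = (\<lambda>v. \<Sum>x\<in>S v. h x)"
  have "jac C F = (\<Sum>x\<in>residues. C x * of_int (h x))" by (simp add: jac_def h_def FL)
  also have "\<dots> = of_int (m 1) + of_int (m w) * w + of_int (m (w\<^sup>2)) * w\<^sup>2"
    using sum_over_cubic_values[of residues "\<lambda>x. x" h] by (simp add: m_def S_def)
  finally have J: "jac C F = of_int (m 1 - m (w\<^sup>2)) + of_int (m w - m (w\<^sup>2)) * w"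
    unfolding w2 by (simp add: algebra_simps)
  have "cnj (jac C F) * jac C F = of_nat p" by (rule jac_norm[OF C(1) F(1) C(3,4) F(3,4) CF])
  then have N: "int p = (m 1 - m (w\<^sup>2))\<^sup>2 - (m 1 - m (w\<^sup>2)) * (m w - m (w\<^sup>2)) + (m w - m (w\<^sup>2))\<^sup>2"
    by (rule cubic_norm_form[OF w _ J])
  have units: "residues - {0} = S 1 \<union> S w \<union> S (w\<^sup>2)"
  proof (intro equalityI subsetI)
    fix x assume x: "x \<in> residues - {0}"
    then have "\<not> int p dvd x" using residues_unit by blast
    then show "x \<in> S 1 \<union> S w \<union> S (w\<^sup>2)" using cube_root_value[OF w C(2)] x by (auto simp: S_def)
  next
    fix x assume "x \<in> S 1 \<union> S w \<union> S (w\<^sup>2)"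
    then have "x \<in> residues" "C x \<noteq> 0" using w_distinct by (auto simp: S_def)
    then show "x \<in> residues - {0}" using mchar_0[OF C(1)] by auto
  qed
  have fin: "finite (S v)" for v unfolding S_def by (rule finite_subset[of _ residues]) auto
  have disj: "S 1 \<inter> S w = {}" "(S 1 \<union> S w) \<inter> S (w\<^sup>2) = {}" using w_distinct by (auto simp: S_def)
  have tot: "m 1 + m w + m (w\<^sup>2) = - 1"
  proof -
    have "(\<Sum>x\<in>residues. F (- 1 * x + 1)) = (\<Sum>x\<in>residues. F x)"
      by (rule sum_residues_affine[OF mchar_periodic[OF F(1)] not_dvd_minus1])
    also have "\<dots> = 0" by (rule sum_mchar[OF F(1,3,4)])
    finally have "of_int (\<Sum>x\<in>residues. h x) = (0 :: complex)" by (simp add: h_def FL)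
    then have "(\<Sum>x\<in>residues. h x) = 0" by (simp only: of_int_eq_0_iff)
    moreover have "(\<Sum>x\<in>residues - {0}. h x) = (\<Sum>x\<in>residues. h x) - h 0"
      using p_gt_2 by (subst sum_diff1) auto
    moreover have "h 0 = 1"
    proof -
      have "(of_int (h 0) :: complex) = 1" using mchar_1[OF F(1)] by (simp add: h_def FL)
      then show ?thesis by simp
    qed
    moreover have "(\<Sum>x\<in>residues - {0}. h x) = m 1 + m w + m (w\<^sup>2)"
      unfolding units m_def using disj fin by (simp add: sum.union_disjoint)
    ultimately show ?thesis by simp
  qed
  have parity: "even (m v - int (card (S v)))" if v: "v \<noteq> 1" for v
  proof -
    have "even (h x - 1)" if "x \<in> S v" for x
    proof -
      have "C x = v" "x \<in> residues" using that by (auto simp: S_def)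
      then have "x \<noteq> 1" using v mchar_1[OF C(1)] by auto
      then consider "x = 0" | "x > 1" "x < int p" using \<open>x \<in> residues\<close> by force
      then have "\<not> int p dvd 1 - x"
      proof cases
        case 1
        then show ?thesis using not_dvd_1 by simp
      next
        case 2
        then have "\<not> int p dvd x - 1" using zdvd_imp_le[of "int p" "x - 1"] by auto
        then show ?thesis by (simp add: dvd_diff_commute)
      qed
      then have "\<not> [1 - x = 0] (mod int p)" by (simp add: cong_0_iff)
      then show ?thesis by (auto simp: h_def Legendre_def)
    qed
    then have "even (\<Sum>x\<in>S v. h x - 1)" by (intro dvd_sum) auto
    then show ?thesis by (simp add: m_def sum_subtractf)
  qed
  have cards: "card (S w) = card (S (w\<^sup>2))"
  proof -
    have "(\<Sum>x\<in>residues. C x * of_int 1) = 0" using sum_mchar[OF C(1,3,4)] by simp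
    then have "of_int (int (card (S 1))) + of_int (int (card (S w))) * w + of_int (int (card (S (w\<^sup>2)))) * w\<^sup>2 = 0"
      using sum_over_cubic_values[of residues "\<lambda>x. x" "\<lambda>_. 1"] by (simp add: S_def)
    then have "of_int (int (card (S 1)) - int (card (S (w\<^sup>2)))) + of_int (int (card (S w)) - int (card (S (w\<^sup>2)))) * w = 0"
      unfolding w2 by (simp add: algebra_simps)
    from int_cube_root_independent(2)[OF w this] show ?thesis by simp
  qed
  have "even ((m w - int (card (S w))) - (m (w\<^sup>2) - int (card (S (w\<^sup>2)))))"
    using parity[OF w_distinct(1)] parity[OF w_distinct(2)] by simp
  then have "even (m w - m (w\<^sup>2))" unfolding cards by simp
  then obtain e where e: "m w - m (w\<^sup>2) = 2 * e" by (rule evenE)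
  define c d where "c = - (m 1 - m (w\<^sup>2)) + e" and "d = - e"
  have "jac C F = - (of_int c + of_int d * (w - w\<^sup>2))"
  proof -
    have s: "w - w\<^sup>2 = 1 + 2 * w" unfolding w2 by simp
    show ?thesis unfolding J e c_def d_def s by (simp add: algebra_simps)
  qed
  moreover have "int p = c\<^sup>2 + 3 * d\<^sup>2"
    using N unfolding e c_def d_def by (simp add: power2_eq_square algebra_simps)
  moreover have "c mod 3 = 1"
  proof -
    have "c = 1 + 3 * (m (w\<^sup>2) + e)" using tot e unfolding c_def by simp
    then show ?thesis by (simp only: mod_mult_self2) simp
  qed
  ultimately show ?thesis using that by blast
qed

end

end

section \<open>Quadratic symbols of the entries of a binary form\<close>

text \<open>On integers prime to \<open>6\<close> this is the quadratic symbol of \<open>3\<close>, a character modulo \<open>12\<close>.\<close>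

definition chi12 :: "nat \<Rightarrow> int" where
  "chi12 n = (if n mod 12 = 1 \<or> n mod 12 = 11 then 1 else - 1)"

lemma chi12_mult:
  assumes "coprime a 6" "coprime b 6"
  shows "chi12 (a * b) = chi12 a * chi12 b"
proof -
  have r: "n mod 12 = 1 \<or> n mod 12 = 5 \<or> n mod 12 = 7 \<or> n mod 12 = 11" if "coprime n 6" for n :: nat
  proof -
    have "\<not> 2 dvd n" "\<not> 3 dvd n"
      using coprime_common_divisor[OF that, of 2] coprime_common_divisor[OF that, of 3] by auto
    then show ?thesis by presburger
  qed
  have "(a * b) mod 12 = ((a mod 12) * (b mod 12)) mod 12" by (simp add: mod_mult_eq)
  then show ?thesis using r[OF assms(1)] r[OF assms(2)] unfolding chi12_def by auto
qed

lemma Legendre_3: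
  assumes q: "prime q" "q \<noteq> 2" "q \<noteq> 3"
  shows "Legendre 3 (int q) = chi12 q"
proof -
  have q2: "q > 2" using prime_ge_2_nat[OF q(1)] q(2) by linarith
  have odd: "odd q" using q prime_odd_nat q2 by blast
  have n3: "\<not> 3 dvd q" using q primes_dvd_imp_eq[of 3 q] by auto
  have QR: "Legendre 3 q * Legendre q 3 = (-1) ^ ((3 - 1) div 2 * ((q - 1) div 2))"
    using Quadratic_Reciprocity[of 3 q] q q2 by simp
  have L3: "Legendre (int q) 3 = (if q mod 3 = 1 then 1 else - 1)"
  proof -
    have m: "q mod 3 = 1 \<or> q mod 3 = 2" using n3 by presburger
    show ?thesis
    proof (cases "q mod 3 = 1")
      case True
      then have "int q mod 3 = 1" by (metis of_nat_1 of_nat_mod of_nat_numeral)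
      then have "[1\<^sup>2 = int q] (mod 3)" by (simp add: cong_def)
      then have "QuadRes 3 (int q)" unfolding QuadRes_def by blast
      moreover have "\<not> [int q = 0] (mod 3)" using \<open>int q mod 3 = 1\<close> by (simp add: cong_def)
      ultimately show ?thesis using True by (simp add: Legendre_def)
    next
      case False
      then have "q mod 3 = 2" using m by simp
      then have q3: "int q mod 3 = 2" by (metis of_nat_mod of_nat_numeral)
      have "\<not> QuadRes 3 (int q)"
      proof
        assume "QuadRes 3 (int q)"
        then obtain y :: int where "[y\<^sup>2 = int q] (mod 3)" by (auto simp: QuadRes_def)
        then have y: "(y * y) mod 3 = 2" using q3 by (simp add: cong_def power2_eq_square)
        have "y mod 3 = 0 \<or> y mod 3 = 1 \<or> y mod 3 = 2" by presburger
        then have "(y * y) mod 3 \<noteq> 2" by (auto simp: mod_mult_eq[of y 3 y, symmetric])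
        then show False using y by simp
      qed
      moreover have "\<not> [int q = 0] (mod 3)" using q3 by (simp add: cong_def)
      ultimately show ?thesis using False by (simp add: Legendre_def)
    qed
  qed
  have L: "Legendre 3 (int q) = Legendre (int q) 3 * (-1) ^ ((q - 1) div 2)"
  proof -
    have "Legendre (int q) 3 * Legendre (int q) 3 = 1" unfolding L3 by simp
    then have "Legendre 3 (int q) = Legendre (int q) 3 * (Legendre 3 q * Legendre q 3)" by (simp add: mult_ac)
    then show ?thesis unfolding QR by simp
  qed
  have "even ((q - 1) div 2) \<longleftrightarrow> q mod 4 = 1" using odd by presburger
  then have s: "(-1 :: int) ^ ((q - 1) div 2) = (if q mod 4 = 1 then 1 else - 1)" by simp
  have "q mod 12 = 1 \<or> q mod 12 = 5 \<or> q mod 12 = 7 \<or> q mod 12 = 11" using odd n3 by presburger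
  then show ?thesis
    unfolding L L3 s chi12_def
  proof (elim disjE)
    assume "q mod 12 = 1"
    moreover from this have "q mod 3 = 1" "q mod 4 = 1" by presburger+
    ultimately show "(if q mod 3 = 1 then 1 else - 1) * (if q mod 4 = 1 then 1 else - 1) = (if q mod 12 = 1 \<or> q mod 12 = 11 then 1 else - (1::int))" by simp
  next
    assume "q mod 12 = 5"
    moreover from this have "q mod 3 = 2" "q mod 4 = 1" by presburger+
    ultimately show "(if q mod 3 = 1 then 1 else - 1) * (if q mod 4 = 1 then 1 else - 1) = (if q mod 12 = 1 \<or> q mod 12 = 11 then 1 else - (1::int))" by simp
  next
    assume "q mod 12 = 7"
    moreover from this have "q mod 3 = 1" "q mod 4 = 3" by presburger+
    ultimately show "(if q mod 3 = 1 then 1 else - 1) * (if q mod 4 = 1 then 1 else - 1) = (if q mod 12 = 1 \<or> q mod 12 = 11 then 1 else - (1::int))" by simp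
  next
    assume "q mod 12 = 11"
    moreover from this have "q mod 3 = 2" "q mod 4 = 3" by presburger+
    ultimately show "(if q mod 3 = 1 then 1 else - 1) * (if q mod 4 = 1 then 1 else - 1) = (if q mod 12 = 1 \<or> q mod 12 = 11 then 1 else - (1::int))" by simp
  qed
qed

context odd_prime
begin

context
  fixes F :: "int \<Rightarrow> complex"
  assumes F: "mchar F" and FL: "\<And>x. F x = of_int (Legendre x p)" and p4: "p mod 4 = 1"
begin

text \<open>Reciprocity has no sign since \<open>p \<equiv> 1\<close> modulo \<open>4\<close>.\<close>

lemma Legendre_flip:
  assumes q: "prime q" "odd q" "q \<noteq> p"
  shows "F (int q) = of_int (Legendre (int p) (int q))"
proof -
  have q2: "q > 2" using prime_ge_2_nat[OF q(1)] q(2) by (cases "q = 2") auto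
  have "Legendre q p * Legendre p q = (-1) ^ ((q - 1) div 2 * ((p - 1) div 2))"
    using Quadratic_Reciprocity[of q p] q q2 prime_p p_gt_2 by simp
  moreover have "even ((p - 1) div 2)" using p4 by presburger
  ultimately have "Legendre q p * Legendre p q = 1" by simp
  moreover have "Legendre q p = 0 \<or> Legendre q p = 1 \<or> Legendre q p = - 1"
    by (simp add: Legendre_def)
  ultimately have "Legendre q p = Legendre p q" by auto
  then show ?thesis unfolding FL by simp
qed

lemma mchar_eq_on_prime_factors:
  assumes "n > 0" "coprime n 6" "\<And>q. prime q \<Longrightarrow> q dvd n \<Longrightarrow> F (int q) = of_int (chi12 q)"
  shows "F (int n) = of_int (chi12 n)"
  using assms
proof (induction n rule: less_induct)
  case (less n)
  show ?case
  proof (cases "n = 1")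
    case True
    then show ?thesis using mchar_1[OF F] by (simp add: chi12_def)
  next
    case False
    then obtain q where q: "prime q" "q dvd n" using prime_factor_nat by blast
    then obtain m where m: "n = q * m" by (auto elim: dvdE)
    have m0: "m > 0" "m < n" using less.prems(1) prime_gt_1_nat[OF q(1)] unfolding m by auto
    have cop: "coprime q 6" "coprime m 6" using less.prems(2) unfolding m by auto
    have "F (int m) = of_int (chi12 m)" using less.IH[OF m0(2,1) cop(2)] less.prems(3) unfolding m by simp
    moreover have "F (int q) = of_int (chi12 q)" using less.prems(3) q by blast
    ultimately show ?thesis unfolding m of_nat_mult mchar_mult[OF F] chi12_mult[OF cop] by simp
  qed
qed

lemma mchar_one_on_prime_factors:
  assumes "n > 0" "\<And>q. prime q \<Longrightarrow> q dvd n \<Longrightarrow> F (int q) = 1"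
  shows "F (int n) = 1"
  using assms
proof (induction n rule: less_induct)
  case (less n)
  show ?case
  proof (cases "n = 1")
    case True
    then show ?thesis using mchar_1[OF F] by simp
  next
    case False
    then obtain q where q: "prime q" "q dvd n" using prime_factor_nat by blast
    then obtain m where m: "n = q * m" by (auto elim: dvdE)
    have m0: "m > 0" "m < n" using less.prems(1) prime_gt_1_nat[OF q(1)] unfolding m by auto
    have "F (int m) = 1" using less.IH[OF m0(2,1)] less.prems(2) unfolding m by simp
    moreover have "F (int q) = 1" using less.prems(2) q by blast
    ultimately show ?thesis unfolding m of_nat_mult mchar_mult[OF F] by simp
  qed
qed

lemma F_euler: "[Legendre x p = x ^ ((p - 1) div 2)] (mod int p)"
  by (rule euler_criterion[OF prime_p p_gt_2])

lemma Legendre_values: "Legendre x p = 0 \<or> Legendre x p = 1 \<or> Legendre x p = - 1"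
  by (simp add: Legendre_def)

lemma F_sq: "\<not> int p dvd x \<Longrightarrow> F x * F x = 1"
  unfolding FL by (simp add: Legendre_def cong_0_iff)

lemma not_cong_1_minus_1: "\<not> [1 = - 1] (mod int p)"
proof
  assume "[1 = - 1] (mod int p)"
  then have "int p dvd 2" by (simp add: cong_iff_dvd_diff)
  then show False using not_dvd_2 by simp
qed

lemma F_from_cong:
  assumes "[x ^ ((p - 1) div 2) = s] (mod int p)" "s = 1 \<or> s = - 1"
  shows "F x = of_int s"
proof -
  have c: "[Legendre x p = s] (mod int p)" using F_euler assms(1) by (rule cong_trans)
  have "\<not> [0 = 1] (mod int p)" "\<not> [0 = - 1] (mod int p)"
    using not_dvd_1 by (auto simp: cong_iff_dvd_diff)
  then have "Legendre x p = s"
    using c Legendre_values[of x] assms(2) not_cong_1_minus_1 cong_sym[of 1 "-1" "int p"] cong_sym[of "-1" 1 "int p"] by auto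
  then show ?thesis unfolding FL by simp
qed

lemma F_minus_one: "F (- 1) = 1"
proof -
  have "even ((p - 1) div 2)" using p4 by presburger
  then show ?thesis using F_from_cong[of "-1" 1] by simp
qed

text \<open>For \<open>i\<^sup>2 = - 1\<close> the identity \<open>(1 + i)\<^sup>2 = 2 i\<close> shows \<open>F 2 = F i\<close>, and Euler's criterion evaluates \<open>F i\<close>.\<close>

lemma F_two: "F 2 = (if p mod 8 = 1 then 1 else - 1)"
proof -
  have "Legendre (- 1) p = 1" using F_minus_one unfolding FL by simp
  then have "QuadRes p (- 1)" by (auto simp: Legendre_def split: if_splits)
  then obtain i where i: "[i\<^sup>2 = - 1] (mod int p)" by (auto simp: QuadRes_def)
  have iu: "\<not> int p dvd i"
  proof
    assume "int p dvd i"
    then have "int p dvd i\<^sup>2" by (simp add: power2_eq_square)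
    then show False using cong_dvd_iff[OF i] not_dvd_minus1 by simp
  qed
  have e: "(p - 1) div 2 = 2 * ((p - 1) div 4)" using p4 by presburger
  have "[i ^ ((p - 1) div 2) = (- 1) ^ ((p - 1) div 4)] (mod int p)"
    unfolding e power_mult using i by (rule cong_pow)
  then have Fi: "F i = of_int ((- 1) ^ ((p - 1) div 4))"
    by (rule F_from_cong) (simp add: minus_one_power_iff)
  have "[1 + (2 * i + i\<^sup>2) = 1 + (2 * i + - 1)] (mod int p)" using i by (intro cong_add cong_refl)
  then have "[(1 + i) * (1 + i) = 2 * i] (mod int p)" by (simp add: power2_eq_square algebra_simps)
  then have "F (1 + i) * F (1 + i) = F 2 * F i"
    using mchar_cong[OF F] by (simp flip: mchar_mult[OF F])
  moreover have "F (2 * i) \<noteq> 0" using iu not_dvd_2 prime_int_p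
    by (simp add: mchar_zero_iff[OF F] prime_dvd_mult_iff)
  then have "\<not> int p dvd 1 + i" using calculation mchar_zero_iff[OF F, of "1 + i"] by (auto simp: mchar_mult[OF F])
  ultimately have 2: "F 2 * F i = 1" using F_sq by simp
  have "F 2 = F 2 * (F i * F i)" using F_sq[OF iu] by simp
  also have "\<dots> = F i" using 2 by (simp add: mult.assoc[symmetric])
  also have "\<dots> = (if p mod 8 = 1 then 1 else - 1)"
  proof -
    have "even ((p - 1) div 4) \<longleftrightarrow> p mod 8 = 1" using p4 by presburger
    then show ?thesis unfolding Fi by simp
  qed
  finally show ?thesis .
qed

text \<open>Put \<open>c = 6 k + 1\<close>, so that \<open>p = c\<^sup>2 + 12 l\<^sup>2\<close>. By reciprocity the symbol modulo \<open>p\<close> of a prime factor \<open>q\<close> of \<open>c\<close> is the symbol of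
\<open>p \<equiv> 3 (2 l)\<^sup>2\<close>, hence of \<open>3\<close>, modulo \<open>q\<close>; so \<open>F c\<close> depends on \<open>c\<close> modulo \<open>12\<close>. The symbol of an odd prime factor of \<open>l\<close> is
that of the square \<open>c\<^sup>2\<close> and equals \<open>1\<close>; what remains is a power of \<open>F 2\<close>, governed by \<open>p\<close> modulo \<open>8\<close>.\<close>

theorem quadratic_symbol_product:
  assumes kl: "int p = (6 * k + 1)\<^sup>2 + 3 * (2 * l)\<^sup>2"
  shows "F (6 * k + 1) * F (2 * l) = (-1) powi (k + l)"
proof -
  define c where "c = 6 * k + 1"
  have pc: "int p = c\<^sup>2 + 12 * l\<^sup>2" using kl by (simp add: c_def power2_eq_square)
  have l0: "l \<noteq> 0"
  proof
    assume "l = 0"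
    then have "int p = c\<^sup>2" using pc by simp
    then show False using prime_not_square[OF prime_p] by blast
  qed
  have neg: "F (- x) = F x" for x using mchar_mult[OF F, of "-1" x] F_minus_one by simp
  have abs: "F x = F (int (nat \<bar>x\<bar>))" for x by (cases "x \<ge> 0") (auto simp: neg)
  have c0: "c \<noteq> 0" unfolding c_def by presburger
  have notboth: False if q: "prime q" "int q dvd c" "int q dvd l" for q
  proof -
    obtain a b where "c = int q * a" "l = int q * b" using q by (auto elim!: dvdE)
    then have "int p = int q * (int q * (a\<^sup>2 + 12 * b\<^sup>2))" unfolding pc by (simp add: power2_eq_square algebra_simps)
    then have "int q * int q dvd int p" by (metis dvd_triv_left mult.assoc)
    then have "q * q dvd p" by (metis int_dvd_int_iff of_nat_mult)
    then have "q * q = 1 \<or> q * q = p" using prime_p prime_nat_iff by blast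
    then show False using prime_not_square[OF prime_p, of "int q"] prime_gt_1_nat[OF q(1)]
      by (auto simp: power2_eq_square)
  qed
  have qp: "q \<noteq> p" if q: "prime q" "int q dvd c \<or> int q dvd l" for q
  proof
    assume e: "q = p"
    have "\<bar>c\<bar> < int p" "\<bar>l\<bar> < int p"
    proof -
      have "\<bar>c\<bar> * \<bar>c\<bar> + 12 * (\<bar>l\<bar> * \<bar>l\<bar>) = int p" unfolding pc by (simp add: power2_eq_square)
      moreover have "\<bar>l\<bar> * \<bar>l\<bar> \<ge> \<bar>l\<bar>" "\<bar>c\<bar> * \<bar>c\<bar> \<ge> \<bar>c\<bar>" "\<bar>l\<bar> \<ge> 1" "\<bar>c\<bar> \<ge> 1"
        using l0 c0 mult_left_mono[of 1 "\<bar>l\<bar>" "\<bar>l\<bar>"] mult_left_mono[of 1 "\<bar>c\<bar>" "\<bar>c\<bar>"] by auto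
      ultimately show "\<bar>c\<bar> < int p" "\<bar>l\<bar> < int p" by linarith+
    qed
    then show False using q e zdvd_imp_le[of "int p" "\<bar>c\<bar>"] zdvd_imp_le[of "int p" "\<bar>l\<bar>"] l0 c0 by auto
  qed
  have qc: "F (int q) = of_int (chi12 q)" if q: "prime q" "q dvd nat \<bar>c\<bar>" for q
  proof -
    have qd: "int q dvd c" using q(2) by (simp add: nat_dvd_iff int_dvd_int_iff[symmetric] del: int_dvd_int_iff)
    have "\<not> 2 dvd c" "\<not> 3 dvd c" unfolding c_def by presburger+
    then have q23: "q \<noteq> 2" "q \<noteq> 3" using qd by auto
    have oq: "odd q" using prime_odd_nat[OF q(1)] prime_ge_2_nat[OF q(1)] q23(1) by linarith
    have nl: "\<not> int q dvd 2 * l"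
    proof
      assume "int q dvd 2 * l"
      then have "int q dvd 2 \<or> int q dvd l" using q(1) by (simp add: prime_dvd_mult_iff)
      moreover have "\<not> int q dvd 2" using q(1) q23 zdvd_imp_le[of "int q" 2] prime_ge_2_nat[OF q(1)] by auto
      ultimately show False using notboth[OF q(1) qd] by blast
    qed
    have cp: "[int p = 3 * (2 * l)\<^sup>2] (mod int q)"
    proof -
      have "int q dvd c\<^sup>2" using qd by (simp add: power2_eq_square)
      moreover have "int p - 3 * (2 * l)\<^sup>2 = c\<^sup>2" unfolding pc by (simp add: power2_eq_square)
      ultimately show ?thesis by (simp add: cong_iff_dvd_diff)
    qed
    interpret Q: odd_prime q by standard (use q oq in auto)
    have LQ: "Legendre (int p) q = Legendre 3 q"
    proof -
      have ec: "[Legendre x q = x ^ ((q - 1) div 2)] (mod int q)" for x by (rule euler_criterion[OF q(1) Q.p_gt_2])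
      have "[int p ^ ((q - 1) div 2) = (3 * (2 * l)\<^sup>2) ^ ((q - 1) div 2)] (mod int q)" using cp by (rule cong_pow)
      also have "(3 * (2 * l)\<^sup>2) ^ ((q - 1) div 2) = 3 ^ ((q - 1) div 2) * (2 * l) ^ (q - 1)"
      proof -
        have "2 * ((q - 1) div 2) = q - 1" using oq by presburger
        then show ?thesis by (simp only: power_mult_distrib flip: power_mult)
      qed
      also have "[3 ^ ((q - 1) div 2) * (2 * l) ^ (q - 1) = 3 ^ ((q - 1) div 2) * 1] (mod int q)"
      proof -
        have "q - 1 = Suc (q - 2)" using Q.p_gt_2 by simp
        then have "[(2 * l) ^ (q - 1) = 1] (mod int q)" using Q.recip[OF nl] by (simp add: Q.recip_def)
        then show ?thesis by (intro cong_mult cong_refl)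
      qed
      finally have "[Legendre (int p) q = Legendre 3 q] (mod int q)"
        using ec[of "int p"] ec[of 3] by (metis cong_sym cong_trans mult_1_right)
      moreover have "\<not> [0 = 1] (mod int q)" "\<not> [0 = - 1] (mod int q)" "\<not> [1 = - 1] (mod int q)"
        using Q.not_dvd_1 Q.not_dvd_2 by (auto simp: cong_iff_dvd_diff)
      ultimately show ?thesis
        using cong_sym_eq[of _ _ "int q"] by (auto simp: Legendre_def split: if_splits)
    qed
    show ?thesis
      using Legendre_flip[OF q(1) oq qp[OF q(1)]] qd LQ Legendre_3[OF q(1) q23] by simp
  qed
  have Fc: "F c = (-1) powi k"
  proof -
    have "coprime (nat \<bar>c\<bar>) 6"
    proof -
      have "coprime c 6"
      proof (rule coprimeI)
        fix d assume d: "d dvd c" "d dvd 6"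
        then have "d dvd c - 6 * k" by (simp add: dvd_diff)
        then show "is_unit d" by (simp add: c_def)
      qed
      then have "coprime \<bar>c\<bar> 6" by simp
      then show ?thesis by (metis abs_ge_zero coprime_int_iff nat_0_le of_nat_numeral)
    qed
    then have "F (int (nat \<bar>c\<bar>)) = of_int (chi12 (nat \<bar>c\<bar>))"
      using mchar_eq_on_prime_factors[of "nat \<bar>c\<bar>"] qc c0 by simp
    moreover have "chi12 (nat \<bar>c\<bar>) = (if even k then 1 else - 1)"
    proof (cases "k \<ge> 0")
      case True
      then have "nat \<bar>c\<bar> = 6 * nat k + 1" unfolding c_def by simp
      moreover have "even k \<longleftrightarrow> even (nat k)" using True by (simp add: even_nat_iff)
      moreover have "even n \<Longrightarrow> (6 * n + 1) mod 12 = 1" "odd n \<Longrightarrow> (6 * n + 1) mod 12 = 7" for n :: nat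
        by presburger+
      ultimately show ?thesis unfolding chi12_def by simp
    next
      case False
      define m where "m = nat (- k - 1)"
      have m: "k = - int m - 1" using False by (auto simp: m_def)
      then have "nat \<bar>c\<bar> = 6 * m + 5" unfolding c_def by auto
      moreover have "even k \<longleftrightarrow> odd m" unfolding m by simp
      moreover have "even n \<Longrightarrow> (6 * n + 5) mod 12 = 5" "odd n \<Longrightarrow> (6 * n + 5) mod 12 = 11" for n :: nat
        by presburger+
      ultimately show ?thesis unfolding chi12_def by simp
    qed
    ultimately show ?thesis unfolding abs[of c] by (cases "even k") (auto simp: power_int_minus_left_even power_int_minus_left_odd)
  qed
  have ql: "F (int q) = 1" if q: "prime q" "q dvd nat \<bar>l\<bar>" "odd q" for q
  proof -
    have qd: "int q dvd l" using q(2) by (simp add: nat_dvd_iff int_dvd_int_iff[symmetric] del: int_dvd_int_iff)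
    have "[c\<^sup>2 = int p] (mod int q)"
    proof -
      have "c\<^sup>2 - int p = l * (- 12 * l)" unfolding pc by (simp add: power2_eq_square)
      then show ?thesis using qd by (simp add: cong_iff_dvd_diff)
    qed
    then have "QuadRes q (int p)" unfolding QuadRes_def by blast
    moreover have "\<not> [int p = 0] (mod int q)"
    proof
      assume "[int p = 0] (mod int q)"
      then have "q dvd p" by (simp add: cong_0_iff)
      then show False using primes_dvd_imp_eq[OF q(1) prime_p] qp[OF q(1)] qd by simp
    qed
    ultimately have "Legendre (int p) q = 1" by (simp add: Legendre_def)
    then show ?thesis using Legendre_flip[OF q(1) q(3) qp[OF q(1)]] qd by simp
  qed
  have c8: "c\<^sup>2 mod 8 = 1"
  proof -
    have "odd c" unfolding c_def by presburger
    then have "c mod 8 = 1 \<or> c mod 8 = 3 \<or> c mod 8 = 5 \<or> c mod 8 = 7" by presburger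
    then show ?thesis unfolding power2_eq_square by (auto simp: mod_mult_eq[of c 8 c, symmetric])
  qed
  have Fl: "F (2 * l) = (-1) powi l"
  proof (cases "even l")
    case True
    then obtain m where m: "l = 2 * m" by (rule evenE)
    have "int p = c\<^sup>2 + 8 * (6 * m\<^sup>2)" unfolding pc m by (simp add: power2_eq_square)
    then have "int p mod 8 = 1" using c8 by (simp only: mod_mult_self2)
    then have "p mod 8 = 1" by (metis of_nat_eq_iff of_nat_mod of_nat_numeral of_nat_1)
    then have F2: "F 2 = 1" using F_two by simp
    have "F (int (nat \<bar>l\<bar>)) = 1"
    proof (rule mchar_one_on_prime_factors)
      fix q assume q: "prime q" "q dvd nat \<bar>l\<bar>"
      show "F (int q) = 1"
      proof (cases "odd q")
        case True then show ?thesis using ql q by blast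
      next
        case False
        then have "q = 2" using q(1) prime_odd_nat[OF q(1)] prime_ge_2_nat[OF q(1)] by linarith
        then show ?thesis using F2 by simp
      qed
    qed (use l0 in auto)
    then show ?thesis using True F2 by (simp add: mchar_mult[OF F] abs[of l] power_int_minus_left_even)
  next
    case False
    then obtain m where m: "l = 2 * m + 1" by (rule oddE)
    have "int p = (c\<^sup>2 + 4) + 8 * (6 * m\<^sup>2 + 6 * m + 1)" unfolding pc m by (simp add: power2_eq_square algebra_simps)
    then have "int p mod 8 = (c\<^sup>2 + 4) mod 8" by (simp only: mod_mult_self2)
    then have "int p mod 8 = 5" using c8 by presburger
    then have "p mod 8 = 5" by (metis of_nat_eq_iff of_nat_mod of_nat_numeral)
    then have F2: "F 2 = - 1" using F_two by simp
    have "F (int (nat \<bar>l\<bar>)) = 1"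
    proof (rule mchar_one_on_prime_factors)
      fix q assume q: "prime q" "q dvd nat \<bar>l\<bar>"
      have "odd (nat \<bar>l\<bar>)" using False by (simp add: even_nat_iff)
      then have "odd q" using q(2) dvd_trans by blast
      then show "F (int q) = 1" using ql q by blast
    qed (use l0 in auto)
    then show ?thesis using False F2 by (simp add: mchar_mult[OF F] abs[of l] power_int_minus_left_odd)
  qed
  show ?thesis using Fc Fl unfolding c_def by (simp add: power_int_add)
qed

end

end

section \<open>The residue field at a prime above p\<close>

context odd_prime
begin

text \<open>A solution of \<open>x\<^sup>n \<equiv> 1\<close> is a power of a primitive root, and comparing exponents shows that this power is a multiple of
\<open>(p - 1) / n\<close>.\<close>

lemma primitive_root_of_order:
  assumes "n > 0" "n dvd p - 1"
  obtains g where "\<not> int p dvd g" "\<And>a b. [g ^ a = g ^ b] (mod int p) \<longleftrightarrow> [a = b] (mod (p - 1))"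
    "\<And>x. \<not> int p dvd x \<Longrightarrow> \<exists>a. [x = g ^ a] (mod int p)"
    "\<And>x. [x ^ n = 1] (mod int p) \<Longrightarrow> \<exists>i. [x = (g ^ i) ^ ((p - 1) div n)] (mod int p)"
proof -
  obtain g0 where g0: "residue_primroot p g0" using prime_primitive_root_exists[OF prime_gt_1_nat[OF prime_p] prime_p] by blast
  have cop: "coprime p g0" and ord: "ord p g0 = p - 1"
    using g0 prime_p by (auto simp: residue_primroot_def totient_prime)
  define g where "g = int g0"
  have g: "\<not> int p dvd g" using cop prime_p unfolding g_def
    by (metis coprime_absorb_left int_dvd_int_iff not_prime_unit)
  have eq: "[g ^ a = g ^ b] (mod int p) \<longleftrightarrow> [a = b] (mod (p - 1))" for a b
    using order_divides_expdiff[OF cop, of a b] unfolding g_def ord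
    by (metis cong_int_iff of_nat_power)
  have gen: "\<exists>a. [x = g ^ a] (mod int p)" if x: "\<not> int p dvd x" for x
  proof -
    have inj: "inj_on (\<lambda>a. g ^ a mod int p) {..<p - 1}"
    proof (rule inj_onI)
      fix a b assume ab: "a \<in> {..<p - 1}" "b \<in> {..<p - 1}" "g ^ a mod int p = g ^ b mod int p"
      then have "[a = b] (mod (p - 1))" using eq by (simp add: cong_def)
      then show "a = b" using ab by (simp add: cong_def)
    qed
    have "(\<lambda>a. g ^ a mod int p) ` {..<p - 1} \<subseteq> residues - {0}"
    proof
      fix y assume "y \<in> (\<lambda>a. g ^ a mod int p) ` {..<p - 1}"
      then obtain a where y: "y = g ^ a mod int p" by auto
      have "\<not> int p dvd g ^ a" using g prime_int_p prime_dvd_power by blast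
      then have "y \<noteq> 0" unfolding y by auto
      moreover have "y \<in> residues" unfolding y using p_gt_2 by simp
      ultimately show "y \<in> residues - {0}" by simp
    qed
    moreover have "card ((\<lambda>a. g ^ a mod int p) ` {..<p - 1}) = card (residues - {0})"
      using p_gt_2 by (subst card_image[OF inj]) (simp add: card_Diff_subset)
    ultimately have "(\<lambda>a. g ^ a mod int p) ` {..<p - 1} = residues - {0}"
      by (intro card_subset_eq) auto
    moreover have "x mod int p \<in> residues - {0}"
      using x p_gt_2 by (auto simp: dvd_eq_mod_eq_0)
    ultimately have "x mod int p \<in> (\<lambda>a. g ^ a mod int p) ` {..<p - 1}" by (simp only:)
    then obtain a where "x mod int p = g ^ a mod int p" by (rule imageE)
    then have "[x = g ^ a] (mod int p)" unfolding cong_def .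
    then show ?thesis by (rule exI)
  qed
  have root: "\<exists>i. [x = (g ^ i) ^ ((p - 1) div n)] (mod int p)" if x: "[x ^ n = 1] (mod int p)" for x
  proof -
    have "\<not> int p dvd x"
    proof
      assume "int p dvd x"
      then have "int p dvd x ^ n" using assms(1) by (meson dvd_power dvd_trans)
      then show False using cong_dvd_iff[OF x] not_dvd_1 by simp
    qed
    then obtain a where a: "[x = g ^ a] (mod int p)" using gen by blast
    then have "[g ^ (a * n) = g ^ 0] (mod int p)"
      using cong_trans[OF cong_sym[OF cong_pow[OF a, of n]] x] by (simp add: power_mult)
    then have "p - 1 dvd a * n" unfolding eq by (simp add: cong_0_iff)
    moreover obtain m where m: "p - 1 = n * m" using assms(2) by (auto elim: dvdE)
    ultimately have "m dvd a" using assms(1) by simp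
    then obtain i where "a = m * i" by (auto elim: dvdE)
    moreover have "(p - 1) div n = m" using m assms(1) by simp
    ultimately have "g ^ a = (g ^ i) ^ ((p - 1) div n)" by (simp add: power_mult mult.commute flip: power_mult)
    then show ?thesis using a by auto
  qed
  show ?thesis using that[OF g eq gen root] .
qed

end

text \<open>Multiplication by a primitive root of unity \<open>u\<close> permutes the roots and multiplies the sum by \<open>u\<^sup>m\<close>.\<close>

lemma sum_powers_roots_of_unity:
  assumes "n > 0"
  shows "(\<Sum>z | z ^ n = (1::complex). z ^ m) = (if n dvd m then of_nat n else 0)"
proof (cases "n dvd m")
  case True
  then obtain k where k: "m = n * k" by (auto elim: dvdE)
  have "(\<Sum>z | z ^ n = (1::complex). z ^ m) = (\<Sum>z | z ^ n = (1::complex). 1)"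
    by (intro sum.cong refl) (simp add: k power_mult)
  then show ?thesis using True card_roots_unity_eq[OF assms] by simp
next
  case False
  define u where "u = cis (2 * pi / real n)"
  have un: "u ^ n = 1"
  proof -
    have "real n * (2 * pi / real n) = 2 * pi" using assms by simp
    then show ?thesis unfolding u_def Complex.DeMoivre by (simp only: cis_2pi)
  qed
  have um: "u ^ m \<noteq> 1"
  proof
    assume "u ^ m = 1"
    then have "cis (2 * pi * real m / real n) = 1" unfolding u_def Complex.DeMoivre by (simp add: mult_ac)
    then have "cos (2 * pi * real m / real n) = 1" by (simp add: cis.code complex_eq_iff)
    then obtain k :: int where k: "2 * pi * real m / real n = of_int k * 2 * pi"
      using cos_one_2pi_int by blast
    then have "real m = of_int k * real n" using assms by (simp add: field_simps)
    then have "int m = k * int n" by (metis of_int_eq_iff of_int_mult of_int_of_nat_eq)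
    then have "int n dvd int m" by simp
    then show False using False by simp
  qed
  have bij: "bij_betw (\<lambda>z. u * z) {z. z ^ n = 1} {z. z ^ n = 1}"
  proof (rule bij_betwI[of _ _ _ "\<lambda>z. u ^ (n - 1) * z"])
    have uu: "u * u ^ (n - 1) = 1" using un assms by (simp flip: power_Suc)
    show "u ^ (n - 1) * (u * z) = z" "u * (u ^ (n - 1) * z) = z" for z
      using uu by (simp_all add: mult.assoc[symmetric] mult.commute)
    show "(\<lambda>z. u * z) \<in> {z. z ^ n = 1} \<rightarrow> {z. z ^ n = 1}" using un by (auto simp: power_mult_distrib)
    have "(u ^ (n - 1)) ^ n = 1" using un by (metis mult.commute power_mult power_one)
    then show "(\<lambda>z. u ^ (n - 1) * z) \<in> {z. z ^ n = 1} \<rightarrow> {z. z ^ n = 1}" by (auto simp: power_mult_distrib)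
  qed
  have "(\<Sum>z | z ^ n = (1::complex). z ^ m) = (\<Sum>z | z ^ n = 1. (u * z) ^ m)"
    by (rule sum.reindex_bij_betw[OF bij, symmetric])
  also have "\<dots> = u ^ m * (\<Sum>z | z ^ n = 1. z ^ m)" by (simp add: power_mult_distrib sum_distrib_left)
  finally show ?thesis using um False by simp
qed

lemma zeta_power_M:
  assumes "M > 0"
  shows "zeta M ^ M = 1"
proof -
  have "real M * (2 * pi / real M) = 2 * pi" using assms by simp
  then show ?thesis unfolding zeta_def Complex.DeMoivre by (simp only: cis_2pi)
qed

lemma zeta_quadratics: "(zeta 3)\<^sup>2 + zeta 3 + 1 = 0" "(zeta 6)\<^sup>2 - zeta 6 + 1 = 0"
  "((zeta 12)\<^sup>2)\<^sup>2 - (zeta 12)\<^sup>2 + 1 = 0"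
proof -
  show "(zeta 3)\<^sup>2 + zeta 3 + 1 = 0" unfolding zeta_def using cis_cube_root by simp
  have 6: "(zeta 6)\<^sup>2 - zeta 6 + 1 = 0" unfolding zeta_def
    by (auto simp: complex_eq_iff power2_eq_square cos_60 sin_60)
  then show "(zeta 6)\<^sup>2 - zeta 6 + 1 = 0" .
  have "(zeta 12)\<^sup>2 = zeta 6" unfolding zeta_def power2_eq_square cis_mult by (simp add: field_simps)
  then show "((zeta 12)\<^sup>2)\<^sup>2 - (zeta 12)\<^sup>2 + 1 = 0" using 6 by simp
qed

lemma roots_of_unity_are_powers:
  assumes "M > 0" "w ^ M = 1"
  obtains i where "i < M" "w = zeta M ^ i"
proof -
  have "w \<in> {z. z ^ M = 1}" using assms by simp
  also have "{z. z ^ M = 1} = (\<lambda>j. exp (2 * of_real pi * \<i> * of_nat j / of_nat M)) ` {..<M}"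
    using complex_roots_unity[of M] assms(1) by (auto simp: image_def)
  finally obtain j where "j < M" "w = exp (2 * of_real pi * \<i> * of_nat j / of_nat M)" by auto
  moreover have "zeta M ^ j = exp (2 * of_real pi * \<i> * of_nat j / of_nat M)"
    unfolding zeta_def cis_conv_exp exp_of_nat_mult[symmetric] by (simp add: mult_ac)
  ultimately show ?thesis using that by metis
qed

text \<open>Every least common denominator that occurs is \<open>3\<close>, \<open>6\<close> or \<open>12\<close>, and for these the quadratic relations \<open>zeta_quadratics\<close>
make the structure of the residue field explicit.\<close>

locale prime_above = odd_prime p + primeideal P "cyclotomic_ring M" for p :: nat and M :: nat and P :: "complex set" +
  assumes M: "M = 3 \<or> M = 6 \<or> M = 12" and pM: "p mod M = 1" and above: "lies_above P p"
begin

abbreviation Z where "Z \<equiv> cyclotomic_ring M"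

lemma M_pos: "M > 0" using M by auto

lemma ring_simps: "x \<otimes>\<^bsub>Z\<^esub> y = x * y" "x \<oplus>\<^bsub>Z\<^esub> y = x + y" "\<one>\<^bsub>Z\<^esub> = 1" "\<zero>\<^bsub>Z\<^esub> = 0"
  by (simp_all add: cyclotomic_ring_def)

lemma poly_in_carrier: "poly (map_poly of_int f) (zeta M) \<in> carrier Z"
  by (auto simp: cyclotomic_ring_def)

lemma carrier_of_int: "of_int k \<in> carrier Z"
  using poly_in_carrier[of "[:k:]"] by (simp add: map_poly_pCons)

lemma carrier_zeta: "zeta M \<in> carrier Z"
  using poly_in_carrier[of "[:0, 1:]"] by (simp add: map_poly_pCons)

lemma carrier_mult: "x \<in> carrier Z \<Longrightarrow> y \<in> carrier Z \<Longrightarrow> x * y \<in> carrier Z"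
  using m_closed[of x y] by (simp add: ring_simps)

lemma carrier_add: "x \<in> carrier Z \<Longrightarrow> y \<in> carrier Z \<Longrightarrow> x + y \<in> carrier Z"
  using ring.ring_simprules(1)[OF ring_axioms, of x y] by (simp add: ring_simps)

lemma carrier_minus: "x \<in> carrier Z \<Longrightarrow> - x \<in> carrier Z"
  using carrier_mult[OF carrier_of_int[of "-1"]] by simp

lemma carrier_diff: "x \<in> carrier Z \<Longrightarrow> y \<in> carrier Z \<Longrightarrow> x - y \<in> carrier Z"
  using carrier_add[of x "- y"] carrier_minus by simp

lemma carrier_power: "x \<in> carrier Z \<Longrightarrow> x ^ n \<in> carrier Z"
  by (induction n) (use carrier_of_int[of 1] carrier_mult in auto)

lemma a_inv_Z: "x \<in> carrier Z \<Longrightarrow> \<ominus>\<^bsub>Z\<^esub> x = - x"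
  by (rule minus_equality) (simp_all add: ring_simps carrier_minus)

lemma a_minus_Z: "x \<in> carrier Z \<Longrightarrow> y \<in> carrier Z \<Longrightarrow> x \<ominus>\<^bsub>Z\<^esub> y = x - y"
  by (simp add: a_minus_def a_inv_Z ring_simps)

lemma P_add: "x \<in> P \<Longrightarrow> y \<in> P \<Longrightarrow> x + y \<in> P"
  using additive_subgroup.a_closed[OF additive_subgroup_axioms, of x y] by (simp add: ring_simps)

lemma P_mult: "x \<in> P \<Longrightarrow> y \<in> carrier Z \<Longrightarrow> y * x \<in> P"
  using I_l_closed[of x y] by (simp add: ring_simps)

lemma P_minus: "x \<in> P \<Longrightarrow> - x \<in> P"
  using P_mult[OF _ carrier_of_int[of "-1"]] by simp

lemma P_prime: "x \<in> carrier Z \<Longrightarrow> y \<in> carrier Z \<Longrightarrow> x * y \<in> P \<Longrightarrow> x \<in> P \<or> y \<in> P"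
  using I_prime[of x y] by (simp add: ring_simps)

lemma P_of_int: "of_int k \<in> P \<longleftrightarrow> int p dvd k"
proof -
  have "of_int k \<in> P \<longleftrightarrow> (of_int k :: complex) \<in> P \<inter> \<int>" by simp
  also have "\<dots> \<longleftrightarrow> (\<exists>n. (of_int k :: complex) = of_int (int p * n))"
    using above unfolding lies_above_def by auto
  also have "\<dots> \<longleftrightarrow> int p dvd k" unfolding of_int_eq_iff dvd_def ..
  finally show ?thesis .
qed

text \<open>Congruence modulo \<open>P\<close> on the ring of cyclotomic integers; including membership in the ring keeps the rules below free of side conditions.\<close>

definition eqP :: "complex \<Rightarrow> complex \<Rightarrow> bool" where
  "eqP x y \<longleftrightarrow> x \<in> carrier Z \<and> y \<in> carrier Z \<and> x - y \<in> P"

lemma eqP_refl: "x \<in> carrier Z \<Longrightarrow> eqP x x"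
  using P_of_int[of 0] by (simp add: eqP_def)

lemma eqP_sym: "eqP x y \<Longrightarrow> eqP y x"
  using P_minus[of "x - y"] by (simp add: eqP_def)

lemma eqP_trans: "eqP x y \<Longrightarrow> eqP y z \<Longrightarrow> eqP x z"
  using P_add[of "x - y" "y - z"] by (simp add: eqP_def)

lemma eqP_add: "eqP x y \<Longrightarrow> eqP u v \<Longrightarrow> eqP (x + u) (y + v)"
  using P_add[of "x - y" "u - v"] by (simp add: eqP_def carrier_add algebra_simps)

lemma eqP_mult:
  assumes "eqP x y" "eqP u v"
  shows "eqP (x * u) (y * v)"
proof -
  have "u * (x - y) + y * (u - v) \<in> P"
    using assms by (intro P_add P_mult) (auto simp: eqP_def)
  moreover have "u * (x - y) + y * (u - v) = x * u - y * v" by (simp add: algebra_simps)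
  ultimately show ?thesis using assms by (simp add: eqP_def carrier_mult)
qed

lemma eqP_power: "eqP x y \<Longrightarrow> eqP (x ^ n) (y ^ n)"
  by (induction n) (auto intro: eqP_mult simp: eqP_refl[OF carrier_of_int[of 1], simplified])

lemma eqP_of_int: "eqP (of_int a) (of_int b) \<longleftrightarrow> [a = b] (mod int p)"
  using P_of_int[of "a - b"] by (simp add: eqP_def carrier_of_int cong_iff_dvd_diff)

lemma M_dvd: "M dvd p - 1"
  using pM mod_eq_dvd_iff_nat[of 1 p M] p_gt_2 M by auto

lemma not_dvd_M: "\<not> int p dvd int M"
proof
  assume "int p dvd int M"
  then have "p \<le> M" using M_pos by (simp add: dvd_imp_le)
  moreover have "M \<le> p - 1" using M_dvd p_gt_2 by (intro dvd_imp_le) auto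
  ultimately show False using p_gt_2 by simp
qed

lemma root_of_order_M:
  obtains h where "\<And>j. [h ^ j = 1] (mod int p) \<longleftrightarrow> M dvd j"
    "\<And>x. [x ^ M = 1] (mod int p) \<Longrightarrow> \<exists>i. [x = h ^ i] (mod int p)"
proof -
  obtain g where g: "\<And>a b. [g ^ a = g ^ b] (mod int p) \<longleftrightarrow> [a = b] (mod (p - 1))"
    "\<And>x. [x ^ M = 1] (mod int p) \<Longrightarrow> \<exists>i. [x = (g ^ i) ^ ((p - 1) div M)] (mod int p)"
    by (rule primitive_root_of_order[OF M_pos M_dvd]) (rule that)
  obtain m where m: "p - 1 = M * m" using M_dvd by (auto elim: dvdE)
  have m0: "m > 0" using m p_gt_2 by (cases m) auto
  have md: "(p - 1) div M = m" using m M_pos by simp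
  have "[(g ^ m) ^ j = 1] (mod int p) \<longleftrightarrow> M dvd j" for j
  proof -
    have "[(g ^ m) ^ j = 1] (mod int p) \<longleftrightarrow> [m * j = 0] (mod (p - 1))"
      using g(1)[of "m * j" 0] by (simp add: power_mult)
    also have "\<dots> \<longleftrightarrow> M dvd j" unfolding m cong_0_iff using m0 by (simp add: mult.commute[of M])
    finally show ?thesis .
  qed
  moreover have "\<exists>i. [x = (g ^ m) ^ i] (mod int p)" if xM: "[x ^ M = 1] (mod int p)" for x
  proof -
    obtain i where "[x = (g ^ i) ^ m] (mod int p)" using g(2)[OF xM] unfolding md by (rule exE)
    moreover have "(g ^ i) ^ m = (g ^ m) ^ i" by (metis mult.commute power_mult)
    ultimately show ?thesis by (intro exI[of _ i]) (simp only:)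
  qed
  ultimately show ?thesis by (rule that)
qed

text \<open>Let \<open>e\<close> be an integer of order \<open>M\<close> modulo \<open>p\<close>. It satisfies the same quadratic equation modulo \<open>p\<close> as \<open>zeta M\<close> does, so a product of
two differences \<open>zeta M - a\<close> lies in \<open>P\<close>, and \<open>P\<close> is prime. For \<open>M = 12\<close> the equation is one for the square, and the
argument is applied twice.\<close>

lemma zeta_eqP_int: "\<exists>h. eqP (zeta M) (of_int h)"
proof -
  obtain e where e: "\<And>j. [e ^ j = 1] (mod int p) \<longleftrightarrow> M dvd j"
    by (rule root_of_order_M) (rule that)
  have nd: "\<not> int p dvd e ^ j - 1" if "\<not> M dvd j" for j
    using e[of j] that by (simp add: cong_iff_dvd_diff)
  have dM: "int p dvd e ^ M - 1" using e[of M] by (simp add: cong_iff_dvd_diff)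
  let ?z = "zeta M"
  have close: "\<exists>h. eqP ?z (of_int h)" if "(?z - of_int a) * (?z - of_int b) \<in> P" for a b
    using P_prime[OF _ _ that] carrier_zeta carrier_of_int carrier_diff unfolding eqP_def by blast
  consider "M = 3" | "M = 6" | "M = 12" using M by blast
  then show ?thesis
  proof cases
    case 1
    have "e ^ M - 1 = (e ^ 1 - 1) * (e\<^sup>2 + e + 1)" by (simp add: 1 eval_nat_numeral algebra_simps)
    then have "int p dvd e\<^sup>2 + e + 1"
      using dM nd[of 1] prime_int_p 1 by (simp add: prime_dvd_mult_iff)
    then have "- of_int (e\<^sup>2 + e + 1) \<in> P" using P_of_int P_minus by blast
    moreover have "(?z - of_int e) * (?z - of_int (- 1 - e)) = (?z\<^sup>2 + ?z + 1) - of_int (e\<^sup>2 + e + 1)"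
      by (simp add: power2_eq_square algebra_simps)
    ultimately show ?thesis using zeta_quadratics(1) 1 by (intro close[of e "- 1 - e"]) simp
  next
    case 2
    have "e ^ M - 1 = (e ^ 3 - 1) * ((e + 1) * (e\<^sup>2 - e + 1))" by (simp add: 2 eval_nat_numeral algebra_simps)
    then have "int p dvd (e + 1) * (e\<^sup>2 - e + 1)"
      using dM nd[of 3] prime_int_p 2 by (simp add: prime_dvd_mult_iff)
    moreover have "\<not> int p dvd e + 1"
    proof
      assume "int p dvd e + 1"
      then have "int p dvd (e + 1) * (e - 1)" by simp
      moreover have "(e + 1) * (e - 1) = e ^ 2 - 1" by (simp add: power2_eq_square algebra_simps)
      ultimately show False using nd[of 2] 2 by simp
    qed
    ultimately have "int p dvd e\<^sup>2 - e + 1" using prime_int_p by (simp add: prime_dvd_mult_iff)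
    then have "- of_int (e\<^sup>2 - e + 1) \<in> P" using P_of_int P_minus by blast
    moreover have "(?z - of_int e) * (?z - of_int (1 - e)) = (?z\<^sup>2 - ?z + 1) - of_int (e\<^sup>2 - e + 1)"
      by (simp add: power2_eq_square algebra_simps)
    ultimately show ?thesis using zeta_quadratics(2) 2 by (intro close[of e "1 - e"]) simp
  next
    case 3
    have "e ^ M - 1 = (e ^ 6 - 1) * ((e\<^sup>2 + 1) * (e ^ 4 - e\<^sup>2 + 1))" by (simp add: 3 eval_nat_numeral algebra_simps)
    then have "int p dvd (e\<^sup>2 + 1) * (e ^ 4 - e\<^sup>2 + 1)"
      using dM nd[of 6] prime_int_p 3 by (simp add: prime_dvd_mult_iff)
    moreover have "\<not> int p dvd e\<^sup>2 + 1"
    proof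
      assume "int p dvd e\<^sup>2 + 1"
      then have "int p dvd (e\<^sup>2 + 1) * (e\<^sup>2 - 1)" by simp
      moreover have "(e\<^sup>2 + 1) * (e\<^sup>2 - 1) = e ^ 4 - 1" by (simp add: eval_nat_numeral algebra_simps)
      ultimately show False using nd[of 4] 3 by simp
    qed
    ultimately have d: "int p dvd e ^ 4 - e\<^sup>2 + 1" using prime_int_p by (simp add: prime_dvd_mult_iff)
    then have "- of_int (e ^ 4 - e\<^sup>2 + 1) \<in> P" using P_of_int P_minus by blast
    moreover have "(?z\<^sup>2 - of_int (e\<^sup>2)) * (?z\<^sup>2 - of_int (1 - e\<^sup>2)) = ((?z\<^sup>2)\<^sup>2 - ?z\<^sup>2 + 1) + - of_int (e ^ 4 - e\<^sup>2 + 1)"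
      by (simp add: eval_nat_numeral algebra_simps)
    ultimately have "(?z\<^sup>2 - of_int (e\<^sup>2)) * (?z\<^sup>2 - of_int (1 - e\<^sup>2)) \<in> P"
      using zeta_quadratics(3) unfolding 3 by (simp only: add_0)
    then have "?z\<^sup>2 - of_int (e\<^sup>2) \<in> P \<or> ?z\<^sup>2 - of_int (1 - e\<^sup>2) \<in> P"
      by (intro P_prime carrier_diff carrier_power carrier_zeta carrier_of_int)
    then show ?thesis
    proof
      assume "?z\<^sup>2 - of_int (e\<^sup>2) \<in> P"
      moreover have "(?z - of_int e) * (?z - of_int (- e)) = ?z\<^sup>2 - of_int (e\<^sup>2)"
        by (simp add: power2_eq_square algebra_simps)
      ultimately show ?thesis by (intro close[of e "- e"]) (simp only:)
    next
      assume z: "?z\<^sup>2 - of_int (1 - e\<^sup>2) \<in> P"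
      \<comment> \<open>The inverse of the sixth root of unity \<open>e\<^sup>2\<close> is both \<open>1 - e\<^sup>2\<close> and \<open>(e ^ 5)\<^sup>2\<close>.\<close>
      have "int p dvd (e ^ 4 - e\<^sup>2 + 1) * (1 - e ^ 4 - e ^ 6)" using d by simp
      then have "of_int ((e ^ 4 - e\<^sup>2 + 1) * (1 - e ^ 4 - e ^ 6)) \<in> P" using P_of_int by blast
      from P_add[OF z this] have "?z\<^sup>2 - of_int (1 - e\<^sup>2) + of_int ((e ^ 4 - e\<^sup>2 + 1) * (1 - e ^ 4 - e ^ 6)) \<in> P" .
      moreover have "(?z - of_int (e ^ 5)) * (?z - of_int (- (e ^ 5))) =
          ?z\<^sup>2 - of_int (1 - e\<^sup>2) + of_int ((e ^ 4 - e\<^sup>2 + 1) * (1 - e ^ 4 - e ^ 6))"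
        by (simp add: eval_nat_numeral algebra_simps)
      ultimately show ?thesis by (intro close[of "e ^ 5" "- (e ^ 5)"]) (simp only:)
    qed
  qed
qed

text \<open>With \<open>zeta M\<close>, every integral polynomial in it is congruent to an integer, so the residue field is the prime field.\<close>

lemma carrier_eqP_int:
  assumes "x \<in> carrier Z"
  shows "\<exists>k. eqP x (of_int k)"
proof -
  obtain h where h: "eqP (zeta M) (of_int h)" using zeta_eqP_int by blast
  obtain f where x: "x = poly (map_poly of_int f) (zeta M)" using assms by (auto simp: cyclotomic_ring_def)
  have "\<exists>k. eqP (poly (map_poly of_int f) (zeta M)) (of_int k)"
  proof (induction f)
    case 0
    then show ?case using eqP_refl[OF carrier_of_int[of 0]] by (intro exI[of _ 0]) simp
  next
    case (pCons a f)
    then obtain k where k: "eqP (poly (map_poly of_int f) (zeta M)) (of_int k)" by blast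
    have "eqP (of_int a + zeta M * poly (map_poly of_int f) (zeta M)) (of_int a + of_int h * of_int k)"
      by (intro eqP_add eqP_mult h k eqP_refl carrier_of_int)
    then show ?case by (intro exI[of _ "a + h * k"]) (simp add: map_poly_pCons)
  qed
  then show ?thesis unfolding x .
qed

lemma carrier_root_of_unity: "w ^ M = 1 \<Longrightarrow> w \<in> carrier Z"
  using roots_of_unity_are_powers[OF M_pos] carrier_power[OF carrier_zeta] by metis

text \<open>If \<open>u \<noteq> 1\<close> is an \<open>M\<close>-th root of unity congruent to \<open>1\<close>, then \<open>0 = 1 + u + \<dots> + u\<^sup>M\<^sup>-\<^sup>1\<close> is congruent to \<open>M\<close>, which is prime to \<open>p\<close>.\<close>

lemma roots_of_unity_inj:
  assumes w: "w ^ M = 1" "w' ^ M = 1" and e: "eqP w w'"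
  shows "w = w'"
proof (rule ccontr)
  assume ne: "w \<noteq> w'"
  define u where "u = w * w' ^ (M - 1)"
  have w'inv: "w' * w' ^ (M - 1) = 1" using w(2) M_pos by (simp flip: power_Suc)
  have "u * w' = w" unfolding u_def using w'inv by (simp add: mult_ac)
  then have u1: "u \<noteq> 1" using ne by auto
  have "eqP u (w' * w' ^ (M - 1))"
    unfolding u_def by (intro eqP_mult e eqP_refl carrier_power carrier_root_of_unity w)
  then have ue: "eqP u 1" unfolding w'inv .
  have uM: "u ^ M = 1"
  proof -
    have "u ^ M = w ^ M * (w' ^ M) ^ (M - 1)"
      unfolding u_def power_mult_distrib by (metis mult.commute power_mult)
    then show ?thesis using w by simp
  qed
  have s: "eqP (\<Sum>i<n. u ^ i) (of_nat n)" for n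
  proof (induction n)
    case 0
    then show ?case using eqP_refl[OF carrier_of_int[of 0]] by simp
  next
    case (Suc n)
    have "eqP ((\<Sum>i<n. u ^ i) + u ^ n) (of_nat n + 1 ^ n)" by (intro eqP_add Suc eqP_power ue)
    then show ?case by (simp add: add.commute)
  qed
  have "(\<Sum>i<M. u ^ i) = 0" using u1 uM by (simp add: geometric_sum)
  then have "eqP (of_int 0) (of_int (int M))" using s[of M] by simp
  then have "int p dvd int M" unfolding eqP_of_int by (simp add: cong_iff_dvd_diff)
  then show False using not_dvd_M by simp
qed

lemma zeta_power_eq_1: "zeta M ^ j = 1 \<longleftrightarrow> M dvd j"
proof -
  have "zeta M ^ (j mod M) \<noteq> 1" if "j mod M \<noteq> 0"
  proof
    assume "zeta M ^ (j mod M) = 1"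
    then have "cis (2 * pi * real (j mod M) / real M) = 1" unfolding zeta_def Complex.DeMoivre by (simp add: mult_ac)
    then have "cos (2 * pi * real (j mod M) / real M) = 1" by (simp add: cis.code complex_eq_iff)
    then obtain k :: int where k: "2 * pi * real (j mod M) / real M = of_int k * 2 * pi"
      using cos_one_2pi_int by blast
    then have "real (j mod M) = of_int k * real M" using M_pos by (simp add: field_simps)
    then have "int (j mod M) = k * int M" by (metis of_int_eq_iff of_int_mult of_int_of_nat_eq)
    then have "int M dvd int (j mod M)" by simp
    then have "M \<le> j mod M" using that by (simp add: dvd_imp_le)
    then show False using M_pos by (meson mod_less_divisor not_less)
  qed
  moreover have "zeta M ^ j = zeta M ^ (j mod M)"
  proof -
    have "zeta M ^ j = zeta M ^ (M * (j div M) + j mod M)" by simp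
    then show ?thesis using zeta_power_M[OF M_pos] by (simp only: power_add power_mult power_one mult_1_left)
  qed
  ultimately show ?thesis by (auto simp: dvd_eq_mod_eq_0)
qed

text \<open>The powers of \<open>zeta M\<close> give \<open>M\<close> different \<open>M\<close>-th roots of unity modulo \<open>p\<close>, and there are at most \<open>M\<close> of them.\<close>

lemma root_mod_p_lifts:
  assumes x: "[x ^ M = 1] (mod int p)"
  shows "\<exists>w. w ^ M = 1 \<and> eqP w (of_int x)"
proof -
  obtain h where h: "\<And>j. [h ^ j = 1] (mod int p) \<longleftrightarrow> M dvd j"
    "\<And>x. [x ^ M = 1] (mod int p) \<Longrightarrow> \<exists>i. [x = h ^ i] (mod int p)"
    by (rule root_of_order_M) (rule that)
  obtain k where k: "eqP (zeta M) (of_int k)" using zeta_eqP_int by blast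
  let ?A = "(\<lambda>i. k ^ i mod int p) ` {..<M}" and ?B = "(\<lambda>i. h ^ i mod int p) ` {..<M}"
  have kp: "eqP (zeta M ^ i) (of_int (k ^ i))" for i using eqP_power[OF k, of i] by simp
  have zM: "(zeta M ^ i) ^ M = 1" for i using zeta_power_M[OF M_pos] by (metis mult.commute power_mult power_one)
  have B: "x mod int p \<in> ?B" if xM: "[x ^ M = 1] (mod int p)" for x
  proof -
    obtain i where "[x = h ^ i] (mod int p)" using h(2)[OF xM] by (rule exE)
    moreover have "[h ^ i = h ^ (i mod M)] (mod int p)"
    proof -
      have "[(h ^ M) ^ (i div M) * h ^ (i mod M) = 1 ^ (i div M) * h ^ (i mod M)] (mod int p)"
        by (intro cong_mult cong_pow cong_refl) (simp add: h(1))
      then show ?thesis by (simp flip: power_mult power_add)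
    qed
    ultimately have "[x = h ^ (i mod M)] (mod int p)" by (rule cong_trans)
    then have "x mod int p = h ^ (i mod M) mod int p" unfolding cong_def .
    then show ?thesis using M_pos by (intro image_eqI[of _ _ "i mod M"]) auto
  qed
  have inj: "inj_on (\<lambda>i. k ^ i mod int p) {..<M}"
  proof (rule linorder_inj_onI')
    fix i j assume ij: "i \<in> {..<M}" "j \<in> {..<M}" "i < j"
    show "k ^ i mod int p \<noteq> k ^ j mod int p"
    proof
      assume "k ^ i mod int p = k ^ j mod int p"
      then have "eqP (of_int (k ^ i)) (of_int (k ^ j))" unfolding eqP_of_int cong_def .
      then have "eqP (zeta M ^ i) (zeta M ^ j)" using kp eqP_trans eqP_sym by blast
      then have "zeta M ^ i = zeta M ^ j" by (rule roots_of_unity_inj[OF zM zM])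
      moreover have "zeta M ^ j = zeta M ^ i * zeta M ^ (j - i)" unfolding power_add[symmetric] using ij by simp
      ultimately have "zeta M ^ i * 1 = zeta M ^ i * zeta M ^ (j - i)" by simp
      moreover have "zeta M \<noteq> 0" by (simp add: zeta_def)
      ultimately have "zeta M ^ (j - i) = 1" by simp
      then have "M dvd j - i" unfolding zeta_power_eq_1 .
      then have "M \<le> j - i" using ij by (intro dvd_imp_le) auto
      then show False using ij by simp
    qed
  qed
  have kM: "[(k ^ i) ^ M = 1] (mod int p)" for i
  proof -
    have "eqP (of_int ((k ^ i) ^ M)) ((zeta M ^ i) ^ M)" using eqP_sym[OF eqP_power[OF kp[of i], of M]] by simp
    then have "eqP (of_int ((k ^ i) ^ M)) (of_int 1)" unfolding zM by simp
    then show ?thesis unfolding eqP_of_int .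
  qed
  have "?A \<subseteq> ?B" using B[OF kM] by auto
  moreover have "card ?B \<le> card ?A" unfolding card_image[OF inj] using card_image_le[of "{..<M}"] by simp
  ultimately have "?A = ?B" by (intro card_seteq) auto
  then have "x mod int p \<in> ?A" using B[OF x] by simp
  then obtain i where "x mod int p = k ^ i mod int p" by (rule imageE)
  then have "[k ^ i = x] (mod int p)" unfolding cong_def by simp
  then have "eqP (of_int (k ^ i)) (of_int x)" unfolding eqP_of_int .
  then have "eqP (zeta M ^ i) (of_int x)" by (rule eqP_trans[OF kp])
  then show ?thesis using zM by blast
qed

abbreviation K where "K \<equiv> residue_field M P"

text \<open>The residue class of an integer. A constant of its own keeps \<open>of_int\<close> from being distributed over sums and products.\<close>

definition cl :: "int \<Rightarrow> complex set" where "cl k = residue_class M P (of_int k)"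

lemma class_eq_iff:
  assumes "x \<in> carrier Z" "y \<in> carrier Z"
  shows "residue_class M P x = residue_class M P y \<longleftrightarrow> eqP x y"
proof -
  have "x \<ominus>\<^bsub>Z\<^esub> y \<in> P \<longleftrightarrow> residue_class M P x = residue_class M P y"
    by (rule quotient_eq_iff_same_a_r_cos[OF is_ideal assms])
  then show ?thesis using assms by (simp add: a_minus_Z eqP_def)
qed

lemma cl_eq_iff: "cl a = cl b \<longleftrightarrow> [a = b] (mod int p)"
  using class_eq_iff[OF carrier_of_int carrier_of_int] eqP_of_int unfolding cl_def by simp

lemma cl_mult: "cl (a * b) = cl a \<otimes>\<^bsub>K\<^esub> cl b"
  using ring_hom_mult[OF rcos_ring_hom carrier_of_int[of a] carrier_of_int[of b]] by (simp add: ring_simps cl_def)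

lemma cl_one: "\<one>\<^bsub>K\<^esub> = cl 1"
  using ring_hom_one[OF rcos_ring_hom] by (simp add: ring_simps cl_def)

lemma cl_carrier: "cl a \<in> carrier K"
  unfolding cl_def by (rule ring_hom_closed[OF rcos_ring_hom carrier_of_int])

lemma cl_zero: "\<zero>\<^bsub>K\<^esub> = cl 0"
  using ring_hom_zero[OF rcos_ring_hom ring_axioms quotient_is_ring] by (simp add: ring_simps cl_def)

lemma cl_add: "cl (a + b) = cl a \<oplus>\<^bsub>K\<^esub> cl b"
  using ring_hom_add[OF rcos_ring_hom carrier_of_int[of a] carrier_of_int[of b]] by (simp add: ring_simps cl_def)

lemma cl_uminus: "\<ominus>\<^bsub>K\<^esub> cl a = cl (- a)"
proof (rule abelian_group.minus_equality)
  show "abelian_group K" using quotient_is_ring by (rule ring.is_abelian_group)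
  show "cl (- a) \<oplus>\<^bsub>K\<^esub> cl a = \<zero>\<^bsub>K\<^esub>" unfolding cl_zero cl_add[symmetric] by simp
qed (rule cl_carrier)+

lemma cl_minus: "cl a \<ominus>\<^bsub>K\<^esub> cl b = cl (a - b)"
  unfolding a_minus_def cl_uminus cl_add[symmetric] by simp

lemma cl_power: "cl a [^]\<^bsub>K\<^esub> n = cl (a ^ n)"
proof (induction n)
  case 0
  have "cl a [^]\<^bsub>K\<^esub> (0::nat) = \<one>\<^bsub>K\<^esub>" by (simp add: nat_pow_def)
  then show ?case by (simp add: cl_one)
next
  case (Suc n)
  have "cl a [^]\<^bsub>K\<^esub> Suc n = cl a [^]\<^bsub>K\<^esub> n \<otimes>\<^bsub>K\<^esub> cl a" by (simp add: nat_pow_def)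
  then show ?case unfolding Suc cl_mult[symmetric] by (simp add: mult.commute)
qed

lemma carrier_K: "carrier K = cl ` residues"
proof (intro equalityI subsetI)
  fix c assume "c \<in> carrier K"
  then obtain x where x: "x \<in> carrier Z" "c = residue_class M P x"
    by (auto simp: FactRing_def A_RCOSETS_def')
  obtain k where k: "eqP x (of_int k)" using carrier_eqP_int[OF x(1)] by blast
  have "c = cl k" unfolding x(2) cl_def using class_eq_iff[OF x(1) carrier_of_int] k by simp
  also have "\<dots> = cl (k mod int p)" unfolding cl_eq_iff by (simp add: cong_def)
  finally show "c \<in> cl ` residues" using p_gt_2 by (intro image_eqI[of _ _ "k mod int p"]) auto
qed (use cl_carrier in auto)

lemma inj_cl: "inj_on cl residues"
  by (rule inj_onI) (simp add: cl_eq_iff cong_def)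

lemma card_K: "card (carrier K) = p"
  unfolding carrier_K card_image[OF inj_cl] by simp

lemma cl_nonzero: "cl k \<in> carrier K - {\<zero>\<^bsub>K\<^esub>} \<longleftrightarrow> \<not> int p dvd k"
  using cl_carrier[of k] cl_eq_iff[of k 0] unfolding cl_zero cong_0_iff by blast

text \<open>The power residue symbol, read as a function on the integers.\<close>

definition X :: "int \<Rightarrow> complex" where
  "X k = (if int p dvd k then 0 else power_residue_symbol M P (cl k))"

lemma power_residue_symbol_ex1:
  assumes "\<not> int p dvd k"
  shows "\<exists>!w. w ^ M = 1 \<and> eqP w (of_int (k ^ ((p - 1) div M)))"
proof -
  have "[(k ^ ((p - 1) div M)) ^ M = 1] (mod int p)"
  proof -
    have "(k ^ ((p - 1) div M)) ^ M = k * recip k"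
    proof -
      have "(p - 1) div M * M = Suc (p - 2)" using M_dvd p_gt_2 by simp
      then show ?thesis by (simp add: recip_def flip: power_mult)
    qed
    then show ?thesis using recip[OF assms] by simp
  qed
  from root_mod_p_lifts[OF this] show ?thesis
    using roots_of_unity_inj eqP_trans eqP_sym by blast
qed

text \<open>This form of the definite description is the one used below: both the multiplicativity and the value set of \<open>X\<close> follow from it.\<close>

lemma X_eq_iff:
  assumes "\<not> int p dvd k"
  shows "X k = w \<longleftrightarrow> w ^ M = 1 \<and> eqP w (of_int (k ^ ((p - 1) div M)))"
proof -
  have "power_residue_symbol M P (cl k) = (THE w. w ^ M = 1 \<and> eqP w (of_int (k ^ ((p - 1) div M))))"
    unfolding power_residue_symbol_def card_K cl_power
    unfolding cl_def by (intro arg_cong[of _ _ The] ext) (metis carrier_root_of_unity class_eq_iff carrier_of_int)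
  then have "X k = (THE w. w ^ M = 1 \<and> eqP w (of_int (k ^ ((p - 1) div M))))"
    using assms by (simp add: X_def)
  then show ?thesis using theI'[OF power_residue_symbol_ex1[OF assms]] power_residue_symbol_ex1[OF assms]
    by metis
qed

lemma X_M: "\<not> int p dvd k \<Longrightarrow> X k ^ M = 1"
  using X_eq_iff by blast

lemma mchar_X: "mchar X"
  unfolding mchar_def
proof (intro conjI allI periodicI)
  show "X x = X y" if "[x = y] (mod int p)" for x y
  proof -
    have "cl x = cl y" using that by (simp only: cl_eq_iff)
    moreover have "int p dvd x \<longleftrightarrow> int p dvd y" by (rule cong_dvd_iff[OF that])
    ultimately show ?thesis by (simp add: X_def)
  qed
  show "X x = 0 \<longleftrightarrow> int p dvd x" for x
  proof (cases "int p dvd x")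
    case False
    then have "X x \<noteq> 0" using X_M[OF False] M_pos by (auto simp: power_0_left)
    then show ?thesis using False by simp
  qed (simp add: X_def)
  show "X (x * y) = X x * X y" for x y
  proof (cases "int p dvd x * y")
    case True
    then have "int p dvd x \<or> int p dvd y" using prime_int_p by (simp add: prime_dvd_mult_iff)
    then show ?thesis using True by (auto simp: X_def)
  next
    case False
    then have xy: "\<not> int p dvd x" "\<not> int p dvd y" by auto
    have "eqP (X x) (of_int (x ^ ((p - 1) div M)))" "eqP (X y) (of_int (y ^ ((p - 1) div M)))"
      using X_eq_iff xy by blast+
    from eqP_mult[OF this] have "eqP (X x * X y) (of_int ((x * y) ^ ((p - 1) div M)))"
      by (simp add: power_mult_distrib)
    then show ?thesis using X_eq_iff[OF False] X_M xy by (simp add: power_mult_distrib)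
  qed
qed

text \<open>The integer congruent to \<open>zeta M\<close> is an \<open>M\<close>-th root of unity modulo \<open>p\<close>, hence a \<open>(p - 1) / M\<close>-th power of some integer \<open>k\<close>.\<close>

lemma X_zeta: "\<exists>k. \<not> int p dvd k \<and> X k = zeta M"
proof -
  obtain g where g: "\<not> int p dvd g"
    "\<And>x. [x ^ M = 1] (mod int p) \<Longrightarrow> \<exists>i. [x = (g ^ i) ^ ((p - 1) div M)] (mod int p)"
    by (rule primitive_root_of_order[OF M_pos M_dvd]) (rule that)
  obtain h where h: "eqP (zeta M) (of_int h)" using zeta_eqP_int by blast
  have "eqP (of_int (h ^ M)) (of_int 1)"
    using eqP_sym[OF eqP_power[OF h, of M]] zeta_power_M[OF M_pos] by simp
  then have "[h ^ M = 1] (mod int p)" unfolding eqP_of_int .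
  then obtain i where "[h = (g ^ i) ^ ((p - 1) div M)] (mod int p)" using g(2) by blast
  then have "eqP (of_int h) (of_int ((g ^ i) ^ ((p - 1) div M)))" unfolding eqP_of_int .
  then have "eqP (zeta M) (of_int ((g ^ i) ^ ((p - 1) div M)))" by (rule eqP_trans[OF h])
  moreover have u: "\<not> int p dvd g ^ i" using g(1) prime_int_p prime_dvd_power by blast
  ultimately have "X (g ^ i) = zeta M"
    using X_eq_iff[OF u] zeta_power_M[OF M_pos] by blast
  then show ?thesis using u by blast
qed

lemma iota_cl:
  assumes "\<lfloor>of_nat M * r\<rfloor> = int j" "j > 0"
  shows "iota M P r (cl k) = X k ^ j"
  using assms cl_nonzero[of k] by (auto simp: iota_def X_def)

end

section \<open>Period functions at 1 are Jacobi sums\<close>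

context prime_above
begin

lemma nonzero_class: "c \<in> carrier K - {\<zero>\<^bsub>K\<^esub>} \<Longrightarrow> \<exists>k. \<not> int p dvd k \<and> c = cl k"
  using carrier_K cl_nonzero by blast

lemma mult_character_outside:
  "\<psi> \<in> mult_characters K \<Longrightarrow> c \<notin> carrier K - {\<zero>\<^bsub>K\<^esub>} \<Longrightarrow> \<psi> c = 0"
  unfolding mult_characters_def by blast

lemma mchar_of_mult_character:
  assumes "\<psi> \<in> mult_characters K"
  shows "mchar (\<lambda>k. \<psi> (cl k))"
proof -
  have one: "\<psi> (cl 1) = 1" and zero: "\<And>k. int p dvd k \<Longrightarrow> \<psi> (cl k) = 0"
    and mult: "\<And>a b. \<not> int p dvd a \<Longrightarrow> \<not> int p dvd b \<Longrightarrow> \<psi> (cl (a * b)) = \<psi> (cl a) * \<psi> (cl b)"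
  proof -
    have \<psi>: "\<psi> \<one>\<^bsub>K\<^esub> = 1 \<and> (\<forall>x \<in> carrier K - {\<zero>\<^bsub>K\<^esub>}. \<forall>y \<in> carrier K - {\<zero>\<^bsub>K\<^esub>}.
        \<psi> (x \<otimes>\<^bsub>K\<^esub> y) = \<psi> x * \<psi> y) \<and> (\<forall>x. x \<notin> carrier K - {\<zero>\<^bsub>K\<^esub>} \<longrightarrow> \<psi> x = 0)"
      using assms unfolding mult_characters_def mem_Collect_eq .
    show "\<psi> (cl 1) = 1" unfolding cl_one[symmetric] by (rule conjunct1[OF \<psi>])
    show "\<psi> (cl k) = 0" if "int p dvd k" for k
      using conjunct2[OF conjunct2[OF \<psi>]] cl_nonzero[of k] that by metis
    show "\<psi> (cl (a * b)) = \<psi> (cl a) * \<psi> (cl b)" if ab: "\<not> int p dvd a" "\<not> int p dvd b" for a b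
      unfolding cl_mult
      by (rule bspec[OF bspec[OF conjunct1[OF conjunct2[OF \<psi>]]]]) (simp_all only: cl_nonzero ab not_False_eq_True)
  qed
  show ?thesis unfolding mchar_def
  proof (intro conjI allI periodicI)
    show "\<psi> (cl x) = \<psi> (cl y)" if "[x = y] (mod int p)" for x y
      using that by (simp only: cl_eq_iff[symmetric])
    show "\<psi> (cl x) = 0 \<longleftrightarrow> int p dvd x" for x
    proof (cases "int p dvd x")
      case False
      have "cl (x * recip x) = cl 1" using recip[OF False] by (simp only: cl_eq_iff)
      then have "\<psi> (cl x) * \<psi> (cl (recip x)) = 1"
        using mult[OF False not_dvd_recip[OF False]] one by simp
      then show ?thesis using False by auto
    qed (use zero in simp)
    show "\<psi> (cl (x * y)) = \<psi> (cl x) * \<psi> (cl y)" for x y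
    proof (cases "int p dvd x * y")
      case True
      then have "int p dvd x \<or> int p dvd y" using prime_int_p by (simp add: prime_dvd_mult_iff)
      then show ?thesis using zero True by auto
    next
      case False
      then show ?thesis by (intro mult) auto
    qed
  qed
qed

text \<open>Evaluation at a primitive root identifies the characters with the complex \<open>(p - 1)\<close>-th roots of unity, whose power sums are known.\<close>

lemma sum_mult_characters:
  assumes k: "\<not> int p dvd k"
  shows "(\<Sum>\<psi>\<in>mult_characters K. \<psi> (cl k)) = (if [k = 1] (mod int p) then of_nat (p - 1) else 0)"
proof -
  obtain g where g: "\<not> int p dvd g" "\<And>a b. [g ^ a = g ^ b] (mod int p) \<longleftrightarrow> [a = b] (mod (p - 1))"
    "\<And>x. \<not> int p dvd x \<Longrightarrow> \<exists>a. [x = g ^ a] (mod int p)"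
    by (rule primitive_root_of_order[OF M_pos M_dvd]) (rule that)
  have gu: "\<not> int p dvd g ^ a" for a using g(1) prime_int_p prime_dvd_power by blast
  have pw: "\<psi> (cl (g ^ a)) = \<psi> (cl g) ^ a" if "\<psi> \<in> mult_characters K" for \<psi> a
    by (rule mchar_power[OF mchar_of_mult_character[OF that]])
  have elem: "\<exists>a. c = cl (g ^ a)" if c: "c \<in> carrier K - {\<zero>\<^bsub>K\<^esub>}" for c
  proof -
    obtain x where x: "\<not> int p dvd x" "c = cl x" using nonzero_class[OF c] by blast
    obtain a where "[x = g ^ a] (mod int p)" using g(3)[OF x(1)] by blast
    then have "cl x = cl (g ^ a)" by (simp only: cl_eq_iff)
    then show ?thesis unfolding x(2) by (rule exI)
  qed
  have bij: "bij_betw (\<lambda>\<psi>. \<psi> (cl g)) (mult_characters K) {z. z ^ (p - 1) = 1}"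
  proof (rule bij_betw_imageI)
    show "inj_on (\<lambda>\<psi>. \<psi> (cl g)) (mult_characters K)"
    proof (rule inj_onI)
      fix \<psi> \<psi>' assume mem: "\<psi> \<in> mult_characters K" "\<psi>' \<in> mult_characters K" and e: "\<psi> (cl g) = \<psi>' (cl g)"
      show "\<psi> = \<psi>'"
      proof
        fix c show "\<psi> c = \<psi>' c"
        proof (cases "c \<in> carrier K - {\<zero>\<^bsub>K\<^esub>}")
          case True
          then obtain a where "c = cl (g ^ a)" using elem by blast
          then show ?thesis using pw[OF mem(1)] pw[OF mem(2)] e by metis
        next
          case False
          then show ?thesis using mult_character_outside mem by metis
        qed
      qed
    qed
    show "(\<lambda>\<psi>. \<psi> (cl g)) ` mult_characters K = {z. z ^ (p - 1) = 1}"
    proof (intro equalityI subsetI)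
      fix z assume "z \<in> (\<lambda>\<psi>. \<psi> (cl g)) ` mult_characters K"
      then obtain \<psi> where \<psi>: "\<psi> \<in> mult_characters K" "z = \<psi> (cl g)" by (rule imageE)
      have "[g ^ (p - 1) = g ^ 0] (mod int p)" unfolding g(2) by (simp add: cong_def)
      then have "cl (g ^ (p - 1)) = cl (g ^ 0)" by (simp only: cl_eq_iff)
      then have "\<psi> (cl g) ^ (p - 1) = \<psi> (cl g) ^ 0" using pw[OF \<psi>(1)] by metis
      then show "z \<in> {z. z ^ (p - 1) = 1}" using \<psi>(2) by simp
    next
      fix z :: complex assume "z \<in> {z. z ^ (p - 1) = 1}"
      then have z: "z ^ (p - 1) = 1" by simp
      have zmod: "z ^ a = z ^ (a mod (p - 1))" for a
      proof -
        have "z ^ a = z ^ ((p - 1) * (a div (p - 1)) + a mod (p - 1))" by simp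
        then show ?thesis using z by (simp only: power_add power_mult power_one mult_1_left)
      qed
      \<comment> \<open>The character with value \<open>z\<close> at the primitive root, defined through a discrete logarithm.\<close>
      define \<psi> where "\<psi> = (\<lambda>c. if c \<in> carrier K - {\<zero>\<^bsub>K\<^esub>} then z ^ (SOME a. c = cl (g ^ a)) else 0)"
      have \<psi>: "\<psi> (cl (g ^ a)) = z ^ a" for a
      proof -
        define b where "b = (SOME b. cl (g ^ a) = cl (g ^ b))"
        have "cl (g ^ a) = cl (g ^ b)" unfolding b_def by (rule someI) (rule refl)
        then have "[a = b] (mod (p - 1))" unfolding cl_eq_iff g(2) .
        then have "z ^ a = z ^ b" using zmod[of a] zmod[of b] by (simp only: cong_def)
        moreover have "cl (g ^ a) \<in> carrier K - {\<zero>\<^bsub>K\<^esub>}" unfolding cl_nonzero by (rule gu)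
        ultimately show ?thesis unfolding \<psi>_def b_def by (simp only: if_True)
      qed
      have "\<psi> \<in> mult_characters K"
        unfolding mult_characters_def mem_Collect_eq
      proof (intro conjI ballI allI impI)
        show "\<psi> \<one>\<^bsub>K\<^esub> = 1" using \<psi>[of 0] by (simp add: cl_one)
        show "\<psi> c = 0" if "c \<notin> carrier K - {\<zero>\<^bsub>K\<^esub>}" for c using that by (simp only: \<psi>_def if_False)
        fix x y assume "x \<in> carrier K - {\<zero>\<^bsub>K\<^esub>}" "y \<in> carrier K - {\<zero>\<^bsub>K\<^esub>}"
        then obtain a b where ab: "x = cl (g ^ a)" "y = cl (g ^ b)" using elem by metis
        show "\<psi> (x \<otimes>\<^bsub>K\<^esub> y) = \<psi> x * \<psi> y"
          unfolding ab cl_mult[symmetric] power_add[symmetric] \<psi> ..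
      qed
      moreover have "z = \<psi> (cl g)" using \<psi>[of 1] by simp
      ultimately show "z \<in> (\<lambda>\<psi>. \<psi> (cl g)) ` mult_characters K" by (intro image_eqI)
    qed
  qed
  obtain a where a: "[k = g ^ a] (mod int p)" using g(3)[OF k] by blast
  then have ck: "cl k = cl (g ^ a)" by (simp only: cl_eq_iff)
  have "(\<Sum>\<psi>\<in>mult_characters K. \<psi> (cl k)) = (\<Sum>\<psi>\<in>mult_characters K. \<psi> (cl g) ^ a)"
    unfolding ck by (intro sum.cong refl pw)
  also have "\<dots> = (\<Sum>z | z ^ (p - 1) = 1. z ^ a)"
    by (rule sum.reindex_bij_betw[OF bij])
  also have "\<dots> = (if (p - 1) dvd a then of_nat (p - 1) else 0)"
    using p_gt_2 by (intro sum_powers_roots_of_unity) simp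
  also have "(p - 1) dvd a \<longleftrightarrow> [k = 1] (mod int p)"
  proof -
    have "[k = 1] (mod int p) \<longleftrightarrow> [g ^ a = g ^ 0] (mod int p)"
      using a cong_trans cong_sym by (metis power_0)
    then show ?thesis unfolding g(2) cong_0_iff by simp
  qed
  finally show ?thesis .
qed

text \<open>For units, the sum tests whether \<open>x y = (1 - x) (1 - y)\<close>, that is, \<open>x + y = 1\<close>. The factors \<open>A x\<close> and \<open>B y\<close> take care of the
arguments where some character value vanishes.\<close>

lemma sum_mult_characters_quadruple:
  assumes A: "mchar A" and B: "mchar B"
  shows "A x * B y * (\<Sum>\<psi>\<in>mult_characters K. \<psi> (cl x) * \<psi> (cl y) * cnj (\<psi> (cl (1 - x))) * cnj (\<psi> (cl (1 - y)))) =
    (if [y = 1 - x] (mod int p) then of_nat (p - 1) * (A x * B (1 - x)) else 0)"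
proof (cases "int p dvd x \<or> int p dvd y")
  case True
  then have 0: "A x * B y = 0" using mchar_zero_iff[OF A] mchar_zero_iff[OF B] by auto
  have "A x * B (1 - x) = 0" if "[y = 1 - x] (mod int p)"
    using 0 mchar_cong[OF B that] by simp
  then show ?thesis unfolding 0 by simp
next
  case False
  then have xy: "\<not> int p dvd x" "\<not> int p dvd y" by auto
  have S: "(\<Sum>\<psi>\<in>mult_characters K. \<psi> (cl x) * \<psi> (cl y) * cnj (\<psi> (cl (1 - x))) * cnj (\<psi> (cl (1 - y)))) =
    (if [y = 1 - x] (mod int p) then of_nat (p - 1) else 0)"
  proof (cases "int p dvd 1 - x \<or> int p dvd 1 - y")
    case True
    have "\<not> [y = 1 - x] (mod int p)"
    proof
      assume e: "[y = 1 - x] (mod int p)"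
      then have "int p dvd y \<longleftrightarrow> int p dvd 1 - x" by (rule cong_dvd_iff)
      then have "int p dvd 1 - y" using True xy by simp
      moreover have "int p dvd y - (1 - x)" using e by (simp add: cong_iff_dvd_diff)
      ultimately have "int p dvd (1 - y) + (y - (1 - x))" by (rule dvd_add)
      then show False using xy by simp
    qed
    moreover have "\<psi> (cl x) * \<psi> (cl y) * cnj (\<psi> (cl (1 - x))) * cnj (\<psi> (cl (1 - y))) = 0" if "\<psi> \<in> mult_characters K" for \<psi>
      using True mchar_zero_iff[OF mchar_of_mult_character[OF that]] by auto
    ultimately show ?thesis by (simp only: if_False sum.neutral_const cong: sum.cong)
  next
    case False
    then have u: "\<not> int p dvd 1 - x" "\<not> int p dvd 1 - y" by auto
    define t where "t = x * y * recip (1 - x) * recip (1 - y)"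
    have tu: "\<not> int p dvd t" unfolding t_def using xy u not_dvd_recip prime_int_p by (simp add: prime_dvd_mult_iff)
    have "\<psi> (cl x) * \<psi> (cl y) * cnj (\<psi> (cl (1 - x))) * cnj (\<psi> (cl (1 - y))) = \<psi> (cl t)" if "\<psi> \<in> mult_characters K" for \<psi>
      unfolding t_def mchar_mult[OF mchar_of_mult_character[OF that]]
        mchar_recip_cnj[OF mchar_of_mult_character[OF that] u(1)] mchar_recip_cnj[OF mchar_of_mult_character[OF that] u(2)] ..
    then have "(\<Sum>\<psi>\<in>mult_characters K. \<psi> (cl x) * \<psi> (cl y) * cnj (\<psi> (cl (1 - x))) * cnj (\<psi> (cl (1 - y)))) =
        (\<Sum>\<psi>\<in>mult_characters K. \<psi> (cl t))" by (intro sum.cong refl)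
    also have "\<dots> = (if [t = 1] (mod int p) then of_nat (p - 1) else 0)" by (rule sum_mult_characters[OF tu])
    also have "[t = 1] (mod int p) \<longleftrightarrow> [y = 1 - x] (mod int p)"
    proof -
      let ?D = "(1 - x) * (1 - y)"
      have "[t * ?D = x * y] (mod int p)"
      proof -
        have "[x * y * (((1 - x) * recip (1 - x)) * ((1 - y) * recip (1 - y))) = x * y * (1 * 1)] (mod int p)"
          by (intro cong_mult cong_refl recip u)
        then show ?thesis by (simp add: t_def mult_ac)
      qed
      moreover have "[t * ?D = 1 * ?D] (mod int p) \<longleftrightarrow> [t = 1] (mod int p)"
      proof (rule cong_mult_rcancel)
        have "\<not> int p dvd ?D" using u prime_int_p by (simp add: prime_dvd_mult_iff)
        then show "coprime ?D (int p)"
          using prime_imp_coprime[OF prime_int_p] coprime_commute by blast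
      qed
      ultimately have "[t = 1] (mod int p) \<longleftrightarrow> [x * y = ?D] (mod int p)"
        unfolding mult_1_left using cong_trans cong_sym by blast
      also have "\<dots> \<longleftrightarrow> int p dvd y - (1 - x)" unfolding cong_iff_dvd_diff by (simp add: algebra_simps)
      finally show ?thesis by (simp add: cong_iff_dvd_diff)
    qed
    finally show ?thesis .
  qed
  show ?thesis
  proof (cases "[y = 1 - x] (mod int p)")
    case True
    then show ?thesis unfolding S using mchar_cong[OF B True] by simp
  qed (simp add: S)
qed

text \<open>The character \<open>iota 1\<close> is trivial, and the signs \<open>\<psi> (- 1)\<close> of the two binomials cancel; the double sum over \<open>x\<close> and \<open>y\<close> then
collapses to the diagonal \<open>y = 1 - x\<close>.\<close>

lemma period_fun_eq_jac:
  assumes j: "\<lfloor>of_nat M * r1\<rfloor> = int j1" "j1 > 0" "\<lfloor>of_nat M * r2\<rfloor> = int j2" "j2 > 0"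
  shows "period_fun M P r1 r2 1 \<one>\<^bsub>K\<^esub> = X (- 1) ^ j2 * jac (\<lambda>k. X k ^ j1) (\<lambda>k. X k ^ j2)"
proof -
  let ?A = "\<lambda>k. X k ^ j1" and ?B = "\<lambda>k. X k ^ j2" and ?M = "mult_characters K"
  have A: "mchar ?A" and B: "mchar ?B" using mchar_pow[OF mchar_X] j by auto
  have i1: "iota M P r1 (cl k) = ?A k" and i2: "iota M P r2 (cl k) = ?B k" for k
    using iota_cl j by auto
  have i3: "iota M P 1 (cl k) = (if int p dvd k then 0 else 1)" for k
    using iota_cl[of 1 M k] X_M[of k] M_pos by (simp add: X_def)
  have js: "jacobi_sum K f h = (\<Sum>x\<in>residues. f (cl x) * h (cl (1 - x)))" for f h
    unfolding jacobi_sum_def carrier_K sum.reindex[OF inj_cl] cl_one cl_minus o_def ..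
  have cb: "char_binom K f h = h (cl (- 1)) / of_nat p * (\<Sum>x\<in>residues. f (cl x) * cnj (h (cl (1 - x))))" for f h
    unfolding char_binom_def js card_K cl_one cl_uminus ..
  let ?q = "\<lambda>\<psi> x y. \<psi> (cl x) * \<psi> (cl y) * cnj (\<psi> (cl (1 - x))) * cnj (\<psi> (cl (1 - y)))"
  have summand: "char_binom K (\<lambda>c. iota M P r1 c * \<psi> c) \<psi> *
      char_binom K (\<lambda>c. iota M P r2 c * \<psi> c) (\<lambda>c. iota M P 1 c * \<psi> c) * \<psi> (cl 1) =
    1 / (of_nat p)\<^sup>2 * (\<Sum>x\<in>residues. \<Sum>y\<in>residues. ?A x * ?B y * ?q \<psi> x y)" if \<psi>: "\<psi> \<in> ?M" for \<psi>
  proof -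
    note m = mchar_of_mult_character[OF \<psi>]
    have Q: "iota M P 1 (cl k) * \<psi> (cl k) = \<psi> (cl k)" for k
      unfolding i3 using mchar_zero_iff[OF m, of k] by simp
    have "char_binom K (\<lambda>c. iota M P r1 c * \<psi> c) \<psi> *
      char_binom K (\<lambda>c. iota M P r2 c * \<psi> c) (\<lambda>c. iota M P 1 c * \<psi> c) * \<psi> (cl 1) =
      (\<psi> (cl (- 1)) * \<psi> (cl (- 1))) / (of_nat p)\<^sup>2 *
       ((\<Sum>x\<in>residues. ?A x * \<psi> (cl x) * cnj (\<psi> (cl (1 - x)))) * (\<Sum>y\<in>residues. ?B y * \<psi> (cl y) * cnj (\<psi> (cl (1 - y)))))"
      unfolding cb Q i1 i2 mchar_1[OF m] by (simp add: power2_eq_square)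
    also have "\<dots> = 1 / (of_nat p)\<^sup>2 * (\<Sum>x\<in>residues. \<Sum>y\<in>residues. ?A x * ?B y * ?q \<psi> x y)"
      unfolding sum_product mchar_minus1_sq[OF m] by (simp add: mult_ac)
    finally show ?thesis .
  qed
  have inner: "(\<Sum>y\<in>residues. if [y = 1 - x] (mod int p) then of_nat (p - 1) * (?A x * ?B (1 - x)) else 0) =
      of_nat (p - 1) * (?A x * ?B (1 - x))" for x
  proof -
    have "(\<Sum>y\<in>residues. if [y = 1 - x] (mod int p) then of_nat (p - 1) * (?A x * ?B (1 - x)) else 0) =
        (\<Sum>y\<in>residues. if y = (1 - x) mod int p then of_nat (p - 1) * (?A x * ?B (1 - x)) else 0)"
      by (intro sum.cong refl) (auto simp: cong_def)
    also have "\<dots> = of_nat (p - 1) * (?A x * ?B (1 - x))"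
      using p_gt_2 by (subst sum.delta) auto
    finally show ?thesis .
  qed
  have "(\<Sum>\<psi>\<in>?M. char_binom K (\<lambda>c. iota M P r1 c * \<psi> c) \<psi> *
      char_binom K (\<lambda>c. iota M P r2 c * \<psi> c) (\<lambda>c. iota M P 1 c * \<psi> c) * \<psi> (cl 1)) =
      (\<Sum>\<psi>\<in>?M. 1 / (of_nat p)\<^sup>2 * (\<Sum>x\<in>residues. \<Sum>y\<in>residues. ?A x * ?B y * ?q \<psi> x y))"
    by (intro sum.cong refl summand)
  also have "\<dots> = 1 / (of_nat p)\<^sup>2 * (\<Sum>\<psi>\<in>?M. \<Sum>x\<in>residues. \<Sum>y\<in>residues. ?A x * ?B y * ?q \<psi> x y)"
    by (rule sum_distrib_left[symmetric])
  also have "(\<Sum>\<psi>\<in>?M. \<Sum>x\<in>residues. \<Sum>y\<in>residues. ?A x * ?B y * ?q \<psi> x y) =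
      (\<Sum>x\<in>residues. \<Sum>\<psi>\<in>?M. \<Sum>y\<in>residues. ?A x * ?B y * ?q \<psi> x y)"
    by (rule sum.swap)
  also have "\<dots> = (\<Sum>x\<in>residues. \<Sum>y\<in>residues. ?A x * ?B y * (\<Sum>\<psi>\<in>?M. ?q \<psi> x y))"
    by (subst sum.swap) (simp only: sum_distrib_left)
  also have "\<dots> = (\<Sum>x\<in>residues. of_nat (p - 1) * (?A x * ?B (1 - x)))"
    by (simp only: sum_mult_characters_quadruple[OF A B] inner)
  also have "\<dots> = of_nat (p - 1) * jac ?A ?B"
    unfolding jac_def sum_distrib_left ..
  finally have S: "(\<Sum>\<psi>\<in>?M. char_binom K (\<lambda>c. iota M P r1 c * \<psi> c) \<psi> *
      char_binom K (\<lambda>c. iota M P r2 c * \<psi> c) (\<lambda>c. iota M P 1 c * \<psi> c) * \<psi> (cl 1)) =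
      1 / (of_nat p)\<^sup>2 * (of_nat (p - 1) * jac ?A ?B)" .
  have i3': "iota M P 1 (cl (- 1)) = 1" using not_dvd_minus1 by (simp add: i3)
  have p1: "(of_nat (p - 1) :: complex) = of_nat p - 1" "(of_nat p :: complex) - 1 \<noteq> 0" "(of_nat p :: complex) \<noteq> 0"
    using p_gt_2 by (auto simp: of_nat_diff)
  have "period_fun M P r1 r2 1 \<one>\<^bsub>K\<^esub> = (of_nat p)\<^sup>2 / (of_nat p - 1) * (?B (- 1) * 1) *
      (1 / (of_nat p)\<^sup>2 * (of_nat (p - 1) * jac ?A ?B))"
    unfolding period_fun_def Let_def card_K cl_one cl_uminus i2 i3' S ..
  also have "\<dots> = ?B (- 1) * jac ?A ?B" using p1(2,3) unfolding p1(1) by (simp add: field_simps)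
  finally show ?thesis .
qed

text \<open>The exponents \<open>M - i\<close> and \<open>M - j\<close> of the second period function give the conjugate characters.\<close>

lemma period_sum_eq:
  assumes M3: "M = 3 * i" and j: "\<lfloor>of_nat M * r\<rfloor> = int j" "0 < j" "j < M" "\<lfloor>of_nat M * (1 - r)\<rfloor> = int (M - j)"
  defines "T \<equiv> X (- 27) ^ j * jac (\<lambda>k. X k ^ i) (\<lambda>k. X k ^ j)"
  shows "iota M P r (residue_class M P 27) * period_fun M P (1/3) r 1 \<one>\<^bsub>K\<^esub> +
      iota M P (1 - r) (residue_class M P 27) * period_fun M P (2/3) (1 - r) 1 \<one>\<^bsub>K\<^esub> = T + cnj T"
proof -
  have i0: "i > 0" "i < M" "M - i > 0" "M - j > 0" using M3 M_pos j by auto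
  have f: "\<lfloor>of_nat M * (1/3 :: rat)\<rfloor> = int i" "\<lfloor>of_nat M * (2/3 :: rat)\<rfloor> = int (M - i)"
  proof -
    have e: "of_nat M * (1/3 :: rat) = of_int (int i)" "of_nat M * (2/3 :: rat) = of_int (int (M - i))"
      using i0 by (simp_all add: M3 of_nat_diff)
    show "\<lfloor>of_nat M * (1/3 :: rat)\<rfloor> = int i" "\<lfloor>of_nat M * (2/3 :: rat)\<rfloor> = int (M - i)"
      unfolding e by (rule floor_of_int)+
  qed
  have conj: "X k ^ (M - n) = cnj (X k ^ n)" if n: "0 < n" "n < M" for k n
  proof (cases "int p dvd k")
    case True
    then show ?thesis using n by (simp add: X_def power_0_left)
  next
    case False
    have "X k ^ (M - n) * X k ^ n = 1" using X_M[OF False] n by (simp flip: power_add)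
    moreover have "cnj (X k ^ n) * X k ^ n = 1"
      using mchar_cnj_mult[OF mchar_X False] by (simp flip: power_mult_distrib)
    ultimately show ?thesis by (metis mult_cancel_right zero_neq_one mult_zero_right)
  qed
  have c27: "residue_class M P 27 = cl 27" by (simp add: cl_def)
  have m27: "X 27 ^ n * X (- 1) ^ n = X (- 27) ^ n" for n
    using mchar_mult[OF mchar_X, of 27 "-1"] by (simp flip: power_mult_distrib)
  have "iota M P r (cl 27) * period_fun M P (1/3) r 1 \<one>\<^bsub>K\<^esub> = T"
    unfolding period_fun_eq_jac[OF f(1) i0(1) j(1,2)] iota_cl[OF j(1,2)] T_def m27[symmetric] by (simp only: mult.assoc)
  moreover have "iota M P (1 - r) (cl 27) * period_fun M P (2/3) (1 - r) 1 \<one>\<^bsub>K\<^esub> =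
      X (- 27) ^ (M - j) * jac (\<lambda>k. X k ^ (M - i)) (\<lambda>k. X k ^ (M - j))"
    unfolding period_fun_eq_jac[OF f(2) i0(3) j(4) i0(4)] iota_cl[OF j(4) i0(4)] m27[symmetric] by (simp only: mult.assoc)
  moreover have "\<dots> = cnj T"
    unfolding conj[OF j(2,3)] conj[OF i0(1,2)] T_def complex_cnj_mult jac_cnj ..
  ultimately show ?thesis unfolding c27 by simp
qed

end

section \<open>Comparison of the two sides\<close>

lemma zeta_3_conj: "zeta 3 + cnj (zeta 3) = - 1" "(zeta 3)\<^sup>2 = cnj (zeta 3)"
  unfolding zeta_def by (auto simp: complex_eq_iff power2_eq_square cos_120 sin_120)

context prime_above
begin

lemma not_dvd_3: "\<not> int p dvd 3" "\<not> int p dvd - 3"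
proof -
  have "int M = 3 * (int M div 3)" using M by auto
  then have "3 dvd int M" by (rule dvdI)
  then show "\<not> int p dvd 3" using not_dvd_M dvd_trans by blast
  then show "\<not> int p dvd - 3" by simp
qed

lemma X_power_nontrivial:
  assumes "\<not> M dvd n"
  shows "\<exists>k. \<not> int p dvd k \<and> X k ^ n \<noteq> 1"
  using X_zeta zeta_power_eq_1[of n] assms by metis

lemma X_power_M: "\<not> int p dvd k \<Longrightarrow> M dvd n \<Longrightarrow> X k ^ n = 1"
  using X_M by (auto elim!: dvdE simp: power_mult)

lemma cnj_X_power: "\<not> int p dvd k \<Longrightarrow> cnj (X k) ^ n * X k ^ n = 1"
  using mchar_cnj_mult[OF mchar_X] by (metis power_mult_distrib power_one)

lemma X_minus_27: "X (- 27) = X (- 3) ^ 3"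
proof -
  have "(- 27 :: int) = (- 3) ^ 3" by simp
  then show ?thesis by (simp only: mchar_power[OF mchar_X])
qed

text \<open>If \<open>p\<close> divides one entry it divides both, and then \<open>p\<^sup>2\<close> divides \<open>p\<close>.\<close>

lemma norm_form_units:
  assumes "int p = c\<^sup>2 + 3 * d\<^sup>2"
  shows "\<not> int p dvd c" "\<not> int p dvd d"
proof -
  have both: False if "int p dvd c" "int p dvd d"
  proof -
    have "int p * int p dvd c * c + 3 * (d * d)" using that by (intro dvd_add dvd_mult mult_dvd_mono)
    then have "int p * int p dvd int p * 1" using assms by (simp add: power2_eq_square)
    then have "int p dvd 1" using p_gt_2 by (simp only: dvd_mult_cancel_left) simp
    then show False using not_dvd_1 by simp
  qed
  have "int p dvd c \<longleftrightarrow> int p dvd d"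
  proof -
    have "int p dvd c \<longleftrightarrow> int p dvd c\<^sup>2" using prime_int_p by (simp add: prime_dvd_power_iff)
    also have "\<dots> \<longleftrightarrow> int p dvd 3 * d\<^sup>2"
    proof -
      have "int p dvd c\<^sup>2 + 3 * d\<^sup>2" using assms by simp
      then show ?thesis by (metis dvd_add_left_iff dvd_add_right_iff)
    qed
    also have "\<dots> \<longleftrightarrow> int p dvd d" using prime_int_p not_dvd_3 by (simp add: prime_dvd_mult_iff prime_dvd_power_iff)
    finally show ?thesis .
  qed
  then show "\<not> int p dvd c" "\<not> int p dvd d" using both by auto
qed

text \<open>Modulo \<open>p\<close> the square of \<open>c\<close> is \<open>- 3 d\<^sup>2\<close>.\<close>

lemma mchar_minus_3:
  assumes "mchar B" "int p = c\<^sup>2 + 3 * d\<^sup>2"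
  shows "B c ^ 2 = B (- 3) * B d ^ 2"
proof -
  have "[c\<^sup>2 = - 3 * d\<^sup>2] (mod int p)" using assms(2) by (simp add: cong_iff_dvd_diff)
  from mchar_cong[OF assms(1) this] show ?thesis by (simp only: mchar_mult[OF assms(1)] mchar_power[OF assms(1)])
qed

text \<open>The trace of the cubic Jacobi sum, from \<open>w + cnj w = - 1\<close>.\<close>

lemma cubic_sum_of_conjugates:
  assumes C: "mchar C" "\<And>x. \<not> int p dvd x \<Longrightarrow> C x ^ 3 = 1" "\<exists>g. \<not> int p dvd g \<and> C g \<noteq> 1"
  obtains y m where "y mod 3 = 1" "int p = y\<^sup>2 + 3 * y * m + 9 * m\<^sup>2" "jac C C + cnj (jac C C) = - of_int (2 * y + 3 * m)"
proof -
  obtain g where g: "\<not> int p dvd g" "C g \<noteq> 1" using C(3) by blast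
  show ?thesis
  proof (rule cubic_jacobi_sum[OF zeta_quadratics(1) C(1,2) g])
    fix y m assume ym: "y mod 3 = 1" "int p = y\<^sup>2 + 3 * y * m + 9 * m\<^sup>2" "jac C C = - of_int y + 3 * of_int m * zeta 3"
    have "jac C C + cnj (jac C C) = - 2 * of_int y + 3 * of_int m * (zeta 3 + cnj (zeta 3))"
      unfolding ym(3) by (simp add: algebra_simps)
    then have "jac C C + cnj (jac C C) = - of_int (2 * y + 3 * m)" unfolding zeta_3_conj by simp
    then show thesis using ym that by blast
  qed
qed

text \<open>The element \<open>w - w\<^sup>2\<close> is purely imaginary.\<close>

lemma cubic_quadratic_sum_of_conjugates:
  assumes C: "mchar C" "\<And>x. \<not> int p dvd x \<Longrightarrow> C x ^ 3 = 1" "\<exists>g. \<not> int p dvd g \<and> C g \<noteq> 1"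
    and F: "mchar F" "\<And>x. \<not> int p dvd x \<Longrightarrow> F x * F x = 1" "\<exists>g. \<not> int p dvd g \<and> F g \<noteq> 1"
    and CF: "\<exists>g. \<not> int p dvd g \<and> C g * F g \<noteq> 1"
  obtains c d where "c mod 3 = 1" "int p = c\<^sup>2 + 3 * d\<^sup>2" "jac C F + cnj (jac C F) = - 2 * of_int c"
proof -
  obtain g k l where g: "\<not> int p dvd g" "C g \<noteq> 1" and k: "\<not> int p dvd k" "F k \<noteq> 1" and l: "\<not> int p dvd l" "C l * F l \<noteq> 1"
    using C(3) F(3) CF by blast
  show ?thesis
  proof (rule cubic_quadratic_jacobi_sum[OF zeta_quadratics(1) C(1,2) g F(1,2) k l])
    fix c d assume cd: "c mod 3 = 1" "int p = c\<^sup>2 + 3 * d\<^sup>2" "jac C F = - (of_int c + of_int d * (zeta 3 - (zeta 3)\<^sup>2))"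
    have "jac C F + cnj (jac C F) = - 2 * of_int c"
      unfolding cd(3) zeta_3_conj(2) by (simp add: algebra_simps)
    then show thesis using cd that by blast
  qed
qed

lemma coeff_f_27_eq_jacobi_sums:
  assumes M3: "M = 3"
  shows "- fourier_coeff f_27_2_a_a p = jac X X + cnj (jac X X)"
proof -
  have nt: "\<exists>g. \<not> int p dvd g \<and> X g \<noteq> 1" using X_power_nontrivial[of 1] by (simp add: M3)
  have X3: "X x ^ 3 = 1" if "\<not> int p dvd x" for x
    using X_M[OF that] unfolding M3 .
  obtain y m where "y mod 3 = 1" "int p = y\<^sup>2 + 3 * y * m + 9 * m\<^sup>2"
    "jac X X + cnj (jac X X) = - of_int (2 * y + 3 * m)"
    by (rule cubic_sum_of_conjugates[OF mchar_X X3 nt]) (assumption | rule that)+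
  then show ?thesis using coeff_f_27[OF prime_p odd_p] by simp
qed

text \<open>The entries \<open>c = 3 t + 1\<close> and \<open>d\<close> of the norm form have different parity, so \<open>t + d\<close> is even and \<open>p\<close> has the shape required by
\<open>coeff_f_36\<close>. The symbol of \<open>-3\<close> is quadratic here, and \<open>-3\<close> is a square modulo \<open>p\<close>.\<close>

lemma coeff_f_36_eq_jacobi_sums:
  assumes M6: "M = 6"
  shows "- fourier_coeff f_36_2_a_a p = jac (\<lambda>k. X k ^ 2) (\<lambda>k. X k ^ 3) + cnj (jac (\<lambda>k. X k ^ 2) (\<lambda>k. X k ^ 3))"
    and "X (- 3) ^ 3 = 1"
proof -
  let ?C = "\<lambda>k. X k ^ 2" and ?F = "\<lambda>k. X k ^ 3"
  have m: "mchar ?C" "mchar ?F" by (simp_all add: mchar_pow[OF mchar_X])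
  have C3: "?C x ^ 3 = 1" if "\<not> int p dvd x" for x
    using X_power_M[OF that, of "2 * 3"] by (simp only: power_mult M6) simp
  have F2: "?F x * ?F x = 1" if "\<not> int p dvd x" for x
    using X_power_M[OF that, of "3 + 3"] by (simp only: power_add M6) simp
  have nt: "\<exists>g. \<not> int p dvd g \<and> ?C g \<noteq> 1" "\<exists>g. \<not> int p dvd g \<and> ?F g \<noteq> 1" "\<exists>g. \<not> int p dvd g \<and> ?C g * ?F g \<noteq> 1"
    using X_power_nontrivial[of 2] X_power_nontrivial[of 3] X_power_nontrivial[of 5]
    by (simp_all add: M6 flip: power_add)
  obtain c d where cd: "c mod 3 = 1" "int p = c\<^sup>2 + 3 * d\<^sup>2" "jac ?C ?F + cnj (jac ?C ?F) = - 2 * of_int c"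
    by (rule cubic_quadratic_sum_of_conjugates[OF m(1) C3 nt(1) m(2) F2 nt(2,3)]) (assumption | rule that)+
  obtain t where t: "c = 3 * t + 1" using cd(1) by (metis mult_div_mod_eq)
  have "odd (c\<^sup>2 + 3 * d\<^sup>2)" using odd_p cd(2) by (metis even_of_nat)
  then have "even (t + d)" unfolding t by auto
  then obtain a where a: "t + d = 2 * a" by (rule evenE)
  define b where "b = t - a"
  have "3 * a + 3 * b + 1 = c" "a - b = d" using a t by (auto simp: b_def)
  then have "fourier_coeff f_36_2_a_a p = 2 * of_int c"
    using coeff_f_36[OF prime_p odd_p, of a b] cd(2) by simp
  then show "- fourier_coeff f_36_2_a_a p = jac ?C ?F + cnj (jac ?C ?F)" using cd(3) by simp
  show "X (- 3) ^ 3 = 1"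
    using mchar_minus_3[OF m(2) cd(2)] F2[OF norm_form_units(1)[OF cd(2)]] F2[OF norm_form_units(2)[OF cd(2)]]
    by (simp add: power2_eq_square)
qed

text \<open>By inversion, since \<open>X\<^sup>2 X\<close> is the real character \<open>X\<^sup>3\<close>.\<close>

lemma jac_sextic:
  assumes M6: "M = 6"
  shows "jac (\<lambda>k. X k ^ 2) X = jac (\<lambda>k. X k ^ 2) (\<lambda>k. X k ^ 3)"
proof -
  let ?C = "\<lambda>k. X k ^ 2" and ?F = "\<lambda>k. X k ^ 3"
  have m: "mchar ?C" "mchar ?F" by (simp_all add: mchar_pow[OF mchar_X])
  have "jac ?C X = ?C (- 1) * jac ?C (\<lambda>x. cnj (?C x * X x))" by (rule jac_inversion'[OF m(1) mchar_X])
  also have "?C (- 1) = 1" using mchar_minus1_sq[OF mchar_X] by (simp add: power2_eq_square)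
  also have "jac ?C (\<lambda>x. cnj (?C x * X x)) = jac ?C ?F"
  proof (rule jac_cong_units)
    fix x assume x: "\<not> int p dvd x"
    have "cnj (X x) ^ 3 * X x ^ 3 = X x ^ 3 * X x ^ 3"
      using cnj_X_power[OF x, of 3] X_power_M[OF x, of "3 + 3"] unfolding M6 power_add by simp
    moreover have "X x ^ 3 \<noteq> 0" using mchar_zero_iff[OF mchar_X] x by simp
    ultimately have "cnj (X x) ^ 3 = X x ^ 3" by (metis mult_cancel_right power_eq_0_iff)
    then show "cnj (?C x * X x) = ?F x" by (simp add: eval_nat_numeral mult.assoc)
  next
    show "mchar (\<lambda>x. cnj (?C x * X x))" by (rule mchar_cnj[OF mchar_times[OF m(1) mchar_X]])
  qed (simp_all add: m)
  finally show ?thesis by simp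
qed

text \<open>With \<open>C = X\<^sup>4\<close> cubic, \<open>L = cnj (X\<^sup>3)\<close> quartic and \<open>F = X\<^sup>6\<close> quadratic one has \<open>X = C L\<close>, so the Jacobi sum is \<open>J C C\<close>. The
cofactor \<open>X (- 27)\<close> is the quartic symbol of \<open>-3\<close>, which is \<open>F c F d\<close> when \<open>p = c\<^sup>2 + 3 d\<^sup>2\<close>.\<close>

lemma coeff_f_432_eq_jacobi_sums:
  assumes M12: "M = 12"
  shows "- fourier_coeff f_432_2_c_a p = X (- 27) * jac (\<lambda>k. X k ^ 4) X + cnj (X (- 27) * jac (\<lambda>k. X k ^ 4) X)"
proof -
  let ?C = "\<lambda>k. X k ^ 4" and ?F = "\<lambda>k. X k ^ 6" and ?N = "\<lambda>k. X k ^ 3"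
  let ?L = "\<lambda>k. cnj (X k ^ 3)"
  have m: "mchar ?C" "mchar ?F" "mchar ?N" by (simp_all add: mchar_pow[OF mchar_X])
  have mL: "mchar ?L" by (rule mchar_cnj[OF m(3)])
  have C3: "?C x ^ 3 = 1" if "\<not> int p dvd x" for x
    using X_power_M[OF that, of "4 * 3"] by (simp only: power_mult M12) simp
  have F2: "?F x * ?F x = 1" if "\<not> int p dvd x" for x
    using X_power_M[OF that, of "6 + 6"] by (simp only: power_add M12) simp
  have nt: "\<exists>g. \<not> int p dvd g \<and> ?C g \<noteq> 1" "\<exists>g. \<not> int p dvd g \<and> ?F g \<noteq> 1" "\<exists>g. \<not> int p dvd g \<and> ?C g * ?F g \<noteq> 1"
    using X_power_nontrivial[of 4] X_power_nontrivial[of 6] X_power_nontrivial[of 10]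
    by (simp_all add: M12 flip: power_add)
  obtain g where g: "\<not> int p dvd g" "?C g \<noteq> 1" using nt(1) by blast
  obtain f where f: "\<not> int p dvd f" "?F f \<noteq> 1" using nt(2) by blast
  obtain h where h: "\<not> int p dvd h" "X h ^ 2 \<noteq> 1" using X_power_nontrivial[of 2] M12 by auto
  have FC: "?F h * cnj (?C h) \<noteq> 1"
  proof -
    have "?F h * cnj (?C h) = X h ^ 2 * (cnj (X h) ^ 4 * X h ^ 4)" by (simp add: eval_nat_numeral)
    then show ?thesis using h cnj_X_power[OF h(1), of 4] by simp
  qed
  have F1: "?F (- 1) = 1"
  proof -
    have "?F (- 1) = (X (- 1) * X (- 1)) ^ 3" by (simp add: eval_nat_numeral)
    then show ?thesis using mchar_minus1_sq[OF mchar_X] by simp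
  qed
  have L2: "?L x * ?L x = ?F x" for x
  proof (cases "int p dvd x")
    case True
    then show ?thesis by (simp add: X_def)
  next
    case False
    have "cnj (X x) ^ 6 * X x ^ 6 = X x ^ 6 * X x ^ 6" using cnj_X_power[OF False, of 6] F2[OF False] by simp
    moreover have "X x ^ 6 \<noteq> 0" using mchar_zero_iff[OF mchar_X] False by simp
    ultimately have "cnj (X x) ^ 6 = X x ^ 6" by (metis mult_cancel_right power_eq_0_iff)
    then show ?thesis by (simp flip: power_add)
  qed
  have "jac ?C (\<lambda>x. ?C x * ?L x) = jac ?C ?C"
    by (rule jac_quartic_twist[OF m(2) F2 nt(2) F1 m(1) C3 g mL L2 h(1) FC])
  moreover have "jac ?C (\<lambda>x. ?C x * ?L x) = jac ?C X"
  proof (rule jac_cong_units)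
    fix x assume x: "\<not> int p dvd x"
    have "?C x * ?L x = X x * (cnj (X x) ^ 3 * X x ^ 3)" by (simp add: eval_nat_numeral)
    then show "?C x * ?L x = X x" using cnj_X_power[OF x, of 3] by simp
  next
    show "mchar (\<lambda>x. ?C x * ?L x)" by (rule mchar_times[OF m(1) mL])
  qed (simp_all add: m mchar_X)
  ultimately have J: "jac ?C X = jac ?C ?C" by simp
  obtain y n where yn: "y mod 3 = 1" "int p = y\<^sup>2 + 3 * y * n + 9 * n\<^sup>2" "jac ?C ?C + cnj (jac ?C ?C) = - of_int (2 * y + 3 * n)"
    by (rule cubic_sum_of_conjugates[OF m(1) C3 nt(1)]) (assumption | rule that)+
  obtain c d where cd: "c mod 3 = 1" "int p = c\<^sup>2 + 3 * d\<^sup>2"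
    by (rule cubic_quadratic_sum_of_conjugates[OF m(1) C3 nt(1) m(2) F2 nt(2,3)]) (assumption | rule that)+
  have p12: "p mod 12 = 1" using pM M12 by simp
  then have p4: "p mod 4 = 1" by presburger
  have parity: "odd c \<and> even d"
  proof -
    have o: "odd c \<noteq> odd d"
    proof -
      have "odd (c\<^sup>2 + 3 * d\<^sup>2)" using odd_p cd(2) by (metis even_of_nat)
      then show ?thesis by auto
    qed
    have "\<not> odd d"
    proof
      assume "odd d"
      then obtain s where s: "d = 2 * s + 1" by (rule oddE)
      obtain t where t: "c = 2 * t" using o \<open>odd d\<close> by (auto elim: evenE)
      define u where "u = t\<^sup>2 + 3 * s\<^sup>2 + 3 * s"
      have "int p = 4 * u + 3" unfolding u_def cd(2) s t by (simp add: power2_eq_square algebra_simps)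
      then have "int p mod 4 = 3" by presburger
      moreover have "int p mod 4 = 1" using p4 by (metis of_nat_1 of_nat_mod of_nat_numeral)
      ultimately show False by simp
    qed
    then show ?thesis using o by auto
  qed
  then obtain l where l: "d = 2 * l" by (auto elim: evenE)
  obtain s where s: "c = 3 * s + 1" using cd(1) by (metis mult_div_mod_eq)
  have "even s" using parity s by auto
  then obtain k where k: "c = 6 * k + 1" using s by (auto elim: evenE)
  have kl: "int p = (6 * k + 1)\<^sup>2 + 3 * (2 * l)\<^sup>2" using cd(2) unfolding k l .
  note u = norm_form_units[OF cd(2)]
  have "?F c * ?F d = (-1) powi (k + l)"
    using quadratic_symbol_product[OF m(2) quadratic_mchar_eq_Legendre[OF m(2) F2 f] p4 kl] unfolding k l .
  moreover have "?F c * ?F d = X (- 27)"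
  proof -
    have e: "?F c = ?N (- 3) * ?F d" using mchar_minus_3[OF m(3) cd(2)] by (simp flip: power_mult)
    show ?thesis unfolding e X_minus_27 using F2[OF u(2)] by (simp add: mult.assoc)
  qed
  ultimately have X27: "X (- 27) = (-1) powi (k + l)" by simp
  have "4 * int p = (2 * y + 3 * n)\<^sup>2 + 27 * n\<^sup>2" unfolding yn(2) by (simp add: power2_eq_square algebra_simps)
  moreover have "(2 * y + 3 * n) mod 3 = 2" using yn(1) by presburger
  ultimately have "fourier_coeff f_432_2_c_a p = (-1) powi (k + l) * of_int (2 * y + 3 * n)"
    by (rule coeff_f_432[OF prime_p p12 kl])
  moreover have "X (- 27) * jac ?C X + cnj (X (- 27) * jac ?C X) = (-1) powi (k + l) * (jac ?C ?C + cnj (jac ?C ?C))"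
    unfolding X27 J by (simp add: distrib_left)
  ultimately show ?thesis unfolding yn(3) by (simp only: mult_minus_right)
qed

end

theorem theorem1p3:
  fixes r :: rat and M p :: nat and P :: "complex set"
  assumes "r \<in> {1/2, 1/3, 1/6, 1/12}"
    and "M = least_common_denom (1/3) r"
    and "prime p" and "[p = 1] (mod M)"
    and "primeideal P (cyclotomic_ring M)" and "lies_above P p"
  shows "- fourier_coeff (f_sharp r) p =
      iota M P r (residue_class M P 27) *
        period_fun M P (1/3) r 1 \<one>\<^bsub>residue_field M P\<^esub> +
      iota M P (1 - r) (residue_class M P 27) *
        period_fun M P (2/3) (1 - r) 1 \<one>\<^bsub>residue_field M P\<^esub>"
proof -
  have rM: "r = 1/2 \<and> M = 6 \<or> r = 1/3 \<and> M = 3 \<or> r = 1/6 \<and> M = 6 \<or> r = 1/12 \<and> M = 12"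
    using assms(1) unfolding assms(2)
    by (elim insertE emptyE) (simp_all only: least_common_denom_values simp_thms)
  then have M: "M = 3 \<or> M = 6 \<or> M = 12" by auto
  have pM: "p mod M = 1" using assms(4) M by (auto simp: cong_def)
  have "odd p"
  proof
    assume "even p"
    then have "p = 2" using assms(3) by (auto simp: prime_nat_iff)
    then show False using pM M by auto
  qed
  interpret prime_above p M P
    by (intro prime_above.intro prime_above_axioms.intro odd_prime.intro assms M pM \<open>odd p\<close>)
  from rM consider "r = 1/2" "M = 6" | "r = 1/3" "M = 3" | "r = 1/6" "M = 6" | "r = 1/12" "M = 12" by blast
  then show ?thesis
  proof cases
    case 1
    have "X (- 27) ^ 3 = 1" unfolding X_minus_27 coeff_f_36_eq_jacobi_sums(2)[OF 1(2)] by simp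
    then show ?thesis
      using period_sum_eq[of 2 r 3] coeff_f_36_eq_jacobi_sums(1)[OF 1(2)] by (simp add: 1 f_sharp_def)
  next
    case 2
    have "X (- 27) = 1" unfolding X_minus_27 using X_M[OF not_dvd_3(2)] 2 by simp
    then show ?thesis
      using period_sum_eq[of 1 r 1] coeff_f_27_eq_jacobi_sums[OF 2(2)] by (simp add: 2 f_sharp_def)
  next
    case 3
    have "X (- 27) = 1" unfolding X_minus_27 coeff_f_36_eq_jacobi_sums(2)[OF 3(2)] by simp
    then show ?thesis
      using period_sum_eq[of 2 r 1] coeff_f_36_eq_jacobi_sums(1)[OF 3(2)] jac_sextic[OF 3(2)] by (simp add: 3 f_sharp_def)
  next
    case 4
    show ?thesis
      using period_sum_eq[of 4 r 1] coeff_f_432_eq_jacobi_sums[OF 4(2)] by (simp add: 4 f_sharp_def)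
  qed
qed

end
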